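(* Let $k$ be a field of characteristic $p>0$, let $(\mathbb{G},\mathcal{E})$ be a linear algebraic group over $k$ of exponential type of infinite height, with Lie algebra $\mathfrak{g}$, and let $M$ be a finite dimensional (rational) $\mathbb{G}$-module. Then for all $r\gg0$ $$JT^{exp}_{\mathfrak{g},\infty,M}(-)=JT^{exp}_{\mathfrak{g},r,M_{|\mathbb{G}_{(r)}}}(-)\circ\Lambda^r:\ \mathcal{C}_\infty(\mathcal{N}_p(\mathfrak{g}))\to\mathcal{C}_r(\mathcal{N}_p(\mathfrak{g}))\to\mathcal{Y},$$ where $\Lambda^r:\mathcal{C}_\infty(\mathcal{N}_p(\mathfrak{g}))\to\mathcal{C}_r(\mathcal{N}_p(\mathfrak{g}))$ is given by sending $(B_0,\dots,B_n,\dots)$ to $(B_{r-1},\dots,B_0)$. In particular, $JT^{exp}_{\mathfrak{g},\infty,M}(-)$ is continuous.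
   Context: $k$ is a field of characteristic $p>0$; unadorned $\otimes$ is over $k$. A linear algebraic group is a reduced, irreducible affine group scheme of finite type over $k$. $\mathbb{G}_{(r)}$ is the kernel of the $r$-th iterated Frobenius; $k\mathbb{G}_{(r)}=\mathrm{Hom}_k(k[\mathbb{G}_{(r)}],k)$ and $k\mathbb{G}=\varinjlim_rk\mathbb{G}_{(r)}$ is the distribution algebra, acting on any rational $\mathbb{G}$-module. $k[\mathbb{G}_{a(r)}]=k[t]/t^{p^r}$, $k\mathbb{G}_{a(r)}=k[u_0,\dots,u_{r-1}]/(u_i^p)$ with $u_i$ dual to $t^{p^i}$. $\mathcal{N}_p(\mathfrak{g})\subset\mathfrak{g}$ is the scheme of $B$ with $B^{[p]}=0$. $\mathcal{C}_r(\mathcal{N}_p(\mathfrak{g}))$ is the affine scheme of $r$-tuples $(B_0,\dots,B_{r-1})$ of pairwise commuting elements with $B_s^{[p]}=0$. $\mathcal{C}_\infty(\mathcal{N}_p(\mathfrak{g}))=\varinjlim_r\mathcal{C}_r(\mathcal{N}_p(\mathfrak{g}))$ (ind-scheme) along $(B_0,\dots,B_{r-1})\mapsto(B_0,\dots,B_{r-1},0)$; its scheme-theoretic points are elements of the direct limit of the sets of points, i.e. finite sequences extended by zeros, with the direct limit topology. Exponentiation of height $r$: a morphism $\mathcal{E}_{(r)}:\mathbb{G}_{a(r)}\times\mathcal{N}_p(\mathfrak{g})\to\mathbb{G}_{(r)}$ such that for every commutative $k$-algebra $A$ and $p$-nilpotent $B,B'\in A\otimes\mathfrak{g}$: (1)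 $\mathcal{E}_{(r),B}:\mathbb{G}_{a(r),A}\to\mathbb{G}_{(r),A}$ is a homomorphism of group schemes; (2) if $[B,B']=0$ then $\mathcal{E}_{(r),B}(\alpha)$ and $\mathcal{E}_{(r),B'}(\beta)$ commute for $\alpha,\beta\in\mathbb{G}_{a(r)}(A)$; (3) $\mathcal{E}_{(r),\alpha B}(-)=\mathcal{E}_{(r),B}(\alpha\cdot-)$ for $\alpha\in A$. Exponential type of height $r$ means in addition that $\underline{B}\mapsto(t\mapsto\prod_{s=0}^{r-1}\mathcal{E}_{(r),B_s}(t^{p^s}))$ is a bijection on geometric points from $\mathcal{C}_r(\mathcal{N}_p(\mathfrak{g}))$ to $V_r(\mathbb{G})$, the affine scheme representing $A\mapsto\{$homomorphisms $\mathbb{G}_{a(r),A}\to\mathbb{G}_A\}$. $\mathbb{G}$ is of exponential type of infinite height if it is equipped with a morphism $\mathcal{E}:\mathbb{G}_a\times\mathcal{N}_p(\mathfrak{g})\to\mathbb{G}$ whose restrictions $\mathcal{E}_{|r}:\mathbb{G}_{a(r)}\times\mathcal{N}_p(\mathfrak{g})\to\mathbb{G}_{(r)}$ make $(\mathbb{G}_{(r)},\mathcal{E}_{|r})$ of exponential type of height $r$ for every $r>0$. For a point $B$ of $\mathcal{N}_p(\mathfrak{g})$ write $(\mathcal{E}_B)_*:k(B)\otimes k\mathbb{G}_a\to k(B)\otimes k\mathbb{G}$ for the induced map of distribution algebras. Jordan types. $\mathcal{Y}=\mathbb{N}^{p}$; the Jordan type $(a_1,\dots,a_p)=\sum a_i[i]$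 of a $p$-nilpotent operator has $a_i$ the number of Jordan blocks of size $i$. $\underline{a}\leq\underline{b}$ iff for each $\ell$ the sum of the $\ell$ largest block sizes of $\underline{a}$ is at most that of $\underline{b}$; closed subsets of $\mathcal{Y}$ are those closed under passing to smaller elements. For a finite dimensional $\mathbb{G}$-module $M$ and $\underline{B}\in\mathcal{C}_\infty(\mathcal{N}_p(\mathfrak{g}))$, $JT^{exp}_{\mathfrak{g},\infty,M}(\underline{B})$ is the Jordan type of $\sum_{s\geq0}(\mathcal{E}_{B_s})_*(1\otimes u_s)$ acting on $k(\underline{B})\otimes M$. For a finite dimensional $\mathbb{G}_{(r)}$-module $N$ and $\underline{B}\in\mathcal{C}_r(\mathcal{N}_p(\mathfrak{g}))$, $JT^{exp}_{\mathfrak{g},r,N}(\underline{B})$ is the Jordan type of $\sum_{s=0}^{r-1}(\mathcal{E}_{|r,B_s})_*(1\otimes u_{r-s-1})$ acting on $k(\underline{B})\otimes N$. *)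

theory Defs
  imports
    "HOL-Algebra.Algebraic_Closure"
    "HOL-Algebra.UnivPoly"
    "HOL-Algebra.QuotRing"
    "HOL-Algebra.Generated_Rings"
    "HOL-Analysis.Abstract_Topology"
    "HOL-Library.Equipollence"
    "HOL-Computational_Algebra.Primes"
begin

text \<open>
  Commutative \<open>k\<close>-algebras are records \<open>A\<close> with \<^term>\<open>algebra k A\<close>.  Conditions "for every commutative
  \<open>k\<close>-algebra" range over the algebras whose carrier lies in a type \<open>'u\<close>, which plays the role of
  a universe: the theorem assumes that \<open>'u\<close> is infinite and at least as large as \<open>k\<close>.  Up to
  isomorphism this gives all finitely generated \<open>k\<close>-algebras, and it is stable under polynomial
  rings, quotients, tensor products, residue fields and algebraic closures.

  Algebra homomorphisms and points are extensional functions on the carrier of their source.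
\<close>

section \<open>Algebras\<close>

definition alg_hom ::
  "'k ring \<Rightarrow> ('k, 'a, 'm) module_scheme \<Rightarrow> ('k, 'b, 'n) module_scheme \<Rightarrow> ('a \<Rightarrow> 'b) set" where
  "alg_hom k A B = {f \<in> ring_hom A B. f \<in> extensional (carrier A) \<and>
     (\<forall>c\<in>carrier k. \<forall>a\<in>carrier A. f (c \<odot>\<^bsub>A\<^esub> a) = c \<odot>\<^bsub>B\<^esub> f a)}"

definition algebra_via :: "('a, 'm) ring_scheme \<Rightarrow> ('k \<Rightarrow> 'a) \<Rightarrow> ('k, 'a) module" where
  "algebra_via R \<eta> = \<lparr>carrier = carrier R, monoid.mult = monoid.mult R, one = \<one>\<^bsub>R\<^esub>, zero = \<zero>\<^bsub>R\<^esub>, add = add R,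
     smult = (\<lambda>c a. \<eta> c \<otimes>\<^bsub>R\<^esub> a)\<rparr>"

definition poly_algebra :: "('k, 'a, 'm) module_scheme \<Rightarrow> ('k, nat \<Rightarrow> 'a) module" where
  "poly_algebra A = algebra_via (UP A) (\<lambda>c. monom (UP A) (c \<odot>\<^bsub>A\<^esub> \<one>\<^bsub>A\<^esub>) 0)"

definition quot_algebra :: "('k, 'a, 'm) module_scheme \<Rightarrow> 'a set \<Rightarrow> ('k, 'a set) module" where
  "quot_algebra A I = algebra_via (A Quot I) (\<lambda>c. I +>\<^bsub>A\<^esub> (c \<odot>\<^bsub>A\<^esub> \<one>\<^bsub>A\<^esub>))"

text \<open>\<open>trunc_algebra p r A\<close> is \<open>A[t]/t^(p^r)\<close>, that is, \<open>A\<close> tensored with the coordinate algebra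
  of \<open>G_a(r)\<close>.\<close>

definition trunc_ideal :: "nat \<Rightarrow> nat \<Rightarrow> ('k, 'a, 'm) module_scheme \<Rightarrow> (nat \<Rightarrow> 'a) set" where
  "trunc_ideal p r A = PIdl\<^bsub>poly_algebra A\<^esub> (monom (UP A) \<one>\<^bsub>A\<^esub> (p ^ r))"

definition trunc_algebra :: "nat \<Rightarrow> nat \<Rightarrow> ('k, 'a, 'm) module_scheme \<Rightarrow> ('k, (nat \<Rightarrow> 'a) set) module" where
  "trunc_algebra p r A = quot_algebra (poly_algebra A) (trunc_ideal p r A)"

definition ga_points :: "nat \<Rightarrow> nat \<Rightarrow> ('k, 'a, 'm) module_scheme \<Rightarrow> 'a set" where
  "ga_points p r A = {\<alpha> \<in> carrier A. \<alpha> [^]\<^bsub>A\<^esub> (p ^ r) = \<zero>\<^bsub>A\<^esub>}"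

section \<open>Prime spectra and residue fields\<close>

definition Spec :: "('a, 'm) ring_scheme \<Rightarrow> 'a set set" where
  "Spec R = {P. primeideal P R}"

definition zariski :: "('a, 'm) ring_scheme \<Rightarrow> 'a set topology" where
  "zariski R = topology (\<lambda>U. \<exists>S\<subseteq>carrier R. U = {P \<in> Spec R. \<not> S \<subseteq> P})"

lemma openin_zariski:
  "openin (zariski R) U \<longleftrightarrow> (\<exists>S\<subseteq>carrier R. U = {P \<in> Spec R. \<not> S \<subseteq> P})"
proof -
  let ?D = "\<lambda>S. {P \<in> Spec R. \<not> S \<subseteq> P}"
  have "istopology (\<lambda>U. \<exists>S\<subseteq>carrier R. U = ?D S)"
    unfolding istopology_def
  proof (intro conjI allI impI)
    fix U V assume "\<exists>S\<subseteq>carrier R. U = ?D S" "\<exists>S\<subseteq>carrier R. V = ?D S"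
    then obtain S T where S: "S \<subseteq> carrier R" "U = ?D S" and T: "T \<subseteq> carrier R" "V = ?D T"
      by blast
    let ?W = "{s \<otimes>\<^bsub>R\<^esub> t | s t. s \<in> S \<and> t \<in> T} \<inter> carrier R"
    have "U \<inter> V = ?D ?W"
    proof (intro equalityI subsetI)
      fix P assume "P \<in> U \<inter> V"
      then obtain s t where st: "s \<in> S" "s \<notin> P" "t \<in> T" "t \<notin> P" and P: "primeideal P R"
        using S T by (auto simp: Spec_def)
      interpret primeideal P R by (rule P)
      have "s \<otimes>\<^bsub>R\<^esub> t \<notin> P" using I_prime[of s t] st S T by blast
      moreover have "s \<otimes>\<^bsub>R\<^esub> t \<in> ?W" using st S T by blast
      ultimately show "P \<in> ?D ?W" using P unfolding Spec_def by blast
    next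
      fix P assume "P \<in> ?D ?W"
      then obtain s t where st: "s \<in> S" "t \<in> T" "s \<otimes>\<^bsub>R\<^esub> t \<notin> P" and P: "primeideal P R"
        by (auto simp: Spec_def)
      interpret primeideal P R by (rule P)
      have "s \<notin> P" "t \<notin> P" using st S T I_l_closed[of t s] I_r_closed[of s t] by blast+
      then show "P \<in> U \<inter> V" using st S T P unfolding Spec_def by blast
    qed
    then show "\<exists>S\<subseteq>carrier R. U \<inter> V = ?D S" by blast
  next
    fix \<K> assume "\<forall>U\<in>\<K>. \<exists>S\<subseteq>carrier R. U = ?D S"
    then obtain f where f: "\<And>U. U \<in> \<K> \<Longrightarrow> f U \<subseteq> carrier R \<and> U = ?D (f U)" by metis
    have "\<Union>\<K> = ?D (\<Union>(f ` \<K>))"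
    proof (intro equalityI subsetI)
      fix P assume "P \<in> \<Union>\<K>"
      then obtain U where "U \<in> \<K>" "P \<in> ?D (f U)" using f by blast
      then show "P \<in> ?D (\<Union>(f ` \<K>))" by blast
    next
      fix P assume "P \<in> ?D (\<Union>(f ` \<K>))"
      then obtain U where "U \<in> \<K>" "P \<in> ?D (f U)" by blast
      then show "P \<in> \<Union>\<K>" using f by blast
    qed
    moreover have "\<Union>(f ` \<K>) \<subseteq> carrier R" using f by blast
    ultimately show "\<exists>S\<subseteq>carrier R. \<Union>\<K> = ?D S" by blast
  qed
  then show ?thesis unfolding zariski_def by (simp add: topology_inverse')
qed

definition irreducible_space :: "'a topology \<Rightarrow> bool" where
  "irreducible_space T \<longleftrightarrow> topspace T \<noteq> {} \<and>
     (\<forall>U V. openin T U \<and> openin T V \<and> U \<noteq> {} \<and> V \<noteq> {} \<longrightarrow> U \<inter> V \<noteq> {})"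

definition spec_map :: "('a \<Rightarrow> 'b) \<Rightarrow> ('a, 'm) ring_scheme \<Rightarrow> 'b set \<Rightarrow> 'a set" where
  "spec_map \<phi> R P = {a \<in> carrier R. \<phi> a \<in> P}"

text \<open>\<open>frac R P a b\<close> is the fraction \<open>a/b\<close>, for \<open>b\<close> outside \<open>P\<close>, in the fraction field of \<open>R/P\<close>.\<close>

definition frac :: "('a, 'm) ring_scheme \<Rightarrow> 'a set \<Rightarrow> 'a \<Rightarrow> 'a \<Rightarrow> ('a \<times> 'a) set" where
  "frac R P a b = {(c, d). c \<in> carrier R \<and> d \<in> carrier R - P \<and> (a \<otimes>\<^bsub>R\<^esub> d) \<ominus>\<^bsub>R\<^esub> (c \<otimes>\<^bsub>R\<^esub> b) \<in> P}"

definition residue_field ::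
  "('k, 'a, 'm) module_scheme \<Rightarrow> 'a set \<Rightarrow> ('k, ('a \<times> 'a) set) module" where
  "residue_field R P = algebra_via
     \<lparr>carrier = {frac R P a b | a b. a \<in> carrier R \<and> b \<in> carrier R - P},
      monoid.mult = (\<lambda>x y. let (a, b) = (SOME z. z \<in> x); (c, d) = (SOME z. z \<in> y)
                    in frac R P (a \<otimes>\<^bsub>R\<^esub> c) (b \<otimes>\<^bsub>R\<^esub> d)),
      one = frac R P \<one>\<^bsub>R\<^esub> \<one>\<^bsub>R\<^esub>,
      zero = frac R P \<zero>\<^bsub>R\<^esub> \<one>\<^bsub>R\<^esub>,
      add = (\<lambda>x y. let (a, b) = (SOME z. z \<in> x); (c, d) = (SOME z. z \<in> y)
                   in frac R P ((a \<otimes>\<^bsub>R\<^esub> d) \<oplus>\<^bsub>R\<^esub> (c \<otimes>\<^bsub>R\<^esub> b)) (b \<otimes>\<^bsub>R\<^esub> d))\<rparr>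
     (\<lambda>c. frac R P (c \<odot>\<^bsub>R\<^esub> \<one>\<^bsub>R\<^esub>) \<one>\<^bsub>R\<^esub>)"

definition to_residue :: "('a, 'm) ring_scheme \<Rightarrow> 'a set \<Rightarrow> 'a \<Rightarrow> ('a \<times> 'a) set" where
  "to_residue R P a = frac R P a \<one>\<^bsub>R\<^esub>"

section \<open>Affine group schemes\<close>

text \<open>
  An affine group scheme is given by its coordinate algebra, a comultiplication and a counit.  The
  list \<open>comult G h = [(a1, b1), ..., (an, bn)]\<close> stands for the tensor \<open>a1 \<otimes> b1 + ... + an \<otimes> bn\<close>;
  only this tensor matters, since \<open>comult\<close> enters through \<open>conv\<close> applied to linear maps.
\<close>

record ('k, 'h) hopf = "('k, 'h) module" +
  comult :: "'h \<Rightarrow> ('h \<times> 'h) list"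
  counit :: "'h \<Rightarrow> 'k"

definition conv :: "('k, 'h, 'g) hopf_scheme \<Rightarrow> ('k, 'a, 'm) module_scheme \<Rightarrow>
    ('h \<Rightarrow> 'a) \<Rightarrow> ('h \<Rightarrow> 'a) \<Rightarrow> 'h \<Rightarrow> 'a" where
  "conv G A f g = (\<lambda>h\<in>carrier G. foldr (\<lambda>(a, b) z. (f a \<otimes>\<^bsub>A\<^esub> g b) \<oplus>\<^bsub>A\<^esub> z) (comult G h) \<zero>\<^bsub>A\<^esub>)"

definition conv_unit :: "('k, 'h, 'g) hopf_scheme \<Rightarrow> ('k, 'a, 'm) module_scheme \<Rightarrow> 'h \<Rightarrow> 'a" where
  "conv_unit G A = (\<lambda>h\<in>carrier G. counit G h \<odot>\<^bsub>A\<^esub> \<one>\<^bsub>A\<^esub>)"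

definition points ::
  "'k ring \<Rightarrow> ('k, 'h, 'g) hopf_scheme \<Rightarrow> ('k, 'a, 'm) module_scheme \<Rightarrow> ('h \<Rightarrow> 'a) monoid" where
  "points k G A = \<lparr>carrier = alg_hom k G A, monoid.mult = conv G A, one = conv_unit G A\<rparr>"

text \<open>The group axioms are those of a representable functor from \<open>k\<close>-algebras to groups.\<close>

definition linear_algebraic_group :: "'u itself \<Rightarrow> 'k ring \<Rightarrow> ('k, 'h) hopf \<Rightarrow> bool" where
  "linear_algebraic_group _ k G \<longleftrightarrow>
     algebra k G \<and>
     (\<forall>h\<in>carrier G. set (comult G h) \<subseteq> carrier G \<times> carrier G) \<and>
     counit G \<in> carrier G \<rightarrow> carrier k \<and>
     (\<forall>A :: ('k, 'u) module. algebra k A \<longrightarrow> group (points k G A)) \<and>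
     (\<exists>S. finite S \<and> S \<subseteq> carrier G \<and>
        generate_ring G (S \<union> (\<lambda>c. c \<odot>\<^bsub>G\<^esub> \<one>\<^bsub>G\<^esub>) ` carrier k) = carrier G) \<and>
     (\<forall>h\<in>carrier G. \<forall>n::nat. h [^]\<^bsub>G\<^esub> n = \<zero>\<^bsub>G\<^esub> \<longrightarrow> h = \<zero>\<^bsub>G\<^esub>) \<and>
     irreducible_space (zariski G)"

definition frob_ideal :: "'k ring \<Rightarrow> nat \<Rightarrow> nat \<Rightarrow> ('k, 'h) hopf \<Rightarrow> 'h set" where
  "frob_ideal k p r G = Idl\<^bsub>G\<^esub> {h [^]\<^bsub>G\<^esub> (p ^ r) | h. h \<in> carrier G \<and> counit G h = \<zero>\<^bsub>k\<^esub>}"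

definition frob_kernel :: "'k ring \<Rightarrow> nat \<Rightarrow> nat \<Rightarrow> ('k, 'h) hopf \<Rightarrow> ('k, 'h set) hopf" where
  "frob_kernel k p r G = (let I = frob_ideal k p r G in
     module.extend (quot_algebra G I)
       (hopf.fields
          (\<lambda>x. map (\<lambda>(a, b). (I +>\<^bsub>G\<^esub> a, I +>\<^bsub>G\<^esub> b)) (comult G (SOME h. h \<in> x)))
          (\<lambda>x. counit G (SOME h. h \<in> x))))"

text \<open>
  A rational module with basis \<open>m_0, ..., m_(d-1)\<close> and coaction \<open>m_j \<mapsto> \<Sum>i. m_i \<otimes> c i j\<close>, that is,
  a homomorphism of group schemes from \<open>G\<close> to \<open>GL_d\<close>.
\<close>

definition rational_module ::
  "'u itself \<Rightarrow> 'k ring \<Rightarrow> ('k, 'h) hopf \<Rightarrow> nat \<Rightarrow> (nat \<Rightarrow> nat \<Rightarrow> 'h) \<Rightarrow> bool" where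
  "rational_module _ k G d c \<longleftrightarrow>
     (\<forall>i<d. \<forall>j<d. c i j \<in> carrier G) \<and>
     (\<forall>A :: ('k, 'u) module. algebra k A \<longrightarrow> (\<forall>i<d. \<forall>j<d.
        \<one>\<^bsub>points k G A\<^esub> (c i j) = (if i = j then \<one>\<^bsub>A\<^esub> else \<zero>\<^bsub>A\<^esub>) \<and>
        (\<forall>x\<in>carrier (points k G A). \<forall>y\<in>carrier (points k G A).
           (x \<otimes>\<^bsub>points k G A\<^esub> y) (c i j) = (\<Oplus>\<^bsub>A\<^esub>l\<in>{..<d}. x (c i l) \<otimes>\<^bsub>A\<^esub> y (c l j)))))"

definition restrict_module ::
  "'k ring \<Rightarrow> nat \<Rightarrow> nat \<Rightarrow> ('k, 'h) hopf \<Rightarrow> (nat \<Rightarrow> nat \<Rightarrow> 'h) \<Rightarrow> nat \<Rightarrow> nat \<Rightarrow> 'h set" where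
  "restrict_module k p r G c = (\<lambda>i j. frob_ideal k p r G +>\<^bsub>G\<^esub> c i j)"

section \<open>The Lie algebra and commuting nilpotent tuples\<close>

definition lie_algebra :: "'k ring \<Rightarrow> ('k, 'h) hopf \<Rightarrow> ('h \<Rightarrow> 'k) set" where
  "lie_algebra k G = {D \<in> carrier G \<rightarrow>\<^sub>E carrier k.
     (\<forall>a\<in>carrier G. \<forall>b\<in>carrier G. D (a \<oplus>\<^bsub>G\<^esub> b) = D a \<oplus>\<^bsub>k\<^esub> D b) \<and>
     (\<forall>c\<in>carrier k. \<forall>a\<in>carrier G. D (c \<odot>\<^bsub>G\<^esub> a) = c \<otimes>\<^bsub>k\<^esub> D a) \<and>
     (\<forall>a\<in>carrier G. \<forall>b\<in>carrier G.
        D (a \<otimes>\<^bsub>G\<^esub> b) = (counit G a \<otimes>\<^bsub>k\<^esub> D b) \<oplus>\<^bsub>k\<^esub> (counit G b \<otimes>\<^bsub>k\<^esub> D a))}"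

text \<open>
  \<open>A \<otimes> g\<close> is realised inside \<open>Hom_k(k[G], A)\<close>, with \<open>\<Sum>i. a_i \<otimes> D_i\<close> the map \<open>h \<mapsto> \<Sum>i. D_i h a_i\<close>.
  There the bracket is the commutator and the \<open>p\<close>-operation the \<open>p\<close>-th power for \<open>conv\<close>.
\<close>

definition lie_points ::
  "'k ring \<Rightarrow> ('k, 'h) hopf \<Rightarrow> ('k, 'a, 'm) module_scheme \<Rightarrow> ('h \<Rightarrow> 'a) set" where
  "lie_points k G A = {(\<lambda>h\<in>carrier G. \<Oplus>\<^bsub>A\<^esub>i\<in>{..<n}. D i h \<odot>\<^bsub>A\<^esub> a i) | (n::nat) a D.
     a \<in> {..<n} \<rightarrow> carrier A \<and> D \<in> {..<n} \<rightarrow> lie_algebra k G}"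

definition lie_zero :: "('k, 'h) hopf \<Rightarrow> ('k, 'a, 'm) module_scheme \<Rightarrow> 'h \<Rightarrow> 'a" where
  "lie_zero G A = (\<lambda>h\<in>carrier G. \<zero>\<^bsub>A\<^esub>)"

definition lie_scale ::
  "('k, 'h) hopf \<Rightarrow> ('k, 'a, 'm) module_scheme \<Rightarrow> 'a \<Rightarrow> ('h \<Rightarrow> 'a) \<Rightarrow> 'h \<Rightarrow> 'a" where
  "lie_scale G A \<alpha> B = (\<lambda>h\<in>carrier G. \<alpha> \<otimes>\<^bsub>A\<^esub> B h)"

definition lie_bracket ::
  "('k, 'h) hopf \<Rightarrow> ('k, 'a, 'm) module_scheme \<Rightarrow> ('h \<Rightarrow> 'a) \<Rightarrow> ('h \<Rightarrow> 'a) \<Rightarrow> 'h \<Rightarrow> 'a" where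
  "lie_bracket G A B B' = (\<lambda>h\<in>carrier G. conv G A B B' h \<ominus>\<^bsub>A\<^esub> conv G A B' B h)"

definition p_map ::
  "nat \<Rightarrow> ('k, 'h) hopf \<Rightarrow> ('k, 'a, 'm) module_scheme \<Rightarrow> ('h \<Rightarrow> 'a) \<Rightarrow> 'h \<Rightarrow> 'a" where
  "p_map p G A B = (conv G A B ^^ p) (conv_unit G A)"

definition nilp_points ::
  "'k ring \<Rightarrow> nat \<Rightarrow> ('k, 'h) hopf \<Rightarrow> ('k, 'a, 'm) module_scheme \<Rightarrow> ('h \<Rightarrow> 'a) set" where
  "nilp_points k p G A = {B \<in> lie_points k G A. p_map p G A B = lie_zero G A}"

definition comm_points ::
  "'k ring \<Rightarrow> nat \<Rightarrow> ('k, 'h) hopf \<Rightarrow> nat \<Rightarrow> ('k, 'a, 'm) module_scheme \<Rightarrow> ('h \<Rightarrow> 'a) list set" where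
  "comm_points k p G r A = {Bs. length Bs = r \<and> set Bs \<subseteq> nilp_points k p G A \<and>
     (\<forall>B\<in>set Bs. \<forall>B'\<in>set Bs. lie_bracket G A B B' = lie_zero G A)}"

text \<open>
  The affine schemes \<open>N_p(g)\<close> and \<open>C_r(N_p(g))\<close> are given by coordinate algebras representing the
  functors \<^const>\<open>nilp_points\<close> and \<^const>\<open>comm_points\<close>, together with the universal point \<open>univ\<close>.
\<close>

record ('k, 'a, 'x) coord = "('k, 'a) module" +
  univ :: 'x

definition nilp_scheme ::
  "'k ring \<Rightarrow> nat \<Rightarrow> ('k, 'h) hopf \<Rightarrow> ('k, 'u, 'h \<Rightarrow> 'u) coord \<Rightarrow> bool" where
  "nilp_scheme k p G N \<longleftrightarrow> algebra k N \<and> univ N \<in> nilp_points k p G N \<and>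
     (\<forall>A :: ('k, 'u) module. algebra k A \<longrightarrow> (\<forall>B\<in>nilp_points k p G A.
        \<exists>!\<phi>. \<phi> \<in> alg_hom k N A \<and> compose (carrier G) \<phi> (univ N) = B))"

definition comm_scheme ::
  "'k ring \<Rightarrow> nat \<Rightarrow> ('k, 'h) hopf \<Rightarrow> nat \<Rightarrow> ('k, 'u, ('h \<Rightarrow> 'u) list) coord \<Rightarrow> bool" where
  "comm_scheme k p G r R \<longleftrightarrow> algebra k R \<and> univ R \<in> comm_points k p G r R \<and>
     (\<forall>A :: ('k, 'u) module. algebra k A \<longrightarrow> (\<forall>Bs\<in>comm_points k p G r A.
        \<exists>!\<phi>. \<phi> \<in> alg_hom k R A \<and> map (compose (carrier G) \<phi>) (univ R) = Bs))"

definition nilp_classify ::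
  "'k ring \<Rightarrow> ('k, 'h) hopf \<Rightarrow> ('k, 'u, 'h \<Rightarrow> 'u) coord \<Rightarrow> ('k, 'u, 'm) module_scheme \<Rightarrow>
    ('h \<Rightarrow> 'u) \<Rightarrow> 'u \<Rightarrow> 'u" where
  "nilp_classify k G N A B =
     (THE \<phi>. \<phi> \<in> alg_hom k N A \<and> compose (carrier G) \<phi> (univ N) = B)"

definition comm_classify ::
  "'k ring \<Rightarrow> ('k, 'h) hopf \<Rightarrow> ('k, 'u, ('h \<Rightarrow> 'u) list) coord \<Rightarrow> ('k, 'u, 'm) module_scheme \<Rightarrow>
    ('h \<Rightarrow> 'u) list \<Rightarrow> 'u \<Rightarrow> 'u" where
  "comm_classify k G R A Bs =
     (THE \<phi>. \<phi> \<in> alg_hom k R A \<and> map (compose (carrier G) \<phi>) (univ R) = Bs)"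

section \<open>Exponentiations\<close>

text \<open>
  For a comorphism \<open>\<psi>\<close> from \<open>G\<close> to \<open>S[t]/t^(p^r)\<close>, a homomorphism \<open>\<chi>\<close> from \<open>S\<close> to \<open>A\<close> and \<open>\<alpha>\<close> in \<open>A\<close>
  with \<open>\<alpha>^(p^r) = 0\<close>, \<open>value_at G S A \<chi> \<alpha> \<psi>\<close> is the composite of \<open>\<psi>\<close> with evaluation at \<open>t = \<alpha>\<close>.
  Elements of \<open>S[t]/t^(p^r)\<close> are cosets, on which the evaluation is constant.
\<close>

definition value_at ::
  "('k, 'h, 'g) hopf_scheme \<Rightarrow> ('k, 's, 'm) module_scheme \<Rightarrow> ('k, 'a, 'n) module_scheme \<Rightarrow>
    ('s \<Rightarrow> 'a) \<Rightarrow> 'a \<Rightarrow> ('h \<Rightarrow> (nat \<Rightarrow> 's) set) \<Rightarrow> 'h \<Rightarrow> 'a" where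
  "value_at G S A \<chi> \<alpha> \<psi> = (\<lambda>h\<in>carrier G. the_elem (UnivPoly.eval S A \<chi> \<alpha> ` \<psi> h))"

definition exp_value ::
  "'k ring \<Rightarrow> nat \<Rightarrow> nat \<Rightarrow> ('k, 'h) hopf \<Rightarrow> ('k, 'u, 'h \<Rightarrow> 'u) coord \<Rightarrow>
    ('h set \<Rightarrow> (nat \<Rightarrow> 'u) set) \<Rightarrow> ('k, 'u) module \<Rightarrow> ('h \<Rightarrow> 'u) \<Rightarrow> 'u \<Rightarrow> 'h set \<Rightarrow> 'u" where
  "exp_value k p r G N \<psi> A B \<alpha> =
     value_at (frob_kernel k p r G) N A (nilp_classify k G N A B) \<alpha> \<psi>"

text \<open>\<open>\<psi>\<close> is the comorphism of \<open>E_(r)\<close> from \<open>G_a(r) \<times> N_p(g)\<close> to \<open>G_(r)\<close>; group schemes over \<open>A\<close> are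
  compared on all \<open>A\<close>-algebras \<open>\<phi> : A \<rightarrow> A'\<close>.\<close>

definition exponentiation ::
  "'k ring \<Rightarrow> nat \<Rightarrow> nat \<Rightarrow> ('k, 'h) hopf \<Rightarrow> ('k, 'u, 'h \<Rightarrow> 'u) coord \<Rightarrow>
    ('h set \<Rightarrow> (nat \<Rightarrow> 'u) set) \<Rightarrow> bool" where
  "exponentiation k p r G N \<psi> \<longleftrightarrow>
     \<psi> \<in> alg_hom k (frob_kernel k p r G) (trunc_algebra p r N) \<and>
     (\<forall>A :: ('k, 'u) module. algebra k A \<longrightarrow> (\<forall>B\<in>nilp_points k p G A.
        (\<forall>(A' :: ('k, 'u) module) \<phi>. algebra k A' \<and> \<phi> \<in> alg_hom k A A' \<longrightarrow>
           (\<forall>\<alpha>\<in>ga_points p r A'. \<forall>\<beta>\<in>ga_points p r A'.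
              exp_value k p r G N \<psi> A' (compose (carrier G) \<phi> B) (\<alpha> \<oplus>\<^bsub>A'\<^esub> \<beta>) =
              exp_value k p r G N \<psi> A' (compose (carrier G) \<phi> B) \<alpha>
                \<otimes>\<^bsub>points k (frob_kernel k p r G) A'\<^esub>
              exp_value k p r G N \<psi> A' (compose (carrier G) \<phi> B) \<beta>)) \<and>
        (\<forall>B'\<in>nilp_points k p G A. lie_bracket G A B B' = lie_zero G A \<longrightarrow>
           (\<forall>\<alpha>\<in>ga_points p r A. \<forall>\<beta>\<in>ga_points p r A.
              exp_value k p r G N \<psi> A B \<alpha> \<otimes>\<^bsub>points k (frob_kernel k p r G) A\<^esub>
              exp_value k p r G N \<psi> A B' \<beta> =
              exp_value k p r G N \<psi> A B' \<beta> \<otimes>\<^bsub>points k (frob_kernel k p r G) A\<^esub>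
              exp_value k p r G N \<psi> A B \<alpha>)) \<and>
        (\<forall>\<alpha>\<in>carrier A. \<forall>(A' :: ('k, 'u) module) \<phi>. algebra k A' \<and> \<phi> \<in> alg_hom k A A' \<longrightarrow>
           (\<forall>\<beta>\<in>ga_points p r A'.
              exp_value k p r G N \<psi> A' (compose (carrier G) \<phi> (lie_scale G A \<alpha> B)) \<beta> =
              exp_value k p r G N \<psi> A' (compose (carrier G) \<phi> B) (\<phi> \<alpha> \<otimes>\<^bsub>A'\<^esub> \<beta>)))))"

text \<open>\<open>V_r(G)(A)\<close>, the homomorphisms from \<open>G_a(r)\<close> to \<open>G\<close> over \<open>A\<close>, as comorphisms.\<close>

definition one_param ::
  "'k ring \<Rightarrow> nat \<Rightarrow> nat \<Rightarrow> ('k, 'h) hopf \<Rightarrow> ('k, 'u) module \<Rightarrow> ('h \<Rightarrow> (nat \<Rightarrow> 'u) set) set" where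
  "one_param k p r G A = {\<theta> \<in> alg_hom k G (trunc_algebra p r A).
     \<forall>(A' :: ('k, 'u) module) \<phi>. algebra k A' \<and> \<phi> \<in> alg_hom k A A' \<longrightarrow>
       (\<forall>\<alpha>\<in>ga_points p r A'. \<forall>\<beta>\<in>ga_points p r A'.
          value_at G A A' \<phi> (\<alpha> \<oplus>\<^bsub>A'\<^esub> \<beta>) \<theta> =
          value_at G A A' \<phi> \<alpha> \<theta> \<otimes>\<^bsub>points k G A'\<^esub> value_at G A A' \<phi> \<beta> \<theta>)}"

text \<open>The product of the \<open>E_(B_s)(t^(p^s))\<close>, taken in \<open>G(A[t]/t^(p^r))\<close>.\<close>

definition exp_product ::
  "'k ring \<Rightarrow> nat \<Rightarrow> nat \<Rightarrow> ('k, 'h) hopf \<Rightarrow> ('k, 'u, 'h \<Rightarrow> 'u) coord \<Rightarrow>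
    ('h set \<Rightarrow> (nat \<Rightarrow> 'u) set) \<Rightarrow> ('k, 'u) module \<Rightarrow> ('h \<Rightarrow> 'u) list \<Rightarrow> 'h \<Rightarrow> (nat \<Rightarrow> 'u) set" where
  "exp_product k p r G N \<psi> A Bs =
     (let T = trunc_algebra p r A;
          cls = (\<lambda>f. trunc_ideal p r A +>\<^bsub>poly_algebra A\<^esub> f);
          t = cls (monom (UP A) \<one>\<^bsub>A\<^esub> 1);
          \<chi> = (\<lambda>B a. cls (monom (UP A) (nilp_classify k G N A B a) 0));
          factor = (\<lambda>s. \<lambda>h\<in>carrier G.
             value_at (frob_kernel k p r G) N T (\<chi> (Bs ! s)) (t [^]\<^bsub>T\<^esub> (p ^ s)) \<psi>
               (frob_ideal k p r G +>\<^bsub>G\<^esub> h))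
      in foldr (\<lambda>s x. factor s \<otimes>\<^bsub>points k G T\<^esub> x) [0..<r] \<one>\<^bsub>points k G T\<^esub>)"

definition exponential_type ::
  "'k ring \<Rightarrow> nat \<Rightarrow> nat \<Rightarrow> ('k, 'h) hopf \<Rightarrow> ('k, 'u, 'h \<Rightarrow> 'u) coord \<Rightarrow>
    ('h set \<Rightarrow> (nat \<Rightarrow> 'u) set) \<Rightarrow> bool" where
  "exponential_type k p r G N \<psi> \<longleftrightarrow> exponentiation k p r G N \<psi> \<and>
     (\<forall>\<Omega> :: ('k, 'u) module. algebra k \<Omega> \<and> algebraically_closed \<Omega> \<longrightarrow>
        bij_betw (exp_product k p r G N \<psi> \<Omega>) (comm_points k p G r \<Omega>) (one_param k p r G \<Omega>))"

text \<open>\<open>E\<close> is the comorphism of the morphism from \<open>G_a \<times> N_p(g)\<close> to \<open>G\<close>.\<close>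

definition exp_restrict ::
  "'k ring \<Rightarrow> nat \<Rightarrow> nat \<Rightarrow> ('k, 'h) hopf \<Rightarrow> ('k, 'u, 'h \<Rightarrow> 'u) coord \<Rightarrow>
    ('h \<Rightarrow> nat \<Rightarrow> 'u) \<Rightarrow> 'h set \<Rightarrow> (nat \<Rightarrow> 'u) set" where
  "exp_restrict k p r G N E = (\<lambda>x\<in>carrier (frob_kernel k p r G).
     the_elem ((\<lambda>h. trunc_ideal p r N +>\<^bsub>poly_algebra N\<^esub> E h) ` x))"

text \<open>The condition on \<^const>\<open>frob_ideal\<close> says that \<open>E\<close> restricts to a morphism from
  \<open>G_a(r) \<times> N_p(g)\<close> to \<open>G_(r)\<close>.\<close>

definition exponential_type_infinite ::
  "'k ring \<Rightarrow> nat \<Rightarrow> ('k, 'h) hopf \<Rightarrow> ('k, 'u, 'h \<Rightarrow> 'u) coord \<Rightarrow> ('h \<Rightarrow> nat \<Rightarrow> 'u) \<Rightarrow> bool" where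
  "exponential_type_infinite k p G N E \<longleftrightarrow>
     E \<in> alg_hom k G (poly_algebra N) \<and>
     (\<forall>r>0. E ` frob_ideal k p r G \<subseteq> trunc_ideal p r N \<and>
            exponential_type k p r G N (exp_restrict k p r G N E))"

section \<open>Jordan types\<close>

text \<open>A Jordan type is the function \<open>a\<close> with \<open>a i\<close> the number of blocks of size \<open>i\<close>.\<close>

definition jordan_types :: "nat \<Rightarrow> (nat \<Rightarrow> nat) set" where
  "jordan_types p = {a. \<forall>i. i \<notin> {1..p} \<longrightarrow> a i = 0}"

definition block_sizes :: "nat \<Rightarrow> (nat \<Rightarrow> nat) \<Rightarrow> nat list" where
  "block_sizes p a = concat (map (\<lambda>i. replicate (a i) i) (rev [1..<Suc p]))"

definition jt_le :: "nat \<Rightarrow> (nat \<Rightarrow> nat) \<Rightarrow> (nat \<Rightarrow> nat) \<Rightarrow> bool" where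
  "jt_le p a b \<longleftrightarrow> (\<forall>l. sum_list (take l (block_sizes p a)) \<le> sum_list (take l (block_sizes p b)))"

definition jt_topology :: "nat \<Rightarrow> (nat \<Rightarrow> nat) topology" where
  "jt_topology p = topology (\<lambda>U. U \<subseteq> jordan_types p \<and>
     (\<forall>a\<in>jordan_types p - U. \<forall>b\<in>jordan_types p. jt_le p b a \<longrightarrow> b \<in> jordan_types p - U))"

lemma openin_jt_topology:
  "openin (jt_topology p) U \<longleftrightarrow> U \<subseteq> jordan_types p \<and>
     (\<forall>a\<in>jordan_types p - U. \<forall>b\<in>jordan_types p. jt_le p b a \<longrightarrow> b \<in> jordan_types p - U)"
proof -
  have "istopology (\<lambda>U. U \<subseteq> jordan_types p \<and>
     (\<forall>a\<in>jordan_types p - U. \<forall>b\<in>jordan_types p. jt_le p b a \<longrightarrow> b \<in> jordan_types p - U))"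
    unfolding istopology_def by blast
  then show ?thesis unfolding jt_topology_def by (simp add: topology_inverse')
qed

text \<open>\<open>jordan_matrix K ns\<close> is block diagonal with nilpotent Jordan blocks of the sizes \<open>ns\<close>; the
  superdiagonal entry is missing where a block ends.\<close>

definition jordan_matrix :: "('a, 'm) ring_scheme \<Rightarrow> nat list \<Rightarrow> nat \<Rightarrow> nat \<Rightarrow> 'a" where
  "jordan_matrix K ns i j =
     (if j = Suc i \<and> j \<notin> {sum_list (take m ns) | m. m \<le> length ns} then \<one>\<^bsub>K\<^esub> else \<zero>\<^bsub>K\<^esub>)"

definition matrix_mult ::
  "('a, 'm) ring_scheme \<Rightarrow> nat \<Rightarrow> (nat \<Rightarrow> nat \<Rightarrow> 'a) \<Rightarrow> (nat \<Rightarrow> nat \<Rightarrow> 'a) \<Rightarrow> nat \<Rightarrow> nat \<Rightarrow> 'a" where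
  "matrix_mult K d S T = (\<lambda>i j. \<Oplus>\<^bsub>K\<^esub>l\<in>{..<d}. S i l \<otimes>\<^bsub>K\<^esub> T l j)"

definition similar_matrices ::
  "('a, 'm) ring_scheme \<Rightarrow> nat \<Rightarrow> (nat \<Rightarrow> nat \<Rightarrow> 'a) \<Rightarrow> (nat \<Rightarrow> nat \<Rightarrow> 'a) \<Rightarrow> bool" where
  "similar_matrices K d S T \<longleftrightarrow> (\<exists>P Q. (\<forall>i<d. \<forall>j<d. P i j \<in> carrier K \<and> Q i j \<in> carrier K \<and>
     matrix_mult K d P Q i j = (if i = j then \<one>\<^bsub>K\<^esub> else \<zero>\<^bsub>K\<^esub>) \<and>
     matrix_mult K d Q P i j = (if i = j then \<one>\<^bsub>K\<^esub> else \<zero>\<^bsub>K\<^esub>) \<and>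
     matrix_mult K d S P i j = matrix_mult K d P T i j))"

definition jordan_type :: "('a, 'm) ring_scheme \<Rightarrow> nat \<Rightarrow> (nat \<Rightarrow> nat \<Rightarrow> 'a) \<Rightarrow> nat \<Rightarrow> nat" where
  "jordan_type K d S = (THE a. \<exists>ns. 0 \<notin> set ns \<and> sum_list ns = d \<and>
     similar_matrices K d S (jordan_matrix K ns) \<and> a = count_list ns)"

section \<open>Distributions acting on modules\<close>

text \<open>
  For a homomorphism \<open>\<chi>\<close> from \<open>k[N_p(g)]\<close> to \<open>L\<close>, corresponding to an \<open>L\<close>-point \<open>B\<close> of \<open>N_p(g)\<close>, the map
  \<open>h \<mapsto> poly_map \<chi> (E h)\<close> is the comorphism \<open>k[G] \<rightarrow> L[t]\<close> of \<open>E_B\<close>.  As \<open>u_s\<close> is the functional taking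
  the coefficient of \<open>t^(p^s)\<close>, \<open>exp_push\<close> is the functional \<open>(E_B)_*(1 \<otimes> u_s)\<close> from \<open>k[G]\<close> to \<open>L\<close>,
  and \<open>exp_push_trunc\<close> is its analogue on \<open>k[G_(r)]\<close>.  A functional \<open>v\<close> acts on the module with
  coaction matrix \<open>c\<close> by the matrix \<open>v (c i j)\<close>.
\<close>

definition poly_map :: "('s \<Rightarrow> 'a) \<Rightarrow> (nat \<Rightarrow> 's) \<Rightarrow> nat \<Rightarrow> 'a" where
  "poly_map \<chi> f = (\<lambda>n. \<chi> (f n))"

definition exp_push ::
  "nat \<Rightarrow> ('k, 'l, 'm) module_scheme \<Rightarrow> ('u \<Rightarrow> 'l) \<Rightarrow> ('h \<Rightarrow> nat \<Rightarrow> 'u) \<Rightarrow> nat \<Rightarrow> 'h \<Rightarrow> 'l" where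
  "exp_push p L \<chi> E s h = coeff (UP L) (poly_map \<chi> (E h)) (p ^ s)"

definition exp_push_trunc ::
  "nat \<Rightarrow> nat \<Rightarrow> ('k, 'l, 'm) module_scheme \<Rightarrow> ('u \<Rightarrow> 'l) \<Rightarrow>
    ('h set \<Rightarrow> (nat \<Rightarrow> 'u) set) \<Rightarrow> nat \<Rightarrow> 'h set \<Rightarrow> 'l" where
  "exp_push_trunc p r L \<chi> \<psi> s x =
     the_elem ((\<lambda>f. coeff (UP L) f (p ^ s)) `
       the_elem ((\<lambda>f. trunc_ideal p r L +>\<^bsub>poly_algebra L\<^esub> poly_map \<chi> f) ` \<psi> x))"

text \<open>The \<open>s\<close>-th member \<open>B_s\<close> of the universal tuple over \<open>k[C_r(N_p(g))]\<close>, extended by zeros.\<close>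

definition component ::
  "('k, 'h) hopf \<Rightarrow> ('k, 'u, ('h \<Rightarrow> 'u) list) coord \<Rightarrow> nat \<Rightarrow> 'h \<Rightarrow> 'u" where
  "component G R s = (if s < length (univ R) then univ R ! s else lie_zero G R)"

definition at_point ::
  "'k ring \<Rightarrow> ('k, 'h) hopf \<Rightarrow> ('k, 'u, 'h \<Rightarrow> 'u) coord \<Rightarrow> ('k, 'u, ('h \<Rightarrow> 'u) list) coord \<Rightarrow>
    'u set \<Rightarrow> nat \<Rightarrow> 'u \<Rightarrow> ('u \<times> 'u) set" where
  "at_point k G N R P s = to_residue R P \<circ> nilp_classify k G N R (component G R s)"

definition JT_exp ::
  "'k ring \<Rightarrow> nat \<Rightarrow> ('k, 'h) hopf \<Rightarrow> ('k, 'u, 'h \<Rightarrow> 'u) coord \<Rightarrow>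
    (nat \<Rightarrow> ('k, 'u, ('h \<Rightarrow> 'u) list) coord) \<Rightarrow> nat \<Rightarrow> ('h set \<Rightarrow> (nat \<Rightarrow> 'u) set) \<Rightarrow>
    nat \<Rightarrow> (nat \<Rightarrow> nat \<Rightarrow> 'h set) \<Rightarrow> 'u set \<Rightarrow> nat \<Rightarrow> nat" where
  "JT_exp k p G N C r \<psi> d c P =
     (let K = residue_field (C r) P
      in jordan_type K d (\<lambda>i j. \<Oplus>\<^bsub>K\<^esub>s\<in>{..<r}.
           exp_push_trunc p r K (at_point k G N (C r) P s) \<psi> (r - s - 1) (c i j)))"

section \<open>The ind-scheme of finite commuting sequences\<close>

text \<open>
  \<open>extend_hom k G C m n\<close> is the comorphism of the map \<open>C_m \<rightarrow> C_n\<close> extending a tuple by zeros.  A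
  point of the ind-scheme is a class of pairs \<open>(m, P)\<close> with \<open>P\<close> a point of \<open>C_m\<close>.
\<close>

definition extend_hom ::
  "'k ring \<Rightarrow> ('k, 'h) hopf \<Rightarrow> (nat \<Rightarrow> ('k, 'u, ('h \<Rightarrow> 'u) list) coord) \<Rightarrow> nat \<Rightarrow> nat \<Rightarrow> 'u \<Rightarrow> 'u" where
  "extend_hom k G C m n =
     comm_classify k G (C n) (C m) (map (component G (C m)) [0..<n])"

definition ind_rel ::
  "'k ring \<Rightarrow> ('k, 'h) hopf \<Rightarrow> (nat \<Rightarrow> ('k, 'u, ('h \<Rightarrow> 'u) list) coord) \<Rightarrow>
    ((nat \<times> 'u set) \<times> (nat \<times> 'u set)) set" where
  "ind_rel k G C = {((m, P), (n, Q)). P \<in> Spec (C m) \<and> Q \<in> Spec (C n) \<and>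
     (\<exists>l. m \<le> l \<and> n \<le> l \<and>
        spec_map (extend_hom k G C m l) (C l) P = spec_map (extend_hom k G C n l) (C l) Q)}"

definition ind_points ::
  "'k ring \<Rightarrow> ('k, 'h) hopf \<Rightarrow> (nat \<Rightarrow> ('k, 'u, ('h \<Rightarrow> 'u) list) coord) \<Rightarrow>
    (nat \<times> 'u set) set set" where
  "ind_points k G C = (SIGMA m:UNIV. Spec (C m)) // ind_rel k G C"

definition ind_topology ::
  "'k ring \<Rightarrow> ('k, 'h) hopf \<Rightarrow> (nat \<Rightarrow> ('k, 'u, ('h \<Rightarrow> 'u) list) coord) \<Rightarrow>
    (nat \<times> 'u set) set topology" where
  "ind_topology k G C = topology (\<lambda>U. U \<subseteq> ind_points k G C \<and>
     (\<forall>m. openin (zariski (C m)) {P \<in> Spec (C m). ind_rel k G C `` {(m, P)} \<in> U}))"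

lemma openin_ind_topology:
  "openin (ind_topology k G C) U \<longleftrightarrow> U \<subseteq> ind_points k G C \<and>
     (\<forall>m. openin (zariski (C m)) {P \<in> Spec (C m). ind_rel k G C `` {(m, P)} \<in> U})"
proof -
  let ?f = "\<lambda>m U. {P \<in> Spec (C m). ind_rel k G C `` {(m, P)} \<in> U}"
  have *: "?f m (U \<inter> V) = ?f m U \<inter> ?f m V" "?f m (\<Union>\<K>) = \<Union>(?f m ` \<K>)" for m U V \<K>
    by auto
  have "istopology (\<lambda>U. U \<subseteq> ind_points k G C \<and> (\<forall>m. openin (zariski (C m)) (?f m U)))"
    unfolding istopology_def * by (auto intro!: openin_Int openin_Union)
  then show ?thesis unfolding ind_topology_def by (simp add: topology_inverse')
qed

text \<open>
  The next two maps are given on representatives \<open>(m, P)\<close>, on which they do not depend.  The set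
  over which \<open>s\<close> is summed is finite: it contains only indices below \<open>m\<close>, as \<open>B_s = 0\<close> for the others.
\<close>

definition JT_exp_infinite ::
  "'k ring \<Rightarrow> nat \<Rightarrow> ('k, 'h) hopf \<Rightarrow> ('k, 'u, 'h \<Rightarrow> 'u) coord \<Rightarrow>
    (nat \<Rightarrow> ('k, 'u, ('h \<Rightarrow> 'u) list) coord) \<Rightarrow> ('h \<Rightarrow> nat \<Rightarrow> 'u) \<Rightarrow>
    nat \<Rightarrow> (nat \<Rightarrow> nat \<Rightarrow> 'h) \<Rightarrow> (nat \<times> 'u set) set \<Rightarrow> nat \<Rightarrow> nat" where
  "JT_exp_infinite k p G N C E d c x = the_elem ((\<lambda>(m, P).
     let K = residue_field (C m) P;
         T = (\<lambda>s i j. exp_push p K (at_point k G N (C m) P s) E s (c i j))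
     in jordan_type K d (\<lambda>i j. \<Oplus>\<^bsub>K\<^esub>s\<in>{s. T s i j \<noteq> \<zero>\<^bsub>K\<^esub>}. T s i j)) ` x)"

definition Lambda ::
  "'k ring \<Rightarrow> ('k, 'h) hopf \<Rightarrow> (nat \<Rightarrow> ('k, 'u, ('h \<Rightarrow> 'u) list) coord) \<Rightarrow> nat \<Rightarrow>
    (nat \<times> 'u set) set \<Rightarrow> 'u set" where
  "Lambda k G C r x = the_elem ((\<lambda>(m, P).
     spec_map (comm_classify k G (C r) (C m) (map (component G (C m)) (rev [0..<r]))) (C r) P) ` x)"

end

theory Submission
  imports Defs
begin

text \<open>
  The matrix coefficients of the module are finitely many functions on the group, and their pullbacks
  along the exponential are polynomials in \<open>t\<close>. So there is an \<open>r0\<close> such that for \<open>s \<ge> r0\<close> all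
  coefficients at \<open>t^(p^s)\<close> vanish, that is, \<open>u_s\<close> acts as zero through every \<open>E_B\<close>. For \<open>r \<ge> r0\<close> the
  operator of infinite height at \<open>(B_0, B_1, ...)\<close> is therefore the sum over \<open>s < r\<close> of the operators
  of \<open>u_s\<close> for \<open>B_s\<close>, and this is the operator of height \<open>r\<close> at \<open>(B_(r-1), ..., B_0)\<close>, where \<open>u_(r-s-1)\<close>
  is paired with the \<open>s\<close>-th entry. The two operators live over different residue fields, and the
  point of \<open>C_r\<close> is only the image of the given point. But the operator is the value at a point of one
  matrix with entries in \<open>k[C_r]\<close>, which pulls back to the corresponding matrix over \<open>k[C_m]\<close>
  (\<open>exp_matrix_hom\<close>), and Jordan types do not change under extensions of fields (\<open>jt_extension\<close>). The
  same argument shows that the Jordan type of infinite height is well defined on classes of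
  representatives \<open>(m, P)\<close>.

  Jordan types of the operators at points make sense because the universal matrix is nilpotent. Let
  \<open>g_n\<close> be the matrix by which the coefficient of \<open>t^n\<close> in \<open>E_B\<close> acts. Since \<open>E_B\<close> is a homomorphism,
  \<open>g_a g_b\<close> is the binomial coefficient of \<open>a + b\<close> over \<open>a\<close> times \<open>g_(a+b)\<close> (\<open>coefm_divided_power\<close>), and
  for commuting elements the matrices commute (\<open>coefm_commute\<close>). Both are obtained by comparing
  coefficients in an extension \<open>A[s, t]/(s^q, t^q)\<close> of the algebra at hand (\<open>bivariate_extension\<close>). It
  follows that the \<open>p\<close>-th power of \<open>g_(p^s)\<close> is a multiple of a binomial coefficient that is zero in \<open>k\<close>,
  and that sums of such operators for commuting elements have \<open>p\<close>-th power zero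
  (\<open>divided_powers_nilpotent\<close>).

  Continuity holds for every matrix with \<open>p\<close>-th power zero over a ring \<open>R\<close> (\<open>jt_continuous\<close>): the rank
  of each power is lower semicontinuous on \<open>Spec R\<close> (\<open>rank_open\<close>), and the order on Jordan types is
  given by the ranks of the powers, because the sum of the \<open>l\<close> largest parts of a partition is the
  minimum over \<open>i\<close> of \<open>l i\<close> plus the rank of the \<open>i\<close>-th power (\<open>jt_le_if_ranks_le\<close>). Jordan forms are
  derived from bases consisting of chains of a nilpotent operator, which arise from any finite
  system of generators by shortening dependent chains (\<open>chain_basis_exists\<close>).
\<close>

section \<open>Linear algebra over fields given as records\<close>

lemma (in abelian_monoid) finsum_swap:
  assumes "finite I" "finite J" "\<And>i j. i \<in> I \<Longrightarrow> j \<in> J \<Longrightarrow> f i j \<in> carrier G"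
  shows "(\<Oplus>i\<in>I. \<Oplus>j\<in>J. f i j) = (\<Oplus>j\<in>J. \<Oplus>i\<in>I. f i j)"
  using assms(1,3)
proof (induction I)
  case empty
  then show ?case by (simp add: finsum_zero)
next
  case (insert x F)
  have "(\<Oplus>j\<in>J. \<Oplus>i\<in>insert x F. f i j) = (\<Oplus>j\<in>J. f x j \<oplus> (\<Oplus>i\<in>F. f i j))"
    using insert by (intro finsum_cong') (auto simp: Pi_def)
  also have "\<dots> = (\<Oplus>j\<in>J. f x j) \<oplus> (\<Oplus>j\<in>J. \<Oplus>i\<in>F. f i j)"
    using insert by (intro finsum_addf) (auto simp: Pi_def)
  also have "\<dots> = (\<Oplus>i\<in>insert x F. \<Oplus>j\<in>J. f i j)"
    using insert by (subst finsum_insert) (auto simp: Pi_def)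
  finally show ?case by simp
qed

lemma (in abelian_monoid) finsum_delta:
  assumes "finite I" "i \<in> I" "f i \<in> carrier G"
  shows "(\<Oplus>j\<in>I. if j = i then f j else \<zero>) = f i"
proof -
  have "(\<Oplus>j\<in>I. if j = i then f j else \<zero>) = (\<Oplus>j\<in>I. if i = j then f j else \<zero>)"
    by (rule arg_cong[where f = "\<lambda>g. finsum G g I"]) auto
  also have "\<dots> = (\<Oplus>j\<in>I. if i = j then (\<lambda>_. f i) j else \<zero>)"
    by (rule arg_cong[where f = "\<lambda>g. finsum G g I"]) auto
  also have "\<dots> = f i"
    using assms by (intro finsum_singleton) auto
  finally show ?thesis .
qed

lemma (in abelian_monoid) finsum_mono_neutral:
  assumes "finite B" "A \<subseteq> B" "\<And>i. i \<in> B - A \<Longrightarrow> f i = \<zero>" "\<And>i. i \<in> A \<Longrightarrow> f i \<in> carrier G"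
  shows "finsum G f A = finsum G f B"
proof (rule add.finprod_mono_neutral_cong_left)
  show "f \<in> B \<rightarrow> carrier G"
  proof
    fix x assume "x \<in> B"
    then show "f x \<in> carrier G" using assms(3,4)[of x] by (cases "x \<in> A") auto
  qed
qed (use assms in auto)

lemma (in module) finsum_smult_rdistr:
  assumes "finite A" "\<And>i. i \<in> A \<Longrightarrow> f i \<in> carrier R" "x \<in> carrier M"
  shows "(\<Oplus>i\<in>A. f i) \<odot>\<^bsub>M\<^esub> x = (\<Oplus>\<^bsub>M\<^esub>i\<in>A. f i \<odot>\<^bsub>M\<^esub> x)"
  using assms
proof (induction A)
  case (insert y F)
  then have "f \<in> F \<rightarrow> carrier R" by auto
  then show ?case using insert by (auto simp: smult_l_distr Pi_def)
qed simp

text \<open>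
  Gaussian elimination, by induction on the set of equations: either the first equation is void, or it
  is used to eliminate an unknown with nonzero coefficient, which removes one equation and one unknown.
\<close>

lemma (in field) homogeneous_system:
  assumes "finite J" "finite I" "card J < card I"
    and "\<And>i j. i \<in> I \<Longrightarrow> j \<in> J \<Longrightarrow> a i j \<in> carrier R"
  shows "\<exists>c. (\<forall>i\<in>I. c i \<in> carrier R) \<and> (\<exists>i\<in>I. c i \<noteq> \<zero>) \<and>
    (\<forall>j\<in>J. (\<Oplus>i\<in>I. c i \<otimes> a i j) = \<zero>)"
  using assms
proof (induction J arbitrary: I a)
  case empty
  then obtain i where "i \<in> I" by fastforce
  then show ?case by (intro exI[of _ "\<lambda>_. \<one>"]) auto
next
  case (insert j J)
  show ?case
  proof (cases "\<forall>i\<in>I. a i j = \<zero>")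
    case True
    obtain c where c: "\<forall>i\<in>I. c i \<in> carrier R" "\<exists>i\<in>I. c i \<noteq> \<zero>"
        "\<forall>j\<in>J. (\<Oplus>i\<in>I. c i \<otimes> a i j) = \<zero>"
      using insert.IH[of I a] insert.prems insert.hyps by auto
    have "(\<Oplus>i\<in>I. c i \<otimes> a i j) = \<zero>"
      using True c(1) by (intro add.finprod_one_eqI) auto
    then show ?thesis using c by auto
  next
    case False
    then obtain i0 where i0: "i0 \<in> I" "a i0 j \<noteq> \<zero>" by blast
    let ?I = "I - {i0}"
    define q where "q = (\<lambda>i. a i j \<otimes> inv (a i0 j))"
    have inv: "inv (a i0 j) \<in> carrier R" "inv (a i0 j) \<otimes> a i0 j = \<one>"
      using i0 insert.prems field_Units by auto
    have q: "q i \<in> carrier R" if "i \<in> I" for i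
      using that inv insert.prems unfolding q_def by auto
    define b where "b = (\<lambda>i l. a i l \<ominus> q i \<otimes> a i0 l)"
    have "card J < card ?I" using insert.prems insert.hyps i0 by auto
    then obtain c where c: "\<forall>i\<in>?I. c i \<in> carrier R" "\<exists>i\<in>?I. c i \<noteq> \<zero>"
        "\<forall>j\<in>J. (\<Oplus>i\<in>?I. c i \<otimes> b i j) = \<zero>"
      using insert.IH[of ?I b] insert.prems q i0 unfolding b_def by auto
    define c0 where "c0 = \<ominus> (\<Oplus>i\<in>?I. c i \<otimes> q i)"
    define c' where "c' = c(i0 := c0)"
    have S: "(\<Oplus>i\<in>?I. c i \<otimes> q i) \<in> carrier R"
      using c q by (intro finsum_closed) auto
    then have c0: "c0 \<in> carrier R" unfolding c0_def by auto
    have eq: "(\<Oplus>i\<in>I. c' i \<otimes> a i l) = (\<Oplus>i\<in>?I. c i \<otimes> b i l)" if l: "l \<in> insert j J" for l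
    proof -
      have "(\<Oplus>i\<in>I. c' i \<otimes> a i l) = (\<Oplus>i\<in>insert i0 ?I. c' i \<otimes> a i l)"
        using i0 by (simp add: insert_absorb)
      also have "\<dots> = c0 \<otimes> a i0 l \<oplus> (\<Oplus>i\<in>?I. c' i \<otimes> a i l)"
        using insert.prems c c0 i0 l by (subst finsum_insert) (auto simp: c'_def Pi_def)
      also have "(\<Oplus>i\<in>?I. c' i \<otimes> a i l) = (\<Oplus>i\<in>?I. c i \<otimes> a i l)"
        using insert.prems c l by (intro finsum_cong') (auto simp: c'_def Pi_def)
      also have "\<dots> = (\<Oplus>i\<in>?I. c i \<otimes> b i l \<oplus> (c i \<otimes> q i) \<otimes> a i0 l)"
      proof (intro finsum_cong')
        fix i assume i: "i \<in> ?I"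
        have m: "c i \<in> carrier R" "a i l \<in> carrier R" "q i \<in> carrier R" "a i0 l \<in> carrier R"
          using c q i i0 insert.prems l by auto
        have "c i \<otimes> b i l \<oplus> (c i \<otimes> q i) \<otimes> a i0 l
            = c i \<otimes> ((a i l \<ominus> q i \<otimes> a i0 l) \<oplus> q i \<otimes> a i0 l)"
          unfolding b_def using m by (simp add: r_distr m_assoc)
        also have "(a i l \<ominus> q i \<otimes> a i0 l) \<oplus> q i \<otimes> a i0 l = a i l"
          using m by (simp add: minus_eq a_assoc l_neg)
        finally show "c i \<otimes> a i l = c i \<otimes> b i l \<oplus> (c i \<otimes> q i) \<otimes> a i0 l" by simp
      qed (use c q i0 insert.prems l in \<open>auto simp: b_def\<close>)
      also have "\<dots> = (\<Oplus>i\<in>?I. c i \<otimes> b i l) \<oplus> (\<Oplus>i\<in>?I. (c i \<otimes> q i) \<otimes> a i0 l)"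
        using c q i0 insert.prems l by (intro finsum_addf) (auto simp: b_def)
      also have "(\<Oplus>i\<in>?I. (c i \<otimes> q i) \<otimes> a i0 l) = (\<Oplus>i\<in>?I. c i \<otimes> q i) \<otimes> a i0 l"
        using c q i0 insert.prems l by (intro finsum_ldistr[symmetric]) auto
      finally have *: "(\<Oplus>i\<in>I. c' i \<otimes> a i l) = c0 \<otimes> a i0 l \<oplus>
        ((\<Oplus>i\<in>?I. c i \<otimes> b i l) \<oplus> (\<Oplus>i\<in>?I. c i \<otimes> q i) \<otimes> a i0 l)" .
      have Sb: "(\<Oplus>i\<in>?I. c i \<otimes> b i l) \<in> carrier R"
        using c q i0 insert.prems l by (intro finsum_closed) (auto simp: b_def)
      have al: "a i0 l \<in> carrier R" using i0 insert.prems l by auto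
      show ?thesis unfolding * c0_def using S Sb al
        by (simp add: l_minus a_ac r_neg1 r_neg2)
          (metis (no_types, lifting) a_assoc a_comm a_inv_closed l_neg m_closed r_zero)
    qed
    have "(\<Oplus>i\<in>?I. c i \<otimes> b i j) = \<zero>"
    proof (intro add.finprod_one_eqI)
      fix i assume i: "i \<in> ?I"
      then have m: "c i \<in> carrier R" "a i j \<in> carrier R" "a i0 j \<in> carrier R"
        using c i0 insert.prems by auto
      have "q i \<otimes> a i0 j = a i j"
        unfolding q_def using m inv by (simp add: m_assoc)
      then have "b i j = \<zero>" unfolding b_def using m by simp
      then show "c i \<otimes> b i j = \<zero>" using m by simp
    qed
    then have "\<forall>l\<in>insert j J. (\<Oplus>i\<in>I. c' i \<otimes> a i l) = \<zero>" using eq c(3) by auto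
    moreover have "\<forall>i\<in>I. c' i \<in> carrier R" using c c0 by (auto simp: c'_def)
    moreover have "\<exists>i\<in>I. c' i \<noteq> \<zero>" using c by (auto simp: c'_def)
    ultimately show ?thesis by blast
  qed
qed

definition lin_indep :: "('k, 'm) ring_scheme \<Rightarrow> ('k, 'v, 'n) module_scheme \<Rightarrow> 'i set \<Rightarrow> ('i \<Rightarrow> 'v) \<Rightarrow> bool"
  where "lin_indep K V I v \<longleftrightarrow> (\<forall>a. (\<forall>i\<in>I. a i \<in> carrier K) \<longrightarrow>
    (\<Oplus>\<^bsub>V\<^esub>i\<in>I. a i \<odot>\<^bsub>V\<^esub> v i) = \<zero>\<^bsub>V\<^esub> \<longrightarrow> (\<forall>i\<in>I. a i = \<zero>\<^bsub>K\<^esub>))"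

definition lin_spans :: "('k, 'm) ring_scheme \<Rightarrow> ('k, 'v, 'n) module_scheme \<Rightarrow> 'i set \<Rightarrow> ('i \<Rightarrow> 'v) \<Rightarrow> bool"
  where "lin_spans K V I v \<longleftrightarrow> (\<forall>x\<in>carrier V. \<exists>a. (\<forall>i\<in>I. a i \<in> carrier K) \<and>
    x = (\<Oplus>\<^bsub>V\<^esub>i\<in>I. a i \<odot>\<^bsub>V\<^esub> v i))"

lemma lin_indepD:
  assumes "lin_indep K V I v" "\<And>i. i \<in> I \<Longrightarrow> a i \<in> carrier K"
    "(\<Oplus>\<^bsub>V\<^esub>i\<in>I. a i \<odot>\<^bsub>V\<^esub> v i) = \<zero>\<^bsub>V\<^esub>" "i \<in> I"
  shows "a i = \<zero>\<^bsub>K\<^esub>"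
  using assms unfolding lin_indep_def by blast

locale vector_space_rec = module K V + field K for K (structure) and V (structure)
begin

lemma lincomb_lincomb:
  assumes "finite I" "finite J" "\<And>i. i \<in> I \<Longrightarrow> c i \<in> carrier K"
    "\<And>i j. i \<in> I \<Longrightarrow> j \<in> J \<Longrightarrow> b i j \<in> carrier K" "\<And>j. j \<in> J \<Longrightarrow> v j \<in> carrier V"
  shows "(\<Oplus>\<^bsub>V\<^esub>i\<in>I. c i \<odot>\<^bsub>V\<^esub> (\<Oplus>\<^bsub>V\<^esub>j\<in>J. b i j \<odot>\<^bsub>V\<^esub> v j)) =
    (\<Oplus>\<^bsub>V\<^esub>j\<in>J. (\<Oplus>i\<in>I. c i \<otimes> b i j) \<odot>\<^bsub>V\<^esub> v j)"
proof -
  have "(\<Oplus>\<^bsub>V\<^esub>i\<in>I. c i \<odot>\<^bsub>V\<^esub> (\<Oplus>\<^bsub>V\<^esub>j\<in>J. b i j \<odot>\<^bsub>V\<^esub> v j)) =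
      (\<Oplus>\<^bsub>V\<^esub>i\<in>I. \<Oplus>\<^bsub>V\<^esub>j\<in>J. (c i \<otimes> b i j) \<odot>\<^bsub>V\<^esub> v j)"
  proof (intro M.finsum_cong')
    fix i assume i: "i \<in> I"
    have "c i \<odot>\<^bsub>V\<^esub> (\<Oplus>\<^bsub>V\<^esub>j\<in>J. b i j \<odot>\<^bsub>V\<^esub> v j) = (\<Oplus>\<^bsub>V\<^esub>j\<in>J. c i \<odot>\<^bsub>V\<^esub> (b i j \<odot>\<^bsub>V\<^esub> v j))"
      using assms i by (intro finsum_smult_ldistr) auto
    also have "\<dots> = (\<Oplus>\<^bsub>V\<^esub>j\<in>J. (c i \<otimes> b i j) \<odot>\<^bsub>V\<^esub> v j)"
      using assms i by (intro M.finsum_cong') (auto simp: smult_assoc1)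
    finally show "c i \<odot>\<^bsub>V\<^esub> (\<Oplus>\<^bsub>V\<^esub>j\<in>J. b i j \<odot>\<^bsub>V\<^esub> v j) = (\<Oplus>\<^bsub>V\<^esub>j\<in>J. (c i \<otimes> b i j) \<odot>\<^bsub>V\<^esub> v j)" .
  qed (use assms in \<open>auto intro!: M.finsum_closed\<close>)
  also have "\<dots> = (\<Oplus>\<^bsub>V\<^esub>j\<in>J. \<Oplus>\<^bsub>V\<^esub>i\<in>I. (c i \<otimes> b i j) \<odot>\<^bsub>V\<^esub> v j)"
    using assms by (intro M.finsum_swap) auto
  also have "\<dots> = (\<Oplus>\<^bsub>V\<^esub>j\<in>J. (\<Oplus>i\<in>I. c i \<otimes> b i j) \<odot>\<^bsub>V\<^esub> v j)"
    using assms
    by (intro M.finsum_cong' finsum_smult_rdistr[symmetric]) (auto intro!: M.finsum_closed finsum_closed)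
  finally show ?thesis .
qed

text \<open>
  The coefficients \<open>b\<close> give a homogeneous system; if there were more \<open>w\<close>'s
  than \<open>v\<close>'s, a nontrivial solution of it would be a relation between the
  \<open>w\<close>'s.
\<close>

lemma steinitz:
  assumes "finite I" "finite J" "lin_indep K V I w"
    and "\<And>j. j \<in> J \<Longrightarrow> v j \<in> carrier V"
    and "\<And>i j. i \<in> I \<Longrightarrow> j \<in> J \<Longrightarrow> b i j \<in> carrier K"
    and "\<And>i. i \<in> I \<Longrightarrow> w i = (\<Oplus>\<^bsub>V\<^esub>j\<in>J. b i j \<odot>\<^bsub>V\<^esub> v j)"
  shows "card I \<le> card J"
proof (rule ccontr)
  assume "\<not> card I \<le> card J"
  then have "card J < card I" by simp
  from homogeneous_system[where a = b, OF assms(2,1) this assms(5)]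
  obtain c where c: "\<forall>i\<in>I. c i \<in> carrier K" "\<exists>i\<in>I. c i \<noteq> \<zero>"
      "\<forall>j\<in>J. (\<Oplus>i\<in>I. c i \<otimes> b i j) = \<zero>" by blast
  have "(\<Oplus>\<^bsub>V\<^esub>i\<in>I. c i \<odot>\<^bsub>V\<^esub> w i) = (\<Oplus>\<^bsub>V\<^esub>i\<in>I. c i \<odot>\<^bsub>V\<^esub> (\<Oplus>\<^bsub>V\<^esub>j\<in>J. b i j \<odot>\<^bsub>V\<^esub> v j))"
  proof (rule M.finsum_cong')
    have "(\<Oplus>\<^bsub>V\<^esub>j\<in>J. b i j \<odot>\<^bsub>V\<^esub> v j) \<in> carrier V" if "i \<in> I" for i
      using assms(4,5) that by (intro M.finsum_closed) auto
    then show "(\<lambda>i. c i \<odot>\<^bsub>V\<^esub> (\<Oplus>\<^bsub>V\<^esub>j\<in>J. b i j \<odot>\<^bsub>V\<^esub> v j)) \<in> I \<rightarrow> carrier V"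
      using c by auto
  qed (simp_all only: assms(6))
  also have "\<dots> = (\<Oplus>\<^bsub>V\<^esub>j\<in>J. (\<Oplus>i\<in>I. c i \<otimes> b i j) \<odot>\<^bsub>V\<^esub> v j)"
    using assms c by (intro lincomb_lincomb) auto
  also have "\<dots> = \<zero>\<^bsub>V\<^esub>"
    using assms c by (intro M.add.finprod_one_eqI) auto
  finally have "c i = \<zero>" if "i \<in> I" for i
    using that c(1) by (intro lin_indepD[OF assms(3)]) auto
  then show False using c(2) by blast
qed

lemma lin_indep_subset:
  assumes "lin_indep K V I v" "finite I" "J \<subseteq> I" "\<And>i. i \<in> I \<Longrightarrow> v i \<in> carrier V"
  shows "lin_indep K V J v"
  unfolding lin_indep_def
proof (intro allI impI)
  fix a assume a: "\<forall>i\<in>J. a i \<in> carrier K" "(\<Oplus>\<^bsub>V\<^esub>i\<in>J. a i \<odot>\<^bsub>V\<^esub> v i) = \<zero>\<^bsub>V\<^esub>"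
  let ?a = "\<lambda>i. if i \<in> J then a i else \<zero>"
  have 1: "(\<Oplus>\<^bsub>V\<^esub>i\<in>I. ?a i \<odot>\<^bsub>V\<^esub> v i) = (\<Oplus>\<^bsub>V\<^esub>i\<in>J. a i \<odot>\<^bsub>V\<^esub> v i)"
    using assms a by (intro M.add.finprod_mono_neutral_cong_left[symmetric]) auto
  have "?a i = \<zero>" if "i \<in> I" for i
    by (rule lin_indepD[OF assms(1) _ trans[OF 1 a(2)] that]) (use a in auto)
  then show "\<forall>i\<in>J. a i = \<zero>" using assms(3) by (metis (full_types) subsetD)
qed

lemma lin_indep_cong:
  assumes "lin_indep K V I v" "\<And>i. i \<in> I \<Longrightarrow> v i = w i" "\<And>i. i \<in> I \<Longrightarrow> w i \<in> carrier V"
  shows "lin_indep K V I w"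
  unfolding lin_indep_def
proof (intro allI impI ballI)
  fix a i assume a: "\<forall>i\<in>I. a i \<in> carrier K" "(\<Oplus>\<^bsub>V\<^esub>i\<in>I. a i \<odot>\<^bsub>V\<^esub> w i) = \<zero>\<^bsub>V\<^esub>" "i \<in> I"
  have "(\<Oplus>\<^bsub>V\<^esub>i\<in>I. a i \<odot>\<^bsub>V\<^esub> v i) = (\<Oplus>\<^bsub>V\<^esub>i\<in>I. a i \<odot>\<^bsub>V\<^esub> w i)"
    using a(1) assms(2,3) by (intro M.finsum_cong') auto
  then show "a i = \<zero>" using a by (intro lin_indepD[OF assms(1)]) auto
qed

lemma lin_indep_reindex:
  assumes "lin_indep K V (h ` J) v" "inj_on h J" "\<And>i. i \<in> h ` J \<Longrightarrow> v i \<in> carrier V"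
  shows "lin_indep K V J (\<lambda>j. v (h j))"
  unfolding lin_indep_def
proof (intro allI impI)
  fix a assume a: "\<forall>i\<in>J. a i \<in> carrier K" "(\<Oplus>\<^bsub>V\<^esub>j\<in>J. a j \<odot>\<^bsub>V\<^esub> v (h j)) = \<zero>\<^bsub>V\<^esub>"
  let ?a = "\<lambda>i. a (the_inv_into J h i)"
  have "(\<Oplus>\<^bsub>V\<^esub>i\<in>h ` J. ?a i \<odot>\<^bsub>V\<^esub> v i) = (\<Oplus>\<^bsub>V\<^esub>j\<in>J. ?a (h j) \<odot>\<^bsub>V\<^esub> v (h j))"
    using assms a by (intro M.finsum_reindex) (auto simp: the_inv_into_f_f)
  also have "\<dots> = (\<Oplus>\<^bsub>V\<^esub>j\<in>J. a j \<odot>\<^bsub>V\<^esub> v (h j))"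
    using assms a by (intro M.finsum_cong') (auto simp: the_inv_into_f_f)
  finally have 1: "(\<Oplus>\<^bsub>V\<^esub>i\<in>h ` J. ?a i \<odot>\<^bsub>V\<^esub> v i) = \<zero>\<^bsub>V\<^esub>" using a by simp
  have "?a i = \<zero>" if "i \<in> h ` J" for i
    by (rule lin_indepD[OF assms(1) _ 1 that]) (use assms(2) a in \<open>auto simp: the_inv_into_f_f\<close>)
  then show "\<forall>i\<in>J. a i = \<zero>" using assms(2) by (metis imageI the_inv_into_f_f)
qed

lemma lin_spans_reindex:
  assumes "lin_spans K V (h ` J) v" "inj_on h J" "\<And>i. i \<in> h ` J \<Longrightarrow> v i \<in> carrier V"
  shows "lin_spans K V J (\<lambda>j. v (h j))"
  unfolding lin_spans_def
proof
  fix x assume "x \<in> carrier V"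
  then obtain a where a: "\<forall>i\<in>h ` J. a i \<in> carrier K" "x = (\<Oplus>\<^bsub>V\<^esub>i\<in>h ` J. a i \<odot>\<^bsub>V\<^esub> v i)"
    using assms(1) unfolding lin_spans_def by blast
  have "(\<Oplus>\<^bsub>V\<^esub>i\<in>h ` J. a i \<odot>\<^bsub>V\<^esub> v i) = (\<Oplus>\<^bsub>V\<^esub>j\<in>J. a (h j) \<odot>\<^bsub>V\<^esub> v (h j))"
    using assms a by (intro M.finsum_reindex) auto
  then show "\<exists>a. (\<forall>i\<in>J. a i \<in> carrier K) \<and> x = (\<Oplus>\<^bsub>V\<^esub>i\<in>J. a i \<odot>\<^bsub>V\<^esub> v (h i))"
    using a by (intro exI[of _ "\<lambda>j. a (h j)"]) auto
qed

lemma lincomb_submodule: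
  assumes "finite I" "\<And>i. i \<in> I \<Longrightarrow> v i \<in> carrier V"
  shows "submodule {x. \<exists>a. (\<forall>i\<in>I. a i \<in> carrier K) \<and> x = (\<Oplus>\<^bsub>V\<^esub>i\<in>I. a i \<odot>\<^bsub>V\<^esub> v i)} K V"
    (is "submodule ?H K V")
proof (rule submoduleI)
  show "?H \<subseteq> carrier V" using assms by (auto intro!: M.finsum_closed)
  show "\<zero>\<^bsub>V\<^esub> \<in> ?H"
    using assms by (auto intro!: exI[of _ "\<lambda>_. \<zero>"] M.add.finprod_one_eqI[symmetric])
  have sm: "c \<odot>\<^bsub>V\<^esub> x \<in> ?H" if "c \<in> carrier K" "x \<in> ?H" for c x
  proof -
    from that obtain a where a: "\<forall>i\<in>I. a i \<in> carrier K" "x = (\<Oplus>\<^bsub>V\<^esub>i\<in>I. a i \<odot>\<^bsub>V\<^esub> v i)" by blast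
    have "c \<odot>\<^bsub>V\<^esub> x = (\<Oplus>\<^bsub>V\<^esub>i\<in>I. c \<odot>\<^bsub>V\<^esub> (a i \<odot>\<^bsub>V\<^esub> v i))"
      unfolding a(2) using assms a that by (intro finsum_smult_ldistr) auto
    also have "\<dots> = (\<Oplus>\<^bsub>V\<^esub>i\<in>I. (c \<otimes> a i) \<odot>\<^bsub>V\<^esub> v i)"
      using assms a that by (intro M.finsum_cong') (auto simp: smult_assoc1)
    finally show ?thesis using a that by (auto intro!: exI[of _ "\<lambda>i. c \<otimes> a i"])
  qed
  then show "\<And>a x. a \<in> carrier K \<Longrightarrow> x \<in> ?H \<Longrightarrow> a \<odot>\<^bsub>V\<^esub> x \<in> ?H" by blast
  have "\<ominus>\<^bsub>V\<^esub> x = (\<ominus> \<one>) \<odot>\<^bsub>V\<^esub> x" if "x \<in> carrier V" for x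
    using that by (simp add: smult_l_minus)
  then show "\<And>a. a \<in> ?H \<Longrightarrow> \<ominus>\<^bsub>V\<^esub> a \<in> ?H"
    using sm \<open>?H \<subseteq> carrier V\<close> by (metis (no_types, lifting) R.a_inv_closed R.one_closed subsetD)
  show "x \<oplus>\<^bsub>V\<^esub> y \<in> ?H" if "x \<in> ?H" "y \<in> ?H" for x y
  proof -
    from that obtain a b where a: "\<forall>i\<in>I. a i \<in> carrier K" "x = (\<Oplus>\<^bsub>V\<^esub>i\<in>I. a i \<odot>\<^bsub>V\<^esub> v i)"
      and b: "\<forall>i\<in>I. b i \<in> carrier K" "y = (\<Oplus>\<^bsub>V\<^esub>i\<in>I. b i \<odot>\<^bsub>V\<^esub> v i)" by blast
    have "x \<oplus>\<^bsub>V\<^esub> y = (\<Oplus>\<^bsub>V\<^esub>i\<in>I. a i \<odot>\<^bsub>V\<^esub> v i \<oplus>\<^bsub>V\<^esub> b i \<odot>\<^bsub>V\<^esub> v i)"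
      unfolding a(2) b(2) using assms a b by (intro M.finsum_addf[symmetric]) auto
    also have "\<dots> = (\<Oplus>\<^bsub>V\<^esub>i\<in>I. (a i \<oplus> b i) \<odot>\<^bsub>V\<^esub> v i)"
      using assms a b by (intro M.finsum_cong') (auto simp: smult_l_distr)
    finally show ?thesis using a b by (auto intro!: exI[of _ "\<lambda>i. a i \<oplus> b i"])
  qed
qed

lemma lincomb_generator:
  assumes "finite I" "\<And>i. i \<in> I \<Longrightarrow> v i \<in> carrier V" "i \<in> I"
  shows "\<exists>a. (\<forall>i\<in>I. a i \<in> carrier K) \<and> v i = (\<Oplus>\<^bsub>V\<^esub>i\<in>I. a i \<odot>\<^bsub>V\<^esub> v i)"
proof -
  have "(\<Oplus>\<^bsub>V\<^esub>j\<in>I. (if j = i then \<one> else \<zero>) \<odot>\<^bsub>V\<^esub> v j) = (\<Oplus>\<^bsub>V\<^esub>j\<in>I. if j = i then v j else \<zero>\<^bsub>V\<^esub>)"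
    using assms by (intro M.finsum_cong') auto
  also have "\<dots> = v i" using assms by (intro M.finsum_delta) auto
  finally show ?thesis by (intro exI[of _ "\<lambda>j. if j = i then \<one> else \<zero>"]) auto
qed

lemma submodule_finsum:
  assumes "submodule H K V" "finite I" "\<And>i. i \<in> I \<Longrightarrow> f i \<in> H"
  shows "finsum V f I \<in> H"
proof -
  interpret H: submodule H K V by fact
  have sub: "H \<subseteq> carrier V" using H.subset by simp
  show ?thesis using assms(2,3)
  proof (induction I)
    case empty
    then show ?case using H.one_closed by simp
  next
    case (insert x F)
    then have "f x \<in> H" "finsum V f F \<in> H" "f \<in> F \<rightarrow> carrier V" "f x \<in> carrier V"
      using sub by auto
    then show ?case using insert.hyps H.m_closed[of "f x" "finsum V f F"]
      by (simp add: M.finsum_insert)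
  qed
qed

end

section \<open>Chain bases of nilpotent operators\<close>

locale lin_op = vector_space_rec K V for K (structure) and V (structure) +
  fixes T :: "'c \<Rightarrow> 'c"
  assumes T_closed: "x \<in> carrier V \<Longrightarrow> T x \<in> carrier V"
    and T_add: "x \<in> carrier V \<Longrightarrow> y \<in> carrier V \<Longrightarrow> T (x \<oplus>\<^bsub>V\<^esub> y) = T x \<oplus>\<^bsub>V\<^esub> T y"
    and T_smult: "a \<in> carrier K \<Longrightarrow> x \<in> carrier V \<Longrightarrow> T (a \<odot>\<^bsub>V\<^esub> x) = a \<odot>\<^bsub>V\<^esub> T x"
begin

lemma pow_closed: "x \<in> carrier V \<Longrightarrow> (T ^^ n) x \<in> carrier V"
  by (induction n) (auto simp: T_closed)

lemma pow_add: "x \<in> carrier V \<Longrightarrow> y \<in> carrier V \<Longrightarrow>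
    (T ^^ n) (x \<oplus>\<^bsub>V\<^esub> y) = (T ^^ n) x \<oplus>\<^bsub>V\<^esub> (T ^^ n) y"
  by (induction n) (auto simp: T_add pow_closed)

lemma pow_smult: "a \<in> carrier K \<Longrightarrow> x \<in> carrier V \<Longrightarrow> (T ^^ n) (a \<odot>\<^bsub>V\<^esub> x) = a \<odot>\<^bsub>V\<^esub> (T ^^ n) x"
  by (induction n) (auto simp: T_smult pow_closed)

lemma pow_zero: "(T ^^ n) \<zero>\<^bsub>V\<^esub> = \<zero>\<^bsub>V\<^esub>"
  using pow_smult[of \<zero> "\<zero>\<^bsub>V\<^esub>" n] by (simp add: pow_closed)

lemma pow_finsum:
  assumes "finite I" "\<And>i. i \<in> I \<Longrightarrow> f i \<in> carrier V"
  shows "(T ^^ n) (\<Oplus>\<^bsub>V\<^esub>i\<in>I. f i) = (\<Oplus>\<^bsub>V\<^esub>i\<in>I. (T ^^ n) (f i))"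
  using assms
proof (induction I)
  case empty
  then show ?case by (simp add: pow_zero)
next
  case (insert x F)
  then have "f \<in> F \<rightarrow> carrier V" "(\<lambda>i. (T ^^ n) (f i)) \<in> F \<rightarrow> carrier V"
      "finsum V f F \<in> carrier V"
    by (auto simp: pow_closed intro!: M.finsum_closed)
  then show ?case using insert by (simp add: M.finsum_insert pow_add pow_closed)
qed

lemma pow_lincomb:
  assumes "finite I" "\<And>i. i \<in> I \<Longrightarrow> v i \<in> carrier V" "\<And>i. i \<in> I \<Longrightarrow> a i \<in> carrier K"
  shows "(T ^^ n) (\<Oplus>\<^bsub>V\<^esub>i\<in>I. a i \<odot>\<^bsub>V\<^esub> v i) = (\<Oplus>\<^bsub>V\<^esub>i\<in>I. a i \<odot>\<^bsub>V\<^esub> (T ^^ n) (v i))"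
proof -
  have "(T ^^ n) (\<Oplus>\<^bsub>V\<^esub>i\<in>I. a i \<odot>\<^bsub>V\<^esub> v i) = (\<Oplus>\<^bsub>V\<^esub>i\<in>I. (T ^^ n) (a i \<odot>\<^bsub>V\<^esub> v i))"
    using assms by (intro pow_finsum) auto
  also have "\<dots> = (\<Oplus>\<^bsub>V\<^esub>i\<in>I. a i \<odot>\<^bsub>V\<^esub> (T ^^ n) (v i))"
    using assms by (intro M.finsum_cong') (auto simp: pow_smult pow_closed)
  finally show ?thesis .
qed

lemma pow_pow: "(T ^^ m) ((T ^^ n) x) = (T ^^ (m + n)) x"
  by (simp add: funpow_add)

lemma pow_eq_zero_mono:
  assumes "(T ^^ n) x = \<zero>\<^bsub>V\<^esub>" "n \<le> m"
  shows "(T ^^ m) x = \<zero>\<^bsub>V\<^esub>"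
proof -
  have "(T ^^ m) x = (T ^^ (m - n)) ((T ^^ n) x)" using assms(2) by (simp add: pow_pow)
  then show ?thesis using assms(1) by (simp add: pow_zero)
qed

end

definition chain_index :: "'i set \<Rightarrow> ('i \<Rightarrow> nat) \<Rightarrow> ('i \<times> nat) set" where
  "chain_index I n = (SIGMA a:I. {..<n a})"

definition chain_vec :: "('v \<Rightarrow> 'v) \<Rightarrow> ('i \<Rightarrow> 'v) \<Rightarrow> 'i \<times> nat \<Rightarrow> 'v" where
  "chain_vec T v = (\<lambda>(a, j). (T ^^ j) (v a))"

definition chain_basis :: "('k, 'm) ring_scheme \<Rightarrow> ('k, 'v, 'n) module_scheme \<Rightarrow> ('v \<Rightarrow> 'v) \<Rightarrow>
    'i set \<Rightarrow> ('i \<Rightarrow> nat) \<Rightarrow> ('i \<Rightarrow> 'v) \<Rightarrow> bool" where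
  "chain_basis K V T I n v \<longleftrightarrow> finite I \<and>
     (\<forall>a\<in>I. v a \<in> carrier V \<and> (T ^^ n a) (v a) = \<zero>\<^bsub>V\<^esub>) \<and>
     lin_indep K V (chain_index I n) (chain_vec T v) \<and>
     lin_spans K V (chain_index I n) (chain_vec T v)"

text \<open>The rank of an operator, through independent values.\<close>

definition rank_at_least ::
  "('k, 'm) ring_scheme \<Rightarrow> ('k, 'v, 'n) module_scheme \<Rightarrow> ('v \<Rightarrow> 'v) \<Rightarrow> nat \<Rightarrow> bool" where
  "rank_at_least K V T m \<longleftrightarrow>
     (\<exists>y. (\<forall>i<m. y i \<in> carrier V) \<and> lin_indep K V {..<m} (\<lambda>i. T (y i)))"

lemma finite_chain_index: "finite I \<Longrightarrow> finite (chain_index I n)"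
  by (auto simp: chain_index_def)

context lin_op
begin

text \<open>A finite system of chains generates \<open>V\<close>; this is the property that is kept while the
  total length of the chains is made minimal.\<close>

definition chain_system :: "nat set \<Rightarrow> (nat \<Rightarrow> nat) \<Rightarrow> (nat \<Rightarrow> 'c) \<Rightarrow> bool" where
  "chain_system I n v \<longleftrightarrow> finite I \<and>
     (\<forall>a\<in>I. v a \<in> carrier V \<and> (T ^^ n a) (v a) = \<zero>\<^bsub>V\<^esub>) \<and>
     (\<forall>H. submodule H K V \<longrightarrow> (\<forall>a\<in>I. \<forall>j<n a. (T ^^ j) (v a) \<in> H) \<longrightarrow> carrier V \<subseteq> H)"

lemma chain_vec_closed:
  assumes "\<And>a. a \<in> I \<Longrightarrow> v a \<in> carrier V" "x \<in> chain_index I n"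
  shows "chain_vec T v x \<in> carrier V"
  using assms by (auto simp: chain_vec_def chain_index_def pow_closed)

text \<open>
  Apply to a relation the highest power of \<open>T\<close> that does not kill it term by term: in every
  chain at most the last vector survives.
\<close>

lemma dependent_last_vectors:
  assumes sys: "chain_system I n v" and dep: "\<not> lin_indep K V (chain_index I n) (chain_vec T v)"
  shows "\<exists>c. (\<forall>a\<in>I. c a \<in> carrier K) \<and> (\<exists>a\<in>I. c a \<noteq> \<zero>) \<and> (\<forall>a\<in>I. c a \<noteq> \<zero> \<longrightarrow> 0 < n a) \<and>
    (\<Oplus>\<^bsub>V\<^esub>a\<in>I. c a \<odot>\<^bsub>V\<^esub> (T ^^ (n a - 1)) (v a)) = \<zero>\<^bsub>V\<^esub>"
proof -
  let ?X = "chain_index I n"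
  have I: "finite I" "\<And>a. a \<in> I \<Longrightarrow> v a \<in> carrier V" "\<And>a. a \<in> I \<Longrightarrow> (T ^^ n a) (v a) = \<zero>\<^bsub>V\<^esub>"
    using sys by (auto simp: chain_system_def)
  have X: "finite ?X" using I by (simp add: finite_chain_index)
  obtain b where b: "\<forall>x\<in>?X. b x \<in> carrier K"
      "(\<Oplus>\<^bsub>V\<^esub>x\<in>?X. b x \<odot>\<^bsub>V\<^esub> chain_vec T v x) = \<zero>\<^bsub>V\<^esub>" "\<exists>x\<in>?X. b x \<noteq> \<zero>"
    using dep unfolding lin_indep_def by blast
  let ?E = "{n a - 1 - j | a j. (a, j) \<in> ?X \<and> b (a, j) \<noteq> \<zero>}"
  have "?E = (\<lambda>(a, j). n a - 1 - j) ` {x \<in> ?X. b x \<noteq> \<zero>}" by (auto simp: image_iff)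
  then have E: "finite ?E" "?E \<noteq> {}" using X b(3) by auto
  define e where "e = Max ?E"
  have "e \<in> ?E" unfolding e_def using E by (rule Max_in)
  have emax: "n a - 1 - j \<le> e" if "(a, j) \<in> ?X" "b (a, j) \<noteq> \<zero>" for a j
    unfolding e_def using E that by (intro Max_ge) auto
  define c where "c = (\<lambda>a. if e < n a then b (a, n a - 1 - e) else \<zero>)"
  have cK: "\<forall>a\<in>I. c a \<in> carrier K"
    using b(1) by (auto simp: c_def chain_index_def)
  have "\<exists>a\<in>I. c a \<noteq> \<zero>"
  proof -
    obtain a j where aj: "(a, j) \<in> ?X" "b (a, j) \<noteq> \<zero>" "e = n a - 1 - j"
      using \<open>e \<in> ?E\<close> by blast
    then have "a \<in> I" "j < n a" by (auto simp: chain_index_def)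
    then have "e < n a" "n a - 1 - e = j" using aj(3) by auto
    then have "c a \<noteq> \<zero>" using aj(2) by (simp add: c_def)
    then show ?thesis using \<open>a \<in> I\<close> by blast
  qed
  moreover have "(\<Oplus>\<^bsub>V\<^esub>a\<in>I. c a \<odot>\<^bsub>V\<^esub> (T ^^ (n a - 1)) (v a)) = \<zero>\<^bsub>V\<^esub>"
  proof -
    let ?Y = "(\<lambda>a. (a, n a - 1 - e)) ` {a \<in> I. e < n a}"
    let ?g = "\<lambda>x. b x \<odot>\<^bsub>V\<^esub> (T ^^ e) (chain_vec T v x)"
    have cl: "?g x \<in> carrier V" if "x \<in> ?X" for x
      using that b(1) I by (intro smult_closed pow_closed chain_vec_closed) auto
    have Y: "?Y \<subseteq> ?X" by (auto simp: chain_index_def)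
    have "\<zero>\<^bsub>V\<^esub> = (T ^^ e) (\<Oplus>\<^bsub>V\<^esub>x\<in>?X. b x \<odot>\<^bsub>V\<^esub> chain_vec T v x)"
      using b(2) by (simp add: pow_zero)
    also have "\<dots> = (\<Oplus>\<^bsub>V\<^esub>x\<in>?X. ?g x)"
      using X b(1) I by (intro pow_lincomb) (auto intro: chain_vec_closed)
    also have "\<dots> = (\<Oplus>\<^bsub>V\<^esub>x\<in>?Y. ?g x)"
    proof (rule M.finsum_mono_neutral[symmetric, OF X Y])
      fix x assume x: "x \<in> ?X - ?Y"
      obtain a j where aj: "x = (a, j)" by (cases x)
      then have a: "a \<in> I" "j < n a" using x by (auto simp: chain_index_def)
      show "?g x = \<zero>\<^bsub>V\<^esub>"
      proof (cases "b x = \<zero>")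
        case True
        then show ?thesis using x I chain_vec_closed[of I v x n] by (simp add: pow_closed)
      next
        case False
        then have "n a - 1 - j \<le> e" using emax x aj by auto
        moreover have "n a - 1 - j \<noteq> e"
        proof
          assume "n a - 1 - j = e"
          then have "x = (a, n a - 1 - e)" "e < n a" using aj a by auto
          then show False using x a by blast
        qed
        ultimately have "n a \<le> e + j" using a by auto
        then have "(T ^^ e) (chain_vec T v x) = \<zero>\<^bsub>V\<^esub>"
          using pow_eq_zero_mono[OF I(3)[OF a(1)]] aj by (simp add: chain_vec_def pow_pow)
        then show ?thesis using b(1) x by simp
      qed
    qed (use cl Y in blast)
    also have "\<dots> = (\<Oplus>\<^bsub>V\<^esub>a\<in>{a \<in> I. e < n a}. ?g (a, n a - 1 - e))"
      using cl Y by (intro M.finsum_reindex) (auto simp: inj_on_def)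
    also have "\<dots> = (\<Oplus>\<^bsub>V\<^esub>a\<in>{a \<in> I. e < n a}. c a \<odot>\<^bsub>V\<^esub> (T ^^ (n a - 1)) (v a))"
      using cK I
      by (intro M.finsum_cong') (auto simp: c_def chain_vec_def pow_pow pow_closed split: if_splits)
    also have "\<dots> = (\<Oplus>\<^bsub>V\<^esub>a\<in>I. c a \<odot>\<^bsub>V\<^esub> (T ^^ (n a - 1)) (v a))"
      using cK I by (intro M.finsum_mono_neutral) (auto simp: c_def pow_closed)
    finally show ?thesis by simp
  qed
  moreover have "\<forall>a\<in>I. c a \<noteq> \<zero> \<longrightarrow> 0 < n a" by (auto simp: c_def)
  ultimately show ?thesis using cK by blast
qed

lemma submodule_cancel:
  assumes "submodule H K V" "c \<in> carrier K" "c \<noteq> \<zero>" "x \<in> carrier V" "y \<in> H"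
    "c \<odot>\<^bsub>V\<^esub> x \<oplus>\<^bsub>V\<^esub> y \<in> H"
  shows "x \<in> H"
proof -
  interpret H: submodule H K V by fact
  have sub: "H \<subseteq> carrier V" using H.subset by simp
  have cx: "c \<odot>\<^bsub>V\<^esub> x \<in> carrier V" "y \<in> carrier V" using assms sub by auto
  have neg: "\<ominus>\<^bsub>V\<^esub> y \<in> H"
    using H.m_inv_closed[OF assms(5)] by (simp add: a_inv_def)
  have "(c \<odot>\<^bsub>V\<^esub> x \<oplus>\<^bsub>V\<^esub> y) \<oplus>\<^bsub>V\<^esub> \<ominus>\<^bsub>V\<^esub> y \<in> H" using H.m_closed assms(6) neg by simp
  moreover have "(c \<odot>\<^bsub>V\<^esub> x \<oplus>\<^bsub>V\<^esub> y) \<oplus>\<^bsub>V\<^esub> \<ominus>\<^bsub>V\<^esub> y = c \<odot>\<^bsub>V\<^esub> x"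
    using cx by (simp add: M.a_assoc M.r_neg)
  ultimately have "c \<odot>\<^bsub>V\<^esub> x \<in> H" by simp
  moreover have inv: "inv c \<in> carrier K" "inv c \<otimes> c = \<one>" using assms field_Units by auto
  ultimately have "inv c \<odot>\<^bsub>V\<^esub> (c \<odot>\<^bsub>V\<^esub> x) \<in> H" using H.smult_closed by blast
  then show ?thesis using inv assms by (simp flip: smult_assoc1)
qed

text \<open>
  Let \<open>a\<close> be a shortest chain occurring in the relation. All other last vectors in it are
  \<open>T^(n a - 1)\<close> applied to members of their chains, so the relation says that \<open>T^(n a
  - 1)\<close> kills a combination \<open>w\<close> of \<open>v a\<close> with those members. Replacing
  \<open>v a\<close> by \<open>w\<close> loses nothing, since \<open>v a\<close> has a nonzero
  coefficient in \<open>w\<close>.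
\<close>

lemma chain_system_shorten:
  assumes sys: "chain_system I n v"
    and c: "\<forall>a\<in>I. c a \<in> carrier K" "\<exists>a\<in>I. c a \<noteq> \<zero>" "\<forall>a\<in>I. c a \<noteq> \<zero> \<longrightarrow> 0 < n a"
      "(\<Oplus>\<^bsub>V\<^esub>a\<in>I. c a \<odot>\<^bsub>V\<^esub> (T ^^ (n a - 1)) (v a)) = \<zero>\<^bsub>V\<^esub>"
  shows "\<exists>a w. a \<in> I \<and> 0 < n a \<and> chain_system I (n(a := n a - 1)) (v(a := w))"
proof -
  have I: "finite I" "\<And>a. a \<in> I \<Longrightarrow> v a \<in> carrier V" "\<And>a. a \<in> I \<Longrightarrow> (T ^^ n a) (v a) = \<zero>\<^bsub>V\<^esub>"
    using sys by (auto simp: chain_system_def)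
  define J where "J = {a \<in> I. c a \<noteq> \<zero>}"
  have J: "finite J" "J \<noteq> {}" "J \<subseteq> I" "\<And>a. a \<in> J \<Longrightarrow> 0 < n a" using I c by (auto simp: J_def)
  obtain s where s: "s \<in> J" "\<And>a. a \<in> J \<Longrightarrow> n s \<le> n a"
    using J(2) ex_has_least_nat[of "\<lambda>a. a \<in> J" _ n] by blast
  have sI: "s \<in> I" "c s \<noteq> \<zero>" "0 < n s" using s J by (auto simp: J_def)
  have cK: "c a \<in> carrier K" if "a \<in> J" for a using that c J by blast
  have vV: "v a \<in> carrier V" if "a \<in> J" for a using that I J by blast
  define w where "w = (\<Oplus>\<^bsub>V\<^esub>a\<in>J. c a \<odot>\<^bsub>V\<^esub> (T ^^ (n a - n s)) (v a))"
  have wV: "w \<in> carrier V" unfolding w_def using cK vV by (intro M.finsum_closed) (auto simp: pow_closed)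
  have Tw: "(T ^^ j) w = (\<Oplus>\<^bsub>V\<^esub>a\<in>J. c a \<odot>\<^bsub>V\<^esub> (T ^^ (j + (n a - n s))) (v a))" for j
  proof -
    have "(T ^^ j) w = (\<Oplus>\<^bsub>V\<^esub>a\<in>J. c a \<odot>\<^bsub>V\<^esub> (T ^^ j) ((T ^^ (n a - n s)) (v a)))"
      unfolding w_def using J cK vV by (intro pow_lincomb) (auto simp: pow_closed)
    then show ?thesis by (simp add: pow_pow)
  qed
  have kill: "(T ^^ (n s - 1)) w = \<zero>\<^bsub>V\<^esub>"
  proof -
    have "(T ^^ (n s - 1)) w = (\<Oplus>\<^bsub>V\<^esub>a\<in>J. c a \<odot>\<^bsub>V\<^esub> (T ^^ (n a - 1)) (v a))"
      unfolding Tw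
    proof (rule M.finsum_cong')
      fix a assume a: "a \<in> J"
      have "n s - 1 + (n a - n s) = n a - 1" using s(2)[OF a] sI(3) by simp
      then show "c a \<odot>\<^bsub>V\<^esub> (T ^^ (n s - 1 + (n a - n s))) (v a) = c a \<odot>\<^bsub>V\<^esub> (T ^^ (n a - 1)) (v a)"
        by simp
    qed (use cK vV pow_closed in auto)
    also have "\<dots> = (\<Oplus>\<^bsub>V\<^esub>a\<in>I. c a \<odot>\<^bsub>V\<^esub> (T ^^ (n a - 1)) (v a))"
      using I J cK vV by (intro M.finsum_mono_neutral) (auto simp: J_def pow_closed)
    finally show ?thesis using c(4) by simp
  qed
  have "chain_system I (n(s := n s - 1)) (v(s := w))"
    unfolding chain_system_def
  proof (intro conjI allI impI)
    show "finite I" by fact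
    show "\<forall>a\<in>I. (v(s := w)) a \<in> carrier V \<and> (T ^^ (n(s := n s - 1)) a) ((v(s := w)) a) = \<zero>\<^bsub>V\<^esub>"
      using I wV kill by auto
    fix H assume H: "submodule H K V"
      "\<forall>a\<in>I. \<forall>j<(n(s := n s - 1)) a. (T ^^ j) ((v(s := w)) a) \<in> H"
    interpret H: submodule H K V by fact
    have old: "(T ^^ j) (v a) \<in> H" if "a \<in> I" "a \<noteq> s" "j < n a" for a j
      using H(2)[rule_format, of a j] that by simp
    have new: "(T ^^ j) w \<in> H" if "j < n s" for j
    proof (cases "j = n s - 1")
      case True
      then show ?thesis using kill H.one_closed by simp
    next
      case False
      then have "j < n s - 1" using that by simp
      then show ?thesis using H(2)[rule_format, of s j] sI by simp
    qed
    have olds: "(T ^^ j) (v s) \<in> H" if j: "j < n s" for j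
    proof (rule submodule_cancel[OF H(1), where c = "c s"
        and y = "\<Oplus>\<^bsub>V\<^esub>a\<in>J - {s}. c a \<odot>\<^bsub>V\<^esub> (T ^^ (j + (n a - n s))) (v a)"])
      show "(\<Oplus>\<^bsub>V\<^esub>a\<in>J - {s}. c a \<odot>\<^bsub>V\<^esub> (T ^^ (j + (n a - n s))) (v a)) \<in> H"
      proof (rule submodule_finsum[OF H(1)])
        fix a assume a: "a \<in> J - {s}"
        then have "j + (n a - n s) < n a" using j s(2)[of a] by simp
        then have "(T ^^ (j + (n a - n s))) (v a) \<in> H" using old a J by blast
        then show "c a \<odot>\<^bsub>V\<^esub> (T ^^ (j + (n a - n s))) (v a) \<in> H"
          using H.smult_closed cK a by blast
      qed (use J in simp)
      have "(T ^^ j) w = (\<Oplus>\<^bsub>V\<^esub>a\<in>insert s (J - {s}). c a \<odot>\<^bsub>V\<^esub> (T ^^ (j + (n a - n s))) (v a))"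
        unfolding Tw using s by (simp add: insert_absorb)
      also have "\<dots> = c s \<odot>\<^bsub>V\<^esub> (T ^^ (j + (n s - n s))) (v s) \<oplus>\<^bsub>V\<^esub>
          (\<Oplus>\<^bsub>V\<^esub>a\<in>J - {s}. c a \<odot>\<^bsub>V\<^esub> (T ^^ (j + (n a - n s))) (v a))"
        using J cK vV s by (intro M.finsum_insert) (auto simp: pow_closed)
      finally show "c s \<odot>\<^bsub>V\<^esub> (T ^^ j) (v s) \<oplus>\<^bsub>V\<^esub>
          (\<Oplus>\<^bsub>V\<^esub>a\<in>J - {s}. c a \<odot>\<^bsub>V\<^esub> (T ^^ (j + (n a - n s))) (v a)) \<in> H"
        using new[OF j] by simp
    qed (use sI c I pow_closed in auto)
    have "(T ^^ j) (v a) \<in> H" if "a \<in> I" "j < n a" for a j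
      using old olds that by (cases "a = s") auto
    then show "carrier V \<subseteq> H" using sys H(1) unfolding chain_system_def by blast
  qed
  then show ?thesis using sI by blast
qed

text \<open>
  Induction on the total length, counting one more for every chain so that dropping an empty chain is
  also progress. A system without empty chains that is not yet independent can be shortened.
\<close>

lemma chain_basis_exists_aux:
  assumes "chain_system I n v"
  shows "\<exists>I n v. finite (I :: nat set) \<and> (\<forall>a\<in>I. 0 < n a) \<and> chain_basis K V T I n v"
  using assms
proof (induction "\<Sum>a\<in>I. Suc (n a)" arbitrary: I n v rule: less_induct)
  case less
  have fin: "finite I" using less.prems by (simp add: chain_system_def)
  have I: "\<And>a. a \<in> I \<Longrightarrow> v a \<in> carrier V" "\<And>a. a \<in> I \<Longrightarrow> (T ^^ n a) (v a) = \<zero>\<^bsub>V\<^esub>"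
    using less.prems by (auto simp: chain_system_def)
  consider a where "a \<in> I" "n a = 0"
    | "\<forall>a\<in>I. 0 < n a" "\<not> lin_indep K V (chain_index I n) (chain_vec T v)"
    | "\<forall>a\<in>I. 0 < n a" "lin_indep K V (chain_index I n) (chain_vec T v)"
    by blast
  then show ?case
  proof cases
    case 1
    have "chain_system (I - {a}) n v"
      unfolding chain_system_def
    proof (intro conjI allI impI)
      fix H assume H: "submodule H K V" "\<forall>a\<in>I - {a}. \<forall>j<n a. (T ^^ j) (v a) \<in> H"
      then have "\<forall>a\<in>I. \<forall>j<n a. (T ^^ j) (v a) \<in> H" using 1 by auto
      then show "carrier V \<subseteq> H" using less.prems H(1) unfolding chain_system_def by blast
    qed (use fin I in auto)
    moreover have "(\<Sum>a\<in>I - {a}. Suc (n a)) < (\<Sum>a\<in>I. Suc (n a))"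
      using sum.remove[OF fin 1(1), of "\<lambda>a. Suc (n a)"] by simp
    ultimately show ?thesis using less.hyps by blast
  next
    case 2
    obtain c where c: "\<forall>a\<in>I. c a \<in> carrier K" "\<exists>a\<in>I. c a \<noteq> \<zero>" "\<forall>a\<in>I. c a \<noteq> \<zero> \<longrightarrow> 0 < n a"
      "(\<Oplus>\<^bsub>V\<^esub>a\<in>I. c a \<odot>\<^bsub>V\<^esub> (T ^^ (n a - 1)) (v a)) = \<zero>\<^bsub>V\<^esub>"
      using dependent_last_vectors[OF less.prems 2(2)] by blast
    obtain a w where a: "a \<in> I" "0 < n a" "chain_system I (n(a := n a - 1)) (v(a := w))"
      using chain_system_shorten[OF less.prems c] by blast
    have "(\<Sum>b\<in>I. Suc ((n(a := n a - 1)) b)) < (\<Sum>b\<in>I. Suc (n b))"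
      using fin a by (intro sum_strict_mono_ex1) auto
    then show ?thesis using less.hyps a(3) by blast
  next
    case 3
    have fX: "finite (chain_index I n)" using fin by (rule finite_chain_index)
    have cl: "\<And>x. x \<in> chain_index I n \<Longrightarrow> chain_vec T v x \<in> carrier V"
      using I by (intro chain_vec_closed)
    have "lin_spans K V (chain_index I n) (chain_vec T v)"
    proof -
      let ?H = "{x. \<exists>a. (\<forall>i\<in>chain_index I n. a i \<in> carrier K) \<and>
        x = (\<Oplus>\<^bsub>V\<^esub>i\<in>chain_index I n. a i \<odot>\<^bsub>V\<^esub> chain_vec T v i)}"
      have H: "submodule ?H K V" using fX cl by (rule lincomb_submodule)
      have "(T ^^ j) (v a) \<in> ?H" if "a \<in> I" "j < n a" for a j
      proof -
        have "(a, j) \<in> chain_index I n" using that by (simp add: chain_index_def)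
        from lincomb_generator[where v = "chain_vec T v", OF fX cl this] show ?thesis
          by (simp add: chain_vec_def)
      qed
      then have "carrier V \<subseteq> ?H" using less.prems H unfolding chain_system_def by blast
      then show ?thesis unfolding lin_spans_def by blast
    qed
    then have "chain_basis K V T I n v"
      using fin I 3 unfolding chain_basis_def by blast
    then show ?thesis using fin 3 by blast
  qed
qed

text \<open>
  Start with the orbits of a finite generating family. The length \<open>Suc e\<close> instead of
  \<open>e\<close> makes every generator a member of its own chain also when \<open>e = 0\<close>.
\<close>

lemma chain_basis_exists:
  assumes "finite F" "\<And>i. i \<in> F \<Longrightarrow> (g i :: 'c) \<in> carrier V" "lin_spans K V (F :: nat set) g"
    and nil: "\<And>x. x \<in> carrier V \<Longrightarrow> (T ^^ e) x = \<zero>\<^bsub>V\<^esub>"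
  shows "\<exists>I n v. finite (I :: nat set) \<and> (\<forall>a\<in>I. 0 < n a) \<and> chain_basis K V T I n v"
proof (rule chain_basis_exists_aux[of F "\<lambda>_. Suc e" g])
  show "chain_system F (\<lambda>_. Suc e) g"
    unfolding chain_system_def
  proof (intro conjI allI impI)
    show "finite F" by fact
    show "\<forall>a\<in>F. g a \<in> carrier V \<and> (T ^^ Suc e) (g a) = \<zero>\<^bsub>V\<^esub>"
      using assms(2) pow_eq_zero_mono[OF nil, of _ "Suc e"] by simp
  next
    fix H assume H: "submodule H K V" "\<forall>a\<in>F. \<forall>j<Suc e. (T ^^ j) (g a) \<in> H"
    interpret H: submodule H K V by fact
    have g: "g a \<in> H" if "a \<in> F" for a using H(2)[rule_format, of a 0] that by simp
    show "carrier V \<subseteq> H"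
    proof
      fix x assume "x \<in> carrier V"
      then obtain a where "\<forall>i\<in>F. a i \<in> carrier K" "x = (\<Oplus>\<^bsub>V\<^esub>i\<in>F. a i \<odot>\<^bsub>V\<^esub> g i)"
        using assms(3) unfolding lin_spans_def by blast
      then show "x \<in> H" using g H.smult_closed assms(1) by (auto intro!: submodule_finsum[OF H(1)])
    qed
  qed
qed

lemma chain_basis_length_le:
  assumes cb: "chain_basis K V T I n v" and nil: "\<And>x. x \<in> carrier V \<Longrightarrow> (T ^^ e) x = \<zero>\<^bsub>V\<^esub>"
    and a: "a \<in> I"
  shows "n a \<le> e"
proof (rule ccontr)
  assume "\<not> n a \<le> e"
  then have x: "(a, e) \<in> chain_index I n" using a by (simp add: chain_index_def)
  have fX: "finite (chain_index I n)" and vV: "\<And>a. a \<in> I \<Longrightarrow> v a \<in> carrier V"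
    using cb by (auto simp: chain_basis_def finite_chain_index)
  have cl: "\<And>x. x \<in> chain_index I n \<Longrightarrow> chain_vec T v x \<in> carrier V"
    using vV by (intro chain_vec_closed)
  have z: "chain_vec T v (a, e) = \<zero>\<^bsub>V\<^esub>" using nil vV a by (simp add: chain_vec_def)
  let ?b = "\<lambda>x. if x = (a, e) then \<one> else \<zero>"
  have "(\<Oplus>\<^bsub>V\<^esub>x\<in>chain_index I n. ?b x \<odot>\<^bsub>V\<^esub> chain_vec T v x) = \<zero>\<^bsub>V\<^esub>"
    using z cl by (intro M.add.finprod_one_eqI) auto
  then have "?b (a, e) = \<zero>"
    using cb x unfolding chain_basis_def by (intro lin_indepD[where a = ?b]) auto
  then show False by simp
qed

text \<open>
  The images under \<open>T^i\<close> of the members of a chain of length \<open>n\<close> are its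
  members from position \<open>i\<close> on, \<open>n - i\<close> in number, and zeros. So the image of
  \<open>T^i\<close> has these members as a basis, and exchange bounds independent families in it.
\<close>

lemma chain_basis_rank:
  assumes cb: "chain_basis K V T I n v"
  shows "rank_at_least K V (T ^^ i) m \<longleftrightarrow> m \<le> (\<Sum>a\<in>I. n a - i)"
proof -
  let ?X = "chain_index I n"
  let ?Y = "{x \<in> ?X. i \<le> snd x}"
  have fI: "finite I" and fX: "finite ?X" and vV: "\<And>a. a \<in> I \<Longrightarrow> v a \<in> carrier V"
    and vz: "\<And>a. a \<in> I \<Longrightarrow> (T ^^ n a) (v a) = \<zero>\<^bsub>V\<^esub>"
    using cb by (auto simp: chain_basis_def finite_chain_index)
  have cl: "\<And>x. x \<in> ?X \<Longrightarrow> chain_vec T v x \<in> carrier V"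
    using vV by (intro chain_vec_closed)
  have Y: "?Y = (SIGMA a:I. {i..<n a})" by (auto simp: chain_index_def)
  have cardY: "card ?Y = (\<Sum>a\<in>I. n a - i)" unfolding Y using fI by (simp add: card_SigmaI)
  have fY: "finite ?Y" using fX by simp
  show ?thesis
  proof
    assume "rank_at_least K V (T ^^ i) m"
    then obtain y where y: "\<forall>l<m. y l \<in> carrier V" "lin_indep K V {..<m} (\<lambda>l. (T ^^ i) (y l))"
      unfolding rank_at_least_def by blast
    have "\<forall>l<m. \<exists>b. (\<forall>x\<in>?X. b x \<in> carrier K) \<and> y l = (\<Oplus>\<^bsub>V\<^esub>x\<in>?X. b x \<odot>\<^bsub>V\<^esub> chain_vec T v x)"
    proof (intro allI impI)
      fix l assume "l < m"
      then have "y l \<in> carrier V" using y(1) by blast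
      moreover have "lin_spans K V ?X (chain_vec T v)" using cb by (simp add: chain_basis_def)
      ultimately show "\<exists>b. (\<forall>x\<in>?X. b x \<in> carrier K) \<and>
          y l = (\<Oplus>\<^bsub>V\<^esub>x\<in>?X. b x \<odot>\<^bsub>V\<^esub> chain_vec T v x)"
        unfolding lin_spans_def by blast
    qed
    then obtain b where "\<forall>l<m. (\<forall>x\<in>?X. b l x \<in> carrier K) \<and>
        y l = (\<Oplus>\<^bsub>V\<^esub>x\<in>?X. b l x \<odot>\<^bsub>V\<^esub> chain_vec T v x)" by moura
    then have b: "\<And>l x. l < m \<Longrightarrow> x \<in> ?X \<Longrightarrow> b l x \<in> carrier K"
        "\<And>l. l < m \<Longrightarrow> y l = (\<Oplus>\<^bsub>V\<^esub>x\<in>?X. b l x \<odot>\<^bsub>V\<^esub> chain_vec T v x)" by blast+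
    have Ty: "(T ^^ i) (y l) = (\<Oplus>\<^bsub>V\<^esub>x\<in>?Y. b l (fst x, snd x - i) \<odot>\<^bsub>V\<^esub> chain_vec T v x)"
      if l: "l < m" for l
    proof -
      let ?Z = "{x \<in> ?X. i + snd x < n (fst x)}"
      have "(T ^^ i) (y l) = (\<Oplus>\<^bsub>V\<^esub>x\<in>?X. b l x \<odot>\<^bsub>V\<^esub> (T ^^ i) (chain_vec T v x))"
        unfolding b(2)[OF l] using fX cl b(1)[OF l] by (intro pow_lincomb) auto
      also have "\<dots> = (\<Oplus>\<^bsub>V\<^esub>x\<in>?Z. b l x \<odot>\<^bsub>V\<^esub> (T ^^ i) (chain_vec T v x))"
      proof (rule M.finsum_mono_neutral[symmetric])
        fix x assume x: "x \<in> ?X - ?Z"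
        then have a: "fst x \<in> I" "n (fst x) \<le> i + snd x" by (auto simp: chain_index_def)
        then have "(T ^^ i) (chain_vec T v x) = \<zero>\<^bsub>V\<^esub>"
          using pow_eq_zero_mono[OF vz] by (simp add: chain_vec_def pow_pow case_prod_beta)
        then show "b l x \<odot>\<^bsub>V\<^esub> (T ^^ i) (chain_vec T v x) = \<zero>\<^bsub>V\<^esub>" using b(1)[OF l] x by simp
      next
        fix x assume "x \<in> ?Z"
        then show "b l x \<odot>\<^bsub>V\<^esub> (T ^^ i) (chain_vec T v x) \<in> carrier V"
          by (intro smult_closed pow_closed b(1)[OF l] cl) simp_all
      qed (use fX in simp_all)
      also have "\<dots> = (\<Oplus>\<^bsub>V\<^esub>x\<in>?Z. b l x \<odot>\<^bsub>V\<^esub> chain_vec T v (fst x, i + snd x))"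
      proof (rule M.finsum_cong'[OF refl])
        fix x assume "x \<in> ?Z"
        then show "b l x \<odot>\<^bsub>V\<^esub> (T ^^ i) (chain_vec T v x) =
            b l x \<odot>\<^bsub>V\<^esub> chain_vec T v (fst x, i + snd x)"
          by (simp add: chain_vec_def pow_pow case_prod_beta)
      next
        show "(\<lambda>x. b l x \<odot>\<^bsub>V\<^esub> chain_vec T v (fst x, i + snd x)) \<in> ?Z \<rightarrow> carrier V"
        proof
          fix x assume "x \<in> ?Z"
          then show "b l x \<odot>\<^bsub>V\<^esub> chain_vec T v (fst x, i + snd x) \<in> carrier V"
            by (intro smult_closed b(1)[OF l] cl) (auto simp: chain_index_def)
        qed
      qed
      also have "\<dots> = (\<Oplus>\<^bsub>V\<^esub>x\<in>?Z. b l (fst (fst x, i + snd x), snd (fst x, i + snd x) - i) \<odot>\<^bsub>V\<^esub>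
          chain_vec T v (fst x, i + snd x))"
        by simp
      also have "\<dots> = (\<Oplus>\<^bsub>V\<^esub>x\<in>(\<lambda>x. (fst x, i + snd x)) ` ?Z. b l (fst x, snd x - i) \<odot>\<^bsub>V\<^esub> chain_vec T v x)"
      proof (rule M.finsum_reindex[symmetric])
        show "(\<lambda>x. b l (fst x, snd x - i) \<odot>\<^bsub>V\<^esub> chain_vec T v x)
          \<in> (\<lambda>x. (fst x, i + snd x)) ` ?Z \<rightarrow> carrier V"
        proof
          fix x assume "x \<in> (\<lambda>x. (fst x, i + snd x)) ` ?Z"
          then show "b l (fst x, snd x - i) \<odot>\<^bsub>V\<^esub> chain_vec T v x \<in> carrier V"
            by (intro smult_closed b(1)[OF l] cl) (auto simp: chain_index_def)
        qed
      qed (auto simp: inj_on_def)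
      also have "(\<lambda>x. (fst x, i + snd x)) ` ?Z = ?Y"
      proof (intro equalityI subsetI)
        fix x assume "x \<in> ?Y"
        then have "(fst x, snd x - i) \<in> ?Z" "x = (\<lambda>x. (fst x, i + snd x)) (fst x, snd x - i)"
          by (auto simp: chain_index_def)
        then show "x \<in> (\<lambda>x. (fst x, i + snd x)) ` ?Z" by blast
      qed (auto simp: chain_index_def)
      finally show ?thesis .
    qed
    have "card {..<m} \<le> card ?Y"
    proof (rule steinitz[OF _ fY y(2), where b = "\<lambda>l x. b l (fst x, snd x - i)"])
      fix l x assume "l \<in> {..<m}" "x \<in> ?Y"
      then show "b l (fst x, snd x - i) \<in> carrier K"
        by (intro b(1)) (auto simp: chain_index_def)
    next
      fix l assume "l \<in> {..<m}"
      then show "(T ^^ i) (y l) =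
          (\<Oplus>\<^bsub>V\<^esub>x\<in>?Y. b l (fst x, snd x - i) \<odot>\<^bsub>V\<^esub> chain_vec T v x)"
        by (intro Ty) simp
    next
      fix x assume "x \<in> ?Y"
      then show "chain_vec T v x \<in> carrier V" by (intro cl) simp
    qed simp
    then show "m \<le> (\<Sum>a\<in>I. n a - i)" using cardY by simp
  next
    assume m: "m \<le> (\<Sum>a\<in>I. n a - i)"
    then have "card {..<m} \<le> card ?Y" using cardY by simp
    then obtain h where h: "inj_on h {..<m}" "h ` {..<m} \<subseteq> ?Y"
      using card_le_inj[of "{..<m}" ?Y] fY by auto
    have hX: "h l \<in> ?X" "i \<le> snd (h l)" if "l < m" for l using h(2) that by auto
    have "lin_indep K V (h ` {..<m}) (chain_vec T v)"
    proof (rule lin_indep_subset[OF _ fX _ cl])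
      show "lin_indep K V ?X (chain_vec T v)" using cb by (simp add: chain_basis_def)
      show "h ` {..<m} \<subseteq> ?X" using h(2) by blast
    qed
    then have ind: "lin_indep K V {..<m} (\<lambda>l. chain_vec T v (h l))"
    proof (rule lin_indep_reindex[OF _ h(1)])
      fix x assume "x \<in> h ` {..<m}"
      then show "chain_vec T v x \<in> carrier V" using h(2) by (intro cl) blast
    qed
    define y where "y = (\<lambda>l. chain_vec T v (fst (h l), snd (h l) - i))"
    have "y l \<in> carrier V" if "l < m" for l
      unfolding y_def using hX[OF that] by (intro cl) (auto simp: chain_index_def)
    moreover have "lin_indep K V {..<m} (\<lambda>l. (T ^^ i) (y l))"
    proof (rule lin_indep_cong[OF ind])
      fix l assume l: "l \<in> {..<m}"
      then show "chain_vec T v (h l) = (T ^^ i) (y l)"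
        using hX[of l] by (simp add: y_def chain_vec_def pow_pow case_prod_beta)
      show "(T ^^ i) (y l) \<in> carrier V"
        using calculation l by (simp add: pow_closed)
    qed
    ultimately show "rank_at_least K V (T ^^ i) m"
      unfolding rank_at_least_def by (intro exI[of _ y]) simp
  qed
qed

end

section \<open>Matrices and the Jordan type\<close>

definition vec_space :: "('a, 'm) ring_scheme \<Rightarrow> nat \<Rightarrow> ('a, nat \<Rightarrow> 'a) module" where
  "vec_space K d = \<lparr>carrier = {..<d} \<rightarrow>\<^sub>E carrier K,
     monoid.mult = (\<lambda>x y. \<lambda>i\<in>{..<d}. x i \<otimes>\<^bsub>K\<^esub> y i), one = (\<lambda>i\<in>{..<d}. \<one>\<^bsub>K\<^esub>),
     zero = (\<lambda>i\<in>{..<d}. \<zero>\<^bsub>K\<^esub>), add = (\<lambda>x y. \<lambda>i\<in>{..<d}. x i \<oplus>\<^bsub>K\<^esub> y i),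
     smult = (\<lambda>a x. \<lambda>i\<in>{..<d}. a \<otimes>\<^bsub>K\<^esub> x i)\<rparr>"

definition mat_op :: "('a, 'm) ring_scheme \<Rightarrow> nat \<Rightarrow> (nat \<Rightarrow> nat \<Rightarrow> 'a) \<Rightarrow> (nat \<Rightarrow> 'a) \<Rightarrow> nat \<Rightarrow> 'a" where
  "mat_op K d S x = (\<lambda>i\<in>{..<d}. \<Oplus>\<^bsub>K\<^esub>l\<in>{..<d}. S i l \<otimes>\<^bsub>K\<^esub> x l)"

definition unit_vec :: "('a, 'm) ring_scheme \<Rightarrow> nat \<Rightarrow> nat \<Rightarrow> nat \<Rightarrow> 'a" where
  "unit_vec K d j = (\<lambda>i\<in>{..<d}. if i = j then \<one>\<^bsub>K\<^esub> else \<zero>\<^bsub>K\<^esub>)"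

lemma vec_space_simps [simp]:
  "carrier (vec_space K d) = {..<d} \<rightarrow>\<^sub>E carrier K"
  "zero (vec_space K d) = (\<lambda>i\<in>{..<d}. \<zero>\<^bsub>K\<^esub>)"
  "add (vec_space K d) x y = (\<lambda>i\<in>{..<d}. x i \<oplus>\<^bsub>K\<^esub> y i)"
  "smult (vec_space K d) a x = (\<lambda>i\<in>{..<d}. a \<otimes>\<^bsub>K\<^esub> x i)"
  by (simp_all add: vec_space_def)

lemma vec_eqI:
  assumes "x \<in> {..<d} \<rightarrow>\<^sub>E A" "y \<in> {..<d} \<rightarrow>\<^sub>E B" "\<And>i. i < (d::nat) \<Longrightarrow> x i = y i"
  shows "x = y"
  using assms by (intro extensionalityI[of _ "{..<d}"]) (auto simp: PiE_def)

context cring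
begin

lemma vec_space_module: "module R (vec_space R d)"
proof (rule moduleI)
  show "cring R" ..
  show "abelian_group (vec_space R d)"
  proof (rule abelian_groupI)
    fix x y z assume x: "x \<in> carrier (vec_space R d)" "y \<in> carrier (vec_space R d)"
      "z \<in> carrier (vec_space R d)"
    then have m: "\<And>i. i < d \<Longrightarrow> x i \<in> carrier R" "\<And>i. i < d \<Longrightarrow> y i \<in> carrier R"
        "\<And>i. i < d \<Longrightarrow> z i \<in> carrier R"
      by auto
    show "x \<oplus>\<^bsub>vec_space R d\<^esub> y \<in> carrier (vec_space R d)" using m by auto
    show "x \<oplus>\<^bsub>vec_space R d\<^esub> y \<oplus>\<^bsub>vec_space R d\<^esub> z = x \<oplus>\<^bsub>vec_space R d\<^esub> (y \<oplus>\<^bsub>vec_space R d\<^esub> z)"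
      using m by (simp add: a_assoc restrict_def fun_eq_iff)
    show "x \<oplus>\<^bsub>vec_space R d\<^esub> y = y \<oplus>\<^bsub>vec_space R d\<^esub> x"
      using m by (simp add: a_comm restrict_def fun_eq_iff)
    show "\<zero>\<^bsub>vec_space R d\<^esub> \<oplus>\<^bsub>vec_space R d\<^esub> x = x"
      using m x by (intro vec_eqI[of _ d "carrier R" _ "carrier R"]) auto
    have "(\<lambda>i\<in>{..<d}. \<ominus> x i) \<oplus>\<^bsub>vec_space R d\<^esub> x = \<zero>\<^bsub>vec_space R d\<^esub>"
      using m by (simp add: l_neg restrict_def fun_eq_iff)
    moreover have "(\<lambda>i\<in>{..<d}. \<ominus> x i) \<in> carrier (vec_space R d)" using m by auto
    ultimately show "\<exists>y\<in>carrier (vec_space R d). y \<oplus>\<^bsub>vec_space R d\<^esub> x = \<zero>\<^bsub>vec_space R d\<^esub>"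
      by blast
  qed auto
  fix a b x y assume a: "a \<in> carrier R" "b \<in> carrier R" and x: "x \<in> carrier (vec_space R d)"
    "y \<in> carrier (vec_space R d)"
  then have m: "\<And>i. i < d \<Longrightarrow> x i \<in> carrier R" "\<And>i. i < d \<Longrightarrow> y i \<in> carrier R" by auto
  show "(a \<oplus> b) \<odot>\<^bsub>vec_space R d\<^esub> x = a \<odot>\<^bsub>vec_space R d\<^esub> x \<oplus>\<^bsub>vec_space R d\<^esub> b \<odot>\<^bsub>vec_space R d\<^esub> x"
    using m a by (simp add: l_distr restrict_def fun_eq_iff)
  show "a \<odot>\<^bsub>vec_space R d\<^esub> (x \<oplus>\<^bsub>vec_space R d\<^esub> y) = a \<odot>\<^bsub>vec_space R d\<^esub> x \<oplus>\<^bsub>vec_space R d\<^esub> a \<odot>\<^bsub>vec_space R d\<^esub> y"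
    using m a by (simp add: r_distr restrict_def fun_eq_iff)
  show "(a \<otimes> b) \<odot>\<^bsub>vec_space R d\<^esub> x = a \<odot>\<^bsub>vec_space R d\<^esub> (b \<odot>\<^bsub>vec_space R d\<^esub> x)"
    using m a by (simp add: m_assoc restrict_def fun_eq_iff)
next
  fix x assume x: "x \<in> carrier (vec_space R d)"
  then have m: "\<And>i. i < d \<Longrightarrow> x i \<in> carrier R" by auto
  show "\<one> \<odot>\<^bsub>vec_space R d\<^esub> x = x"
    using m x by (intro vec_eqI[of _ d "carrier R" _ "carrier R"]) auto
qed auto

lemma vec_finsum:
  assumes "finite I" "\<And>i. i \<in> I \<Longrightarrow> f i \<in> carrier (vec_space R d)" "l < d"
  shows "(\<Oplus>\<^bsub>vec_space R d\<^esub>i\<in>I. f i) l = (\<Oplus>i\<in>I. f i l)"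
proof -
  interpret V: module R "vec_space R d" by (rule vec_space_module)
  show ?thesis using assms
  proof (induction I)
    case (insert x F)
    have 1: "f \<in> F \<rightarrow> carrier (vec_space R d)" "f x \<in> carrier (vec_space R d)"
      using insert.prems by auto
    have 2: "(\<lambda>i. f i l) \<in> F \<rightarrow> carrier R" "f x l \<in> carrier R"
      using insert.prems by (auto simp: PiE_iff)
    show ?case
      using insert 1 2 by (simp add: V.M.finsum_insert finsum_insert del: vec_space_simps(1))
  qed simp
qed

lemma vec_lincomb:
  assumes "finite I" "\<And>i. i \<in> I \<Longrightarrow> v i \<in> carrier (vec_space R d)" "\<And>i. i \<in> I \<Longrightarrow> a i \<in> carrier R"
    "l < d"
  shows "(\<Oplus>\<^bsub>vec_space R d\<^esub>i\<in>I. a i \<odot>\<^bsub>vec_space R d\<^esub> v i) l = (\<Oplus>i\<in>I. a i \<otimes> v i l)"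
proof -
  interpret V: module R "vec_space R d" by (rule vec_space_module)
  have "(\<Oplus>\<^bsub>vec_space R d\<^esub>i\<in>I. a i \<odot>\<^bsub>vec_space R d\<^esub> v i) l = (\<Oplus>i\<in>I. (a i \<odot>\<^bsub>vec_space R d\<^esub> v i) l)"
    using assms by (intro vec_finsum V.smult_closed) auto
  also have "\<dots> = (\<Oplus>i\<in>I. a i \<otimes> v i l)"
    using assms by (intro finsum_cong') auto
  finally show ?thesis .
qed

lemma vec_lincomb_closed:
  assumes "\<And>i. i \<in> I \<Longrightarrow> v i \<in> carrier (vec_space R d)" "\<And>i. i \<in> I \<Longrightarrow> a i \<in> carrier R"
  shows "(\<Oplus>\<^bsub>vec_space R d\<^esub>i\<in>I. a i \<odot>\<^bsub>vec_space R d\<^esub> v i) \<in> carrier (vec_space R d)"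
proof -
  interpret V: module R "vec_space R d" by (rule vec_space_module)
  show ?thesis by (intro V.M.finsum_closed funcsetI V.smult_closed assms)
qed

lemma mat_op_closed:
  assumes "\<And>i j. i < d \<Longrightarrow> j < d \<Longrightarrow> S i j \<in> carrier R" "x \<in> carrier (vec_space R d)"
  shows "mat_op R d S x \<in> carrier (vec_space R d)"
  using assms by (auto simp: mat_op_def intro!: finsum_closed)

lemma mat_op_linear:
  assumes S: "\<And>i j. i < d \<Longrightarrow> j < d \<Longrightarrow> S i j \<in> carrier R"
  shows "x \<in> carrier (vec_space R d) \<Longrightarrow> y \<in> carrier (vec_space R d) \<Longrightarrow>
      mat_op R d S (x \<oplus>\<^bsub>vec_space R d\<^esub> y) = mat_op R d S x \<oplus>\<^bsub>vec_space R d\<^esub> mat_op R d S y"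
    and "a \<in> carrier R \<Longrightarrow> x \<in> carrier (vec_space R d) \<Longrightarrow>
      mat_op R d S (a \<odot>\<^bsub>vec_space R d\<^esub> x) = a \<odot>\<^bsub>vec_space R d\<^esub> mat_op R d S x"
proof -
  assume x: "x \<in> carrier (vec_space R d)" and y: "y \<in> carrier (vec_space R d)"
  then have m: "\<And>i. i < d \<Longrightarrow> x i \<in> carrier R" "\<And>i. i < d \<Longrightarrow> y i \<in> carrier R" by auto
  have "(\<Oplus>l\<in>{..<d}. S i l \<otimes> (x l \<oplus> y l)) = (\<Oplus>l\<in>{..<d}. S i l \<otimes> x l) \<oplus> (\<Oplus>l\<in>{..<d}. S i l \<otimes> y l)"
    if "i < d" for i
  proof -
    have "(\<Oplus>l\<in>{..<d}. S i l \<otimes> (x l \<oplus> y l)) = (\<Oplus>l\<in>{..<d}. S i l \<otimes> x l \<oplus> S i l \<otimes> y l)"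
      using that S m by (intro finsum_cong') (auto simp: r_distr)
    also have "\<dots> = (\<Oplus>l\<in>{..<d}. S i l \<otimes> x l) \<oplus> (\<Oplus>l\<in>{..<d}. S i l \<otimes> y l)"
      using that S m by (intro finsum_addf) auto
    finally show ?thesis .
  qed
  moreover have "(\<Oplus>l\<in>{..<d}. S i l \<otimes> (x \<oplus>\<^bsub>vec_space R d\<^esub> y) l) = (\<Oplus>l\<in>{..<d}. S i l \<otimes> (x l \<oplus> y l))"
    if "i < d" for i
    using that S m by (intro finsum_cong') auto
  ultimately show "mat_op R d S (x \<oplus>\<^bsub>vec_space R d\<^esub> y) = mat_op R d S x \<oplus>\<^bsub>vec_space R d\<^esub> mat_op R d S y"
    by (simp add: mat_op_def restrict_def fun_eq_iff)
next
  assume a: "a \<in> carrier R" and x: "x \<in> carrier (vec_space R d)"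
  then have m: "\<And>i. i < d \<Longrightarrow> x i \<in> carrier R" by auto
  have "(\<Oplus>l\<in>{..<d}. S i l \<otimes> (a \<odot>\<^bsub>vec_space R d\<^esub> x) l) = a \<otimes> (\<Oplus>l\<in>{..<d}. S i l \<otimes> x l)"
    if "i < d" for i
  proof -
    have "(\<Oplus>l\<in>{..<d}. S i l \<otimes> (a \<odot>\<^bsub>vec_space R d\<^esub> x) l) = (\<Oplus>l\<in>{..<d}. a \<otimes> (S i l \<otimes> x l))"
      using that S m a by (intro finsum_cong') (auto simp: m_lcomm)
    also have "\<dots> = a \<otimes> (\<Oplus>l\<in>{..<d}. S i l \<otimes> x l)"
      using that S m a by (intro finsum_rdistr[symmetric]) auto
    finally show ?thesis .
  qed
  then show "mat_op R d S (a \<odot>\<^bsub>vec_space R d\<^esub> x) = a \<odot>\<^bsub>vec_space R d\<^esub> mat_op R d S x"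
    by (simp add: mat_op_def restrict_def fun_eq_iff)
qed

end

context field
begin

lemma vec_space_vector_space: "vector_space_rec R (vec_space R d)"
  by (intro vector_space_rec.intro vec_space_module) (rule field_axioms)

lemma mat_op_lin_op:
  assumes S: "\<And>i j. i < d \<Longrightarrow> j < d \<Longrightarrow> S i j \<in> carrier R"
  shows "lin_op R (vec_space R d) (mat_op R d S)"
  by (intro lin_op.intro vec_space_vector_space lin_op_axioms.intro mat_op_closed[OF S]
      mat_op_linear[OF S])

lemma unit_vec_closed: "unit_vec R d j \<in> carrier (vec_space R d)"
  by (auto simp: unit_vec_def)

lemma unit_vec_lincomb:
  assumes "\<And>i. i < d \<Longrightarrow> a i \<in> carrier R" "l < d"
  shows "(\<Oplus>\<^bsub>vec_space R d\<^esub>i\<in>{..<d}. a i \<odot>\<^bsub>vec_space R d\<^esub> unit_vec R d i) l = a l"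
proof -
  have "(\<Oplus>\<^bsub>vec_space R d\<^esub>i\<in>{..<d}. a i \<odot>\<^bsub>vec_space R d\<^esub> unit_vec R d i) l = (\<Oplus>i\<in>{..<d}. a i \<otimes> unit_vec R d i l)"
    using assms unit_vec_closed by (intro vec_lincomb) auto
  also have "\<dots> = (\<Oplus>i\<in>{..<d}. if i = l then a i else \<zero>)"
    using assms by (intro finsum_cong') (auto simp: unit_vec_def)
  also have "\<dots> = a l" using assms by (intro finsum_delta) auto
  finally show ?thesis .
qed

lemma unit_vec_indep: "lin_indep R (vec_space R d) {..<d} (unit_vec R d)"
  unfolding lin_indep_def
proof (intro allI impI ballI)
  fix a i assume a: "\<forall>i\<in>{..<d}. a i \<in> carrier R" "i \<in> {..<d}"
    "(\<Oplus>\<^bsub>vec_space R d\<^esub>i\<in>{..<d}. a i \<odot>\<^bsub>vec_space R d\<^esub> unit_vec R d i) = \<zero>\<^bsub>vec_space R d\<^esub>"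
  have "a i = (\<Oplus>\<^bsub>vec_space R d\<^esub>i\<in>{..<d}. a i \<odot>\<^bsub>vec_space R d\<^esub> unit_vec R d i) i"
    using a(1,2) by (intro unit_vec_lincomb[symmetric]) auto
  also have "\<dots> = \<zero>\<^bsub>vec_space R d\<^esub> i" by (rule fun_cong[OF a(3)])
  also have "\<dots> = \<zero>" using a(2) by simp
  finally show "a i = \<zero>" .
qed

lemma unit_vec_expand:
  assumes "x \<in> carrier (vec_space R d)"
  shows "x = (\<Oplus>\<^bsub>vec_space R d\<^esub>i\<in>{..<d}. x i \<odot>\<^bsub>vec_space R d\<^esub> unit_vec R d i)"
proof (rule vec_eqI)
  have m: "\<And>i. i < d \<Longrightarrow> x i \<in> carrier R" using assms by auto
  show "x \<in> {..<d} \<rightarrow>\<^sub>E carrier R" using assms by simp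
  show "(\<Oplus>\<^bsub>vec_space R d\<^esub>i\<in>{..<d}. x i \<odot>\<^bsub>vec_space R d\<^esub> unit_vec R d i) \<in> {..<d} \<rightarrow>\<^sub>E carrier R"
    using vec_lincomb_closed[of "{..<d}" "unit_vec R d" d x] m unit_vec_closed by simp
  show "x i = (\<Oplus>\<^bsub>vec_space R d\<^esub>i\<in>{..<d}. x i \<odot>\<^bsub>vec_space R d\<^esub> unit_vec R d i) i" if "i < d" for i
    using m that by (intro unit_vec_lincomb[symmetric]) auto
qed

lemma unit_vec_spans: "lin_spans R (vec_space R d) {..<d} (unit_vec R d)"
  unfolding lin_spans_def
proof
  fix x assume x: "x \<in> carrier (vec_space R d)"
  then have "\<forall>i\<in>{..<d}. x i \<in> carrier R" by auto
  then show "\<exists>a. (\<forall>i\<in>{..<d}. a i \<in> carrier R) \<and>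
      x = (\<Oplus>\<^bsub>vec_space R d\<^esub>i\<in>{..<d}. a i \<odot>\<^bsub>vec_space R d\<^esub> unit_vec R d i)"
    using unit_vec_expand[OF x] by blast
qed

lemma basis_card:
  assumes "finite I" "\<And>i. i \<in> I \<Longrightarrow> v i \<in> carrier (vec_space R d)"
    "lin_indep R (vec_space R d) I v" "lin_spans R (vec_space R d) I v"
  shows "card I = d"
proof -
  interpret V: vector_space_rec R "vec_space R d" by (rule vec_space_vector_space)
  have "card I \<le> card {..<d}"
  proof (rule V.steinitz[OF assms(1) _ assms(3), where b = v and v = "unit_vec R d"])
    show "v i = (\<Oplus>\<^bsub>vec_space R d\<^esub>j\<in>{..<d}. v i j \<odot>\<^bsub>vec_space R d\<^esub> unit_vec R d j)" if "i \<in> I" for i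
      using assms(2)[OF that] by (rule unit_vec_expand)
    show "v i j \<in> carrier R" if "i \<in> I" "j \<in> {..<d}" for i j
      using assms(2)[OF that(1)] that(2) by auto
  qed (use unit_vec_closed in auto)
  moreover have "card {..<d} \<le> card I"
  proof -
    have "\<forall>j. \<exists>a. (\<forall>i\<in>I. a i \<in> carrier R) \<and>
        unit_vec R d j = (\<Oplus>\<^bsub>vec_space R d\<^esub>i\<in>I. a i \<odot>\<^bsub>vec_space R d\<^esub> v i)"
    proof
      fix j
      show "\<exists>a. (\<forall>i\<in>I. a i \<in> carrier R) \<and>
        unit_vec R d j = (\<Oplus>\<^bsub>vec_space R d\<^esub>i\<in>I. a i \<odot>\<^bsub>vec_space R d\<^esub> v i)"
        using assms(4)[unfolded lin_spans_def, rule_format, OF unit_vec_closed[of d j]] by blast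
    qed
    from choice[OF this] obtain a where a: "\<forall>j. (\<forall>i\<in>I. a j i \<in> carrier R) \<and>
        unit_vec R d j = (\<Oplus>\<^bsub>vec_space R d\<^esub>i\<in>I. a j i \<odot>\<^bsub>vec_space R d\<^esub> v i)" ..
    show ?thesis
      by (rule V.steinitz[OF _ assms(1) unit_vec_indep assms(2), where b = a]) (use a in blast)+
  qed
  ultimately show ?thesis by simp
qed

end

subsection \<open>Jordan matrices and chain bases\<close>

text \<open>The column in which \<open>T^t (v a)\<close> is placed: the \<open>a\<close>-th block is filled from its end.\<close>

definition block_pos :: "nat list \<Rightarrow> nat \<times> nat \<Rightarrow> nat" where
  "block_pos ns = (\<lambda>(a, t). sum_list (take (Suc a) ns) - Suc t)"

lemma sum_list_take_mono:
  "m \<le> m' \<Longrightarrow> sum_list (take m ns) \<le> sum_list (take m' (ns :: nat list))"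
  by (metis le_add1 le_iff_add sum_list_append take_add)

lemma sum_list_take_Suc:
  "a < length ns \<Longrightarrow> sum_list (take (Suc a) ns) = sum_list (take a ns) + (ns ! a :: nat)"
  by (simp add: take_Suc_conv_app_nth)

lemma block_pos_bounds:
  assumes "a < length ns" "t < ns ! a"
  shows "sum_list (take a ns) \<le> block_pos ns (a, t)" "block_pos ns (a, t) < sum_list (take (Suc a) ns)"
    "block_pos ns (a, t) = sum_list (take a ns) + (ns ! a - Suc t)" "block_pos ns (a, t) < sum_list ns"
  using assms sum_list_take_mono[of "Suc a" "length ns" ns] sum_list_take_Suc[of a ns]
  by (auto simp: block_pos_def)

lemma block_pos_bij:
  "bij_betw (block_pos ns) (chain_index {..<length ns} ((!) ns)) {..<sum_list ns}"
proof -
  let ?X = "chain_index {..<length ns} ((!) ns)"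
  have inj: "inj_on (block_pos ns) ?X"
  proof (rule inj_onI)
    fix x y assume x: "x \<in> ?X" and y: "y \<in> ?X" and eq: "block_pos ns x = block_pos ns y"
    obtain a t b u where xy: "x = (a, t)" "y = (b, u)" by (cases x, cases y)
    have a: "a < length ns" "t < ns ! a" and b: "b < length ns" "u < ns ! b"
      using x y xy by (auto simp: chain_index_def)
    have "\<not> a < b"
      using block_pos_bounds(2)[OF a] block_pos_bounds(1)[OF b] sum_list_take_mono[of "Suc a" b ns] eq xy
      by auto
    moreover have "\<not> b < a"
      using block_pos_bounds(2)[OF b] block_pos_bounds(1)[OF a] sum_list_take_mono[of "Suc b" a ns] eq xy
      by auto
    ultimately have "a = b" by simp
    then show "x = y" using block_pos_bounds(3)[OF a] block_pos_bounds(3)[OF b] eq xy a b by auto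
  qed
  have "card ?X = (\<Sum>a<length ns. ns ! a)" by (simp add: chain_index_def)
  also have "\<dots> = sum_list ns" by (simp add: sum_list_sum_nth atLeast0LessThan)
  finally have "card (block_pos ns ` ?X) = card {..<sum_list ns}" using inj by (simp add: card_image)
  moreover have "block_pos ns ` ?X \<subseteq> {..<sum_list ns}"
    using block_pos_bounds(4) by (auto simp: chain_index_def)
  ultimately have "block_pos ns ` ?X = {..<sum_list ns}" by (intro card_subset_eq) auto
  then show ?thesis using inj by (simp add: bij_betw_def)
qed

lemma block_start:
  assumes "a < length ns" "t < ns ! a"
  shows "block_pos ns (a, t) \<in> {sum_list (take m ns) | m. m \<le> length ns} \<longleftrightarrow> Suc t = ns ! a"
proof
  assume "block_pos ns (a, t) \<in> {sum_list (take m ns) | m. m \<le> length ns}"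
  then obtain m where m: "block_pos ns (a, t) = sum_list (take m ns)" by blast
  have "m \<le> a" using block_pos_bounds(2)[OF assms] sum_list_take_mono[of "Suc a" m ns] m by force
  then have "sum_list (take m ns) \<le> sum_list (take a ns)" by (rule sum_list_take_mono)
  then show "Suc t = ns ! a" using block_pos_bounds(3)[OF assms] m assms by simp
next
  assume "Suc t = ns ! a"
  then have "block_pos ns (a, t) = sum_list (take a ns)" using block_pos_bounds(3)[OF assms] by simp
  then show "block_pos ns (a, t) \<in> {sum_list (take m ns) | m. m \<le> length ns}"
    using assms by (auto intro!: exI[of _ a])
qed

lemma block_pos_Suc:
  assumes "a < length ns" "Suc t < ns ! a"
  shows "block_pos ns (a, t) = Suc (block_pos ns (a, Suc t))"
  using block_pos_bounds(3)[OF assms] block_pos_bounds(3)[of a ns t] assms by simp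

context cring
begin

lemma matrix_mult_closed:
  assumes "\<And>i j. i < d \<Longrightarrow> j < d \<Longrightarrow> S i j \<in> carrier R" "\<And>i j. i < d \<Longrightarrow> j < d \<Longrightarrow> T i j \<in> carrier R"
    "i < d" "j < d"
  shows "matrix_mult R d S T i j \<in> carrier R"
  using assms unfolding matrix_mult_def by (intro finsum_closed) auto

lemma mat_op_mat_op:
  assumes A: "\<And>i j. i < d \<Longrightarrow> j < d \<Longrightarrow> A i j \<in> carrier R" and B: "\<And>i j. i < d \<Longrightarrow> j < d \<Longrightarrow> B i j \<in> carrier R"
    and x: "x \<in> carrier (vec_space R d)"
  shows "mat_op R d A (mat_op R d B x) = mat_op R d (matrix_mult R d A B) x"
proof
  fix i
  show "mat_op R d A (mat_op R d B x) i = mat_op R d (matrix_mult R d A B) x i"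
  proof (cases "i < d")
    case i: True
    have xR: "\<And>l. l < d \<Longrightarrow> x l \<in> carrier R" using x by auto
    have "mat_op R d A (mat_op R d B x) i = (\<Oplus>l\<in>{..<d}. A i l \<otimes> (\<Oplus>j\<in>{..<d}. B l j \<otimes> x j))"
      unfolding mat_op_def using i A B xR by (auto intro!: finsum_cong' finsum_closed)
    also have "\<dots> = (\<Oplus>l\<in>{..<d}. \<Oplus>j\<in>{..<d}. (A i l \<otimes> B l j) \<otimes> x j)"
    proof (rule finsum_cong'[OF refl])
      fix l assume l: "l \<in> {..<d}"
      have "A i l \<otimes> (\<Oplus>j\<in>{..<d}. B l j \<otimes> x j) = (\<Oplus>j\<in>{..<d}. A i l \<otimes> (B l j \<otimes> x j))"
        using A B xR i l by (intro finsum_rdistr) auto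
      also have "\<dots> = (\<Oplus>j\<in>{..<d}. (A i l \<otimes> B l j) \<otimes> x j)"
        using A B xR i l by (intro finsum_cong') (auto simp: m_assoc)
      finally show "A i l \<otimes> (\<Oplus>j\<in>{..<d}. B l j \<otimes> x j) = (\<Oplus>j\<in>{..<d}. (A i l \<otimes> B l j) \<otimes> x j)" .
    qed (use A B xR i in \<open>auto intro!: finsum_closed\<close>)
    also have "\<dots> = (\<Oplus>j\<in>{..<d}. \<Oplus>l\<in>{..<d}. (A i l \<otimes> B l j) \<otimes> x j)"
      using A B xR i by (intro finsum_swap) auto
    also have "\<dots> = (\<Oplus>j\<in>{..<d}. matrix_mult R d A B i j \<otimes> x j)"
      unfolding matrix_mult_def using A B xR i
      by (intro finsum_cong' finsum_ldistr[symmetric]) (auto intro!: finsum_closed)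
    finally show ?thesis using i by (simp add: mat_op_def)
  qed (simp add: mat_op_def)
qed

end

context field
begin

text \<open>
  A Jordan matrix shifts columns: column \<open>j\<close> of \<open>P J\<close> is column \<open>j -
  1\<close> of \<open>P\<close>, or zero at the start of a block.
\<close>

lemma mult_jordan_column:
  assumes P: "\<And>i j. i < d \<Longrightarrow> j < d \<Longrightarrow> P i j \<in> carrier R" and d: "sum_list ns = d"
    and a: "a < length ns" "t < ns ! a" and i: "i < d"
  shows "matrix_mult R d P (jordan_matrix R ns) i (block_pos ns (a, t)) =
    (if Suc t < ns ! a then P i (block_pos ns (a, Suc t)) else \<zero>)"
proof (cases "Suc t < ns ! a")
  case True
  let ?c = "block_pos ns (a, Suc t)"
  have c: "?c < d" using block_pos_bounds(4)[OF a(1) True] d by simp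
  have "block_pos ns (a, t) \<notin> {sum_list (take m ns) | m. m \<le> length ns}"
    using block_start[OF a] True by simp
  then have J: "jordan_matrix R ns l (block_pos ns (a, t)) = (if l = ?c then \<one> else \<zero>)" for l
    unfolding jordan_matrix_def using block_pos_Suc[OF a(1) True] by auto
  have "matrix_mult R d P (jordan_matrix R ns) i (block_pos ns (a, t)) =
      (\<Oplus>l\<in>{..<d}. if l = ?c then P i l else \<zero>)"
    unfolding matrix_mult_def J using P i by (intro finsum_cong') auto
  also have "\<dots> = P i ?c" using P i c by (intro finsum_delta) auto
  finally show ?thesis using True by simp
next
  case False
  then have "block_pos ns (a, t) \<in> {sum_list (take m ns) | m. m \<le> length ns}"
    using block_start[OF a] a(2) by simp
  then have J: "jordan_matrix R ns l (block_pos ns (a, t)) = \<zero>" for l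
    unfolding jordan_matrix_def by (metis (no_types, lifting))
  have "matrix_mult R d P (jordan_matrix R ns) i (block_pos ns (a, t)) = \<zero>"
    unfolding matrix_mult_def J using P i by (intro add.finprod_one_eqI) auto
  then show ?thesis using False by simp
qed

text \<open>
  In \<open>S P = P J\<close> the columns of \<open>P\<close> belonging to one block form a chain. They
  are independent and generate because \<open>P\<close> is invertible.
\<close>

lemma similar_jordan_imp_chain_basis:
  assumes S: "\<And>i j. i < d \<Longrightarrow> j < d \<Longrightarrow> S i j \<in> carrier R" and d: "sum_list ns = d"
    and sim: "similar_matrices R d S (jordan_matrix R ns)"
  shows "\<exists>v. chain_basis R (vec_space R d) (mat_op R d S) {..<length ns} ((!) ns) v"
proof -
  interpret V: lin_op R "vec_space R d" "mat_op R d S" by (rule mat_op_lin_op[OF S])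
  let ?V = "vec_space R d" and ?X = "chain_index {..<length ns} ((!) ns)"
  obtain P Q where PQ: "\<forall>i<d. \<forall>j<d. P i j \<in> carrier R \<and> Q i j \<in> carrier R \<and>
     matrix_mult R d P Q i j = (if i = j then \<one> else \<zero>) \<and>
     matrix_mult R d Q P i j = (if i = j then \<one> else \<zero>) \<and>
     matrix_mult R d S P i j = matrix_mult R d P (jordan_matrix R ns) i j"
    using sim unfolding similar_matrices_def by blast
  then have P: "\<And>i j. i < d \<Longrightarrow> j < d \<Longrightarrow> P i j \<in> carrier R"
    and Q: "\<And>i j. i < d \<Longrightarrow> j < d \<Longrightarrow> Q i j \<in> carrier R" by blast+
  define col where "col = (\<lambda>j. \<lambda>i\<in>{..<d}. P i j)"
  have col: "col j \<in> carrier ?V" if "j < d" for j using P that by (auto simp: col_def)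
  have col_step: "mat_op R d S (col (block_pos ns (a, t))) =
      (if Suc t < ns ! a then col (block_pos ns (a, Suc t)) else \<zero>\<^bsub>?V\<^esub>)"
    if a: "a < length ns" "t < ns ! a" for a t
  proof (rule vec_eqI[where d = d and A = "carrier R" and B = "carrier R"])
    have c: "block_pos ns (a, t) < d" using block_pos_bounds(4)[OF a] d by simp
    have c': "block_pos ns (a, Suc t) < d" if "Suc t < ns ! a"
      using block_pos_bounds(4)[OF a(1) that] d by simp
    show "mat_op R d S (col (block_pos ns (a, t))) \<in> {..<d} \<rightarrow>\<^sub>E carrier R"
      using V.T_closed[OF col[OF c]] by simp
    show "(if Suc t < ns ! a then col (block_pos ns (a, Suc t)) else \<zero>\<^bsub>?V\<^esub>) \<in> {..<d} \<rightarrow>\<^sub>E carrier R"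
      using col c' by auto
    fix i assume i: "i < d"
    have "mat_op R d S (col (block_pos ns (a, t))) i = matrix_mult R d S P i (block_pos ns (a, t))"
      using i S P c by (auto simp: mat_op_def matrix_mult_def col_def intro!: finsum_cong')
    also have "\<dots> = matrix_mult R d P (jordan_matrix R ns) i (block_pos ns (a, t))"
      using PQ i c by blast
    also have "\<dots> = (if Suc t < ns ! a then P i (block_pos ns (a, Suc t)) else \<zero>)"
      by (rule mult_jordan_column[OF P d a i])
    also have "\<dots> = (if Suc t < ns ! a then col (block_pos ns (a, Suc t)) else \<zero>\<^bsub>?V\<^esub>) i"
      using i by (simp add: col_def)
    finally show "mat_op R d S (col (block_pos ns (a, t))) i =
      (if Suc t < ns ! a then col (block_pos ns (a, Suc t)) else \<zero>\<^bsub>?V\<^esub>) i" .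
  qed
  define v where "v = (\<lambda>a. if 0 < ns ! a then col (block_pos ns (a, 0)) else \<zero>\<^bsub>?V\<^esub>)"
  have vec: "(mat_op R d S ^^ t) (v a) = col (block_pos ns (a, t))" if "a < length ns" "t < ns ! a" for a t
    using that(2)
  proof (induction t)
    case (Suc t)
    then have "(mat_op R d S ^^ Suc t) (v a) = mat_op R d S (col (block_pos ns (a, t)))" by simp
    then show ?case using col_step[OF that(1), of t] Suc.prems by simp
  qed (simp add: v_def)
  have vV: "v a \<in> carrier ?V" if "a < length ns" for a
  proof (cases "0 < ns ! a")
    case True
    then have "block_pos ns (a, 0) < d" using block_pos_bounds(4)[OF that] d by simp
    then show ?thesis using True by (simp add: v_def col del: vec_space_simps)
  qed (simp add: v_def del: vec_space_simps)
  have vz: "(mat_op R d S ^^ (ns ! a)) (v a) = \<zero>\<^bsub>?V\<^esub>" if a: "a < length ns" for a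
  proof (cases "ns ! a")
    case (Suc t)
    then have "(mat_op R d S ^^ (ns ! a)) (v a) = mat_op R d S (col (block_pos ns (a, t)))"
      using vec[OF a, of t] by simp
    then show ?thesis using col_step[OF a, of t] Suc by simp
  qed (simp add: v_def)
  have img: "block_pos ns ` ?X = {..<d}" "inj_on (block_pos ns) ?X"
    using block_pos_bij[of ns] d by (auto simp: bij_betw_def)
  have lc: "(\<Oplus>\<^bsub>?V\<^esub>j\<in>{..<d}. b j \<odot>\<^bsub>?V\<^esub> col j) i = (\<Oplus>j\<in>{..<d}. b j \<otimes> P i j)"
    if "\<And>j. j < d \<Longrightarrow> b j \<in> carrier R" "i < d" for b i
  proof -
    have "(\<Oplus>\<^bsub>?V\<^esub>j\<in>{..<d}. b j \<odot>\<^bsub>?V\<^esub> col j) i = (\<Oplus>j\<in>{..<d}. b j \<otimes> col j i)"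
      using that col by (intro vec_lincomb) auto
    also have "\<dots> = (\<Oplus>j\<in>{..<d}. b j \<otimes> P i j)"
      using that P by (intro finsum_cong') (auto simp: col_def)
    finally show ?thesis .
  qed
  have mult_assoc': "(\<Oplus>l\<in>{..<d}. A i l \<otimes> (\<Oplus>j\<in>{..<d}. b j \<otimes> B l j)) = (\<Oplus>j\<in>{..<d}. b j \<otimes> matrix_mult R d A B i j)"
    if A: "\<And>i j. i < d \<Longrightarrow> j < d \<Longrightarrow> A i j \<in> carrier R" and B: "\<And>i j. i < d \<Longrightarrow> j < d \<Longrightarrow> B i j \<in> carrier R"
      and b: "\<And>j. j < d \<Longrightarrow> b j \<in> carrier R" and i: "i < d" for A B b i
  proof -
    have "(\<Oplus>l\<in>{..<d}. A i l \<otimes> (\<Oplus>j\<in>{..<d}. b j \<otimes> B l j)) = (\<Oplus>l\<in>{..<d}. \<Oplus>j\<in>{..<d}. b j \<otimes> (A i l \<otimes> B l j))"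
    proof (rule finsum_cong'[OF refl])
      fix l assume l: "l \<in> {..<d}"
      have "A i l \<otimes> (\<Oplus>j\<in>{..<d}. b j \<otimes> B l j) = (\<Oplus>j\<in>{..<d}. A i l \<otimes> (b j \<otimes> B l j))"
        using A B b i l by (intro finsum_rdistr) auto
      also have "\<dots> = (\<Oplus>j\<in>{..<d}. b j \<otimes> (A i l \<otimes> B l j))"
        using A B b i l by (intro finsum_cong') (auto simp: m_lcomm)
      finally show "A i l \<otimes> (\<Oplus>j\<in>{..<d}. b j \<otimes> B l j) = (\<Oplus>j\<in>{..<d}. b j \<otimes> (A i l \<otimes> B l j))" .
    qed (use A B b i in \<open>auto intro!: finsum_closed\<close>)
    also have "\<dots> = (\<Oplus>j\<in>{..<d}. \<Oplus>l\<in>{..<d}. b j \<otimes> (A i l \<otimes> B l j))"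
      using A B b i by (intro finsum_swap) auto
    also have "\<dots> = (\<Oplus>j\<in>{..<d}. b j \<otimes> matrix_mult R d A B i j)"
      unfolding matrix_mult_def using A B b i
      by (intro finsum_cong' finsum_rdistr[symmetric]) (auto intro!: finsum_closed)
    finally show ?thesis .
  qed
  have delta: "(\<Oplus>j\<in>{..<d}. b j \<otimes> (if i = j then \<one> else \<zero>)) = b i"
    if "\<And>j. j < d \<Longrightarrow> b j \<in> carrier R" "i < d" for b i
  proof -
    have "(\<Oplus>j\<in>{..<d}. b j \<otimes> (if i = j then \<one> else \<zero>)) = (\<Oplus>j\<in>{..<d}. if j = i then b j else \<zero>)"
      using that by (intro finsum_cong') auto
    also have "\<dots> = b i" using that by (intro finsum_delta) auto
    finally show ?thesis .
  qed
  have ind: "lin_indep R ?V {..<d} col"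
    unfolding lin_indep_def
  proof (intro allI impI ballI)
    fix b i assume b: "\<forall>i\<in>{..<d}. b i \<in> carrier R" "i \<in> {..<d}"
      "(\<Oplus>\<^bsub>?V\<^esub>j\<in>{..<d}. b j \<odot>\<^bsub>?V\<^esub> col j) = \<zero>\<^bsub>?V\<^esub>"
    have z: "(\<Oplus>j\<in>{..<d}. b j \<otimes> P l j) = \<zero>" if "l < d" for l
    proof -
      have "(\<Oplus>j\<in>{..<d}. b j \<otimes> P l j) = (\<Oplus>\<^bsub>?V\<^esub>j\<in>{..<d}. b j \<odot>\<^bsub>?V\<^esub> col j) l"
        using b that by (intro lc[symmetric]) auto
      also have "\<dots> = \<zero>\<^bsub>?V\<^esub> l" by (rule fun_cong[OF b(3)])
      finally show ?thesis using that by simp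
    qed
    have "b i = (\<Oplus>j\<in>{..<d}. b j \<otimes> (if i = j then \<one> else \<zero>))"
      using b by (intro delta[symmetric]) auto
    also have "\<dots> = (\<Oplus>j\<in>{..<d}. b j \<otimes> matrix_mult R d Q P i j)"
      using PQ b by (intro finsum_cong') auto
    also have "\<dots> = (\<Oplus>l\<in>{..<d}. Q i l \<otimes> (\<Oplus>j\<in>{..<d}. b j \<otimes> P l j))"
      using b P Q by (intro mult_assoc'[symmetric]) auto
    also have "\<dots> = \<zero>" using z Q b by (intro add.finprod_one_eqI) auto
    finally show "b i = \<zero>" .
  qed
  have spn: "lin_spans R ?V {..<d} col"
    unfolding lin_spans_def
  proof
    fix x assume x: "x \<in> carrier ?V"
    then have m: "\<And>i. i < d \<Longrightarrow> x i \<in> carrier R" by auto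
    define b where "b = (\<lambda>i. \<Oplus>l\<in>{..<d}. x l \<otimes> Q i l)"
    have b: "\<And>i. i < d \<Longrightarrow> b i \<in> carrier R" unfolding b_def using m Q by (intro finsum_closed) auto
    have "x = (\<Oplus>\<^bsub>?V\<^esub>j\<in>{..<d}. b j \<odot>\<^bsub>?V\<^esub> col j)"
    proof (rule vec_eqI[where d = d and A = "carrier R" and B = "carrier R"])
      show "(\<Oplus>\<^bsub>?V\<^esub>j\<in>{..<d}. b j \<odot>\<^bsub>?V\<^esub> col j) \<in> {..<d} \<rightarrow>\<^sub>E carrier R"
        using vec_lincomb_closed[of "{..<d}" col d b] col b by simp
      fix i assume i: "i < d"
      have "x i = (\<Oplus>j\<in>{..<d}. x j \<otimes> (if i = j then \<one> else \<zero>))"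
        using m i by (intro delta[symmetric]) auto
      also have "\<dots> = (\<Oplus>j\<in>{..<d}. x j \<otimes> matrix_mult R d P Q i j)"
        using PQ m i by (intro finsum_cong') auto
      also have "\<dots> = (\<Oplus>l\<in>{..<d}. P i l \<otimes> b l)"
        unfolding b_def using m i P Q by (intro mult_assoc'[symmetric]) auto
      also have "\<dots> = (\<Oplus>l\<in>{..<d}. b l \<otimes> P i l)"
        using b P i by (intro finsum_cong') (auto simp: m_comm)
      also have "\<dots> = (\<Oplus>\<^bsub>?V\<^esub>j\<in>{..<d}. b j \<odot>\<^bsub>?V\<^esub> col j) i"
        using b i by (intro lc[symmetric])
      finally show "x i = (\<Oplus>\<^bsub>?V\<^esub>j\<in>{..<d}. b j \<odot>\<^bsub>?V\<^esub> col j) i" .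
    qed (use x in simp)
    then show "\<exists>a. (\<forall>i\<in>{..<d}. a i \<in> carrier R) \<and> x = (\<Oplus>\<^bsub>?V\<^esub>i\<in>{..<d}. a i \<odot>\<^bsub>?V\<^esub> col i)"
      using b by (intro exI[of _ b]) simp
  qed
  have cv: "col (block_pos ns x) = chain_vec (mat_op R d S) v x" if "x \<in> ?X" for x
    using vec that by (auto simp: chain_index_def chain_vec_def)
  have colX: "col i \<in> carrier ?V" if "i \<in> block_pos ns ` ?X" for i using col that img(1) by simp
  have cvX: "chain_vec (mat_op R d S) v x \<in> carrier ?V" if "x \<in> ?X" for x
    using colX[of "block_pos ns x"] that unfolding cv[OF that, symmetric] by blast
  have "lin_indep R ?V ?X (chain_vec (mat_op R d S) v)"
  proof (rule V.lin_indep_cong)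
    show "lin_indep R ?V ?X (\<lambda>x. col (block_pos ns x))"
      by (rule V.lin_indep_reindex) (use ind img colX in simp_all)
  qed (use cv cvX in blast)+
  moreover have "lin_spans R ?V ?X (chain_vec (mat_op R d S) v)"
  proof -
    have "lin_spans R ?V ?X (\<lambda>x. col (block_pos ns x))"
      by (rule V.lin_spans_reindex) (use spn img colX in simp_all)
    moreover have "(\<Oplus>\<^bsub>?V\<^esub>x\<in>?X. b x \<odot>\<^bsub>?V\<^esub> col (block_pos ns x)) =
        (\<Oplus>\<^bsub>?V\<^esub>x\<in>?X. b x \<odot>\<^bsub>?V\<^esub> chain_vec (mat_op R d S) v x)" if "\<forall>x\<in>?X. b x \<in> carrier R" for b
    proof (rule V.M.finsum_cong'[OF refl])
      show "(\<lambda>x. b x \<odot>\<^bsub>?V\<^esub> chain_vec (mat_op R d S) v x) \<in> ?X \<rightarrow> carrier ?V"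
        using that cvX by (intro funcsetI V.smult_closed) blast+
    qed (simp only: cv)
    ultimately show ?thesis unfolding lin_spans_def by (simp cong: conj_cong)
  qed
  ultimately show ?thesis
    using vV vz unfolding chain_basis_def by (intro exI[of _ v]) (simp del: vec_space_simps)
qed

end

lemma (in vector_space_rec) lin_indep_unique:
  assumes "lin_indep K V I v" "\<And>i. i \<in> I \<Longrightarrow> v i \<in> carrier V"
    "\<And>i. i \<in> I \<Longrightarrow> a i \<in> carrier K" "\<And>i. i \<in> I \<Longrightarrow> b i \<in> carrier K"
    "(\<Oplus>\<^bsub>V\<^esub>i\<in>I. a i \<odot>\<^bsub>V\<^esub> v i) = (\<Oplus>\<^bsub>V\<^esub>i\<in>I. b i \<odot>\<^bsub>V\<^esub> v i)" "i \<in> I"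
  shows "a i = b i"
proof -
  let ?d = "\<lambda>i. a i \<oplus> \<ominus> b i"
  have cl: "(\<Oplus>\<^bsub>V\<^esub>i\<in>I. b i \<odot>\<^bsub>V\<^esub> v i) \<in> carrier V" "(\<Oplus>\<^bsub>V\<^esub>i\<in>I. ?d i \<odot>\<^bsub>V\<^esub> v i) \<in> carrier V"
    using assms(2-4) by (intro M.finsum_closed funcsetI smult_closed; simp)+
  have "(\<Oplus>\<^bsub>V\<^esub>i\<in>I. ?d i \<odot>\<^bsub>V\<^esub> v i) \<oplus>\<^bsub>V\<^esub> (\<Oplus>\<^bsub>V\<^esub>i\<in>I. b i \<odot>\<^bsub>V\<^esub> v i) =
      (\<Oplus>\<^bsub>V\<^esub>i\<in>I. ?d i \<odot>\<^bsub>V\<^esub> v i \<oplus>\<^bsub>V\<^esub> b i \<odot>\<^bsub>V\<^esub> v i)"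
    using assms(2-4) by (intro M.finsum_addf[symmetric] funcsetI smult_closed) auto
  also have "\<dots> = (\<Oplus>\<^bsub>V\<^esub>i\<in>I. a i \<odot>\<^bsub>V\<^esub> v i)"
    using assms(2-4)
    by (intro M.finsum_cong') (auto simp: R.a_assoc R.l_neg simp flip: smult_l_distr)
  finally have "(\<Oplus>\<^bsub>V\<^esub>i\<in>I. ?d i \<odot>\<^bsub>V\<^esub> v i) = \<zero>\<^bsub>V\<^esub>"
    using assms(5) cl M.add.r_cancel_one' by metis
  then have "?d i = \<zero>"
    using assms(3,4,6) by (intro lin_indepD[OF assms(1), of ?d]) auto
  then have "a i \<ominus> b i = \<zero>" by (simp add: R.minus_eq)
  then show ?thesis using assms(3)[OF assms(6)] assms(4)[OF assms(6)] by (simp add: R.r_right_minus_eq)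
qed

context field
begin

text \<open>
  The matrix \<open>P\<close> has the vectors of the chains as columns, in the order given by
  \<open>block_pos\<close>, and \<open>Q\<close> has as entries the coefficients expressing the unit
  vectors in them.
\<close>

lemma chain_basis_imp_similar:
  assumes S: "\<And>i j. i < d \<Longrightarrow> j < d \<Longrightarrow> S i j \<in> carrier R"
    and cb: "chain_basis R (vec_space R d) (mat_op R d S) {..<length ns} ((!) ns) v"
  shows "sum_list ns = d" "similar_matrices R d S (jordan_matrix R ns)"
proof -
  interpret V: lin_op R "vec_space R d" "mat_op R d S" by (rule mat_op_lin_op[OF S])
  let ?V = "vec_space R d" and ?X = "chain_index {..<length ns} ((!) ns)"
  let ?e = "chain_vec (mat_op R d S) v"
  have vV: "\<And>a. a < length ns \<Longrightarrow> v a \<in> carrier ?V"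
    and vz: "\<And>a. a < length ns \<Longrightarrow> (mat_op R d S ^^ (ns ! a)) (v a) = \<zero>\<^bsub>?V\<^esub>"
    and ind: "lin_indep R ?V ?X ?e" and spn: "lin_spans R ?V ?X ?e"
    using cb unfolding chain_basis_def by (auto simp del: vec_space_simps)
  have fX: "finite ?X" by (simp add: finite_chain_index)
  have eV: "?e x \<in> carrier ?V" if "x \<in> ?X" for x
    using vV that by (intro V.chain_vec_closed[of "{..<length ns}" v _ "(!) ns"]) auto
  have "card ?X = sum_list ns" using bij_betw_same_card[OF block_pos_bij[of ns]] by simp
  moreover have "card ?X = d" by (rule basis_card[OF fX eV ind spn])
  ultimately show d: "sum_list ns = d" by simp
  define g where "g = the_inv_into ?X (block_pos ns)"
  have g: "bij_betw g {..<d} ?X"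
    unfolding g_def using block_pos_bij[of ns] d bij_betw_the_inv_into by blast
  have gpos: "g (block_pos ns x) = x" if "x \<in> ?X" for x
    unfolding g_def using that block_pos_bij[of ns] by (simp add: bij_betw_def the_inv_into_f_f)
  have gX: "g ` {..<d} = ?X" "inj_on g {..<d}" using g by (auto simp: bij_betw_def)
  define col where "col = (\<lambda>j. ?e (g j))"
  have col: "col j \<in> carrier ?V" if "j < d" for j
    unfolding col_def using that gX(1) by (intro eV) blast
  have icol: "lin_indep R ?V {..<d} col"
    unfolding col_def by (rule V.lin_indep_reindex) (use gX ind eV in \<open>simp_all del: vec_space_simps\<close>)
  have scol: "lin_spans R ?V {..<d} col"
    unfolding col_def by (rule V.lin_spans_reindex) (use gX spn eV in \<open>simp_all del: vec_space_simps\<close>)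
  have "\<forall>l. \<exists>a. (\<forall>i\<in>{..<d}. a i \<in> carrier R) \<and> unit_vec R d l = (\<Oplus>\<^bsub>?V\<^esub>i\<in>{..<d}. a i \<odot>\<^bsub>?V\<^esub> col i)"
  proof
    fix l show "\<exists>a. (\<forall>i\<in>{..<d}. a i \<in> carrier R) \<and> unit_vec R d l = (\<Oplus>\<^bsub>?V\<^esub>i\<in>{..<d}. a i \<odot>\<^bsub>?V\<^esub> col i)"
      by (rule scol[unfolded lin_spans_def, rule_format, OF unit_vec_closed])
  qed
  from choice[OF this] obtain q where q: "\<forall>l. (\<forall>i\<in>{..<d}. q l i \<in> carrier R) \<and>
    unit_vec R d l = (\<Oplus>\<^bsub>?V\<^esub>i\<in>{..<d}. q l i \<odot>\<^bsub>?V\<^esub> col i)" ..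
  define P where "P = (\<lambda>i j. col j i)"
  define Q where "Q = (\<lambda>i j. q j i)"
  have P: "P i j \<in> carrier R" if "i < d" "j < d" for i j
    using col[OF that(2)] that(1) by (auto simp: P_def)
  have Q: "Q i j \<in> carrier R" if "i < d" "j < d" for i j using q that by (simp add: Q_def)
  have PQ: "matrix_mult R d P Q i l = (if i = l then \<one> else \<zero>)" if "i < d" "l < d" for i l
  proof -
    have "matrix_mult R d P Q i l = (\<Oplus>j\<in>{..<d}. Q j l \<otimes> col j i)"
      unfolding matrix_mult_def using P Q that by (intro finsum_cong') (auto simp: m_comm P_def)
    also have "\<dots> = (\<Oplus>\<^bsub>?V\<^esub>j\<in>{..<d}. q l j \<odot>\<^bsub>?V\<^esub> col j) i"
      unfolding Q_def using q col that by (intro vec_lincomb[symmetric]) auto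
    also have "\<dots> = unit_vec R d l i" using q by (metis (no_types, lifting))
    finally show ?thesis using that by (simp add: unit_vec_def)
  qed
  have QP: "matrix_mult R d Q P i j = (if i = j then \<one> else \<zero>)" if ij: "i < d" "j < d" for i j
  proof -
    let ?c = "\<lambda>c. \<Oplus>l\<in>{..<d}. col j l \<otimes> q l c"
    have cj: "col j l \<in> carrier R" if "l < d" for l using col[OF ij(2)] that by auto
    have "(\<Oplus>\<^bsub>?V\<^esub>c\<in>{..<d}. ?c c \<odot>\<^bsub>?V\<^esub> col c) =
        (\<Oplus>\<^bsub>?V\<^esub>l\<in>{..<d}. col j l \<odot>\<^bsub>?V\<^esub> (\<Oplus>\<^bsub>?V\<^esub>c\<in>{..<d}. q l c \<odot>\<^bsub>?V\<^esub> col c))"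
      by (rule V.lincomb_lincomb[symmetric]) (use cj q col in \<open>simp_all del: vec_space_simps\<close>)
    also have "\<dots> = (\<Oplus>\<^bsub>?V\<^esub>l\<in>{..<d}. col j l \<odot>\<^bsub>?V\<^esub> unit_vec R d l)"
      using q by (simp del: vec_space_simps)
    also have "\<dots> = col j" by (rule unit_vec_expand[OF col[OF ij(2)], symmetric])
    also have "\<dots> = (\<Oplus>\<^bsub>?V\<^esub>c\<in>{..<d}. if c = j then col c else \<zero>\<^bsub>?V\<^esub>)"
      using ij col by (intro V.M.finsum_delta[symmetric]) (simp_all del: vec_space_simps)
    also have "\<dots> = (\<Oplus>\<^bsub>?V\<^esub>c\<in>{..<d}. (if c = j then \<one> else \<zero>) \<odot>\<^bsub>?V\<^esub> col c)"
    proof (rule V.M.finsum_cong'[OF refl])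
      show "(if c = j then col c else \<zero>\<^bsub>?V\<^esub>) = (if c = j then \<one> else \<zero>) \<odot>\<^bsub>?V\<^esub> col c"
        if "c \<in> {..<d}" for c
      proof (cases "c = j")
        case True
        then show ?thesis using V.smult_one[OF col[OF ij(2)]] by (simp del: vec_space_simps)
      next
        case False
        then show ?thesis using that V.smult_l_null[OF col[of c]] by (simp del: vec_space_simps)
      qed
      show "(\<lambda>c. (if c = j then \<one> else \<zero>) \<odot>\<^bsub>?V\<^esub> col c) \<in> {..<d} \<rightarrow> carrier ?V"
        using col by (intro funcsetI V.smult_closed) (simp_all del: vec_space_simps)
    qed
    finally have eq: "(\<Oplus>\<^bsub>?V\<^esub>c\<in>{..<d}. ?c c \<odot>\<^bsub>?V\<^esub> col c) =
      (\<Oplus>\<^bsub>?V\<^esub>c\<in>{..<d}. (if c = j then \<one> else \<zero>) \<odot>\<^bsub>?V\<^esub> col c)" .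
    have c1: "\<And>i. i \<in> {..<d} \<Longrightarrow> ?c i \<in> carrier R"
      using cj q by (intro finsum_closed) auto
    have "?c i = (if i = j then \<one> else \<zero>)"
      by (rule V.lin_indep_unique[OF icol _ c1 _ eq]) (use col ij in \<open>simp_all del: vec_space_simps\<close>)
    moreover have "matrix_mult R d Q P i j = ?c i"
      unfolding matrix_mult_def using P Q ij by (intro finsum_cong') (auto simp: m_comm P_def Q_def)
    ultimately show ?thesis by simp
  qed
  have SP: "matrix_mult R d S P i j = matrix_mult R d P (jordan_matrix R ns) i j"
    if ij: "i < d" "j < d" for i j
  proof -
    have "j \<in> block_pos ns ` ?X" using block_pos_bij[of ns] d ij by (auto simp: bij_betw_def)
    then obtain a t where at: "(a, t) \<in> ?X" "j = block_pos ns (a, t)" by (metis imageE surj_pair)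
    then have a: "a < length ns" "t < ns ! a" by (auto simp: chain_index_def)
    have colat: "col (block_pos ns (a, u)) = (mat_op R d S ^^ u) (v a)" if "u < ns ! a" for u
      using gpos[of "(a, u)"] that a by (simp add: col_def chain_vec_def chain_index_def)
    have "matrix_mult R d S P i j = mat_op R d S (col j) i"
      using ij by (simp add: mat_op_def matrix_mult_def P_def)
    also have "\<dots> = (mat_op R d S ^^ Suc t) (v a) i" using colat[OF a(2)] at(2) by simp
    also have "\<dots> = (if Suc t < ns ! a then P i (block_pos ns (a, Suc t)) else \<zero>)"
    proof (cases "Suc t < ns ! a")
      case True
      then show ?thesis using colat[OF True] by (simp add: P_def)
    next
      case False
      then have "Suc t = ns ! a" using a by simp
      then have "(mat_op R d S ^^ Suc t) (v a) = \<zero>\<^bsub>?V\<^esub>" using vz[OF a(1)] by simp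
      then show ?thesis using False ij by simp
    qed
    also have "\<dots> = matrix_mult R d P (jordan_matrix R ns) i j"
      unfolding at(2) by (rule mult_jordan_column[OF P d a ij(1), symmetric])
    finally show ?thesis .
  qed
  show "similar_matrices R d S (jordan_matrix R ns)"
    unfolding similar_matrices_def
    by (rule exI[of _ P], rule exI[of _ Q]) (simp add: P Q PQ QP SP)
qed

text \<open>
  Enumerate the index set of a chain basis by an initial segment of the naturals and read off the
  lengths.
\<close>

lemma nilpotent_jordan_form:
  assumes S: "\<And>i j. i < d \<Longrightarrow> j < d \<Longrightarrow> S i j \<in> carrier R"
    and nil: "\<And>x. x \<in> carrier (vec_space R d) \<Longrightarrow> (mat_op R d S ^^ e) x = \<zero>\<^bsub>vec_space R d\<^esub>"
  shows "\<exists>ns. set ns \<subseteq> {1..e} \<and> sum_list ns = d \<and> similar_matrices R d S (jordan_matrix R ns)"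
proof -
  interpret V: lin_op R "vec_space R d" "mat_op R d S" by (rule mat_op_lin_op[OF S])
  let ?V = "vec_space R d" and ?T = "mat_op R d S"
  obtain I n v where I: "finite (I :: nat set)" "\<forall>a\<in>I. 0 < n a" and cb: "chain_basis R ?V ?T I n v"
    using V.chain_basis_exists[OF _ unit_vec_closed unit_vec_spans nil] by blast
  define js where "js = sorted_list_of_set I"
  have js': "set js = I" "distinct js" using I by (auto simp: js_def)
  define ns where "ns = map n js"
  define h where "h = (\<lambda>(a, t). (js ! a, t :: nat))"
  let ?X = "chain_index {..<length ns} ((!) ns)"
  have hX: "h ` ?X = chain_index I n"
  proof (intro equalityI subsetI)
    fix x assume "x \<in> chain_index I n"
    then obtain b t where x: "x = (b, t)" "b \<in> I" "t < n b" by (auto simp: chain_index_def)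
    then obtain a where "a < length js" "b = js ! a" using js' by (metis in_set_conv_nth)
    then have "(a, t) \<in> ?X" "x = h (a, t)" using x by (auto simp: chain_index_def ns_def h_def)
    then show "x \<in> h ` ?X" by blast
  next
    fix x assume "x \<in> h ` ?X"
    then show "x \<in> chain_index I n" using js' by (auto simp: chain_index_def ns_def h_def)
  qed
  have hi: "inj_on h ?X"
    using js'(2) by (auto simp: inj_on_def h_def chain_index_def ns_def nth_eq_iff_index_eq)
  have vI: "\<And>a. a \<in> I \<Longrightarrow> v a \<in> carrier ?V" "\<And>a. a \<in> I \<Longrightarrow> (?T ^^ n a) (v a) = \<zero>\<^bsub>?V\<^esub>"
    and ind: "lin_indep R ?V (chain_index I n) (chain_vec ?T v)"
    and spn: "lin_spans R ?V (chain_index I n) (chain_vec ?T v)"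
    using cb unfolding chain_basis_def by (auto simp del: vec_space_simps)
  have cl: "chain_vec ?T v x \<in> carrier ?V" if "x \<in> h ` ?X" for x
    using vI(1) that unfolding hX by (rule V.chain_vec_closed)
  have ch: "chain_vec ?T (\<lambda>a. v (js ! a)) = (\<lambda>x. chain_vec ?T v (h x))"
    by (auto simp: chain_vec_def h_def fun_eq_iff)
  have "chain_basis R ?V ?T {..<length ns} ((!) ns) (\<lambda>a. v (js ! a))"
    unfolding chain_basis_def ch
  proof (intro conjI ballI)
    fix a assume "a \<in> {..<length ns}"
    then have a: "js ! a \<in> I" "ns ! a = n (js ! a)" using js' by (auto simp: ns_def)
    then show "v (js ! a) \<in> carrier ?V" "(?T ^^ (ns ! a)) (v (js ! a)) = \<zero>\<^bsub>?V\<^esub>"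
      using vI by (simp_all del: vec_space_simps)
  next
    show "lin_indep R ?V ?X (\<lambda>x. chain_vec ?T v (h x))"
      by (rule V.lin_indep_reindex[OF _ hi cl]) (simp_all only: hX ind)
    show "lin_spans R ?V ?X (\<lambda>x. chain_vec ?T v (h x))"
      by (rule V.lin_spans_reindex[OF _ hi cl]) (simp_all only: hX spn)
  qed simp
  note res = chain_basis_imp_similar[OF S this]
  have "n a \<le> e" if "a \<in> I" for a by (rule V.chain_basis_length_le[OF cb nil that])
  then have "set ns \<subseteq> {1..e}" using I js' by (force simp: ns_def)
  then show ?thesis using res by blast
qed

lemma similar_jordan_rank:
  assumes S: "\<And>i j. i < d \<Longrightarrow> j < d \<Longrightarrow> S i j \<in> carrier R" and "sum_list ns = d"
    and "similar_matrices R d S (jordan_matrix R ns)"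
  shows "rank_at_least R (vec_space R d) (mat_op R d S ^^ i) m \<longleftrightarrow> m \<le> (\<Sum>n\<leftarrow>ns. n - i)"
proof -
  interpret V: lin_op R "vec_space R d" "mat_op R d S" by (rule mat_op_lin_op[OF S])
  obtain v where "chain_basis R (vec_space R d) (mat_op R d S) {..<length ns} ((!) ns) v"
    using similar_jordan_imp_chain_basis[OF assms] by blast
  then have "rank_at_least R (vec_space R d) (mat_op R d S ^^ i) m \<longleftrightarrow> m \<le> (\<Sum>a<length ns. ns ! a - i)"
    by (rule V.chain_basis_rank)
  also have "(\<Sum>a<length ns. ns ! a - i) = (\<Sum>n\<leftarrow>ns. n - i)"
    by (simp add: sum_list_sum_nth atLeast0LessThan)
  finally show ?thesis .
qed

end

text \<open>
  A block of size \<open>m\<close> contributes \<open>m - i\<close> to the rank of the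
  \<open>i\<close>-th power. As a function of \<open>i\<close> this has second difference
  \<open>1\<close> at \<open>i = m\<close> and \<open>0\<close> at other positive \<open>i\<close>.
\<close>

lemma count_list_second_difference:
  assumes "0 < n"
  shows "count_list ns n + 2 * (\<Sum>m\<leftarrow>ns. m - n) = (\<Sum>m\<leftarrow>ns. m - (n - 1)) + (\<Sum>m\<leftarrow>ns. m - Suc n)"
  by (induction ns) (use assms in auto)

text \<open>
  Hence the ranks of all powers determine the multiplicities of the blocks, which makes the description
  in the definition of Jordan types unique.
\<close>

lemma count_list_eq_if_ranks_eq:
  assumes "0 \<notin> set ns" "0 \<notin> set ms" "\<And>i. (\<Sum>m\<leftarrow>ns. m - i) = (\<Sum>m\<leftarrow>ms. m - (i :: nat))"
  shows "count_list ns = count_list ms"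
proof
  fix n
  show "count_list ns n = count_list ms n"
  proof (cases "n = 0")
    case True
    then show ?thesis using assms(1,2) by (simp add: count_list_0_iff)
  next
    case False
    then show ?thesis
      using count_list_second_difference[of n ns] count_list_second_difference[of n ms]
        assms(3)[of n] assms(3)[of "n - 1"] assms(3)[of "Suc n"] by linarith
  qed
qed

lemma (in field) jordan_type_eq:
  assumes S: "\<And>i j. i < d \<Longrightarrow> j < d \<Longrightarrow> S i j \<in> carrier R" and ns: "0 \<notin> set ns" "sum_list ns = d"
    "similar_matrices R d S (jordan_matrix R ns)"
  shows "jordan_type R d S = count_list ns"
  unfolding jordan_type_def
proof (rule the_equality)
  show "\<exists>ms. 0 \<notin> set ms \<and> sum_list ms = d \<and> similar_matrices R d S (jordan_matrix R ms) \<and>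
      count_list ns = count_list ms"
    using ns by blast
  fix a assume "\<exists>ms. 0 \<notin> set ms \<and> sum_list ms = d \<and>
    similar_matrices R d S (jordan_matrix R ms) \<and> a = count_list ms"
  then obtain ms where ms: "0 \<notin> set ms" "sum_list ms = d"
    "similar_matrices R d S (jordan_matrix R ms)" "a = count_list ms" by blast
  have "(\<Sum>m\<leftarrow>ms. m - i) = (\<Sum>m\<leftarrow>ns. m - i)" for i
    using similar_jordan_rank[OF S ns(2,3), of i] similar_jordan_rank[OF S ms(2,3), of i]
    by (metis order_antisym order_refl)
  then show "a = count_list ns" using count_list_eq_if_ranks_eq[OF ms(1) ns(1)] ms(4) by simp
qed

text \<open>
  The conjugating matrices and their inverses are mapped along, and the Jordan matrix has entries
  \<open>0\<close> and \<open>1\<close>. So extending scalars to a larger field leaves the Jordan type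
  unchanged.
\<close>

lemma similar_jordan_hom:
  assumes "field K" "field L" and h: "h \<in> ring_hom K L"
    and S: "\<And>i j. i < d \<Longrightarrow> j < d \<Longrightarrow> S i j \<in> carrier K"
    and sim: "similar_matrices K d S (jordan_matrix K ns)"
  shows "similar_matrices L d (\<lambda>i j. h (S i j)) (jordan_matrix L ns)"
proof -
  interpret K: field K by fact
  interpret L: field L by fact
  interpret h: ring_hom_cring K L h
    by (intro ring_hom_cring.intro ring_hom_cring_axioms.intro h K.is_cring L.is_cring)
  have hm: "h (matrix_mult K d A B i j) = matrix_mult L d (\<lambda>i j. h (A i j)) (\<lambda>i j. h (B i j)) i j"
    if "\<And>i j. i < d \<Longrightarrow> j < d \<Longrightarrow> A i j \<in> carrier K" "\<And>i j. i < d \<Longrightarrow> j < d \<Longrightarrow> B i j \<in> carrier K"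
      "i < d" "j < d" for A B i j
  proof -
    have "h (matrix_mult K d A B i j) = (\<Oplus>\<^bsub>L\<^esub>l\<in>{..<d}. (h \<circ> (\<lambda>l. A i l \<otimes>\<^bsub>K\<^esub> B l j)) l)"
      unfolding matrix_mult_def using that by (subst h.hom_finsum) auto
    also have "\<dots> = matrix_mult L d (\<lambda>i j. h (A i j)) (\<lambda>i j. h (B i j)) i j"
      unfolding matrix_mult_def using that by (intro L.finsum_cong') auto
    finally show ?thesis .
  qed
  have hJ: "(\<lambda>i j. h (jordan_matrix K ns i j)) = jordan_matrix L ns"
    by (auto simp: jordan_matrix_def fun_eq_iff)
  have JK: "jordan_matrix K ns i j \<in> carrier K" for i j by (simp add: jordan_matrix_def)
  obtain P Q where PQ: "\<forall>i<d. \<forall>j<d. P i j \<in> carrier K \<and> Q i j \<in> carrier K \<and>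
     matrix_mult K d P Q i j = (if i = j then \<one>\<^bsub>K\<^esub> else \<zero>\<^bsub>K\<^esub>) \<and>
     matrix_mult K d Q P i j = (if i = j then \<one>\<^bsub>K\<^esub> else \<zero>\<^bsub>K\<^esub>) \<and>
     matrix_mult K d S P i j = matrix_mult K d P (jordan_matrix K ns) i j"
    using sim unfolding similar_matrices_def by blast
  then have P: "\<And>i j. i < d \<Longrightarrow> j < d \<Longrightarrow> P i j \<in> carrier K"
    and Q: "\<And>i j. i < d \<Longrightarrow> j < d \<Longrightarrow> Q i j \<in> carrier K" by blast+
  let ?P = "\<lambda>i j. h (P i j)" and ?Q = "\<lambda>i j. h (Q i j)"
  show ?thesis
    unfolding similar_matrices_def
  proof (rule exI[of _ ?P], rule exI[of _ ?Q], intro allI impI conjI)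
    fix i j assume ij: "i < d" "j < d"
    note e = PQ[rule_format, OF ij]
    show "h (P i j) \<in> carrier L" "h (Q i j) \<in> carrier L" using e by auto
    show "matrix_mult L d ?P ?Q i j = (if i = j then \<one>\<^bsub>L\<^esub> else \<zero>\<^bsub>L\<^esub>)"
      using e by (simp flip: hm[OF P Q ij])
    show "matrix_mult L d ?Q ?P i j = (if i = j then \<one>\<^bsub>L\<^esub> else \<zero>\<^bsub>L\<^esub>)"
      using e by (simp flip: hm[OF Q P ij])
    have "h (matrix_mult K d S P i j) = h (matrix_mult K d P (jordan_matrix K ns) i j)" using e by simp
    then show "matrix_mult L d (\<lambda>i j. h (S i j)) ?P i j = matrix_mult L d ?P (jordan_matrix L ns) i j"
      using hm[OF S P ij] hm[OF P JK ij] hJ by simp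
  qed
qed

lemma similar_matrices_mono:
  assumes "field K" "\<And>i j. i < d \<Longrightarrow> j < d \<Longrightarrow> S i j = S' i j" "\<And>i j. i < d \<Longrightarrow> j < d \<Longrightarrow> S' i j \<in> carrier K"
    and sim: "similar_matrices K d S T"
  shows "similar_matrices K d S' T"
proof -
  interpret K: field K by fact
  obtain P Q where PQ: "\<forall>i<d. \<forall>j<d. P i j \<in> carrier K \<and> Q i j \<in> carrier K \<and>
     matrix_mult K d P Q i j = (if i = j then \<one>\<^bsub>K\<^esub> else \<zero>\<^bsub>K\<^esub>) \<and>
     matrix_mult K d Q P i j = (if i = j then \<one>\<^bsub>K\<^esub> else \<zero>\<^bsub>K\<^esub>) \<and>
     matrix_mult K d S P i j = matrix_mult K d P T i j"
    using sim unfolding similar_matrices_def by blast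
  have "matrix_mult K d S' P i j = matrix_mult K d S P i j" if "i < d" "j < d" for i j
    unfolding matrix_mult_def using assms(2,3) that PQ by (intro K.finsum_cong') auto
  then show ?thesis unfolding similar_matrices_def
    by (intro exI[of _ P] exI[of _ Q]) (use PQ in simp)
qed

lemma similar_matrices_cong:
  assumes "field K" "\<And>i j. i < d \<Longrightarrow> j < d \<Longrightarrow> S i j = S' i j" "\<And>i j. i < d \<Longrightarrow> j < d \<Longrightarrow> S' i j \<in> carrier K"
  shows "similar_matrices K d S T \<longleftrightarrow> similar_matrices K d S' T"
proof
  show "similar_matrices K d S T \<Longrightarrow> similar_matrices K d S' T"
    by (rule similar_matrices_mono[OF assms])
  show "similar_matrices K d S' T \<Longrightarrow> similar_matrices K d S T"
    by (rule similar_matrices_mono[OF assms(1)]) (use assms(2,3) in simp_all)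
qed

lemma jordan_type_cong:
  assumes "field K" "\<And>i j. i < d \<Longrightarrow> j < d \<Longrightarrow> S i j = S' i j" "\<And>i j. i < d \<Longrightarrow> j < d \<Longrightarrow> S' i j \<in> carrier K"
  shows "jordan_type K d S = jordan_type K d S'"
  unfolding jordan_type_def using similar_matrices_cong[OF assms] by simp

section \<open>Ranks and the order on Jordan types\<close>

lemma block_sizes_Suc: "block_sizes (Suc p) a = replicate (a (Suc p)) (Suc p) @ block_sizes p a"
  by (simp add: block_sizes_def)

lemma block_sizes_props:
  "sorted_wrt (\<ge>) (block_sizes p a) \<and> set (block_sizes p a) \<subseteq> {1..p} \<and>
   (\<forall>i. count_list (block_sizes p a) i = (if i \<in> {1..p} then a i else 0))"
proof (induction p)
  case 0
  then show ?case by (simp add: block_sizes_def)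
next
  case (Suc p)
  have r: "count_list (replicate n x) y = (if x = y then n else 0)" for n and x y :: nat
    by (induction n) auto
  have srt: "sorted_wrt (\<ge>) (replicate n x)" for n and x :: nat
    by (induction n) auto
  show ?case unfolding block_sizes_Suc
    using Suc by (force simp: sorted_wrt_append r srt)
qed

text \<open>
  Each of the \<open>l\<close> parts is at most \<open>i\<close> plus its excess over \<open>i\<close>.
  Equality holds when \<open>i\<close> is the first omitted part, which makes the sum of the
  \<open>l\<close> largest parts a minimum over \<open>i\<close>.
\<close>

lemma sum_list_take_le:
  "sum_list (take l xs) \<le> l * i + (\<Sum>x\<leftarrow>xs. x - (i :: nat))"
proof (induction xs arbitrary: l)
  case (Cons x xs)
  show ?case
  proof (cases l)
    case (Suc l')
    then show ?thesis using Cons[of l'] by simp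
  qed simp
qed simp

lemma sum_list_take_eq:
  assumes "sorted_wrt (\<ge>) xs" "l < length xs"
  shows "sum_list (take l xs) = l * (xs ! l) + (\<Sum>x\<leftarrow>xs. x - (xs ! l :: nat))"
  using assms
proof (induction xs arbitrary: l)
  case (Cons x xs)
  show ?case
  proof (cases l)
    case 0
    have "(\<Sum>y\<leftarrow>xs. y - x) = 0" using Cons.prems(1) by (simp add: sum_list_eq_0_iff)
    then show ?thesis using 0 by simp
  next
    case (Suc l')
    define y where "y = xs ! l'"
    have y: "(x # xs) ! l = y" "y \<le> x" using Cons.prems Suc by (simp_all add: y_def)
    have "sum_list (take l' xs) = l' * y + (\<Sum>x\<leftarrow>xs. x - y)"
      using Cons.IH[of l'] Cons.prems Suc by (simp add: y_def)
    then show ?thesis unfolding y(1) using y(2) Suc by simp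
  qed
qed simp

text \<open>
  The sum of the \<open>l\<close> largest parts is the minimum over \<open>i\<close> of \<open>l *
  i\<close> plus the rank of the \<open>i\<close>-th power. Larger ranks thus give a larger Jordan type.
\<close>

lemma jt_le_if_ranks_le:
  assumes ns: "set ns \<subseteq> {1..p}" and ms: "set ms \<subseteq> {1..p}"
    and le: "\<And>i. (\<Sum>m\<leftarrow>ns. m - i) \<le> (\<Sum>m\<leftarrow>ms. m - i)"
  shows "jt_le p (count_list ns) (count_list ms)"
  unfolding jt_le_def
proof
  fix l
  have perm: "mset (block_sizes p (count_list xs)) = mset xs" if "set xs \<subseteq> {1..p}" for xs
  proof (rule multiset_eqI)
    fix i
    show "count (mset (block_sizes p (count_list xs))) i = count (mset xs) i"
      using block_sizes_props[of p "count_list xs"] that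
      by (auto simp: count_mset count_list_0_iff)
  qed
  have rk: "(\<Sum>m\<leftarrow>block_sizes p (count_list xs). m - i) = (\<Sum>m\<leftarrow>xs. m - i)" if "set xs \<subseteq> {1..p}" for xs i
    using perm[OF that] by (metis mset_map sum_mset_sum_list)
  let ?N = "block_sizes p (count_list ns)" and ?M = "block_sizes p (count_list ms)"
  have "\<exists>i. sum_list (take l ?M) = l * i + (\<Sum>m\<leftarrow>?M. m - i)"
  proof (cases "l < length ?M")
    case True
    then show ?thesis using sum_list_take_eq block_sizes_props by blast
  next
    case False
    then show ?thesis by (intro exI[of _ 0]) simp
  qed
  then obtain i where i: "sum_list (take l ?M) = l * i + (\<Sum>m\<leftarrow>?M. m - i)" by blast
  have "sum_list (take l ?N) \<le> l * i + (\<Sum>m\<leftarrow>?N. m - i)" by (rule sum_list_take_le)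
  then show "sum_list (take l ?N) \<le> sum_list (take l ?M)"
    unfolding i rk[OF ns] rk[OF ms] using le[of i] by simp
qed

section \<open>Residue fields\<close>

context primeideal
begin

lemma combination_mem:
  "x \<in> carrier R \<Longrightarrow> y \<in> carrier R \<Longrightarrow> u \<in> I \<Longrightarrow> v \<in> I \<Longrightarrow> x \<otimes> u \<oplus> y \<otimes> v \<in> I"
  by (intro additive_subgroup.a_closed[OF additive_subgroup_axioms] I_l_closed)

lemma minus_swap_mem: "x \<in> carrier R \<Longrightarrow> y \<in> carrier R \<Longrightarrow> x \<ominus> y \<in> I \<Longrightarrow> y \<ominus> x \<in> I"
proof -
  assume a: "x \<in> carrier R" "y \<in> carrier R" "x \<ominus> y \<in> I"
  then have "\<ominus> (x \<ominus> y) \<in> I" by simp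
  moreover have "\<ominus> (x \<ominus> y) = y \<ominus> x" using a(1,2) by algebra
  ultimately show ?thesis by simp
qed

lemma frac_self: "a \<in> carrier R \<Longrightarrow> b \<in> carrier R - I \<Longrightarrow> (a, b) \<in> frac R I a b"
  by (simp add: frac_def a_minus_def r_neg)

lemma frac_trans:
  assumes "a \<in> carrier R" "b \<in> carrier R" "c \<in> carrier R" "d \<in> carrier R - I" "e \<in> carrier R" "f \<in> carrier R"
    and "a \<otimes> d \<ominus> c \<otimes> b \<in> I" "c \<otimes> f \<ominus> e \<otimes> d \<in> I"
  shows "a \<otimes> f \<ominus> e \<otimes> b \<in> I"
proof -
  have "f \<otimes> (a \<otimes> d \<ominus> c \<otimes> b) \<oplus> b \<otimes> (c \<otimes> f \<ominus> e \<otimes> d) \<in> I"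
    using assms by (intro combination_mem) auto
  moreover have "f \<otimes> (a \<otimes> d \<ominus> c \<otimes> b) \<oplus> b \<otimes> (c \<otimes> f \<ominus> e \<otimes> d) = d \<otimes> (a \<otimes> f \<ominus> e \<otimes> b)"
  proof -
    have "a \<in> carrier R" "b \<in> carrier R" "c \<in> carrier R" "d \<in> carrier R" "e \<in> carrier R" "f \<in> carrier R"
      using assms by auto
    then show ?thesis by algebra
  qed
  ultimately have p: "d \<otimes> (a \<otimes> f \<ominus> e \<otimes> b) \<in> I" by simp
  have "d \<in> I \<or> a \<otimes> f \<ominus> e \<otimes> b \<in> I"
    by (rule I_prime[OF _ _ p]) (use assms(1,2,4-6) in \<open>simp_all add: minus_closed\<close>)
  then show ?thesis using assms(4) by blast
qed

lemma frac_eq_iff: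
  assumes "a \<in> carrier R" "b \<in> carrier R - I" "c \<in> carrier R" "d \<in> carrier R - I"
  shows "frac R I a b = frac R I c d \<longleftrightarrow> a \<otimes> d \<ominus> c \<otimes> b \<in> I"
proof
  assume "frac R I a b = frac R I c d"
  then have "(c, d) \<in> frac R I a b" using frac_self assms by simp
  then show "a \<otimes> d \<ominus> c \<otimes> b \<in> I" by (simp add: frac_def)
next
  assume ad: "a \<otimes> d \<ominus> c \<otimes> b \<in> I"
  then have cb: "c \<otimes> b \<ominus> a \<otimes> d \<in> I" using assms
    by (intro minus_swap_mem[OF _ _ ad] m_closed) simp_all
  have "(e, f) \<in> frac R I c d" if "(e, f) \<in> frac R I a b" for e f
    using that frac_trans[OF assms(3) _ assms(1,2) _ _ cb, of e f] assms by (simp add: frac_def)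
  moreover have "(e, f) \<in> frac R I a b" if "(e, f) \<in> frac R I c d" for e f
    using that frac_trans[OF assms(1) _ assms(3,4) _ _ ad, of e f] assms by (simp add: frac_def)
  ultimately show "frac R I a b = frac R I c d" by (intro equalityI subrelI)
qed

lemma frac_some:
  assumes "a \<in> carrier R" "b \<in> carrier R - I"
  obtains a' b' where "(SOME z. z \<in> frac R I a b) = (a', b')" "a' \<in> carrier R" "b' \<in> carrier R - I"
    "a \<otimes> b' \<ominus> a' \<otimes> b \<in> I"
proof -
  have "(SOME z. z \<in> frac R I a b) \<in> frac R I a b"
    using frac_self[OF assms] by (rule someI)
  then show ?thesis using that by (cases "SOME z. z \<in> frac R I a b") (auto simp: frac_def)
qed

lemma prod_notin: "b \<in> carrier R - I \<Longrightarrow> d \<in> carrier R - I \<Longrightarrow> b \<otimes> d \<in> carrier R - I"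
  using I_prime[of b d] by auto

lemma one_notin: "\<one> \<in> carrier R - I"
  using I_notcarr one_imp_carrier by auto

end

lemma residue_field_carrier:
  "carrier (residue_field R P) = {frac R P a b | a b. a \<in> carrier R \<and> b \<in> carrier R - P}"
  by (simp add: residue_field_def algebra_via_def)

locale prime_point = primeideal P R for P and R :: "('k, 'a, 'm) module_scheme" (structure)
begin

abbreviation "\<kappa> \<equiv> residue_field R P"

lemma residue_one: "\<one>\<^bsub>\<kappa>\<^esub> = frac R P \<one> \<one>" and residue_zero: "\<zero>\<^bsub>\<kappa>\<^esub> = frac R P \<zero> \<one>"
  by (simp_all add: residue_field_def algebra_via_def)

lemma frac_closed: "a \<in> carrier R \<Longrightarrow> b \<in> carrier R - P \<Longrightarrow> frac R P a b \<in> carrier \<kappa>"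
  unfolding residue_field_carrier by blast

lemma residue_cases:
  assumes "x \<in> carrier \<kappa>"
  obtains a b where "x = frac R P a b" "a \<in> carrier R" "b \<in> carrier R - P"
  using assms unfolding residue_field_carrier by blast

lemma residue_mult:
  assumes ab: "a \<in> carrier R" "b \<in> carrier R - P" and cd: "c \<in> carrier R" "d \<in> carrier R - P"
  shows "frac R P a b \<otimes>\<^bsub>\<kappa>\<^esub> frac R P c d = frac R P (a \<otimes> c) (b \<otimes> d)"
proof -
  obtain a' b' where a': "(SOME z. z \<in> frac R P a b) = (a', b')" "a' \<in> carrier R" "b' \<in> carrier R - P"
    "a \<otimes> b' \<ominus> a' \<otimes> b \<in> P" using frac_some[OF ab] .
  obtain c' d' where c': "(SOME z. z \<in> frac R P c d) = (c', d')" "c' \<in> carrier R" "d' \<in> carrier R - P"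
    "c \<otimes> d' \<ominus> c' \<otimes> d \<in> P" using frac_some[OF cd] .
  have m: "a \<in> carrier R" "b \<in> carrier R" "c \<in> carrier R" "d \<in> carrier R"
    "a' \<in> carrier R" "b' \<in> carrier R" "c' \<in> carrier R" "d' \<in> carrier R"
    using ab cd a' c' by auto
  have "(c \<otimes> d') \<otimes> (a \<otimes> b' \<ominus> a' \<otimes> b) \<oplus> (a' \<otimes> b) \<otimes> (c \<otimes> d' \<ominus> c' \<otimes> d) \<in> P"
    using m a'(4) c'(4) by (intro combination_mem) auto
  moreover have "(c \<otimes> d') \<otimes> (a \<otimes> b' \<ominus> a' \<otimes> b) \<oplus> (a' \<otimes> b) \<otimes> (c \<otimes> d' \<ominus> c' \<otimes> d) =
      (a \<otimes> c) \<otimes> (b' \<otimes> d') \<ominus> (a' \<otimes> c') \<otimes> (b \<otimes> d)"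
    using m by algebra
  ultimately have "(a \<otimes> c) \<otimes> (b' \<otimes> d') \<ominus> (a' \<otimes> c') \<otimes> (b \<otimes> d) \<in> P" by simp
  then have "frac R P (a \<otimes> c) (b \<otimes> d) = frac R P (a' \<otimes> c') (b' \<otimes> d')"
    using m by (intro frac_eq_iff[THEN iffD2] prod_notin ab cd a' c' m_closed)
  moreover have "frac R P a b \<otimes>\<^bsub>\<kappa>\<^esub> frac R P c d = frac R P (a' \<otimes> c') (b' \<otimes> d')"
    by (simp add: residue_field_def algebra_via_def a'(1) c'(1))
  ultimately show ?thesis by simp
qed

lemma residue_add:
  assumes ab: "a \<in> carrier R" "b \<in> carrier R - P" and cd: "c \<in> carrier R" "d \<in> carrier R - P"
  shows "frac R P a b \<oplus>\<^bsub>\<kappa>\<^esub> frac R P c d = frac R P (a \<otimes> d \<oplus> c \<otimes> b) (b \<otimes> d)"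
proof -
  obtain a' b' where a': "(SOME z. z \<in> frac R P a b) = (a', b')" "a' \<in> carrier R" "b' \<in> carrier R - P"
    "a \<otimes> b' \<ominus> a' \<otimes> b \<in> P" using frac_some[OF ab] .
  obtain c' d' where c': "(SOME z. z \<in> frac R P c d) = (c', d')" "c' \<in> carrier R" "d' \<in> carrier R - P"
    "c \<otimes> d' \<ominus> c' \<otimes> d \<in> P" using frac_some[OF cd] .
  have m: "a \<in> carrier R" "b \<in> carrier R" "c \<in> carrier R" "d \<in> carrier R"
    "a' \<in> carrier R" "b' \<in> carrier R" "c' \<in> carrier R" "d' \<in> carrier R"
    using ab cd a' c' by auto
  have "(d \<otimes> d') \<otimes> (a \<otimes> b' \<ominus> a' \<otimes> b) \<oplus> (b \<otimes> b') \<otimes> (c \<otimes> d' \<ominus> c' \<otimes> d) \<in> P"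
    using m a'(4) c'(4) by (intro combination_mem) auto
  moreover have "(d \<otimes> d') \<otimes> (a \<otimes> b' \<ominus> a' \<otimes> b) \<oplus> (b \<otimes> b') \<otimes> (c \<otimes> d' \<ominus> c' \<otimes> d) =
      (a \<otimes> d \<oplus> c \<otimes> b) \<otimes> (b' \<otimes> d') \<ominus> (a' \<otimes> d' \<oplus> c' \<otimes> b') \<otimes> (b \<otimes> d)"
    using m by algebra
  ultimately have "(a \<otimes> d \<oplus> c \<otimes> b) \<otimes> (b' \<otimes> d') \<ominus> (a' \<otimes> d' \<oplus> c' \<otimes> b') \<otimes> (b \<otimes> d) \<in> P" by simp
  then have "frac R P (a \<otimes> d \<oplus> c \<otimes> b) (b \<otimes> d) = frac R P (a' \<otimes> d' \<oplus> c' \<otimes> b') (b' \<otimes> d')"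
    using m by (intro frac_eq_iff[THEN iffD2] prod_notin ab cd a' c' m_closed a_closed)
  moreover have "frac R P a b \<oplus>\<^bsub>\<kappa>\<^esub> frac R P c d = frac R P (a' \<otimes> d' \<oplus> c' \<otimes> b') (b' \<otimes> d')"
    by (simp add: residue_field_def algebra_via_def a'(1) c'(1))
  ultimately show ?thesis by simp
qed

lemma frac_cancel:
  assumes "a \<in> carrier R" "b \<in> carrier R - P" "c \<in> carrier R" "d \<in> carrier R - P" "a \<otimes> d = c \<otimes> b"
  shows "frac R P a b = frac R P c d"
proof -
  have "a \<otimes> d \<ominus> c \<otimes> b = \<zero>" using assms(1,3,4) unfolding assms(5)[symmetric]
    by (simp add: a_minus_def r_neg)
  then show ?thesis using frac_eq_iff[OF assms(1-4)] by simp
qed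

lemma residue_field_field: "field \<kappa>"
proof -
  have nz: "b \<otimes> d \<in> carrier R - P" if "b \<in> carrier R - P" "d \<in> carrier R - P" for b d
    using that by (rule prod_notin)
  have "cring \<kappa>"
  proof (rule cringI)
    show "abelian_group \<kappa>"
    proof (rule abelian_groupI)
      fix x y z assume "x \<in> carrier \<kappa>" "y \<in> carrier \<kappa>" "z \<in> carrier \<kappa>"
      then obtain a b c d e f where x: "x = frac R P a b" "a \<in> carrier R" "b \<in> carrier R - P"
        and y: "y = frac R P c d" "c \<in> carrier R" "d \<in> carrier R - P"
        and z: "z = frac R P e f" "e \<in> carrier R" "f \<in> carrier R - P"
        by (elim residue_cases)
      note nn = nz[OF x(3) y(3)] nz[OF y(3) z(3)] nz[OF nz[OF x(3) y(3)] z(3)]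
        nz[OF x(3) nz[OF y(3) z(3)]] nz[OF y(3) x(3)]
      have m: "a \<in> carrier R" "b \<in> carrier R" "c \<in> carrier R" "d \<in> carrier R" "e \<in> carrier R" "f \<in> carrier R"
        using x y z by auto
      show "x \<oplus>\<^bsub>\<kappa>\<^esub> y \<in> carrier \<kappa>"
        unfolding x(1) y(1) residue_add[OF x(2,3) y(2,3)] by (intro frac_closed a_closed m_closed m nn)
      have eq: "(a \<otimes> d \<oplus> c \<otimes> b) \<otimes> f \<oplus> e \<otimes> (b \<otimes> d) = a \<otimes> (d \<otimes> f) \<oplus> (c \<otimes> f \<oplus> e \<otimes> d) \<otimes> b"
        "(b \<otimes> d) \<otimes> f = b \<otimes> (d \<otimes> f)" using m by algebra+
      have m2: "a \<otimes> d \<oplus> c \<otimes> b \<in> carrier R" "c \<otimes> f \<oplus> e \<otimes> d \<in> carrier R" using m by simp_all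
      show "x \<oplus>\<^bsub>\<kappa>\<^esub> y \<oplus>\<^bsub>\<kappa>\<^esub> z = x \<oplus>\<^bsub>\<kappa>\<^esub> (y \<oplus>\<^bsub>\<kappa>\<^esub> z)"
        unfolding x(1) y(1) z(1) residue_add[OF x(2,3) y(2,3)] residue_add[OF y(2,3) z(2,3)]
          residue_add[OF m2(1) nn(1) z(2,3)] residue_add[OF x(2,3) m2(2) nn(2)] eq by (rule refl)
      have "a \<otimes> d \<oplus> c \<otimes> b = c \<otimes> b \<oplus> a \<otimes> d" "b \<otimes> d = d \<otimes> b" using m by algebra+
      then show "x \<oplus>\<^bsub>\<kappa>\<^esub> y = y \<oplus>\<^bsub>\<kappa>\<^esub> x"
        unfolding x(1) y(1) residue_add[OF x(2,3) y(2,3)] residue_add[OF y(2,3) x(2,3)] by simp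
    next
      show "\<zero>\<^bsub>\<kappa>\<^esub> \<in> carrier \<kappa>" unfolding residue_zero by (intro frac_closed one_closed zero_closed one_notin)
    next
      fix x assume "x \<in> carrier \<kappa>"
      then obtain a b where x: "x = frac R P a b" "a \<in> carrier R" "b \<in> carrier R - P"
        by (rule residue_cases)
      then have m: "a \<in> carrier R" "b \<in> carrier R" by auto
      show "\<zero>\<^bsub>\<kappa>\<^esub> \<oplus>\<^bsub>\<kappa>\<^esub> x = x"
        unfolding residue_zero x(1) residue_add[OF zero_closed one_notin x(2,3)]
        using m by (simp only: l_null r_one l_one l_zero m_closed)
      have "frac R P (\<ominus> a) b \<oplus>\<^bsub>\<kappa>\<^esub> x = \<zero>\<^bsub>\<kappa>\<^esub>"
        unfolding residue_zero x(1) residue_add[OF a_inv_closed[OF m(1)] x(3) x(2,3)]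
      proof (rule frac_cancel)
        show "(\<ominus> a \<otimes> b \<oplus> a \<otimes> b) \<otimes> \<one> = \<zero> \<otimes> (b \<otimes> b)" using m by algebra
      qed (intro a_closed m_closed a_inv_closed m nz x one_notin zero_closed)+
      moreover have "frac R P (\<ominus> a) b \<in> carrier \<kappa>" using x by (intro frac_closed a_inv_closed)
      ultimately show "\<exists>y\<in>carrier \<kappa>. y \<oplus>\<^bsub>\<kappa>\<^esub> x = \<zero>\<^bsub>\<kappa>\<^esub>" by blast
    qed
    show "comm_monoid \<kappa>"
    proof (rule comm_monoidI)
      fix x y z assume "x \<in> carrier \<kappa>" "y \<in> carrier \<kappa>" "z \<in> carrier \<kappa>"
      then obtain a b c d e f where x: "x = frac R P a b" "a \<in> carrier R" "b \<in> carrier R - P"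
        and y: "y = frac R P c d" "c \<in> carrier R" "d \<in> carrier R - P"
        and z: "z = frac R P e f" "e \<in> carrier R" "f \<in> carrier R - P"
        by (elim residue_cases)
      note nn = nz[OF x(3) y(3)] nz[OF y(3) z(3)]
      have m: "a \<in> carrier R" "b \<in> carrier R" "c \<in> carrier R" "d \<in> carrier R" "e \<in> carrier R" "f \<in> carrier R"
        using x y z by auto
      show "x \<otimes>\<^bsub>\<kappa>\<^esub> y \<in> carrier \<kappa>"
        unfolding x(1) y(1) residue_mult[OF x(2,3) y(2,3)] by (intro frac_closed a_closed m_closed m nn)
      show "x \<otimes>\<^bsub>\<kappa>\<^esub> y \<otimes>\<^bsub>\<kappa>\<^esub> z = x \<otimes>\<^bsub>\<kappa>\<^esub> (y \<otimes>\<^bsub>\<kappa>\<^esub> z)"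
        unfolding x(1) y(1) z(1) residue_mult[OF x(2,3) y(2,3)] residue_mult[OF y(2,3) z(2,3)]
          residue_mult[OF m_closed[OF m(1,3)] nn(1) z(2,3)]
          residue_mult[OF x(2,3) m_closed[OF m(3,5)] nn(2)]
        using m by (simp only: m_assoc)
      show "x \<otimes>\<^bsub>\<kappa>\<^esub> y = y \<otimes>\<^bsub>\<kappa>\<^esub> x"
        unfolding x(1) y(1) residue_mult[OF x(2,3) y(2,3)] residue_mult[OF y(2,3) x(2,3)]
        using m by (simp add: m_comm)
    next
      show "\<one>\<^bsub>\<kappa>\<^esub> \<in> carrier \<kappa>" unfolding residue_one by (intro frac_closed one_closed zero_closed one_notin)
      fix x assume "x \<in> carrier \<kappa>"
      then obtain a b where x: "x = frac R P a b" "a \<in> carrier R" "b \<in> carrier R - P"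
        by (rule residue_cases)
      then show "\<one>\<^bsub>\<kappa>\<^esub> \<otimes>\<^bsub>\<kappa>\<^esub> x = x"
        unfolding residue_one x(1) residue_mult[OF one_closed one_notin x(2,3)] by simp
    qed
    fix x y z assume "x \<in> carrier \<kappa>" "y \<in> carrier \<kappa>" "z \<in> carrier \<kappa>"
    then obtain a b c d e f where x: "x = frac R P a b" "a \<in> carrier R" "b \<in> carrier R - P"
      and y: "y = frac R P c d" "c \<in> carrier R" "d \<in> carrier R - P"
      and z: "z = frac R P e f" "e \<in> carrier R" "f \<in> carrier R - P"
      by (elim residue_cases)
    note nn = nz[OF x(3) y(3)] nz[OF y(3) z(3)] nz[OF x(3) z(3)]
    have m: "a \<in> carrier R" "b \<in> carrier R" "c \<in> carrier R" "d \<in> carrier R" "e \<in> carrier R" "f \<in> carrier R"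
      using x y z by auto
    have "(x \<oplus>\<^bsub>\<kappa>\<^esub> y) \<otimes>\<^bsub>\<kappa>\<^esub> z = frac R P ((a \<otimes> d \<oplus> c \<otimes> b) \<otimes> e) ((b \<otimes> d) \<otimes> f)"
      unfolding x(1) y(1) z(1) residue_add[OF x(2,3) y(2,3)]
      by (intro residue_mult a_closed m_closed m nn(1) z)
    also have "\<dots> = frac R P ((a \<otimes> e) \<otimes> (d \<otimes> f) \<oplus> (c \<otimes> e) \<otimes> (b \<otimes> f)) ((b \<otimes> f) \<otimes> (d \<otimes> f))"
    proof (rule frac_cancel)
      show "(a \<otimes> d \<oplus> c \<otimes> b) \<otimes> e \<otimes> (b \<otimes> f \<otimes> (d \<otimes> f)) =
        (a \<otimes> e \<otimes> (d \<otimes> f) \<oplus> c \<otimes> e \<otimes> (b \<otimes> f)) \<otimes> (b \<otimes> d \<otimes> f)"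
        using m by algebra
    qed (intro a_closed m_closed m nz[OF nn(1) z(3)] nz[OF nn(3) nn(2)])+
    also have "\<dots> = x \<otimes>\<^bsub>\<kappa>\<^esub> z \<oplus>\<^bsub>\<kappa>\<^esub> y \<otimes>\<^bsub>\<kappa>\<^esub> z"
      unfolding x(1) y(1) z(1) residue_mult[OF x(2,3) z(2,3)] residue_mult[OF y(2,3) z(2,3)]
      by (intro residue_add[symmetric] m_closed m nn)
    finally show "(x \<oplus>\<^bsub>\<kappa>\<^esub> y) \<otimes>\<^bsub>\<kappa>\<^esub> z = x \<otimes>\<^bsub>\<kappa>\<^esub> z \<oplus>\<^bsub>\<kappa>\<^esub> y \<otimes>\<^bsub>\<kappa>\<^esub> z" .
  qed
  then interpret K: cring \<kappa> .
  show ?thesis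
  proof (rule K.cring_fieldI2)
    have "\<one> \<otimes> \<one> \<ominus> \<zero> \<otimes> \<one> \<notin> P" using one_notin by (simp add: a_minus_def)
    then show "\<zero>\<^bsub>\<kappa>\<^esub> \<noteq> \<one>\<^bsub>\<kappa>\<^esub>"
      unfolding residue_zero residue_one
      using frac_eq_iff[OF one_closed one_notin zero_closed one_notin] by metis
    fix x assume x0: "x \<in> carrier \<kappa>" "x \<noteq> \<zero>\<^bsub>\<kappa>\<^esub>"
    from x0(1) obtain a b where x: "x = frac R P a b" "a \<in> carrier R" "b \<in> carrier R - P"
      by (rule residue_cases)
    have "a \<notin> P"
    proof
      assume "a \<in> P"
      then have "a \<otimes> \<one> \<ominus> \<zero> \<otimes> b \<in> P" using x by (simp add: a_minus_def)
      then have "x = \<zero>\<^bsub>\<kappa>\<^esub>" unfolding x(1) residue_zero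
        by (intro frac_eq_iff[THEN iffD2] x zero_closed one_notin)
      then show False using x0 by simp
    qed
    then have a: "a \<in> carrier R - P" using x by simp
    have b: "b \<in> carrier R" using x by simp
    have "x \<otimes>\<^bsub>\<kappa>\<^esub> frac R P b a = \<one>\<^bsub>\<kappa>\<^esub>"
      unfolding x(1) residue_one residue_mult[OF x(2,3) b a]
    proof (rule frac_cancel)
      show "a \<otimes> b \<otimes> \<one> = \<one> \<otimes> (b \<otimes> a)" using x(2) b by algebra
    qed (intro m_closed x b nz[OF x(3) a] one_closed one_notin)+
    then show "\<exists>y\<in>carrier \<kappa>. x \<otimes>\<^bsub>\<kappa>\<^esub> y = \<one>\<^bsub>\<kappa>\<^esub>" using frac_closed[OF b a] by blast
  qed
qed

lemma to_residue_hom: "to_residue R P \<in> ring_hom R \<kappa>"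
proof (rule ring_hom_memI)
  fix a b assume "a \<in> carrier R" "b \<in> carrier R"
  then show "to_residue R P (a \<otimes> b) = to_residue R P a \<otimes>\<^bsub>\<kappa>\<^esub> to_residue R P b"
    "to_residue R P (a \<oplus> b) = to_residue R P a \<oplus>\<^bsub>\<kappa>\<^esub> to_residue R P b"
    "to_residue R P a \<in> carrier \<kappa>"
    using one_notin frac_closed unfolding to_residue_def
    by (simp_all only: residue_mult residue_add r_one l_one one_closed)
qed (simp add: to_residue_def residue_one)

lemma to_residue_zero_iff:
  assumes "a \<in> carrier R"
  shows "to_residue R P a = \<zero>\<^bsub>\<kappa>\<^esub> \<longleftrightarrow> a \<in> P"
proof -
  have "to_residue R P a = \<zero>\<^bsub>\<kappa>\<^esub> \<longleftrightarrow> a \<otimes> \<one> \<ominus> \<zero> \<otimes> \<one> \<in> P"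
    unfolding to_residue_def residue_zero by (intro frac_eq_iff assms zero_closed one_notin)
  then show ?thesis using assms by (simp add: a_minus_def)
qed

lemma residue_frac_mult:
  assumes "a \<in> carrier R" "b \<in> carrier R - P"
  shows "to_residue R P b \<otimes>\<^bsub>\<kappa>\<^esub> frac R P a b = to_residue R P a"
proof -
  have "to_residue R P b \<otimes>\<^bsub>\<kappa>\<^esub> frac R P a b = frac R P (b \<otimes> a) (\<one> \<otimes> b)"
    unfolding to_residue_def using assms(2) by (intro residue_mult one_notin assms) simp
  also have "\<dots> = to_residue R P a"
    unfolding to_residue_def
  proof (rule frac_cancel)
    have b: "b \<in> carrier R" using assms(2) by simp
    show "b \<otimes> a \<otimes> \<one> = a \<otimes> (\<one> \<otimes> b)" using assms(1) b by algebra
    show "b \<otimes> a \<in> carrier R" using assms(1) b by simp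
  qed (intro assms one_notin prod_notin)+
  finally show ?thesis .
qed

lemma common_denominator:
  assumes "finite A" "\<And>i. i \<in> A \<Longrightarrow> a i \<in> carrier \<kappa>"
  shows "\<exists>s\<in>carrier R - P. \<exists>c. (\<forall>i\<in>A. c i \<in> carrier R) \<and>
    (\<forall>i\<in>A. to_residue R P s \<otimes>\<^bsub>\<kappa>\<^esub> a i = to_residue R P (c i))"
  using assms
proof (induction A)
  case empty
  then show ?case using one_notin by blast
next
  case (insert x A)
  interpret K: field \<kappa> by (rule residue_field_field)
  interpret h: ring_hom_cring R \<kappa> "to_residue R P"
    by (intro ring_hom_cring.intro ring_hom_cring_axioms.intro to_residue_hom is_cring K.is_cring)
  obtain s c where s: "s \<in> carrier R - P" "\<And>i. i \<in> A \<Longrightarrow> c i \<in> carrier R"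
    "\<And>i. i \<in> A \<Longrightarrow> to_residue R P s \<otimes>\<^bsub>\<kappa>\<^esub> a i = to_residue R P (c i)"
    using insert by blast
  obtain e b where x: "a x = frac R P e b" "e \<in> carrier R" "b \<in> carrier R - P"
    using insert.prems[of x] residue_cases by blast
  let ?c = "\<lambda>i. if i = x then s \<otimes> e else b \<otimes> c i"
  have m: "s \<in> carrier R" "b \<in> carrier R" using s x by auto
  have "to_residue R P (s \<otimes> b) \<otimes>\<^bsub>\<kappa>\<^esub> a i = to_residue R P (?c i)" if i: "i \<in> insert x A" for i
  proof (cases "i = x")
    case True
    have "to_residue R P (s \<otimes> b) \<otimes>\<^bsub>\<kappa>\<^esub> a x = to_residue R P s \<otimes>\<^bsub>\<kappa>\<^esub> (to_residue R P b \<otimes>\<^bsub>\<kappa>\<^esub> a x)"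
      using m insert.prems[of x] by (simp add: K.m_assoc)
    then show ?thesis using True residue_frac_mult[OF x(2,3)] x m by simp
  next
    case False
    then have iA: "i \<in> A" using i by simp
    have "to_residue R P (s \<otimes> b) \<otimes>\<^bsub>\<kappa>\<^esub> a i = to_residue R P b \<otimes>\<^bsub>\<kappa>\<^esub> (to_residue R P s \<otimes>\<^bsub>\<kappa>\<^esub> a i)"
      using m insert.prems[of i] iA K.m_lcomm[of "to_residue R P s" "to_residue R P b" "a i"]
      by (simp add: K.m_assoc)
    then show ?thesis using s(2,3)[OF iA] False m by simp
  qed
  moreover have "s \<otimes> b \<in> carrier R - P" using s x by (intro prod_notin)
  moreover have "\<forall>i\<in>insert x A. ?c i \<in> carrier R" using s x m by auto
  ultimately show ?case by (intro bexI[of _ "s \<otimes> b"] exI[of _ ?c]) auto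
qed

end

text \<open>
  For a prime of the target of \<open>f\<close> and its preimage, this is the induced extension of
  residue fields, defined on a fraction through an arbitrary representative.
\<close>

definition residue_map ::
  "('b, 'm) ring_scheme \<Rightarrow> 'b set \<Rightarrow> ('a \<Rightarrow> 'b) \<Rightarrow> ('a \<times> 'a) set \<Rightarrow> ('b \<times> 'b) set" where
  "residue_map R' P' f x = (let (a, b) = (SOME z. z \<in> x) in frac R' P' (f a) (f b))"

lemma residue_map_frac:
  assumes f: "f \<in> ring_hom R R'" and "cring R" "cring R'" and P': "primeideal P' R'"
    and P: "P = spec_map f R P'"
    and ab: "a \<in> carrier R" "b \<in> carrier R - P"
  shows "primeideal P R" "f b \<in> carrier R' - P'"
    "residue_map R' P' f (frac R P a b) = frac R' P' (f a) (f b)"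
proof -
  interpret f: ring_hom_cring R R' f
    by (intro ring_hom_cring.intro ring_hom_cring_axioms.intro assms)
  interpret P': primeideal P' R' by fact
  show pP: "primeideal P R"
    using ring_hom_ring.primeideal_vimage[OF ring_hom_ringI2[OF cring.axioms(1)[OF assms(2)]
      cring.axioms(1)[OF assms(3)] f] assms(2) P'] unfolding P spec_map_def .
  interpret P: primeideal P R by fact
  have notin: "f x \<in> carrier R' - P'" if "x \<in> carrier R - P" for x
    using that f.hom_closed unfolding P spec_map_def by simp
  then show "f b \<in> carrier R' - P'" using ab by blast
  obtain a' b' where a': "(SOME z. z \<in> frac R P a b) = (a', b')" "a' \<in> carrier R" "b' \<in> carrier R - P"
    "a \<otimes>\<^bsub>R\<^esub> b' \<ominus>\<^bsub>R\<^esub> a' \<otimes>\<^bsub>R\<^esub> b \<in> P" using P.frac_some[OF ab] .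
  have m: "a \<in> carrier R" "b \<in> carrier R" "a' \<in> carrier R" "b' \<in> carrier R" using ab a' by auto
  have "f (a \<otimes>\<^bsub>R\<^esub> b' \<ominus>\<^bsub>R\<^esub> a' \<otimes>\<^bsub>R\<^esub> b) \<in> P'" using a'(4) unfolding P spec_map_def by simp
  then have "f a \<otimes>\<^bsub>R'\<^esub> f b' \<ominus>\<^bsub>R'\<^esub> f a' \<otimes>\<^bsub>R'\<^esub> f b \<in> P'"
    using m by (simp add: a_minus_def)
  then have "frac R' P' (f a) (f b) = frac R' P' (f a') (f b')"
    by (intro P'.frac_eq_iff[THEN iffD2] f.hom_closed m notin ab a'(3))
  then show "residue_map R' P' f (frac R P a b) = frac R' P' (f a) (f b)"
    unfolding residue_map_def a'(1) by simp
qed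

lemma residue_map_hom:
  assumes f: "f \<in> ring_hom R R'" and "cring R" "cring R'" and P': "primeideal P' R'"
    and P: "P = spec_map f R P'"
  shows "residue_map R' P' f \<in> ring_hom (residue_field R P) (residue_field R' P')"
    "a \<in> carrier R \<Longrightarrow> residue_map R' P' f (to_residue R P a) = to_residue R' P' (f a)"
proof -
  interpret f: ring_hom_cring R R' f
    by (intro ring_hom_cring.intro ring_hom_cring_axioms.intro assms)
  interpret P': prime_point P' R' by (intro prime_point.intro P')
  have "primeideal P R"
    using ring_hom_ring.primeideal_vimage[OF ring_hom_ringI2[OF cring.axioms(1)[OF assms(2)]
      cring.axioms(1)[OF assms(3)] f] assms(2) P'] unfolding P spec_map_def .
  then interpret P: prime_point P R by (intro prime_point.intro)
  note fr = residue_map_frac[OF assms]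
  show tr: "residue_map R' P' f (to_residue R P a) = to_residue R' P' (f a)" if "a \<in> carrier R" for a
    unfolding to_residue_def using fr(3)[OF that P.one_notin] by simp
  show "residue_map R' P' f \<in> ring_hom (residue_field R P) (residue_field R' P')"
  proof (rule ring_hom_memI)
    fix x assume "x \<in> carrier P.\<kappa>"
    then obtain a b where x: "x = frac R P a b" "a \<in> carrier R" "b \<in> carrier R - P"
      by (rule P.residue_cases)
    then show "residue_map R' P' f x \<in> carrier P'.\<kappa>"
      unfolding x(1) fr(3)[OF x(2,3)] by (intro P'.frac_closed fr(2)[OF x(2,3)]) simp
    fix y assume "y \<in> carrier P.\<kappa>"
    then obtain c d where y: "y = frac R P c d" "c \<in> carrier R" "d \<in> carrier R - P"
      by (rule P.residue_cases)
    have bd: "b \<otimes>\<^bsub>R\<^esub> d \<in> carrier R - P" using x y by (intro P.prod_notin)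
    have m: "b \<in> carrier R" "d \<in> carrier R" using x y by auto
    have ac: "a \<otimes>\<^bsub>R\<^esub> c \<in> carrier R" using x(2) y(2) by simp
    show "residue_map R' P' f (x \<otimes>\<^bsub>P.\<kappa>\<^esub> y) = residue_map R' P' f x \<otimes>\<^bsub>P'.\<kappa>\<^esub> residue_map R' P' f y"
      unfolding x(1) y(1) P.residue_mult[OF x(2,3) y(2,3)] fr(3)[OF ac bd]
        fr(3)[OF x(2,3)] fr(3)[OF y(2,3)]
        P'.residue_mult[OF f.hom_closed[OF x(2)] fr(2)[OF x(2,3)] f.hom_closed[OF y(2)] fr(2)[OF y(2,3)]]
      using x(2) y(2) m by simp
    have ad: "a \<otimes>\<^bsub>R\<^esub> d \<oplus>\<^bsub>R\<^esub> c \<otimes>\<^bsub>R\<^esub> b \<in> carrier R" using x(2) y(2) m by simp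
    show "residue_map R' P' f (x \<oplus>\<^bsub>P.\<kappa>\<^esub> y) = residue_map R' P' f x \<oplus>\<^bsub>P'.\<kappa>\<^esub> residue_map R' P' f y"
      unfolding x(1) y(1) P.residue_add[OF x(2,3) y(2,3)] fr(3)[OF ad bd]
        fr(3)[OF x(2,3)] fr(3)[OF y(2,3)]
        P'.residue_add[OF f.hom_closed[OF x(2)] fr(2)[OF x(2,3)] f.hom_closed[OF y(2)] fr(2)[OF y(2,3)]]
      using x(2) y(2) m by simp
  next
    have "residue_map R' P' f \<one>\<^bsub>P.\<kappa>\<^esub> = residue_map R' P' f (to_residue R P \<one>\<^bsub>R\<^esub>)"
      by (simp add: P.residue_one to_residue_def)
    also have "\<dots> = to_residue R' P' \<one>\<^bsub>R'\<^esub>" using tr[of "\<one>\<^bsub>R\<^esub>"] by simp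
    finally show "residue_map R' P' f \<one>\<^bsub>P.\<kappa>\<^esub> = \<one>\<^bsub>P'.\<kappa>\<^esub>"
      by (simp add: P'.residue_one to_residue_def)
  qed
qed

section \<open>Semicontinuity of ranks\<close>

text \<open>
  Clearing denominators turns linear independence over the residue field at \<open>P\<close> into this
  condition on elements of the ring.
\<close>

definition indep_mod :: "('a, 'm) ring_scheme \<Rightarrow> 'a set \<Rightarrow> nat \<Rightarrow> nat \<Rightarrow> (nat \<Rightarrow> nat \<Rightarrow> 'a) \<Rightarrow> bool" where
  "indep_mod R P d m w \<longleftrightarrow> (\<forall>c. (\<forall>i<m. c i \<in> carrier R) \<longrightarrow>
     (\<forall>l<d. (\<Oplus>\<^bsub>R\<^esub>i\<in>{..<m}. c i \<otimes>\<^bsub>R\<^esub> w i l) \<in> P) \<longrightarrow> (\<forall>i<m. c i \<in> P))"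

lemma (in cring) elimination_identities:
  assumes "s \<in> carrier R" "t \<in> carrier R" "w \<in> carrier R" "a \<in> carrier R" "c \<in> carrier R"
  shows "\<ominus> t \<otimes> w \<oplus> a \<otimes> s = a \<otimes> s \<ominus> t \<otimes> w"
    "a \<otimes> (c \<otimes> w \<oplus> s) \<oplus> (\<ominus> w) \<otimes> (c \<otimes> a \<oplus> t) = a \<otimes> s \<ominus> t \<otimes> w"
    "(c \<otimes> a \<oplus> s) \<ominus> s = c \<otimes> a"
  using assms by algebra+

lemma (in ideal) finsum_mem:
  assumes "finite A" "\<And>i. i \<in> A \<Longrightarrow> f i \<in> I"
  shows "(\<Oplus>i\<in>A. f i) \<in> I"
  using assms
proof (induction A)
  case (insert x A)
  then have "f \<in> A \<rightarrow> carrier R" "f x \<in> carrier R" by auto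
  then show ?case using insert
    by (simp add: finsum_insert additive_subgroup.a_closed[OF additive_subgroup_axioms])
qed simp

text \<open>
  Induction on the number of vectors. Some entry of the last one is outside \<open>P\<close>; with it as
  pivot, one coordinate is eliminated from the other vectors without division. Where the pivot is
  outside \<open>Q\<close>, independence of the original vectors at \<open>Q\<close> is equivalent to
  that of the eliminated ones.
\<close>

lemma (in cring) indep_mod_open:
  assumes P: "primeideal P R" and w: "\<And>i l. i < m \<Longrightarrow> l < d \<Longrightarrow> w i l \<in> carrier R"
    and ind: "indep_mod R P d m w"
  shows "\<exists>f\<in>carrier R - P. \<forall>Q. primeideal Q R \<longrightarrow> f \<notin> Q \<longrightarrow> indep_mod R Q d m w"
  using w ind
proof (induction m arbitrary: w)
  case 0
  interpret P: primeideal P R by fact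
  show ?case using P.one_notin by (auto simp: indep_mod_def)
next
  case (Suc m)
  interpret P: primeideal P R by fact
  have w: "w i l \<in> carrier R" if "i < Suc m" "l < d" for i l using Suc.prems(1) that .
  have spl: "(\<Oplus>i\<in>{..<Suc m}. g i) = g m \<oplus> (\<Oplus>i\<in>{..<m}. g i)" if "\<And>i. i < Suc m \<Longrightarrow> g i \<in> carrier R" for g
    unfolding lessThan_Suc using that by (intro finsum_insert) auto
  have "\<exists>l<d. w m l \<notin> P"
  proof (rule ccontr)
    assume no: "\<not> (\<exists>l<d. w m l \<notin> P)"
    let ?c = "\<lambda>i. if i = m then \<one> else \<zero>"
    have "(\<Oplus>i\<in>{..<Suc m}. ?c i \<otimes> w i l) \<in> P" if l: "l < d" for l
    proof -
      have "(\<Oplus>i\<in>{..<Suc m}. ?c i \<otimes> w i l) = (\<Oplus>i\<in>{..<Suc m}. if i = m then w i l else \<zero>)"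
        using w l by (intro finsum_cong') auto
      also have "\<dots> = w m l" using w l by (intro finsum_delta) auto
      finally show ?thesis using no l by simp
    qed
    then have "?c m \<in> P" using Suc.prems(2)[unfolded indep_mod_def, rule_format, of ?c m] by simp
    then show False using P.one_notin by simp
  qed
  then obtain l where l: "l < d" "w m l \<notin> P" by blast
  define a where "a = w m l"
  have a: "a \<in> carrier R" "a \<notin> P" using w l by (auto simp: a_def)
  \<comment> \<open>The combinations of the vectors with the last one that vanish at coordinate \<open>l\<close>.\<close>
  define v where "v = (\<lambda>i j. a \<otimes> w i j \<ominus> w i l \<otimes> w m j)"
  have v: "v i j \<in> carrier R" if "i < m" "j < d" for i j using a w l that by (simp add: v_def)
  have vsum: "(\<Oplus>i\<in>{..<m}. c i \<otimes> v i j) =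
      a \<otimes> (\<Oplus>i\<in>{..<m}. c i \<otimes> w i j) \<ominus> (\<Oplus>i\<in>{..<m}. c i \<otimes> w i l) \<otimes> w m j"
    if c: "\<And>i. i < m \<Longrightarrow> c i \<in> carrier R" and j: "j < d" for c j
  proof -
    have "(\<Oplus>i\<in>{..<m}. c i \<otimes> v i j) = (\<Oplus>i\<in>{..<m}. a \<otimes> (c i \<otimes> w i j) \<oplus> (c i \<otimes> w i l) \<otimes> (\<ominus> w m j))"
    proof (rule finsum_cong'[OF refl])
      fix i assume "i \<in> {..<m}"
      then have "c i \<in> carrier R" "w i j \<in> carrier R" "w i l \<in> carrier R" "w m j \<in> carrier R"
        using c w j l by auto
      then show "c i \<otimes> v i j = a \<otimes> (c i \<otimes> w i j) \<oplus> (c i \<otimes> w i l) \<otimes> (\<ominus> w m j)"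
        unfolding v_def using a(1) by algebra
    qed (use a c w j l in auto)
    also have "\<dots> = (\<Oplus>i\<in>{..<m}. a \<otimes> (c i \<otimes> w i j)) \<oplus> (\<Oplus>i\<in>{..<m}. (c i \<otimes> w i l) \<otimes> (\<ominus> w m j))"
      using a c w j l by (intro finsum_addf) auto
    also have "(\<Oplus>i\<in>{..<m}. a \<otimes> (c i \<otimes> w i j)) = a \<otimes> (\<Oplus>i\<in>{..<m}. c i \<otimes> w i j)"
      using a c w j by (intro finsum_rdistr[symmetric]) auto
    also have "(\<Oplus>i\<in>{..<m}. (c i \<otimes> w i l) \<otimes> (\<ominus> w m j)) = (\<Oplus>i\<in>{..<m}. c i \<otimes> w i l) \<otimes> (\<ominus> w m j)"
      using c w j l by (intro finsum_ldistr[symmetric]) auto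
    finally have *: "(\<Oplus>i\<in>{..<m}. c i \<otimes> v i j) =
      a \<otimes> (\<Oplus>i\<in>{..<m}. c i \<otimes> w i j) \<oplus> (\<Oplus>i\<in>{..<m}. c i \<otimes> w i l) \<otimes> (\<ominus> w m j)" .
    have "(\<Oplus>i\<in>{..<m}. c i \<otimes> w i l) \<in> carrier R" using c w l by (intro finsum_closed) auto
    then show ?thesis unfolding * using w j by (simp add: a_minus_def r_minus)
  qed
  have indv: "indep_mod R P d m v"
    unfolding indep_mod_def
  proof (intro allI impI)
    fix c i assume c: "\<forall>i<m. c i \<in> carrier R" "\<forall>j<d. (\<Oplus>i\<in>{..<m}. c i \<otimes> v i j) \<in> P" and i: "i < m"
    let ?S = "\<lambda>j. \<Oplus>i\<in>{..<m}. c i \<otimes> w i j"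
    have S: "?S j \<in> carrier R" if "j < d" for j using c w that by (intro finsum_closed) auto
    define b where "b = (\<lambda>i. if i = m then \<ominus> ?S l else a \<otimes> c i)"
    have b: "b i \<in> carrier R" if "i < Suc m" for i using that a c(1) S[OF l(1)] by (auto simp: b_def)
    have "(\<Oplus>i\<in>{..<Suc m}. b i \<otimes> w i j) \<in> P" if j: "j < d" for j
    proof -
      have "(\<Oplus>i\<in>{..<Suc m}. b i \<otimes> w i j) = b m \<otimes> w m j \<oplus> (\<Oplus>i\<in>{..<m}. b i \<otimes> w i j)"
        using b w j by (intro spl) auto
      also have "(\<Oplus>i\<in>{..<m}. b i \<otimes> w i j) = (\<Oplus>i\<in>{..<m}. a \<otimes> (c i \<otimes> w i j))"
        using a c w j by (intro finsum_cong') (auto simp: b_def m_assoc)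
      also have "\<dots> = a \<otimes> ?S j" using a c w j by (intro finsum_rdistr[symmetric]) auto
      finally have "(\<Oplus>i\<in>{..<Suc m}. b i \<otimes> w i j) = \<ominus> ?S l \<otimes> w m j \<oplus> a \<otimes> ?S j" by (simp add: b_def)
      also have "\<dots> = a \<otimes> ?S j \<ominus> ?S l \<otimes> w m j"
        by (rule elimination_identities(1)[OF S[OF j] S[OF l(1)] w[OF lessI j] a(1) a(1)])
      also have "\<dots> = (\<Oplus>i\<in>{..<m}. c i \<otimes> v i j)" using c(1) j by (intro vsum[symmetric]) auto
      finally show ?thesis using c(2) j by simp
    qed
    then have "b i \<in> P" using Suc.prems(2)[unfolded indep_mod_def, rule_format, of b i] b i by simp
    then have "a \<otimes> c i \<in> P" using i by (simp add: b_def)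
    then show "c i \<in> P" using P.I_prime[of a "c i"] a c(1) i by blast
  qed
  from Suc.IH[of v, OF v indv] obtain f where f: "f \<in> carrier R - P"
    and fQ': "\<forall>Q. primeideal Q R \<longrightarrow> f \<notin> Q \<longrightarrow> indep_mod R Q d m v"
    by (rule bexE)
  have "indep_mod R Q d (Suc m) w" if Q: "primeideal Q R" and fa: "f \<otimes> a \<notin> Q" for Q
  proof -
    interpret Q: primeideal Q R by fact
    have fQ: "f \<notin> Q" using fa Q.I_r_closed[of f a] a by blast
    have aQ: "a \<notin> Q" using fa Q.I_l_closed[of a f] f by blast
    show ?thesis
      unfolding indep_mod_def
    proof (intro allI impI)
      fix c i assume c: "\<forall>i<Suc m. c i \<in> carrier R" "\<forall>j<d. (\<Oplus>i\<in>{..<Suc m}. c i \<otimes> w i j) \<in> Q"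
        and i: "i < Suc m"
      let ?S = "\<lambda>j. \<Oplus>i\<in>{..<m}. c i \<otimes> w i j"
      have S: "?S j \<in> carrier R" if "j < d" for j using c w that by (intro finsum_closed) auto
      have cm: "c m \<in> carrier R" using c by simp
      have full: "c m \<otimes> w m j \<oplus> ?S j \<in> Q" if "j < d" for j
      proof -
        have "(\<Oplus>i\<in>{..<Suc m}. c i \<otimes> w i j) = c m \<otimes> w m j \<oplus> ?S j"
          by (rule spl) (use c(1) w that in simp)
        then show ?thesis using c(2)[rule_format, OF that] by metis
      qed
      have "(\<Oplus>i\<in>{..<m}. c i \<otimes> v i j) \<in> Q" if j: "j < d" for j
      proof -
        have "a \<otimes> (c m \<otimes> w m j \<oplus> ?S j) \<oplus> (\<ominus> w m j) \<otimes> (c m \<otimes> w m l \<oplus> ?S l) \<in> Q"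
          using a(1) w[of m j] j l(1) full by (intro Q.combination_mem) auto
        moreover have "a \<otimes> (c m \<otimes> w m j \<oplus> ?S j) \<oplus> (\<ominus> w m j) \<otimes> (c m \<otimes> a \<oplus> ?S l) =
            a \<otimes> ?S j \<ominus> ?S l \<otimes> w m j"
          by (rule elimination_identities(2)[OF S[OF j] S[OF l(1)] w[OF lessI j] a(1) cm])
        ultimately show ?thesis using vsum[of c j] c(1) j by (simp add: a_def)
      qed
      then have "\<forall>i<m. c i \<in> Q"
        using fQ'[rule_format, OF Q fQ, unfolded indep_mod_def, rule_format, of c] c(1) by simp
      moreover have "c m \<in> Q"
      proof -
        have SQ: "?S l \<in> Q"
          using \<open>\<forall>i<m. c i \<in> Q\<close> w l(1) by (intro Q.finsum_mem Q.I_r_closed) auto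
        have "(c m \<otimes> a \<oplus> ?S l) \<ominus> ?S l \<in> Q"
          unfolding a_minus_def
          using full[OF l(1)] SQ additive_subgroup.a_closed[OF Q.additive_subgroup_axioms]
          by (simp add: a_def)
        moreover have "(c m \<otimes> a \<oplus> ?S l) \<ominus> ?S l = c m \<otimes> a" 
          by (rule elimination_identities(3)[OF S[OF l(1)] S[OF l(1)] S[OF l(1)] a(1) cm])
        ultimately have "c m \<otimes> a \<in> Q" by simp
        then show ?thesis using Q.I_prime[of "c m" a] cm a aQ by blast
      qed
      ultimately show "c i \<in> Q" using i less_Suc_eq by auto
    qed
  qed
  then have "\<forall>Q. primeideal Q R \<longrightarrow> f \<otimes> a \<notin> Q \<longrightarrow> indep_mod R Q d (Suc m) w" by (intro allI impI)
  moreover have "f \<otimes> a \<in> carrier R - P" using a by (intro P.prod_notin f) auto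
  ultimately show ?case by (rule bexI)
qed

definition res_vec :: "('k, 'a, 'm) module_scheme \<Rightarrow> 'a set \<Rightarrow> nat \<Rightarrow> (nat \<Rightarrow> 'a) \<Rightarrow> nat \<Rightarrow> ('a \<times> 'a) set" where
  "res_vec R P d x = (\<lambda>l\<in>{..<d}. to_residue R P (x l))"

definition res_mat :: "('k, 'a, 'm) module_scheme \<Rightarrow> 'a set \<Rightarrow> (nat \<Rightarrow> nat \<Rightarrow> 'a) \<Rightarrow> nat \<Rightarrow> nat \<Rightarrow> ('a \<times> 'a) set" where
  "res_mat R P U = (\<lambda>i j. to_residue R P (U i j))"

lemma (in cring) mat_op_pow_closed:
  assumes U: "\<And>i j. i < d \<Longrightarrow> j < d \<Longrightarrow> U i j \<in> carrier R" and x: "x \<in> {..<d} \<rightarrow>\<^sub>E carrier R"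
  shows "(mat_op R d U ^^ e) x \<in> {..<d} \<rightarrow>\<^sub>E carrier R"
proof (induction e)
  case (Suc e)
  have "mat_op R d U y \<in> {..<d} \<rightarrow>\<^sub>E carrier R" if "y \<in> {..<d} \<rightarrow>\<^sub>E carrier R" for y
    unfolding mat_op_def using U that by (auto intro!: finsum_closed)
  then show ?case using Suc by simp
qed (use x in simp)

context prime_point
begin

sublocale K: field \<kappa> by (rule residue_field_field)

sublocale h: ring_hom_cring R \<kappa> "to_residue R P"
  by (intro ring_hom_cring.intro ring_hom_cring_axioms.intro to_residue_hom is_cring K.is_cring)

context
  fixes d :: nat
begin

lemma res_vec_closed: "x \<in> {..<d} \<rightarrow>\<^sub>E carrier R \<Longrightarrow> res_vec R P d x \<in> carrier (vec_space \<kappa> d)"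
  by (auto simp: res_vec_def)

lemma clear_denominators:
  fixes m :: nat
  assumes y: "\<And>i. i < m \<Longrightarrow> y i \<in> carrier (vec_space \<kappa> d)"
  shows "\<exists>s\<in>carrier R - P. \<exists>Y. \<forall>i<m. Y i \<in> {..<d} \<rightarrow>\<^sub>E carrier R \<and>
    to_residue R P s \<odot>\<^bsub>vec_space \<kappa> d\<^esub> y i = res_vec R P d (Y i)"
proof -
  have "finite ({..<m} \<times> {..<d})" by simp
  moreover have "case x of (i, l) \<Rightarrow> y i l \<in> carrier \<kappa>" if "x \<in> {..<m} \<times> {..<d}" for x
    using y that by fastforce
  ultimately obtain s c where s: "s \<in> carrier R - P"
    and c: "\<forall>x\<in>{..<m} \<times> {..<d}. c x \<in> carrier R"
      "\<forall>x\<in>{..<m} \<times> {..<d}. to_residue R P s \<otimes>\<^bsub>\<kappa>\<^esub> (case x of (i, l) \<Rightarrow> y i l) = to_residue R P (c x)"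
    using common_denominator[of "{..<m} \<times> {..<d}" "\<lambda>(i, l). y i l"] by auto
  define Y where "Y = (\<lambda>i. \<lambda>l\<in>{..<d}. c (i, l))"
  have "Y i \<in> {..<d} \<rightarrow>\<^sub>E carrier R \<and> to_residue R P s \<odot>\<^bsub>vec_space \<kappa> d\<^esub> y i = res_vec R P d (Y i)"
    if "i < m" for i
  proof
    show "Y i \<in> {..<d} \<rightarrow>\<^sub>E carrier R" using c(1) that by (auto simp: Y_def)
    show "to_residue R P s \<odot>\<^bsub>vec_space \<kappa> d\<^esub> y i = res_vec R P d (Y i)"
      using c(2) that by (simp add: res_vec_def Y_def restrict_def fun_eq_iff)
  qed
  then show ?thesis using s by blast
qed

lemma unit_residue:
  assumes "s \<in> carrier R - P"
  shows "to_residue R P s \<in> carrier \<kappa>" "to_residue R P s \<noteq> \<zero>\<^bsub>\<kappa>\<^esub>"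
  using assms to_residue_zero_iff[of s] by auto

lemma smult_unit_zero:
  assumes "s \<in> carrier R - P" "x \<in> carrier (vec_space \<kappa> d)"
    "to_residue R P s \<odot>\<^bsub>vec_space \<kappa> d\<^esub> x = \<zero>\<^bsub>vec_space \<kappa> d\<^esub>"
  shows "x = \<zero>\<^bsub>vec_space \<kappa> d\<^esub>"
proof (rule vec_eqI[of _ d "carrier \<kappa>" _ "carrier \<kappa>"])
  show "x \<in> {..<d} \<rightarrow>\<^sub>E carrier \<kappa>" using assms(2) by simp
  show "\<zero>\<^bsub>vec_space \<kappa> d\<^esub> \<in> {..<d} \<rightarrow>\<^sub>E carrier \<kappa>" by auto
  fix i assume i: "i < d"
  have "to_residue R P s \<otimes>\<^bsub>\<kappa>\<^esub> x i = \<zero>\<^bsub>\<kappa>\<^esub>" using fun_cong[OF assms(3), of i] i by simp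
  moreover have "x i \<in> carrier \<kappa>" using assms(2) i by auto
  ultimately have "x i = \<zero>\<^bsub>\<kappa>\<^esub>" using K.integral[of "to_residue R P s" "x i"] unit_residue[OF assms(1)] by blast
  then show "x i = \<zero>\<^bsub>vec_space \<kappa> d\<^esub> i" using i by simp
qed

lemma res_vec_finsum:
  fixes m :: nat
  assumes c: "\<And>i. i < m \<Longrightarrow> c i \<in> carrier R" and w: "\<And>i. i < m \<Longrightarrow> w i \<in> {..<d} \<rightarrow>\<^sub>E carrier R" and l: "l < d"
  shows "(\<Oplus>\<^bsub>vec_space \<kappa> d\<^esub>i\<in>{..<m}. to_residue R P (c i) \<odot>\<^bsub>vec_space \<kappa> d\<^esub> res_vec R P d (w i)) l =
    to_residue R P (\<Oplus>i\<in>{..<m}. c i \<otimes> w i l)"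
proof -
  have wl: "w i l \<in> carrier R" if "i < m" for i using w[OF that] l by auto
  have "(\<Oplus>\<^bsub>vec_space \<kappa> d\<^esub>i\<in>{..<m}. to_residue R P (c i) \<odot>\<^bsub>vec_space \<kappa> d\<^esub> res_vec R P d (w i)) l =
      (\<Oplus>\<^bsub>\<kappa>\<^esub>i\<in>{..<m}. to_residue R P (c i) \<otimes>\<^bsub>\<kappa>\<^esub> res_vec R P d (w i) l)"
    by (rule K.vec_lincomb[OF finite_lessThan res_vec_closed _ l]) (use c w in auto)
  also have "\<dots> = (\<Oplus>\<^bsub>\<kappa>\<^esub>i\<in>{..<m}. (to_residue R P \<circ> (\<lambda>i. c i \<otimes> w i l)) i)"
    using c wl l by (intro K.finsum_cong') (auto simp: res_vec_def)
  also have "\<dots> = to_residue R P (\<Oplus>i\<in>{..<m}. c i \<otimes> w i l)"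
    using c wl by (subst h.hom_finsum) auto
  finally show ?thesis .
qed

text \<open>
  A relation over the residue field can be multiplied by a common denominator, which is a unit there.
\<close>

lemma indep_mod_iff_lin_indep:
  assumes w: "\<And>i. i < m \<Longrightarrow> w i \<in> {..<d} \<rightarrow>\<^sub>E carrier R"
  shows "indep_mod R P d m w \<longleftrightarrow> lin_indep \<kappa> (vec_space \<kappa> d) {..<m} (\<lambda>i. res_vec R P d (w i))"
proof
  interpret V: vector_space_rec \<kappa> "vec_space \<kappa> d" by (rule K.vec_space_vector_space)
  have wl: "w i l \<in> carrier R" if "i < m" "l < d" for i l using w[OF that(1)] that(2) by auto
  assume ind: "lin_indep \<kappa> (vec_space \<kappa> d) {..<m} (\<lambda>i. res_vec R P d (w i))"
  show "indep_mod R P d m w"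
    unfolding indep_mod_def
  proof (intro allI impI)
    fix c i assume c: "\<forall>i<m. c i \<in> carrier R" "\<forall>l<d. (\<Oplus>i\<in>{..<m}. c i \<otimes> w i l) \<in> P" and i: "i < m"
    have "(\<Oplus>\<^bsub>vec_space \<kappa> d\<^esub>i\<in>{..<m}. to_residue R P (c i) \<odot>\<^bsub>vec_space \<kappa> d\<^esub> res_vec R P d (w i)) = \<zero>\<^bsub>vec_space \<kappa> d\<^esub>"
    proof (rule vec_eqI[of _ d "carrier \<kappa>" _ "carrier \<kappa>"])
      show "(\<Oplus>\<^bsub>vec_space \<kappa> d\<^esub>i\<in>{..<m}. to_residue R P (c i) \<odot>\<^bsub>vec_space \<kappa> d\<^esub> res_vec R P d (w i)) \<in> {..<d} \<rightarrow>\<^sub>E carrier \<kappa>"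
        using K.vec_lincomb_closed[of "{..<m}" "\<lambda>i. res_vec R P d (w i)" d "\<lambda>i. to_residue R P (c i)"]
          res_vec_closed w c(1) by simp
      show "\<zero>\<^bsub>vec_space \<kappa> d\<^esub> \<in> {..<d} \<rightarrow>\<^sub>E carrier \<kappa>" by auto
      fix l assume l: "l < d"
      have "(\<Oplus>i\<in>{..<m}. c i \<otimes> w i l) \<in> carrier R" using c wl l by (intro finsum_closed) auto
      then have "to_residue R P (\<Oplus>i\<in>{..<m}. c i \<otimes> w i l) = \<zero>\<^bsub>\<kappa>\<^esub>"
        using c(2) l by (simp add: to_residue_zero_iff)
      then show "(\<Oplus>\<^bsub>vec_space \<kappa> d\<^esub>i\<in>{..<m}. to_residue R P (c i) \<odot>\<^bsub>vec_space \<kappa> d\<^esub> res_vec R P d (w i)) l = \<zero>\<^bsub>vec_space \<kappa> d\<^esub> l"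
        using res_vec_finsum[of m c w l] c w l by simp
    qed
    then have "to_residue R P (c i) = \<zero>\<^bsub>\<kappa>\<^esub>"
      using c i by (intro lin_indepD[OF ind, of "\<lambda>i. to_residue R P (c i)"]) auto
    then show "c i \<in> P" using c i by (simp add: to_residue_zero_iff)
  qed
next
  interpret V: vector_space_rec \<kappa> "vec_space \<kappa> d" by (rule K.vec_space_vector_space)
  assume ind: "indep_mod R P d m w"
  show "lin_indep \<kappa> (vec_space \<kappa> d) {..<m} (\<lambda>i. res_vec R P d (w i))"
    unfolding lin_indep_def
  proof (intro allI impI ballI)
    fix a i assume a: "\<forall>i\<in>{..<m}. a i \<in> carrier \<kappa>" and i: "i \<in> {..<m}"
      and z: "(\<Oplus>\<^bsub>vec_space \<kappa> d\<^esub>i\<in>{..<m}. a i \<odot>\<^bsub>vec_space \<kappa> d\<^esub> res_vec R P d (w i)) = \<zero>\<^bsub>vec_space \<kappa> d\<^esub>"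
    have rV: "res_vec R P d (w i) \<in> carrier (vec_space \<kappa> d)" if "i \<in> {..<m}" for i
      using res_vec_closed w that by simp
    obtain s c where s: "s \<in> carrier R - P" and c: "\<forall>i\<in>{..<m}. c i \<in> carrier R"
      "\<forall>i\<in>{..<m}. to_residue R P s \<otimes>\<^bsub>\<kappa>\<^esub> a i = to_residue R P (c i)"
      using common_denominator[of "{..<m}" a] a by auto
    note su = unit_residue[OF s]
    have "(\<Oplus>\<^bsub>vec_space \<kappa> d\<^esub>i\<in>{..<m}. to_residue R P (c i) \<odot>\<^bsub>vec_space \<kappa> d\<^esub> res_vec R P d (w i)) =
        (\<Oplus>\<^bsub>vec_space \<kappa> d\<^esub>i\<in>{..<m}. to_residue R P s \<odot>\<^bsub>vec_space \<kappa> d\<^esub> (a i \<odot>\<^bsub>vec_space \<kappa> d\<^esub> res_vec R P d (w i)))"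
    proof (rule V.M.finsum_cong'[OF refl])
      show "(\<lambda>i. to_residue R P s \<odot>\<^bsub>vec_space \<kappa> d\<^esub> (a i \<odot>\<^bsub>vec_space \<kappa> d\<^esub> res_vec R P d (w i))) \<in>
          {..<m} \<rightarrow> carrier (vec_space \<kappa> d)"
        using a by (intro funcsetI V.smult_closed su rV) auto
      fix i assume i: "i \<in> {..<m}"
      show "to_residue R P (c i) \<odot>\<^bsub>vec_space \<kappa> d\<^esub> res_vec R P d (w i) =
          to_residue R P s \<odot>\<^bsub>vec_space \<kappa> d\<^esub> (a i \<odot>\<^bsub>vec_space \<kappa> d\<^esub> res_vec R P d (w i))"
        using V.smult_assoc1[OF su(1) a[rule_format, OF i] rV[OF i]] c(2) i by metis
    qed
    also have "\<dots> = to_residue R P s \<odot>\<^bsub>vec_space \<kappa> d\<^esub>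
        (\<Oplus>\<^bsub>vec_space \<kappa> d\<^esub>i\<in>{..<m}. a i \<odot>\<^bsub>vec_space \<kappa> d\<^esub> res_vec R P d (w i))"
    proof (rule V.finsum_smult_ldistr[symmetric, OF finite_lessThan su(1)])
      show "(\<lambda>i. a i \<odot>\<^bsub>vec_space \<kappa> d\<^esub> res_vec R P d (w i)) \<in> {..<m} \<rightarrow> carrier (vec_space \<kappa> d)"
        using a by (intro funcsetI V.smult_closed rV) auto
    qed
    also have "\<dots> = \<zero>\<^bsub>vec_space \<kappa> d\<^esub>" unfolding z by (rule V.smult_r_null[OF su(1)])
    finally have z': "(\<Oplus>\<^bsub>vec_space \<kappa> d\<^esub>i\<in>{..<m}. to_residue R P (c i) \<odot>\<^bsub>vec_space \<kappa> d\<^esub> res_vec R P d (w i)) =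
      \<zero>\<^bsub>vec_space \<kappa> d\<^esub>" .
    have "(\<Oplus>i\<in>{..<m}. c i \<otimes> w i l) \<in> P" if l: "l < d" for l
    proof -
      have wl: "w i l \<in> carrier R" if "i < m" for i using w[OF that] l by auto
      have "to_residue R P (\<Oplus>i\<in>{..<m}. c i \<otimes> w i l) = \<zero>\<^bsub>vec_space \<kappa> d\<^esub> l"
        unfolding z'[symmetric] by (rule res_vec_finsum[symmetric]) (use c w l in auto)
      moreover have "(\<Oplus>i\<in>{..<m}. c i \<otimes> w i l) \<in> carrier R" using c wl by (intro finsum_closed) auto
      ultimately show ?thesis using l by (simp add: to_residue_zero_iff)
    qed
    then have "c i \<in> P" using ind[unfolded indep_mod_def, rule_format, of c] c(1) i by auto
    then have "to_residue R P s \<otimes>\<^bsub>\<kappa>\<^esub> a i = \<zero>\<^bsub>\<kappa>\<^esub>" using c i by (simp add: to_residue_zero_iff)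
    then show "a i = \<zero>\<^bsub>\<kappa>\<^esub>" using K.integral[of "to_residue R P s" "a i"] su a i by blast
  qed
qed

end

context
  fixes d :: nat and U :: "nat \<Rightarrow> nat \<Rightarrow> 'a"
  assumes U: "\<And>i j. i < d \<Longrightarrow> j < d \<Longrightarrow> U i j \<in> carrier R"
begin

lemma res_mat_closed: "i < d \<Longrightarrow> j < d \<Longrightarrow> res_mat R P U i j \<in> carrier \<kappa>"
  using U by (simp add: res_mat_def)

lemma res_vec_mat_op:
  assumes x: "x \<in> {..<d} \<rightarrow>\<^sub>E carrier R"
  shows "res_vec R P d (mat_op R d U x) = mat_op \<kappa> d (res_mat R P U) (res_vec R P d x)"
proof
  fix i
  show "res_vec R P d (mat_op R d U x) i = mat_op \<kappa> d (res_mat R P U) (res_vec R P d x) i"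
  proof (cases "i < d")
    case True
    have xR: "\<And>l. l < d \<Longrightarrow> x l \<in> carrier R" using x by auto
    have "res_vec R P d (mat_op R d U x) i = to_residue R P (\<Oplus>l\<in>{..<d}. U i l \<otimes> x l)"
      using True by (simp add: res_vec_def mat_op_def)
    also have "\<dots> = (\<Oplus>\<^bsub>\<kappa>\<^esub>l\<in>{..<d}. (to_residue R P \<circ> (\<lambda>l. U i l \<otimes> x l)) l)"
      using U xR True by (subst h.hom_finsum) auto
    also have "\<dots> = (\<Oplus>\<^bsub>\<kappa>\<^esub>l\<in>{..<d}. res_mat R P U i l \<otimes>\<^bsub>\<kappa>\<^esub> res_vec R P d x l)"
      using U xR True by (intro K.finsum_cong') (auto simp: res_mat_def res_vec_def)
    also have "\<dots> = mat_op \<kappa> d (res_mat R P U) (res_vec R P d x) i"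
      using True by (simp add: mat_op_def)
    finally show ?thesis .
  qed (simp add: res_vec_def mat_op_def)
qed

lemma res_vec_mat_op_pow:
  assumes x: "x \<in> {..<d} \<rightarrow>\<^sub>E carrier R"
  shows "res_vec R P d ((mat_op R d U ^^ e) x) = (mat_op \<kappa> d (res_mat R P U) ^^ e) (res_vec R P d x)"
proof (induction e)
  case (Suc e)
  then show ?case
    using res_vec_mat_op[OF mat_op_pow_closed[where e = e, OF U x]] by simp
qed simp

lemma res_nilpotent:
  assumes nil: "\<And>x. x \<in> {..<d} \<rightarrow>\<^sub>E carrier R \<Longrightarrow> (mat_op R d U ^^ e) x = (\<lambda>l\<in>{..<d}. \<zero>)"
    and x: "x \<in> carrier (vec_space \<kappa> d)"
  shows "(mat_op \<kappa> d (res_mat R P U) ^^ e) x = \<zero>\<^bsub>vec_space \<kappa> d\<^esub>"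
proof -
  interpret V: lin_op \<kappa> "vec_space \<kappa> d" "mat_op \<kappa> d (res_mat R P U)"
    by (rule K.mat_op_lin_op[OF res_mat_closed])
  obtain s Y where s: "s \<in> carrier R - P" and Y: "Y \<in> {..<d} \<rightarrow>\<^sub>E carrier R"
    "to_residue R P s \<odot>\<^bsub>vec_space \<kappa> d\<^esub> x = res_vec R P d Y"
  proof -
    from clear_denominators[of 1 "\<lambda>_. x", OF x] obtain s Y where "s \<in> carrier R - P"
      "\<forall>i<(1::nat). Y i \<in> {..<d} \<rightarrow>\<^sub>E carrier R \<and> to_residue R P s \<odot>\<^bsub>vec_space \<kappa> d\<^esub> x = res_vec R P d (Y i)"
      by blast
    then show ?thesis using that[of s "Y 0"] by blast
  qed
  have "to_residue R P s \<odot>\<^bsub>vec_space \<kappa> d\<^esub> (mat_op \<kappa> d (res_mat R P U) ^^ e) x =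
      (mat_op \<kappa> d (res_mat R P U) ^^ e) (res_vec R P d Y)"
    unfolding Y(2)[symmetric] by (rule V.pow_smult[OF unit_residue(1)[OF s] x, symmetric])
  also have "\<dots> = res_vec R P d ((mat_op R d U ^^ e) Y)" by (rule res_vec_mat_op_pow[OF Y(1), symmetric])
  also have "\<dots> = \<zero>\<^bsub>vec_space \<kappa> d\<^esub>" unfolding nil[OF Y(1)] by (simp add: res_vec_def restrict_def fun_eq_iff)
  finally show ?thesis by (rule smult_unit_zero[OF s V.pow_closed[OF x]])
qed

end

end

text \<open>
  After clearing denominators, the vectors whose images are independent come from vectors over
  \<open>R\<close>. Independence modulo \<open>P\<close> of the images of these is an open condition.
\<close>

lemma rank_open:
  fixes R :: "('k, 'a, 'm) module_scheme"
  assumes "cring R" and P: "primeideal P R" and U: "\<And>i j. i < d \<Longrightarrow> j < d \<Longrightarrow> U i j \<in> carrier R"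
    and rk: "rank_at_least (residue_field R P) (vec_space (residue_field R P) d)
      (mat_op (residue_field R P) d (res_mat R P U) ^^ e) m"
  shows "\<exists>f\<in>carrier R - P. \<forall>Q. primeideal Q R \<longrightarrow> f \<notin> Q \<longrightarrow>
    rank_at_least (residue_field R Q) (vec_space (residue_field R Q) d)
      (mat_op (residue_field R Q) d (res_mat R Q U) ^^ e) m"
proof -
  interpret R: cring R by fact
  interpret P: prime_point P R by (intro prime_point.intro P)
  let ?V = "vec_space P.\<kappa> d" and ?T = "mat_op P.\<kappa> d (res_mat R P U) ^^ e"
  interpret V: lin_op P.\<kappa> ?V "mat_op P.\<kappa> d (res_mat R P U)"
    by (rule P.K.mat_op_lin_op[OF P.res_mat_closed[OF U]])
  obtain y where y: "\<forall>i<m. y i \<in> carrier ?V" "lin_indep P.\<kappa> ?V {..<m} (\<lambda>i. ?T (y i))"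
    using rk unfolding rank_at_least_def by blast
  obtain s Y where s: "s \<in> carrier R - P" and Y: "\<forall>i<m. Y i \<in> {..<d} \<rightarrow>\<^sub>E carrier R \<and>
      to_residue R P s \<odot>\<^bsub>?V\<^esub> y i = res_vec R P d (Y i)"
    using P.clear_denominators[where m = m and y = y and d = d] y(1) by blast
  note su = P.unit_residue[OF s]
  define w where "w = (\<lambda>i. (mat_op R d U ^^ e) (Y i))"
  have Yc: "Y i \<in> {..<d} \<rightarrow>\<^sub>E carrier R" if "i < m" for i using Y that by blast
  have wc: "w i \<in> {..<d} \<rightarrow>\<^sub>E carrier R" if "i < m" for i
    unfolding w_def by (rule R.mat_op_pow_closed[OF U Yc[OF that]])
  have rw: "res_vec R P d (w i) = to_residue R P s \<odot>\<^bsub>?V\<^esub> ?T (y i)" if i: "i < m" for i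
  proof -
    have "res_vec R P d (w i) = ?T (res_vec R P d (Y i))"
      unfolding w_def by (rule P.res_vec_mat_op_pow[OF U Yc[OF i]])
    also have "\<dots> = ?T (to_residue R P s \<odot>\<^bsub>?V\<^esub> y i)" using Y i by simp
    also have "\<dots> = to_residue R P s \<odot>\<^bsub>?V\<^esub> ?T (y i)"
      by (rule V.pow_smult[OF su(1)]) (use y i in blast)
    finally show ?thesis .
  qed
  have Ty: "?T (y i) \<in> carrier ?V" if "i < m" for i using V.pow_closed y that by blast
  have "lin_indep P.\<kappa> ?V {..<m} (\<lambda>i. res_vec R P d (w i))"
    unfolding lin_indep_def
  proof (intro allI impI ballI)
    fix a i assume a: "\<forall>i\<in>{..<m}. a i \<in> carrier P.\<kappa>" and i: "i \<in> {..<m}"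
      and z: "(\<Oplus>\<^bsub>?V\<^esub>i\<in>{..<m}. a i \<odot>\<^bsub>?V\<^esub> res_vec R P d (w i)) = \<zero>\<^bsub>?V\<^esub>"
    have "(\<Oplus>\<^bsub>?V\<^esub>i\<in>{..<m}. (a i \<otimes>\<^bsub>P.\<kappa>\<^esub> to_residue R P s) \<odot>\<^bsub>?V\<^esub> ?T (y i)) =
        (\<Oplus>\<^bsub>?V\<^esub>i\<in>{..<m}. a i \<odot>\<^bsub>?V\<^esub> res_vec R P d (w i))"
    proof (rule V.M.finsum_cong'[OF refl])
      show "(\<lambda>i. a i \<odot>\<^bsub>?V\<^esub> res_vec R P d (w i)) \<in> {..<m} \<rightarrow> carrier ?V"
        using a by (intro funcsetI V.smult_closed P.res_vec_closed wc) auto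
      fix i assume i: "i \<in> {..<m}"
      then have "i < m" by simp
      show "(a i \<otimes>\<^bsub>P.\<kappa>\<^esub> to_residue R P s) \<odot>\<^bsub>?V\<^esub> ?T (y i) = a i \<odot>\<^bsub>?V\<^esub> res_vec R P d (w i)"
        unfolding rw[OF \<open>i < m\<close>] by (rule V.smult_assoc1[OF a[rule_format, OF i] su(1) Ty[OF \<open>i < m\<close>]])
    qed
    then have "a i \<otimes>\<^bsub>P.\<kappa>\<^esub> to_residue R P s = \<zero>\<^bsub>P.\<kappa>\<^esub>"
      using a su(1) i z by (intro lin_indepD[OF y(2), of "\<lambda>i. a i \<otimes>\<^bsub>P.\<kappa>\<^esub> to_residue R P s"]) auto
    then show "a i = \<zero>\<^bsub>P.\<kappa>\<^esub>" using P.K.integral su a i by blast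
  qed
  then have ind: "indep_mod R P d m w" using P.indep_mod_iff_lin_indep[where w = w and m = m and d = d, OF wc] by blast
  have wl: "w i l \<in> carrier R" if "i < m" "l < d" for i l using wc[OF that(1)] that(2) by auto
  from R.indep_mod_open[OF P wl ind] obtain f where f: "f \<in> carrier R - P"
    "\<forall>Q. primeideal Q R \<longrightarrow> f \<notin> Q \<longrightarrow> indep_mod R Q d m w" by (rule bexE)
  have "rank_at_least (residue_field R Q) (vec_space (residue_field R Q) d)
      (mat_op (residue_field R Q) d (res_mat R Q U) ^^ e) m" if Q: "primeideal Q R" "f \<notin> Q" for Q
  proof -
    interpret Q: prime_point Q R by (intro prime_point.intro Q(1))
    have "indep_mod R Q d m w" using f(2) Q by blast
    then have "lin_indep Q.\<kappa> (vec_space Q.\<kappa> d) {..<m} (\<lambda>i. res_vec R Q d (w i))"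
      using Q.indep_mod_iff_lin_indep[where w = w and m = m and d = d, OF wc] by blast
    then have "lin_indep Q.\<kappa> (vec_space Q.\<kappa> d) {..<m}
        (\<lambda>i. (mat_op Q.\<kappa> d (res_mat R Q U) ^^ e) (res_vec R Q d (Y i)))"
    proof (rule vector_space_rec.lin_indep_cong[OF Q.K.vec_space_vector_space])
      fix i assume "i \<in> {..<m}"
      then have i: "i < m" by simp
      show "res_vec R Q d (w i) = (mat_op Q.\<kappa> d (res_mat R Q U) ^^ e) (res_vec R Q d (Y i))"
        unfolding w_def by (rule Q.res_vec_mat_op_pow[OF U Yc[OF i]])
      then show "(mat_op Q.\<kappa> d (res_mat R Q U) ^^ e) (res_vec R Q d (Y i)) \<in> carrier (vec_space Q.\<kappa> d)"
        using Q.res_vec_closed[OF wc[OF i]] by simp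
    qed
    then show ?thesis unfolding rank_at_least_def
      using Q.res_vec_closed[OF Yc] by (intro exI[of _ "\<lambda>i. res_vec R Q d (Y i)"]) simp
  qed
  then show ?thesis using f(1) by blast
qed

text \<open>
  A matrix over \<open>R\<close> is regarded as a family of operators over the residue fields,
  parametrised by \<open>Spec R\<close>; its nilpotency over \<open>R\<close> gives Jordan forms with
  blocks of size at most \<open>p\<close> at all points.
\<close>

locale nilpotent_matrix = cring R for R :: "('k, 'a, 'm) module_scheme" (structure) +
  fixes d p :: nat and U :: "nat \<Rightarrow> nat \<Rightarrow> 'a"
  assumes entries: "\<And>i j. i < d \<Longrightarrow> j < d \<Longrightarrow> U i j \<in> carrier R"
    and nilpotent: "\<And>x. x \<in> {..<d} \<rightarrow>\<^sub>E carrier R \<Longrightarrow> (mat_op R d U ^^ p) x = (\<lambda>l\<in>{..<d}. \<zero>)"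
begin

abbreviation "jt P \<equiv> jordan_type (residue_field R P) d (res_mat R P U)"

lemma jordan_form_at:
  assumes P: "primeideal P R"
  shows "\<exists>ns. set ns \<subseteq> {1..p} \<and> sum_list ns = d \<and> jt P = count_list ns \<and>
    similar_matrices (residue_field R P) d (res_mat R P U) (jordan_matrix (residue_field R P) ns)"
proof -
  interpret P: prime_point P R by (intro prime_point.intro P)
  obtain ns where ns: "set ns \<subseteq> {1..p}" "sum_list ns = d"
    "similar_matrices P.\<kappa> d (res_mat R P U) (jordan_matrix P.\<kappa> ns)"
    using P.K.nilpotent_jordan_form[OF P.res_mat_closed[where d = d and U = U, OF entries]
      P.res_nilpotent[where d = d and U = U and e = p, OF entries nilpotent]]
    by blast
  have z: "0 \<notin> set ns" using ns(1) by auto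
  have "jt P = count_list ns"
    by (rule P.K.jordan_type_eq[OF P.res_mat_closed[where d = d and U = U, OF entries] z ns(2,3)])
  then show ?thesis using ns by blast
qed

text \<open>
  Over the residue field at the image point choose a Jordan form; it remains one over the extension
  field.
\<close>

lemma jt_extension:
  fixes R' :: "('l, 'b, 'n) module_scheme"
  assumes f: "f \<in> ring_hom R R'" and "cring R'" and P': "primeideal P' R'"
  shows "jordan_type (residue_field R' P') d (res_mat R' P' (\<lambda>i j. f (U i j))) = jt (spec_map f R P')"
proof -
  interpret R': cring R' by fact
  interpret P': prime_point P' R' by (intro prime_point.intro P')
  have P: "primeideal (spec_map f R P') R"
    unfolding spec_map_def
    by (rule ring_hom_ring.primeideal_vimage[OF ring_hom_ringI2[OF ring_axioms R'.ring_axioms f] is_cring P'])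
  interpret P: prime_point "spec_map f R P'" R by (intro prime_point.intro P)
  obtain ns where ns: "set ns \<subseteq> {1..p}" "sum_list ns = d" "jt (spec_map f R P') = count_list ns"
    "similar_matrices P.\<kappa> d (res_mat R (spec_map f R P') U) (jordan_matrix P.\<kappa> ns)"
    using jordan_form_at[OF P] by blast
  have z: "0 \<notin> set ns" using ns(1) by auto
  note rm = residue_map_hom[OF f is_cring R'.is_cring P' refl]
  have fU: "f (U i j) \<in> carrier R'" if "i < d" "j < d" for i j
    using f entries that by (auto simp: ring_hom_def)
  have "similar_matrices P'.\<kappa> d (\<lambda>i j. residue_map R' P' f (res_mat R (spec_map f R P') U i j))
      (jordan_matrix P'.\<kappa> ns)"
    by (rule similar_jordan_hom[OF P.residue_field_field P'.residue_field_field rm(1)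
          P.res_mat_closed[where d = d and U = U, OF entries] ns(4)])
  then have "similar_matrices P'.\<kappa> d (res_mat R' P' (\<lambda>i j. f (U i j))) (jordan_matrix P'.\<kappa> ns)"
  proof (rule similar_matrices_mono[OF P'.residue_field_field, rotated 2])
    fix i j assume "i < d" "j < d"
    then show "residue_map R' P' f (res_mat R (spec_map f R P') U i j) = res_mat R' P' (\<lambda>i j. f (U i j)) i j"
      unfolding res_mat_def by (intro rm(2) entries)
  qed (use P'.res_mat_closed[where d = d and U = "\<lambda>i j. f (U i j)", OF fU] in blast)
  then show ?thesis
    using P'.K.jordan_type_eq[OF P'.res_mat_closed[where d = d and U = "\<lambda>i j. f (U i j)", OF fU] z ns(2)] ns(3) by simp
qed

lemma jt_in_jordan_types:
  assumes "primeideal P R" shows "jt P \<in> jordan_types p"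
proof -
  obtain ns where "set ns \<subseteq> {1..p}" "jt P = count_list ns" using jordan_form_at[OF assms] by blast
  then show ?thesis by (auto simp: jordan_types_def count_list_0_iff)
qed

text \<open>
  Ranks can only drop under specialisation: near \<open>P\<close> all ranks of powers are at least those
  at \<open>P\<close>, so the Jordan types near \<open>P\<close> are above the one at \<open>P\<close>,
  and open sets of Jordan types are closed upwards. Only the powers below \<open>p\<close> matter, so
  finitely many open conditions suffice.
\<close>

lemma jt_continuous:
  assumes W: "openin (jt_topology p) W"
  shows "openin (zariski R) {P \<in> Spec R. jt P \<in> W}"
proof -
  let ?Z = "{P \<in> Spec R. jt P \<in> W}"
  let ?S = "{f \<in> carrier R. \<forall>Q\<in>Spec R. f \<notin> Q \<longrightarrow> Q \<in> ?Z}"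
  have "\<exists>f\<in>?S. f \<notin> P" if P: "P \<in> ?Z" for P
  proof -
    have pP: "primeideal P R" using P by (simp add: Spec_def)
    interpret P: prime_point P R by (intro prime_point.intro pP)
    obtain ns where ns: "set ns \<subseteq> {1..p}" "sum_list ns = d" "jt P = count_list ns"
      "similar_matrices P.\<kappa> d (res_mat R P U) (jordan_matrix P.\<kappa> ns)"
      using jordan_form_at[OF pP] by blast
    define rk where "rk = (\<lambda>Q i m. rank_at_least (residue_field R Q) (vec_space (residue_field R Q) d)
      (mat_op (residue_field R Q) d (res_mat R Q U) ^^ i) m)"
    have "\<exists>f\<in>carrier R - P. \<forall>Q. primeideal Q R \<longrightarrow> f \<notin> Q \<longrightarrow> (\<forall>i<n. rk Q i (\<Sum>m\<leftarrow>ns. m - i))" for n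
    proof (induction n)
      case 0
      then show ?case using P.one_notin by auto
    next
      case (Suc n)
      then obtain f where f: "f \<in> carrier R - P"
        "\<And>Q. primeideal Q R \<Longrightarrow> f \<notin> Q \<Longrightarrow> \<forall>i<n. rk Q i (\<Sum>m\<leftarrow>ns. m - i)" by blast
      have "rk P n (\<Sum>m\<leftarrow>ns. m - n)"
        unfolding rk_def by (subst P.K.similar_jordan_rank[OF P.res_mat_closed[where d = d and U = U, OF entries] ns(2,4)]) simp_all
      from rank_open[where d = d and U = U, OF is_cring pP entries this[unfolded rk_def]] obtain g where g: "g \<in> carrier R - P"
        "\<And>Q. primeideal Q R \<Longrightarrow> g \<notin> Q \<Longrightarrow> rk Q n (\<Sum>m\<leftarrow>ns. m - n)"
        unfolding rk_def by blast
      have "\<forall>i<Suc n. rk Q i (\<Sum>m\<leftarrow>ns. m - i)" if Q: "primeideal Q R" and fg: "f \<otimes> g \<notin> Q" for Q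
      proof -
        interpret Q: primeideal Q R by fact
        have "f \<notin> Q" using fg Q.I_r_closed[of f g] g(1) by blast
        moreover have "g \<notin> Q" using fg Q.I_l_closed[of g f] f(1) by blast
        ultimately show ?thesis using f(2)[OF Q] g(2)[OF Q] less_Suc_eq by auto
      qed
      moreover have "f \<otimes> g \<in> carrier R - P" by (intro P.prod_notin f(1) g(1))
      ultimately show ?case by blast
    qed
    then obtain f where f: "f \<in> carrier R - P"
      "\<And>Q. primeideal Q R \<Longrightarrow> f \<notin> Q \<Longrightarrow> \<forall>i<p. rk Q i (\<Sum>m\<leftarrow>ns. m - i)" by blast
    have "Q \<in> ?Z" if Q: "Q \<in> Spec R" "f \<notin> Q" for Q
    proof -
      have pQ: "primeideal Q R" using Q by (simp add: Spec_def)
      interpret Q: prime_point Q R by (intro prime_point.intro pQ)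
      obtain ms where ms: "set ms \<subseteq> {1..p}" "sum_list ms = d" "jt Q = count_list ms"
        "similar_matrices Q.\<kappa> d (res_mat R Q U) (jordan_matrix Q.\<kappa> ms)"
        using jordan_form_at[OF pQ] by blast
      have "(\<Sum>m\<leftarrow>ns. m - i) \<le> (\<Sum>m\<leftarrow>ms. m - i)" for i
      proof (cases "i < p")
        case True
        then have "rk Q i (\<Sum>m\<leftarrow>ns. m - i)" using f(2)[OF pQ Q(2)] by blast
        then show ?thesis
          unfolding rk_def
          by (subst (asm) Q.K.similar_jordan_rank[OF Q.res_mat_closed[where d = d and U = U, OF entries] ms(2,4)])
      next
        case False
        then have "(\<Sum>m\<leftarrow>ns. m - i) = 0" using ns(1) by (auto simp: sum_list_eq_0_iff)
        then show ?thesis by (simp only: zero_le)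
      qed
      then have "jt_le p (jt P) (jt Q)" unfolding ns(3) ms(3) by (rule jt_le_if_ranks_le[OF ns(1) ms(1)])
      then have "jt Q \<in> W"
        using W P jt_in_jordan_types[OF pP] jt_in_jordan_types[OF pQ] unfolding openin_jt_topology by blast
      then show ?thesis using Q by simp
    qed
    then show ?thesis using f(1) by blast
  qed
  then have "?Z = {P \<in> Spec R. \<not> ?S \<subseteq> P}" by blast
  moreover have "?S \<subseteq> carrier R" by blast
  ultimately show ?thesis unfolding openin_zariski by blast
qed

end

section \<open>The binomial theorem and Frobenius\<close>

lemma (in ring) binomial_theorem:
  assumes x: "x \<in> carrier R" and y: "y \<in> carrier R" and xy: "x \<otimes> y = y \<otimes> x"
  shows "(x \<oplus> y) [^] n = (\<Oplus>i\<in>{..n}. [(n choose i)] \<cdot> (x [^] i \<otimes> y [^] (n - i)))"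
proof (induction n)
  case 0
  show ?case using x y by simp
next
  case (Suc n)
  define t where "t = (\<lambda>(c :: nat) i j. [c] \<cdot> (x [^] (i :: nat) \<otimes> y [^] (j :: nat)))"
  have t: "t c i j \<in> carrier R" for c :: nat and i j using x y by (simp add: t_def)
  have tadd: "t (c + c') i j = t c i j \<oplus> t c' i j" for c c' :: nat and i j
    using x y by (simp add: t_def add.nat_pow_mult)
  have yx: "y [^] j \<otimes> x = x \<otimes> y [^] j" for j :: nat
  proof (induction j)
    case (Suc j)
    have "y [^] Suc j \<otimes> x = y [^] j \<otimes> (x \<otimes> y)" using x y by (simp add: m_assoc xy)
    also have "\<dots> = (x \<otimes> y [^] j) \<otimes> y" using x y Suc by (simp add: m_assoc[symmetric])
    finally show ?case using x y by (simp add: m_assoc)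
  qed (use x y in simp)
  have tx: "t c i j \<otimes> x = t c (Suc i) j" for c :: nat and i j
  proof -
    have "x [^] i \<otimes> y [^] j \<otimes> x = x [^] Suc i \<otimes> y [^] j" using x y by (simp add: m_assoc yx)
    then show ?thesis using x y by (simp add: t_def add_pow_ldistr)
  qed
  have ty: "t c i j \<otimes> y = t c i (Suc j)" for c :: nat and i j
    using x y by (simp add: t_def add_pow_ldistr m_assoc)
  have IH: "(x \<oplus> y) [^] n = (\<Oplus>i\<in>{..n}. t (n choose i) i (n - i))" using Suc by (simp add: t_def)
  have A: "(x \<oplus> y) [^] n \<otimes> x = (\<Oplus>i\<in>{..n}. t (n choose i) (Suc i) (n - i))"
  proof -
    have "(x \<oplus> y) [^] n \<otimes> x = (\<Oplus>i\<in>{..n}. t (n choose i) i (n - i) \<otimes> x)"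
      unfolding IH using x t by (intro finsum_ldistr) auto
    then show ?thesis by (simp add: tx)
  qed
  have B: "(x \<oplus> y) [^] n \<otimes> y = (\<Oplus>i\<in>{..n}. t (n choose Suc i) (Suc i) (n - i)) \<oplus> t 1 0 (Suc n)"
  proof -
    let ?g = "\<lambda>i. t (n choose i) i (Suc n - i)"
    have "(x \<oplus> y) [^] n \<otimes> y = (\<Oplus>i\<in>{..n}. t (n choose i) i (n - i) \<otimes> y)"
      unfolding IH using y t by (intro finsum_ldistr) auto
    also have "\<dots> = finsum R ?g {..n}" using t by (intro finsum_cong') (auto simp: ty Suc_diff_le)
    also have "\<dots> = finsum R ?g {..Suc n}"
    proof -
      have "?g (Suc n) = \<zero>" using x y by (simp add: t_def binomial_eq_0)
      then show ?thesis using t by simp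
    qed
    also have "\<dots> = (\<Oplus>i\<in>{..n}. ?g (Suc i)) \<oplus> ?g 0" using t by (intro finsum_Suc2) auto
    finally show ?thesis by simp
  qed
  have "(x \<oplus> y) [^] Suc n = (x \<oplus> y) [^] n \<otimes> x \<oplus> (x \<oplus> y) [^] n \<otimes> y"
    using x y by (simp add: r_distr)
  also have "\<dots> = ((\<Oplus>i\<in>{..n}. t (n choose i) (Suc i) (n - i)) \<oplus>
      (\<Oplus>i\<in>{..n}. t (n choose Suc i) (Suc i) (n - i))) \<oplus> t 1 0 (Suc n)"
    unfolding A B using t by (intro a_assoc[symmetric]) auto
  also have "(\<Oplus>i\<in>{..n}. t (n choose i) (Suc i) (n - i)) \<oplus> (\<Oplus>i\<in>{..n}. t (n choose Suc i) (Suc i) (n - i))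
      = (\<Oplus>i\<in>{..n}. t (n choose i) (Suc i) (n - i) \<oplus> t (n choose Suc i) (Suc i) (n - i))"
    using t by (intro finsum_addf[symmetric]) auto
  also have "\<dots> = (\<Oplus>i\<in>{..n}. t (Suc n choose Suc i) (Suc i) (n - i))"
    using t by (intro finsum_cong') (auto simp flip: tadd)
  also have "\<dots> \<oplus> t 1 0 (Suc n) = (\<Oplus>i\<in>{..Suc n}. t (Suc n choose i) i (Suc n - i))"
    using t finsum_Suc2[of "\<lambda>i. t (Suc n choose i) i (Suc n - i)" n] by simp
  finally show ?case by (simp add: t_def)
qed

lemma (in ring) char_mult_zero:
  assumes p: "[(p :: nat)] \<cdot> \<one> = \<zero>" and x: "x \<in> carrier R" and "p dvd n"
  shows "[(n :: nat)] \<cdot> x = \<zero>"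
proof -
  have px: "[p] \<cdot> x = \<zero>" using add_pow_ldistr[of \<one> x p] x p by simp
  obtain m where "n = p * m" using assms(3) by blast
  then have "[n] \<cdot> x = [m] \<cdot> ([p] \<cdot> x)" using x by (simp add: add.nat_pow_pow)
  then show ?thesis using px by simp
qed

lemma (in ring) frobenius_commute:
  assumes x: "x \<in> carrier R" and y: "y \<in> carrier R" and xy: "x \<otimes> y = y \<otimes> x"
    and p: "Factorial_Ring.prime (p :: nat)" "[p] \<cdot> \<one> = \<zero>"
  shows "(x \<oplus> y) [^] p = x [^] p \<oplus> y [^] p"
proof -
  let ?t = "\<lambda>i. [(p choose i)] \<cdot> (x [^] i \<otimes> y [^] (p - i))"
  have p0: "0 < p" using p(1) by (simp add: prime_gt_0_nat)
  have cl: "?t i \<in> carrier R" for i using x y by simp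
  have "(x \<oplus> y) [^] p = (\<Oplus>i\<in>{..p}. ?t i)" by (rule binomial_theorem[OF x y xy])
  also have "\<dots> = (\<Oplus>i\<in>{0, p}. ?t i)"
  proof (rule finsum_mono_neutral[symmetric])
    fix i assume "i \<in> {..p} - {0, p}"
    then have "p dvd (p choose i)" using p(1) by (intro dvd_choose_prime) auto
    then show "?t i = \<zero>" using x y by (intro char_mult_zero[OF p(2)]) auto
  qed (use cl in auto)
  also have "\<dots> = ?t 0 \<oplus> (\<Oplus>i\<in>{p}. ?t i)" using x y p0 by (intro finsum_insert) auto
  also have "(\<Oplus>i\<in>{p}. ?t i) = ?t p \<oplus> (\<Oplus>i\<in>{}. ?t i)" using x y by (intro finsum_insert) auto
  also have "?t 0 \<oplus> (?t p \<oplus> (\<Oplus>i\<in>{}. ?t i)) = x [^] p \<oplus> y [^] p"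
    using x y by (simp add: a_comm)
  finally show ?thesis .
qed

lemma (in cring) frobenius_add:
  assumes x: "x \<in> carrier R" and y: "y \<in> carrier R"
    and p: "Factorial_Ring.prime (p :: nat)" "[p] \<cdot> \<one> = \<zero>"
  shows "(x \<oplus> y) [^] (p ^ r) = x [^] (p ^ r) \<oplus> y [^] (p ^ r)"
proof (induction r)
  case (Suc r)
  have e: "z [^] (p ^ Suc r) = (z [^] (p ^ r)) [^] p" if "z \<in> carrier R" for z
    using that by (simp add: nat_pow_pow mult.commute)
  show ?case using x y Suc by (simp add: e frobenius_commute m_comm p del: power_Suc)
qed (use x y in simp)

text \<open>
  The \<open>p\<close>-th power is additive on commuting elements, as \<open>p\<close> divides the inner
  binomial coefficients.
\<close>

lemma (in ring) sum_commuting_nilpotent: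
  assumes "finite S" "\<And>s. s \<in> S \<Longrightarrow> x s \<in> carrier R" "\<And>s. s \<in> S \<Longrightarrow> x s [^] p = \<zero>"
    and "\<And>s t. s \<in> S \<Longrightarrow> t \<in> S \<Longrightarrow> x s \<otimes> x t = x t \<otimes> x s"
    and p: "Factorial_Ring.prime (p :: nat)" "[p] \<cdot> \<one> = \<zero>"
  shows "(\<Oplus>s\<in>S. x s) [^] p = \<zero>"
  using assms(1-4)
proof (induction S)
  case empty
  show ?case using p(1) by (simp add: nat_pow_zero prime_gt_0_nat)
next
  case (insert s S)
  have m: "x s \<in> carrier R" "\<And>t. t \<in> S \<Longrightarrow> x t \<in> carrier R" using insert.prems(1) by auto
  have S: "(\<Oplus>s\<in>S. x s) \<in> carrier R" using m by (intro finsum_closed) auto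
  have "x s \<otimes> (\<Oplus>t\<in>S. x t) = (\<Oplus>t\<in>S. x s \<otimes> x t)"
    using m insert.hyps by (intro finsum_rdistr) auto
  also have "\<dots> = (\<Oplus>t\<in>S. x t \<otimes> x s)"
    using m insert.prems(3)[of s] by (intro finsum_cong') auto
  also have "\<dots> = (\<Oplus>t\<in>S. x t) \<otimes> x s"
    using m insert.hyps by (intro finsum_ldistr[symmetric]) auto
  finally have c: "x s \<otimes> (\<Oplus>t\<in>S. x t) = (\<Oplus>t\<in>S. x t) \<otimes> x s" .
  have "(\<Oplus>s\<in>insert s S. x s) = x s \<oplus> (\<Oplus>s\<in>S. x s)" using insert m by (intro finsum_insert) auto
  moreover have "(\<Oplus>s\<in>S. x s) [^] p = \<zero>" using insert by auto
  moreover have "x s [^] p = \<zero>" using insert.prems(2) by simp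
  ultimately show ?case using frobenius_commute[OF m(1) S c p] by simp
qed

section \<open>Endomorphisms of an abelian group\<close>

definition End_ring :: "('v, 'm) ring_scheme \<Rightarrow> ('v \<Rightarrow> 'v) ring" where
  "End_ring V = \<lparr>carrier = {f \<in> carrier V \<rightarrow>\<^sub>E carrier V. \<forall>x\<in>carrier V. \<forall>y\<in>carrier V.
       f (x \<oplus>\<^bsub>V\<^esub> y) = f x \<oplus>\<^bsub>V\<^esub> f y},
     monoid.mult = compose (carrier V), one = (\<lambda>x\<in>carrier V. x),
     zero = (\<lambda>x\<in>carrier V. \<zero>\<^bsub>V\<^esub>), add = (\<lambda>f g. \<lambda>x\<in>carrier V. f x \<oplus>\<^bsub>V\<^esub> g x)\<rparr>"

lemma End_ring_simps:
  "f \<in> carrier (End_ring V) \<longleftrightarrow> f \<in> carrier V \<rightarrow>\<^sub>E carrier V \<and> (\<forall>x\<in>carrier V. \<forall>y\<in>carrier V.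
       f (x \<oplus>\<^bsub>V\<^esub> y) = f x \<oplus>\<^bsub>V\<^esub> f y)"
  "f \<otimes>\<^bsub>End_ring V\<^esub> g = compose (carrier V) f g" "\<one>\<^bsub>End_ring V\<^esub> = (\<lambda>x\<in>carrier V. x)"
  "\<zero>\<^bsub>End_ring V\<^esub> = (\<lambda>x\<in>carrier V. \<zero>\<^bsub>V\<^esub>)"
  "f \<oplus>\<^bsub>End_ring V\<^esub> g = (\<lambda>x\<in>carrier V. f x \<oplus>\<^bsub>V\<^esub> g x)"
  by (simp_all add: End_ring_def)

lemma End_ring_eqI:
  assumes "f \<in> A \<rightarrow>\<^sub>E B" "g \<in> A \<rightarrow>\<^sub>E B" "\<And>x. x \<in> A \<Longrightarrow> f x = g x"
  shows "f = g"
  using assms by (intro extensionalityI[of _ A]) (auto simp: PiE_def)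

lemma (in abelian_group) End_ring_ring: "ring (End_ring G)"
proof -
  let ?E = "End_ring G"
  have mem: "f x \<in> carrier G" if "f \<in> carrier ?E" "x \<in> carrier G" for f x
    using that by (auto simp: End_ring_simps)
  have hom: "f (x \<oplus> y) = f x \<oplus> f y" if "f \<in> carrier ?E" "x \<in> carrier G" "y \<in> carrier G" for f x y
    using that by (auto simp: End_ring_simps)
  have ext: "f = g" if "f \<in> carrier ?E" "g \<in> carrier ?E" "\<And>x. x \<in> carrier G \<Longrightarrow> f x = g x" for f g
    using that by (intro End_ring_eqI[of f "carrier G" "carrier G" g]) (auto simp: End_ring_simps)
  have add: "f \<oplus>\<^bsub>?E\<^esub> g \<in> carrier ?E" if "f \<in> carrier ?E" "g \<in> carrier ?E" for f g
    unfolding End_ring_simps(1,5)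
    by (auto simp: mem hom that a_ac)
  have mul: "f \<otimes>\<^bsub>?E\<^esub> g \<in> carrier ?E" if "f \<in> carrier ?E" "g \<in> carrier ?E" for f g
    unfolding End_ring_simps(1,2)
    by (auto simp: mem hom that compose_def)
  have zero: "\<zero>\<^bsub>?E\<^esub> \<in> carrier ?E" and one: "\<one>\<^bsub>?E\<^esub> \<in> carrier ?E"
    by (auto simp: End_ring_simps)
  have addx: "(f \<oplus>\<^bsub>?E\<^esub> g) x = f x \<oplus> g x" and mulx: "(f \<otimes>\<^bsub>?E\<^esub> g) x = f (g x)"
    and zerox: "\<zero>\<^bsub>?E\<^esub> x = \<zero>" and onex: "\<one>\<^bsub>?E\<^esub> x = x"
    if "x \<in> carrier G" for f g x using that by (simp_all add: End_ring_simps compose_def)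
  show ?thesis
  proof (rule ringI)
    show "abelian_group ?E"
    proof (rule abelian_groupI)
      fix f g h assume m: "f \<in> carrier ?E" "g \<in> carrier ?E" "h \<in> carrier ?E"
      show "f \<oplus>\<^bsub>?E\<^esub> g \<in> carrier ?E" using m(1,2) by (rule add)
      show "f \<oplus>\<^bsub>?E\<^esub> g \<oplus>\<^bsub>?E\<^esub> h = f \<oplus>\<^bsub>?E\<^esub> (g \<oplus>\<^bsub>?E\<^esub> h)"
        by (rule ext) (use m in \<open>simp_all add: add addx mem a_assoc\<close>)
      show "f \<oplus>\<^bsub>?E\<^esub> g = g \<oplus>\<^bsub>?E\<^esub> f" by (rule ext) (use m in \<open>simp_all add: add addx mem a_comm\<close>)
    next
      fix f assume m: "f \<in> carrier ?E"
      show "\<zero>\<^bsub>?E\<^esub> \<oplus>\<^bsub>?E\<^esub> f = f" by (rule ext) (use m zero in \<open>simp_all add: add addx zerox mem\<close>)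
      have n: "(\<lambda>x\<in>carrier G. \<ominus> f x) \<in> carrier ?E"
        unfolding End_ring_simps(1) by (auto simp: mem[OF m] hom[OF m] minus_add)
      have "(\<lambda>x\<in>carrier G. \<ominus> f x) \<oplus>\<^bsub>?E\<^esub> f = \<zero>\<^bsub>?E\<^esub>"
        by (rule ext) (use m n zero in \<open>simp_all add: add addx zerox mem l_neg\<close>)
      then show "\<exists>g\<in>carrier ?E. g \<oplus>\<^bsub>?E\<^esub> f = \<zero>\<^bsub>?E\<^esub>" using n by blast
    qed (rule zero)
    show "monoid ?E"
    proof (rule monoidI)
      fix f g h assume m: "f \<in> carrier ?E" "g \<in> carrier ?E" "h \<in> carrier ?E"
      show "f \<otimes>\<^bsub>?E\<^esub> g \<in> carrier ?E" using m(1,2) by (rule mul)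
      show "f \<otimes>\<^bsub>?E\<^esub> g \<otimes>\<^bsub>?E\<^esub> h = f \<otimes>\<^bsub>?E\<^esub> (g \<otimes>\<^bsub>?E\<^esub> h)"
        by (rule ext) (use m in \<open>simp_all add: mul mulx mem\<close>)
    next
      fix f assume m: "f \<in> carrier ?E"
      show "\<one>\<^bsub>?E\<^esub> \<otimes>\<^bsub>?E\<^esub> f = f" by (rule ext) (use m one in \<open>simp_all add: mul mulx onex mem\<close>)
      show "f \<otimes>\<^bsub>?E\<^esub> \<one>\<^bsub>?E\<^esub> = f" by (rule ext) (use m one in \<open>simp_all add: mul mulx onex mem\<close>)
    qed (rule one)
    fix f g h assume m: "f \<in> carrier ?E" "g \<in> carrier ?E" "h \<in> carrier ?E"
    show "(f \<oplus>\<^bsub>?E\<^esub> g) \<otimes>\<^bsub>?E\<^esub> h = f \<otimes>\<^bsub>?E\<^esub> h \<oplus>\<^bsub>?E\<^esub> g \<otimes>\<^bsub>?E\<^esub> h"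
      by (rule ext) (use m in \<open>simp_all add: mul add mulx addx mem\<close>)
    show "h \<otimes>\<^bsub>?E\<^esub> (f \<oplus>\<^bsub>?E\<^esub> g) = h \<otimes>\<^bsub>?E\<^esub> f \<oplus>\<^bsub>?E\<^esub> h \<otimes>\<^bsub>?E\<^esub> g"
      by (rule ext) (use m in \<open>simp_all add: mul add mulx addx mem hom\<close>)
  qed
qed

section \<open>Algebras in the universe\<close>

text \<open>
  Algebras built from polynomial rings and quotients live in other types; the injection transports their
  structure.
\<close>

lemma algebra_copy:
  fixes B :: "('b, 'm) ring_scheme" and \<iota> :: "'b \<Rightarrow> 'u"
  assumes k: "cring k" and B: "cring B" and e: "e \<in> ring_hom k B" and inj: "inj_on \<iota> (carrier B)"
  shows "\<exists>A :: ('k, 'u) module. algebra k A \<and> \<iota> \<in> ring_hom B A \<and>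
    (\<forall>c\<in>carrier k. \<forall>x\<in>carrier B. c \<odot>\<^bsub>A\<^esub> \<iota> x = \<iota> (e c \<otimes>\<^bsub>B\<^esub> x)) \<and> \<zero>\<^bsub>A\<^esub> = \<iota> \<zero>\<^bsub>B\<^esub>"
proof -
  interpret k: cring k by fact
  interpret B: cring B by fact
  interpret e: ring_hom_cring k B e
    by (intro ring_hom_cring.intro ring_hom_cring_axioms.intro k B e)
  define g where "g = the_inv_into (carrier B) \<iota>"
  have g: "g (\<iota> x) = x" if "x \<in> carrier B" for x
    unfolding g_def using inj that by (rule the_inv_into_f_f)
  define A where "A = \<lparr>carrier = \<iota> ` carrier B, monoid.mult = (\<lambda>x y. \<iota> (g x \<otimes>\<^bsub>B\<^esub> g y)),
    one = \<iota> \<one>\<^bsub>B\<^esub>, zero = \<iota> \<zero>\<^bsub>B\<^esub>, add = (\<lambda>x y. \<iota> (g x \<oplus>\<^bsub>B\<^esub> g y)), smult = (\<lambda>c x. \<iota> (e c \<otimes>\<^bsub>B\<^esub> g x))\<rparr>"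
  have A: "carrier A = \<iota> ` carrier B" "\<one>\<^bsub>A\<^esub> = \<iota> \<one>\<^bsub>B\<^esub>" "\<zero>\<^bsub>A\<^esub> = \<iota> \<zero>\<^bsub>B\<^esub>"
    by (simp_all add: A_def)
  have ops: "\<iota> x \<otimes>\<^bsub>A\<^esub> \<iota> y = \<iota> (x \<otimes>\<^bsub>B\<^esub> y)" "\<iota> x \<oplus>\<^bsub>A\<^esub> \<iota> y = \<iota> (x \<oplus>\<^bsub>B\<^esub> y)"
    if "x \<in> carrier B" "y \<in> carrier B" for x y
    using that by (simp_all add: A_def g)
  have sm: "c \<odot>\<^bsub>A\<^esub> \<iota> x = \<iota> (e c \<otimes>\<^bsub>B\<^esub> x)" if "x \<in> carrier B" for c x
    using that by (simp add: A_def g)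
  have hom: "\<iota> \<in> ring_hom B A"
    by (rule ring_hom_memI) (simp_all add: A ops)
  have cr: "cring A"
  proof (rule cringI)
    show "abelian_group A"
    proof (rule abelian_groupI)
      show "\<exists>y\<in>carrier A. y \<oplus>\<^bsub>A\<^esub> x = \<zero>\<^bsub>A\<^esub>" if "x \<in> carrier A" for x
      proof -
        obtain b where b: "b \<in> carrier B" "x = \<iota> b" using \<open>x \<in> carrier A\<close> A by blast
        then have "\<iota> (\<ominus>\<^bsub>B\<^esub> b) \<oplus>\<^bsub>A\<^esub> x = \<zero>\<^bsub>A\<^esub>" using A by (simp add: ops B.l_neg)
        then show ?thesis using b A by blast
      qed
    qed (auto simp: A ops B.a_ac)
    show "comm_monoid A"
      by (rule comm_monoidI) (auto simp: A ops B.m_ac)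
  qed (auto simp: A ops B.l_distr)
  have "algebra k A"
    by (rule algebraI) (use k cr in \<open>auto simp: A ops sm B.l_distr B.r_distr B.m_assoc\<close>)
  then show ?thesis using hom sm A(3) by (intro exI[of _ A] conjI ballI) auto
qed

text \<open>
  This is how the universe absorbs truncated polynomials, which are lists of coefficients of fixed
  length.
\<close>

lemma infinite_list_inj:
  assumes "infinite (UNIV :: 'u set)"
  shows "\<exists>e :: 'u list \<Rightarrow> 'u. inj_on e {xs. length xs = n}"
proof (induction n)
  case 0
  then show ?case by (auto simp: inj_on_def)
next
  case (Suc n)
  then obtain e :: "'u list \<Rightarrow> 'u" where e: "inj_on e {xs. length xs = n}" by blast
  obtain f :: "'u \<times> 'u \<Rightarrow> 'u" where "bij_betw f (UNIV \<times> UNIV) UNIV"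
    using card_of_Times_same_infinite[OF assms] unfolding card_of_ordIso[symmetric] by blast
  then have f: "inj f" by (simp add: bij_betw_def)
  let ?e = "\<lambda>xs. f (hd xs, e (tl xs))"
  have "inj_on ?e {xs. length xs = Suc n}"
  proof (rule inj_onI)
    fix xs ys assume l: "xs \<in> {xs. length xs = Suc n}" "ys \<in> {xs. length xs = Suc n}"
      and eq: "?e xs = ?e ys"
    obtain x xs' where x: "xs = x # xs'" "length xs' = n" using l(1) by (cases xs) auto
    obtain y ys' where y: "ys = y # ys'" "length ys' = n" using l(2) by (cases ys) auto
    have "(x, e xs') = (y, e ys')" using injD[OF f eq] x y by simp
    then show "xs = ys" using inj_onD[OF e, of xs' ys'] x y by simp
  qed
  then show ?case by (intro exI[of _ ?e])
qed

text \<open>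
  This is a copy of \<open>A[t]/t^q\<close> in the universe, with \<open>\<alpha>\<close> the class of
  \<open>t\<close>. The independence of its powers below \<open>q\<close> allows coefficients to be
  compared in identities that are only known for values at \<open>\<alpha>\<close>.
\<close>

lemma truncated_extension:
  fixes A :: "('k, 'u) module" and q :: nat
  assumes A: "algebra k A" and inf: "infinite (UNIV :: 'u set)"
  shows "\<exists>(A' :: ('k, 'u) module) \<phi> \<alpha>. algebra k A' \<and> \<phi> \<in> alg_hom k A A' \<and> \<alpha> \<in> carrier A' \<and>
    \<alpha> [^]\<^bsub>A'\<^esub> q = \<zero>\<^bsub>A'\<^esub> \<and>
    (\<forall>x. (\<forall>a<q. x a \<in> carrier A) \<longrightarrow> (\<Oplus>\<^bsub>A'\<^esub>a\<in>{..<q}. \<phi> (x a) \<otimes>\<^bsub>A'\<^esub> \<alpha> [^]\<^bsub>A'\<^esub> a) = \<zero>\<^bsub>A'\<^esub> \<longrightarrow>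
      (\<forall>a<q. x a = \<zero>\<^bsub>A\<^esub>))"
proof -
  have kc: "cring k" and Ac: "cring A" using algebra.R_cring[OF A] algebra.M_cring[OF A] .
  interpret A1: cring A by (rule Ac)
  interpret A: algebra k A by fact
  define P where "P = UP A"
  interpret P: UP_cring A P by (intro UP_cring.intro Ac) (simp add: P_def)
  define J where "J = {f \<in> carrier P. \<forall>n<q. coeff P f n = \<zero>\<^bsub>A\<^esub>}"
  have "ideal J P"
  proof (rule idealI)
    show "ring P" by (rule P.UP_ring)
    show "subgroup J (add_monoid P)"
    proof (rule P.P.add.subgroupI)
      show "J \<subseteq> carrier P" by (auto simp: J_def)
      have "\<zero>\<^bsub>P\<^esub> \<in> J" by (simp add: J_def)
      then show "J \<noteq> {}" by blast
      show "\<ominus>\<^bsub>P\<^esub> f \<in> J" if "f \<in> J" for f using that by (simp add: J_def)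
      show "f \<oplus>\<^bsub>P\<^esub> g \<in> J" if "f \<in> J" "g \<in> J" for f g using that by (simp add: J_def)
    qed
    fix f g assume f: "f \<in> J" and g: "g \<in> carrier P"
    have "coeff P (g \<otimes>\<^bsub>P\<^esub> f) n = \<zero>\<^bsub>A\<^esub>" if "n < q" for n
    proof -
      have "coeff P (g \<otimes>\<^bsub>P\<^esub> f) n = (\<Oplus>\<^bsub>A\<^esub>i\<in>{..n}. coeff P g i \<otimes>\<^bsub>A\<^esub> coeff P f (n - i))"
        using f g by (simp add: J_def)
      also have "\<dots> = \<zero>\<^bsub>A\<^esub>" using f g that by (intro A1.add.finprod_one_eqI) (auto simp: J_def)
      finally show ?thesis .
    qed
    then show gf: "g \<otimes>\<^bsub>P\<^esub> f \<in> J" using f g by (simp add: J_def)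
    have "f \<otimes>\<^bsub>P\<^esub> g = g \<otimes>\<^bsub>P\<^esub> f" using f g by (intro P.UP_m_comm) (auto simp: J_def)
    then show "f \<otimes>\<^bsub>P\<^esub> g \<in> J" using gf by simp
  qed
  then interpret J: ideal J P .
  define B where "B = P Quot J"
  define \<pi> where "\<pi> = (\<lambda>f. J +>\<^bsub>P\<^esub> f)"
  have Bc: "cring B" unfolding B_def by (rule J.quotient_is_cring[OF P.UP_cring])
  interpret B: cring B by (rule Bc)
  have \<pi>: "\<pi> \<in> ring_hom P B" unfolding \<pi>_def B_def by (rule J.rcos_ring_hom)
  interpret \<pi>: ring_hom_cring P B \<pi>
    by (intro ring_hom_cring.intro ring_hom_cring_axioms.intro \<pi> P.UP_cring Bc)
  have eq: "\<pi> f = \<pi> g \<longleftrightarrow> f \<ominus>\<^bsub>P\<^esub> g \<in> J" if "f \<in> carrier P" "g \<in> carrier P" for f g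
    unfolding \<pi>_def using P.P.quotient_eq_iff_same_a_r_cos[OF J.ideal_axioms that] by simp
  have zeroB: "\<pi> f = \<zero>\<^bsub>B\<^esub> \<longleftrightarrow> f \<in> J" if f: "f \<in> carrier P" for f
  proof -
    have "\<pi> f = \<zero>\<^bsub>B\<^esub> \<longleftrightarrow> \<pi> f = \<pi> \<zero>\<^bsub>P\<^esub>" by simp
    also have "\<dots> \<longleftrightarrow> f \<ominus>\<^bsub>P\<^esub> \<zero>\<^bsub>P\<^esub> \<in> J" using f by (intro eq) auto
    finally show ?thesis using f by (simp add: a_minus_def)
  qed
  obtain e :: "'u list \<Rightarrow> 'u" where e: "inj_on e {xs. length xs = q}"
    using infinite_list_inj[OF inf] by blast
  define \<iota> where "\<iota> = (\<lambda>x. e (map (\<lambda>n. coeff P (SOME f. f \<in> x) n) [0..<q]))"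
  have rep: "(SOME f. f \<in> x) \<in> carrier P \<and> \<pi> (SOME f. f \<in> x) = x" if xB: "x \<in> carrier B" for x
  proof -
    obtain f where f: "f \<in> carrier P" "x = \<pi> f"
      using xB by (auto simp: B_def FactRing_def A_RCOSETS_def' \<pi>_def)
    have "f \<in> x" using J.a_rcos_self[OF f(1)] f(2) by (simp add: \<pi>_def)
    then have "(SOME f. f \<in> x) \<in> x" by (rule someI[of "\<lambda>f. f \<in> x"])
    then have s: "(SOME f. f \<in> x) \<in> J +>\<^bsub>P\<^esub> f" using f(2) by (simp add: \<pi>_def)
    have c: "(SOME f. f \<in> x) \<in> carrier P" using J.a_elemrcos_carrier[OF f(1) s] .
    have "J +>\<^bsub>P\<^esub> f = J +>\<^bsub>P\<^esub> (SOME f. f \<in> x)" by (rule P.P.a_repr_independence[OF s f(1) J.a_subgroup])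
    then show ?thesis using c f(2) by (simp add: \<pi>_def)
  qed
  have inj: "inj_on \<iota> (carrier B)"
  proof (rule inj_onI)
    fix x y assume x: "x \<in> carrier B" and y: "y \<in> carrier B" and xy: "\<iota> x = \<iota> y"
    define f where "f = (SOME f. f \<in> x)"
    define g where "g = (SOME f. f \<in> y)"
    have f: "f \<in> carrier P" "\<pi> f = x" and g: "g \<in> carrier P" "\<pi> g = y"
      using rep[OF x] rep[OF y] unfolding f_def g_def by blast+
    have "e (map (\<lambda>n. coeff P f n) [0..<q]) = e (map (\<lambda>n. coeff P g n) [0..<q])"
      using xy unfolding \<iota>_def f_def g_def .
    then have "map (\<lambda>n. coeff P f n) [0..<q] = map (\<lambda>n. coeff P g n) [0..<q]"
      by (rule inj_onD[OF e]) simp_all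
    then have cf: "coeff P f n = coeff P g n" if "n < q" for n using that by simp
    have "f \<ominus>\<^bsub>P\<^esub> g \<in> J"
      unfolding J_def
    proof (intro CollectI conjI allI impI)
      show "f \<ominus>\<^bsub>P\<^esub> g \<in> carrier P" using f(1) g(1) by simp
      fix n assume n: "n < q"
      show "coeff P (f \<ominus>\<^bsub>P\<^esub> g) n = \<zero>\<^bsub>A\<^esub>"
        unfolding P.coeff_minus[OF f(1) g(1)] cf[OF n] using P.coeff_closed[OF g(1)]
        by (simp add: a_minus_def A1.r_neg)
    qed
    then have "\<pi> f = \<pi> g" by (rule eq[OF f(1) g(1), THEN iffD2])
    then show "x = y" using f(2) g(2) by simp
  qed
  define \<epsilon> where "\<epsilon> = (\<lambda>c. \<pi> (monom P (c \<odot>\<^bsub>A\<^esub> \<one>\<^bsub>A\<^esub>) 0))"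
  have one_mult: "(c \<odot>\<^bsub>A\<^esub> \<one>\<^bsub>A\<^esub>) \<otimes>\<^bsub>A\<^esub> a = c \<odot>\<^bsub>A\<^esub> a" if "c \<in> carrier k" "a \<in> carrier A" for c a
    using that by (simp add: A.smult_assoc2)
  have mon: "monom P (a \<otimes>\<^bsub>A\<^esub> b) n = monom P a 0 \<otimes>\<^bsub>P\<^esub> monom P b n"
    if "a \<in> carrier A" "b \<in> carrier A" for a b n
    using P.monom_mult[OF that, of 0 n] by simp
  have "\<epsilon> \<in> ring_hom k B"
  proof (rule ring_hom_memI)
    fix a b assume ab: "a \<in> carrier k" "b \<in> carrier k"
    show "\<epsilon> a \<in> carrier B" using ab by (simp add: \<epsilon>_def)
    show "\<epsilon> (a \<oplus>\<^bsub>k\<^esub> b) = \<epsilon> a \<oplus>\<^bsub>B\<^esub> \<epsilon> b" using ab by (simp add: \<epsilon>_def A.smult_l_distr)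
    have "(a \<otimes>\<^bsub>k\<^esub> b) \<odot>\<^bsub>A\<^esub> \<one>\<^bsub>A\<^esub> = (a \<odot>\<^bsub>A\<^esub> \<one>\<^bsub>A\<^esub>) \<otimes>\<^bsub>A\<^esub> (b \<odot>\<^bsub>A\<^esub> \<one>\<^bsub>A\<^esub>)"
      using ab by (simp add: one_mult A.smult_assoc1)
    then show "\<epsilon> (a \<otimes>\<^bsub>k\<^esub> b) = \<epsilon> a \<otimes>\<^bsub>B\<^esub> \<epsilon> b" using ab by (simp add: \<epsilon>_def mon)
  qed (simp add: \<epsilon>_def)
  from algebra_copy[OF kc Bc this inj] obtain A' :: "('k, 'u) module" where A0: "algebra k A' \<and>
    \<iota> \<in> ring_hom B A' \<and>
    (\<forall>c\<in>carrier k. \<forall>x\<in>carrier B. c \<odot>\<^bsub>A'\<^esub> \<iota> x = \<iota> (\<epsilon> c \<otimes>\<^bsub>B\<^esub> x)) \<and> \<zero>\<^bsub>A'\<^esub> = \<iota> \<zero>\<^bsub>B\<^esub>" by (rule exE)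
  then have A': "algebra k A'" "\<iota> \<in> ring_hom B A'" "\<zero>\<^bsub>A'\<^esub> = \<iota> \<zero>\<^bsub>B\<^esub>" by simp_all
  have A'sm: "c \<odot>\<^bsub>A'\<^esub> \<iota> x = \<iota> (\<epsilon> c \<otimes>\<^bsub>B\<^esub> x)" if "c \<in> carrier k" "x \<in> carrier B" for c x
    using A0 that by simp
  interpret A'1: cring A' by (rule algebra.M_cring[OF A'(1)])
  interpret A': algebra k A' by (rule A'(1))
  interpret h: ring_hom_cring P A' "\<lambda>f. \<iota> (\<pi> f)"
  proof (intro ring_hom_cring.intro ring_hom_cring_axioms.intro P.UP_cring A'.M_cring)
    show "(\<lambda>f. \<iota> (\<pi> f)) \<in> ring_hom P A'" using ring_hom_trans[OF \<pi> A'(2)] by (simp add: comp_def)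
  qed
  interpret i: ring_hom_cring B A' \<iota>
    by (intro ring_hom_cring.intro ring_hom_cring_axioms.intro Bc A'.M_cring A'(2))
  define \<phi> where "\<phi> = (\<lambda>a\<in>carrier A. \<iota> (\<pi> (monom P a 0)))"
  define \<alpha> where "\<alpha> = \<iota> (\<pi> (monom P \<one>\<^bsub>A\<^esub> 1))"
  have \<phi>: "\<phi> \<in> alg_hom k A A'"
    unfolding alg_hom_def
  proof (intro CollectI conjI ballI)
    show "\<phi> \<in> ring_hom A A'"
      by (rule ring_hom_memI) (simp_all add: \<phi>_def mon)
    show "\<phi> \<in> extensional (carrier A)" by (simp add: \<phi>_def)
    fix c a assume c: "c \<in> carrier k" and a: "a \<in> carrier A"
    have "c \<odot>\<^bsub>A'\<^esub> \<phi> a = \<iota> (\<epsilon> c \<otimes>\<^bsub>B\<^esub> \<pi> (monom P a 0))" using A'sm[OF c] a by (simp add: \<phi>_def)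
    also have "\<epsilon> c \<otimes>\<^bsub>B\<^esub> \<pi> (monom P a 0) = \<pi> (monom P ((c \<odot>\<^bsub>A\<^esub> \<one>\<^bsub>A\<^esub>) \<otimes>\<^bsub>A\<^esub> a) 0)"
      using c a by (simp add: \<epsilon>_def mon)
    finally show "\<phi> (c \<odot>\<^bsub>A\<^esub> a) = c \<odot>\<^bsub>A'\<^esub> \<phi> a" using c a by (simp add: \<phi>_def one_mult)
  qed
  have \<alpha>pow: "\<alpha> [^]\<^bsub>A'\<^esub> n = \<iota> (\<pi> (monom P \<one>\<^bsub>A\<^esub> n))" for n :: nat
  proof -
    have "\<alpha> [^]\<^bsub>A'\<^esub> n = \<iota> (\<pi> (monom P \<one>\<^bsub>A\<^esub> 1 [^]\<^bsub>P\<^esub> n))"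
      unfolding \<alpha>_def by (rule h.hom_pow[symmetric]) simp
    also have "monom P \<one>\<^bsub>A\<^esub> 1 [^]\<^bsub>P\<^esub> n = monom P (\<one>\<^bsub>A\<^esub> [^]\<^bsub>A\<^esub> n) (1 * n)"
      by (rule P.monom_pow) simp
    finally show ?thesis by simp
  qed
  have "monom P \<one>\<^bsub>A\<^esub> q \<in> J"
    unfolding J_def
  proof (intro CollectI conjI allI impI)
    fix n assume "n < q"
    then show "coeff P (monom P \<one>\<^bsub>A\<^esub> q) n = \<zero>\<^bsub>A\<^esub>" by (subst P.coeff_monom) auto
  qed simp
  then have "\<pi> (monom P \<one>\<^bsub>A\<^esub> q) = \<zero>\<^bsub>B\<^esub>" by (intro zeroB[THEN iffD2] P.monom_closed) auto
  then have \<alpha>q: "\<alpha> [^]\<^bsub>A'\<^esub> q = \<zero>\<^bsub>A'\<^esub>" unfolding \<alpha>pow A'(3) by (rule arg_cong)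
  have ind: "x n = \<zero>\<^bsub>A\<^esub>" if x: "\<forall>a<q. x a \<in> carrier A" and n: "n < q"
    and z: "(\<Oplus>\<^bsub>A'\<^esub>a\<in>{..<q}. \<phi> (x a) \<otimes>\<^bsub>A'\<^esub> \<alpha> [^]\<^bsub>A'\<^esub> a) = \<zero>\<^bsub>A'\<^esub>" for x n
  proof -
    let ?f = "\<Oplus>\<^bsub>P\<^esub>a\<in>{..<q}. monom P (x a) a"
    have f: "?f \<in> carrier P" using x by (intro P.P.finsum_closed) auto
    have "\<iota> (\<pi> ?f) = (\<Oplus>\<^bsub>A'\<^esub>a\<in>{..<q}. ((\<lambda>f. \<iota> (\<pi> f)) \<circ> (\<lambda>a. monom P (x a) a)) a)"
      using x by (subst h.hom_finsum) auto
    also have "\<dots> = (\<Oplus>\<^bsub>A'\<^esub>a\<in>{..<q}. \<phi> (x a) \<otimes>\<^bsub>A'\<^esub> \<alpha> [^]\<^bsub>A'\<^esub> a)"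
    proof (rule A'1.finsum_cong'[OF refl])
      fix a assume a: "a \<in> {..<q}"
      then have "monom P (x a) a = monom P (x a) 0 \<otimes>\<^bsub>P\<^esub> monom P \<one>\<^bsub>A\<^esub> a"
        using x mon[of "x a" "\<one>\<^bsub>A\<^esub>" a] by simp
      then show "((\<lambda>f. \<iota> (\<pi> f)) \<circ> (\<lambda>a. monom P (x a) a)) a = \<phi> (x a) \<otimes>\<^bsub>A'\<^esub> \<alpha> [^]\<^bsub>A'\<^esub> a"
        using x a by (simp add: \<phi>_def \<alpha>pow)
    qed (use x in \<open>auto simp: \<phi>_def \<alpha>pow\<close>)
    also note z
    also note A'(3)
    finally have "\<iota> (\<pi> ?f) = \<iota> \<zero>\<^bsub>B\<^esub>" .
    then have "\<pi> ?f = \<zero>\<^bsub>B\<^esub>" by (rule inj_onD[OF inj]) (use f in simp_all)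
    then have "?f \<in> J" by (rule zeroB[OF f, THEN iffD1])
    then have z0: "coeff P ?f n = \<zero>\<^bsub>A\<^esub>" using n unfolding J_def by blast
    have "coeff P ?f n = (\<Oplus>\<^bsub>A\<^esub>a\<in>{..<q}. coeff P (monom P (x a) a) n)"
      using x by (intro P.coeff_finsum) auto
    also have "\<dots> = (\<Oplus>\<^bsub>A\<^esub>a\<in>{..<q}. if a = n then x a else \<zero>\<^bsub>A\<^esub>)"
      using x by (intro A1.finsum_cong') auto
    also have "\<dots> = x n" using x n by (intro A1.finsum_delta) auto
    finally show ?thesis using z0 by metis
  qed
  have "\<alpha> \<in> carrier A'" by (simp add: \<alpha>_def)
  then show ?thesis using A'(1) \<phi> \<alpha>q ind
    by (intro exI[of _ A'] exI[of _ \<phi>] exI[of _ \<alpha>] conjI allI impI) (assumption | blast)+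
qed

section \<open>Functoriality of points\<close>

lemma alg_homD:
  assumes "f \<in> alg_hom k A B"
  shows "f \<in> ring_hom A B" "f \<in> extensional (carrier A)"
    "\<And>c a. c \<in> carrier k \<Longrightarrow> a \<in> carrier A \<Longrightarrow> f (c \<odot>\<^bsub>A\<^esub> a) = c \<odot>\<^bsub>B\<^esub> f a"
    "\<And>a. a \<in> carrier A \<Longrightarrow> f a \<in> carrier B"
  using assms by (auto simp: alg_hom_def ring_hom_def)

text \<open>Coordinate algebras carry extra data, which the algebra structure ignores.\<close>

definition plain :: "('k, 'a, 'm) module_scheme \<Rightarrow> ('k, 'a) module" where
  "plain A = module.truncate A"

lemma plain_simps [simp]:
  "carrier (plain A) = carrier A" "monoid.mult (plain A) = monoid.mult A" "one (plain A) = one A"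
  "zero (plain A) = zero A" "add (plain A) = add A" "smult (plain A) = smult A"
  by (simp_all add: plain_def module.defs)

lemma finsum_plain [simp]: "finsum (plain A) = finsum A"
  by (simp add: finsum_def finprod_def fun_eq_iff)

lemma a_inv_plain [simp]: "a_inv (plain A) = a_inv A"
  by (simp add: a_inv_def m_inv_def fun_eq_iff)

lemma a_minus_plain [simp]: "a_minus (plain A) = a_minus A"
  by (simp add: a_minus_def fun_eq_iff)

lemma algebra_plain:
  assumes "algebra k A" shows "algebra k (plain A)"
proof -
  interpret A1: cring A by (rule algebra.M_cring[OF assms])
  interpret A: algebra k A by fact
  have "cring (plain A)"
  proof (rule cringI)
    show "abelian_group (plain A)"
      by (rule abelian_groupI) (auto simp: A1.a_ac intro: A1.a_inv_closed A1.l_neg bexI[of _ "\<ominus>\<^bsub>A\<^esub> _"])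
    show "comm_monoid (plain A)" by (rule comm_monoidI) (auto simp: A1.m_ac)
  qed (simp add: A1.l_distr)
  then show ?thesis
    by (intro algebraI)
      (simp_all add: algebra.R_cring[OF assms] A.smult_l_distr A.smult_r_distr A.smult_assoc1 A.smult_assoc2)
qed

lemma alg_hom_plain [simp]:
  "alg_hom k (plain A) B = alg_hom k A B" "alg_hom k A (plain B) = alg_hom k A B"
  by (simp_all add: alg_hom_def ring_hom_def)

lemma conv_plain [simp]: "conv G (plain A) = conv G A" "conv_unit G (plain A) = conv_unit G A"
  by (simp_all add: conv_def conv_unit_def fun_eq_iff)

lemma points_plain [simp]:
  "nilp_points k p G (plain A) = nilp_points k p G A"
  "comm_points k p G r (plain A) = comm_points k p G r A"
  "nilp_classify k G N (plain A) = nilp_classify k G N A"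
  "comm_classify k G R (plain A) = comm_classify k G R A"
  by (simp_all add: nilp_points_def comm_points_def lie_points_def p_map_def lie_zero_def lie_bracket_def
      nilp_classify_def comm_classify_def fun_eq_iff)

lemma ring_hom_cring_of_alg_hom:
  assumes "algebra k A" "algebra k B" "f \<in> alg_hom k A B"
  shows "ring_hom_cring A B f"
  by (intro ring_hom_cring.intro ring_hom_cring_axioms.intro algebra.M_cring[OF assms(1)]
      algebra.M_cring[OF assms(2)] alg_homD(1)[OF assms(3)])

lemma alg_hom_compose:
  assumes A: "algebra k A" and f: "f \<in> alg_hom k A B" and g: "g \<in> alg_hom k B D"
  shows "compose (carrier A) g f \<in> alg_hom k A D"
proof -
  interpret A1: cring A by (rule algebra.M_cring[OF A])
  interpret A: algebra k A by fact
  note f' = alg_homD[OF f] and g' = alg_homD[OF g]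
  have "g \<circ> f \<in> ring_hom A D" by (rule ring_hom_trans[OF f'(1) g'(1)])
  then have "compose (carrier A) g f \<in> ring_hom A D"
    by (simp add: ring_hom_def compose_def Pi_def)
  moreover have "compose (carrier A) g f (c \<odot>\<^bsub>A\<^esub> a) = c \<odot>\<^bsub>D\<^esub> compose (carrier A) g f a"
    if "c \<in> carrier k" "a \<in> carrier A" for c a
    using f'(3)[OF that] g'(3)[OF that(1) f'(4)[OF that(2)]] that by (simp add: compose_def)
  moreover have "compose (carrier A) g f \<in> extensional (carrier A)" by (simp add: compose_def)
  ultimately show ?thesis by (simp add: alg_hom_def)
qed

definition tensor_sum :: "('k, 'a, 'm) module_scheme \<Rightarrow> ('h \<Rightarrow> 'a) \<Rightarrow> ('h \<Rightarrow> 'a) \<Rightarrow> ('h \<times> 'h) list \<Rightarrow> 'a" where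
  "tensor_sum A f g xs = foldr (\<lambda>(a, b) z. (f a \<otimes>\<^bsub>A\<^esub> g b) \<oplus>\<^bsub>A\<^esub> z) xs \<zero>\<^bsub>A\<^esub>"

lemma tensor_sum_simps [simp]:
  "tensor_sum A f g [] = \<zero>\<^bsub>A\<^esub>"
  "tensor_sum A f g ((a, b) # xs) = (f a \<otimes>\<^bsub>A\<^esub> g b) \<oplus>\<^bsub>A\<^esub> tensor_sum A f g xs"
  by (simp_all add: tensor_sum_def)

lemma conv_tensor_sum: "h \<in> carrier G \<Longrightarrow> conv G A f g h = tensor_sum A f g (comult G h)"
  by (simp add: conv_def tensor_sum_def)

lemma tensor_sum_closed:
  assumes "cring A" "set xs \<subseteq> H \<times> H" "\<And>h. h \<in> H \<Longrightarrow> f h \<in> carrier A" "\<And>h. h \<in> H \<Longrightarrow> g h \<in> carrier A"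
  shows "tensor_sum A f g xs \<in> carrier A"
proof -
  interpret cring A by fact
  show ?thesis using assms(2-4) by (induction xs) auto
qed

lemma tensor_sum_hom:
  assumes "ring_hom_cring A B \<phi>" "set xs \<subseteq> H \<times> H" "\<And>h. h \<in> H \<Longrightarrow> f h \<in> carrier A" "\<And>h. h \<in> H \<Longrightarrow> g h \<in> carrier A"
    "\<And>h. h \<in> H \<Longrightarrow> f' h = \<phi> (f h)" "\<And>h. h \<in> H \<Longrightarrow> g' h = \<phi> (g h)"
  shows "\<phi> (tensor_sum A f g xs) = tensor_sum B f' g' xs"
proof -
  interpret h: ring_hom_cring A B \<phi> by fact
  show ?thesis using assms(2)
  proof (induction xs)
    case (Cons x xs)
    obtain a b where x: "x = (a, b)" by (cases x)
    have ab: "a \<in> H" "b \<in> H" and xs: "set xs \<subseteq> H \<times> H" using Cons.prems x by auto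
    have "tensor_sum A f g xs \<in> carrier A"
      by (rule tensor_sum_closed[OF h.R.is_cring xs assms(3,4)])
    then show ?case using Cons.IH[OF xs] assms(3,4)[OF ab(1)] assms(3,4)[OF ab(2)]
      by (simp add: x assms(5)[OF ab(1)] assms(6)[OF ab(2)])
  qed simp
qed

locale algebraic_group_setup =
  fixes k :: "'k ring" and p :: nat and G :: "('k, 'h) hopf" and ty :: "'u itself"
  assumes field: "field k" "Factorial_Ring.prime p" "add_pow k p \<one>\<^bsub>k\<^esub> = \<zero>\<^bsub>k\<^esub>"
    and group: "linear_algebraic_group TYPE('u) k G"
begin

lemma G_algebra: "algebra k G" using group by (simp add: linear_algebraic_group_def)

sublocale G: cring G by (rule algebra.M_cring[OF G_algebra])
sublocale kf: field k by (rule field(1))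
sublocale Ga: algebra k G by (rule G_algebra)

lemma comult_closed: "h \<in> carrier G \<Longrightarrow> set (comult G h) \<subseteq> carrier G \<times> carrier G"
  using group by (simp add: linear_algebraic_group_def)

lemma p_pos: "0 < p" using field(2) by (simp add: prime_gt_0_nat)

lemma conv_hom:
  assumes "algebra k A" "algebra k B" "\<phi> \<in> alg_hom k A B"
    "f \<in> carrier G \<rightarrow> carrier A" "g \<in> carrier G \<rightarrow> carrier A"
  shows "compose (carrier G) \<phi> (conv G A f g) = conv G B (compose (carrier G) \<phi> f) (compose (carrier G) \<phi> g)"
proof
  fix h
  show "compose (carrier G) \<phi> (conv G A f g) h = conv G B (compose (carrier G) \<phi> f) (compose (carrier G) \<phi> g) h"
  proof (cases "h \<in> carrier G")
    case True
    have "\<phi> (tensor_sum A f g (comult G h)) =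
        tensor_sum B (compose (carrier G) \<phi> f) (compose (carrier G) \<phi> g) (comult G h)"
      by (rule tensor_sum_hom[OF ring_hom_cring_of_alg_hom[OF assms(1-3)] comult_closed[OF True]])
        (use assms(4,5) in \<open>auto simp: compose_def\<close>)
    then show ?thesis using True by (simp add: compose_def conv_tensor_sum)
  qed (simp add: compose_def conv_def)
qed

lemma conv_closed:
  assumes "algebra k A" "f \<in> carrier G \<rightarrow> carrier A" "g \<in> carrier G \<rightarrow> carrier A"
  shows "conv G A f g \<in> carrier G \<rightarrow> carrier A"
proof
  fix h assume h: "h \<in> carrier G"
  show "conv G A f g h \<in> carrier A"
    unfolding conv_tensor_sum[OF h]
    by (rule tensor_sum_closed[OF algebra.M_cring[OF assms(1)] comult_closed[OF h]])
      (use assms(2,3) in auto)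
qed

lemma counit_closed: "h \<in> carrier G \<Longrightarrow> counit G h \<in> carrier k"
  using group by (auto simp: linear_algebraic_group_def)

lemma conv_unit_closed:
  assumes "algebra k A" shows "conv_unit G A \<in> carrier G \<rightarrow> carrier A"
proof -
  interpret A1: cring A by (rule algebra.M_cring[OF assms])
  interpret A: algebra k A by fact
  show ?thesis using counit_closed by (auto simp: conv_unit_def)
qed

lemma conv_unit_hom:
  assumes "algebra k A" "algebra k B" "\<phi> \<in> alg_hom k A B"
  shows "compose (carrier G) \<phi> (conv_unit G A) = conv_unit G B"
proof -
  interpret h: ring_hom_cring A B \<phi> by (rule ring_hom_cring_of_alg_hom[OF assms])
  show ?thesis
    using alg_homD(3)[OF assms(3) counit_closed h.R.one_closed]
    by (simp add: conv_unit_def compose_def restrict_def fun_eq_iff)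
qed

lemma p_map_hom:
  assumes "algebra k A" "algebra k B" "\<phi> \<in> alg_hom k A B" "f \<in> carrier G \<rightarrow> carrier A"
  shows "compose (carrier G) \<phi> (p_map p G A f) = p_map p G B (compose (carrier G) \<phi> f)"
proof -
  have "(conv G A f ^^ n) (conv_unit G A) \<in> carrier G \<rightarrow> carrier A \<and>
    compose (carrier G) \<phi> ((conv G A f ^^ n) (conv_unit G A)) =
    (conv G B (compose (carrier G) \<phi> f) ^^ n) (conv_unit G B)" for n
  proof (induction n)
    case 0
    then show ?case using conv_unit_closed[OF assms(1)] conv_unit_hom[OF assms(1-3)] by simp
  next
    case (Suc n)
    then show ?case
      using conv_hom[OF assms(1-4), of "(conv G A f ^^ n) (conv_unit G A)"]
        conv_closed[OF assms(1,4), of "(conv G A f ^^ n) (conv_unit G A)"] by simp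
  qed
  then show ?thesis by (simp add: p_map_def)
qed

lemma lie_points_closed:
  assumes "algebra k A" "B \<in> lie_points k G A"
  shows "B \<in> carrier G \<rightarrow> carrier A" "B \<in> extensional (carrier G)"
proof -
  interpret A1: cring A by (rule algebra.M_cring[OF assms(1)])
  interpret A: algebra k A by fact
  obtain n a D where B: "B = (\<lambda>h\<in>carrier G. \<Oplus>\<^bsub>A\<^esub>i\<in>{..<n::nat}. D i h \<odot>\<^bsub>A\<^esub> a i)"
    and a: "a \<in> {..<n} \<rightarrow> carrier A" and D: "D \<in> {..<n} \<rightarrow> lie_algebra k G"
    using assms(2) unfolding lie_points_def by blast
  have "D i h \<in> carrier k" if "i < n" "h \<in> carrier G" for i h
    using D that by (auto simp: lie_algebra_def)
  then show "B \<in> carrier G \<rightarrow> carrier A" "B \<in> extensional (carrier G)"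
    using a unfolding B by (auto intro!: A1.finsum_closed)
qed

lemma lie_points_hom:
  assumes A: "algebra k A" and A': "algebra k A'" and \<phi>: "\<phi> \<in> alg_hom k A A'" and B: "B \<in> lie_points k G A"
  shows "compose (carrier G) \<phi> B \<in> lie_points k G A'"
proof -
  interpret A1: cring A by (rule algebra.M_cring[OF A])
  interpret A: algebra k A by fact
  interpret h: ring_hom_cring A A' \<phi> by (rule ring_hom_cring_of_alg_hom[OF A A' \<phi>])
  interpret A': algebra k A' by fact
  obtain n a D where B': "B = (\<lambda>h\<in>carrier G. \<Oplus>\<^bsub>A\<^esub>i\<in>{..<n::nat}. D i h \<odot>\<^bsub>A\<^esub> a i)"
    and a: "a \<in> {..<n} \<rightarrow> carrier A" and D: "D \<in> {..<n} \<rightarrow> lie_algebra k G"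
    using B unfolding lie_points_def by blast
  have Dk: "D i h \<in> carrier k" if "i < n" "h \<in> carrier G" for i h
    using D that by (auto simp: lie_algebra_def)
  have "compose (carrier G) \<phi> B = (\<lambda>h\<in>carrier G. \<Oplus>\<^bsub>A'\<^esub>i\<in>{..<n}. D i h \<odot>\<^bsub>A'\<^esub> \<phi> (a i))"
  proof
    fix h
    show "compose (carrier G) \<phi> B h = (\<lambda>h\<in>carrier G. \<Oplus>\<^bsub>A'\<^esub>i\<in>{..<n}. D i h \<odot>\<^bsub>A'\<^esub> \<phi> (a i)) h"
    proof (cases "h \<in> carrier G")
      case True
      have "\<phi> (\<Oplus>\<^bsub>A\<^esub>i\<in>{..<n}. D i h \<odot>\<^bsub>A\<^esub> a i) = (\<Oplus>\<^bsub>A'\<^esub>i\<in>{..<n}. (\<phi> \<circ> (\<lambda>i. D i h \<odot>\<^bsub>A\<^esub> a i)) i)"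
        using a Dk True by (subst h.hom_finsum) auto
      also have "\<dots> = (\<Oplus>\<^bsub>A'\<^esub>i\<in>{..<n}. D i h \<odot>\<^bsub>A'\<^esub> \<phi> (a i))"
      proof (rule h.S.finsum_cong'[OF refl])
        fix i assume "i \<in> {..<n}"
        then show "(\<phi> \<circ> (\<lambda>i. D i h \<odot>\<^bsub>A\<^esub> a i)) i = D i h \<odot>\<^bsub>A'\<^esub> \<phi> (a i)"
          using alg_homD(3)[OF \<phi>, of "D i h" "a i"] a Dk True by auto
      qed (use a Dk True in auto)
      finally show ?thesis using True by (simp add: B' compose_def)
    qed (simp add: compose_def)
  qed
  moreover have "(\<lambda>i. \<phi> (a i)) \<in> {..<n} \<rightarrow> carrier A'" using a by auto
  ultimately show ?thesis unfolding lie_points_def using D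
    by (intro CollectI exI[of _ n] exI[of _ "\<lambda>i. \<phi> (a i)"] exI[of _ D] conjI)
qed

lemma lie_zero_hom:
  assumes "algebra k A" "algebra k A'" "\<phi> \<in> alg_hom k A A'"
  shows "compose (carrier G) \<phi> (lie_zero G A) = lie_zero G A'"
proof -
  interpret h: ring_hom_cring A A' \<phi> by (rule ring_hom_cring_of_alg_hom[OF assms])
  show ?thesis by (simp add: lie_zero_def compose_def restrict_def fun_eq_iff)
qed

lemma nilp_points_hom:
  assumes "algebra k A" "algebra k A'" "\<phi> \<in> alg_hom k A A'" "B \<in> nilp_points k p G A"
  shows "compose (carrier G) \<phi> B \<in> nilp_points k p G A'"
proof -
  have B: "B \<in> lie_points k G A" "p_map p G A B = lie_zero G A"
    using assms(4) by (simp_all add: nilp_points_def)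
  have "p_map p G A' (compose (carrier G) \<phi> B) = lie_zero G A'"
    using p_map_hom[OF assms(1-3) lie_points_closed(1)[OF assms(1) B(1)]] B(2) lie_zero_hom[OF assms(1-3)]
    by simp
  then show ?thesis using lie_points_hom[OF assms(1-3) B(1)] by (simp add: nilp_points_def)
qed

lemma lie_bracket_hom:
  assumes "algebra k A" "algebra k A'" "\<phi> \<in> alg_hom k A A'"
    "B \<in> carrier G \<rightarrow> carrier A" "B' \<in> carrier G \<rightarrow> carrier A"
    and z: "lie_bracket G A B B' = lie_zero G A"
  shows "lie_bracket G A' (compose (carrier G) \<phi> B) (compose (carrier G) \<phi> B') = lie_zero G A'"
proof -
  interpret h: ring_hom_cring A A' \<phi> by (rule ring_hom_cring_of_alg_hom[OF assms(1-3)])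
  note cl = conv_closed[OF assms(1)]
  have "lie_bracket G A' (compose (carrier G) \<phi> B) (compose (carrier G) \<phi> B') =
      compose (carrier G) \<phi> (lie_bracket G A B B')"
  proof
    fix x
    have "\<phi> (conv G A B B' x \<ominus>\<^bsub>A\<^esub> conv G A B' B x) =
        \<phi> (conv G A B B' x) \<ominus>\<^bsub>A'\<^esub> \<phi> (conv G A B' B x)" if "x \<in> carrier G"
      using cl[OF assms(4,5)] cl[OF assms(5,4)] that by (simp add: a_minus_def Pi_def)
    then show "lie_bracket G A' (compose (carrier G) \<phi> B) (compose (carrier G) \<phi> B') x =
      compose (carrier G) \<phi> (lie_bracket G A B B') x"
      unfolding lie_bracket_def conv_hom[OF assms(1-5), symmetric] conv_hom[OF assms(1-3,5,4), symmetric]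
      by (simp add: compose_def)
  qed
  then show ?thesis using z lie_zero_hom[OF assms(1-3)] by simp
qed

lemma nilp_points_closed:
  assumes "algebra k A" "B \<in> nilp_points k p G A"
  shows "B \<in> carrier G \<rightarrow> carrier A"
  using assms lie_points_closed(1) by (auto simp: nilp_points_def)

lemma conv_lie_zero:
  assumes A: "algebra k A" and f: "f \<in> carrier G \<rightarrow> carrier A"
  shows "conv G A (lie_zero G A) f = lie_zero G A" "conv G A f (lie_zero G A) = lie_zero G A"
proof -
  interpret A1: cring A by (rule algebra.M_cring[OF A])
  have "tensor_sum A (lie_zero G A) f xs = \<zero>\<^bsub>A\<^esub> \<and> tensor_sum A f (lie_zero G A) xs = \<zero>\<^bsub>A\<^esub>"
    if "set xs \<subseteq> carrier G \<times> carrier G" for xs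
    using that f by (induction xs) (auto simp: lie_zero_def Pi_def)
  then have z: "conv G A (lie_zero G A) f h = \<zero>\<^bsub>A\<^esub>" "conv G A f (lie_zero G A) h = \<zero>\<^bsub>A\<^esub>"
    if "h \<in> carrier G" for h
    using comult_closed[OF that] by (simp_all add: conv_tensor_sum[OF that])
  have e: "u = lie_zero G A" if "u \<in> extensional (carrier G)" "\<And>h. h \<in> carrier G \<Longrightarrow> u h = \<zero>\<^bsub>A\<^esub>" for u
    by (rule extensionalityI[OF that(1)]) (use that(2) in \<open>simp_all add: lie_zero_def\<close>)
  show "conv G A (lie_zero G A) f = lie_zero G A" "conv G A f (lie_zero G A) = lie_zero G A"
    by (rule e; use z in \<open>simp add: conv_def\<close>)+
qed

lemma lie_zero_nilp:
  assumes A: "algebra k A" shows "lie_zero G A \<in> nilp_points k p G A"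
proof -
  interpret A1: cring A by (rule algebra.M_cring[OF A])
  have pw: "(conv G A (lie_zero G A) ^^ n) (conv_unit G A) \<in> carrier G \<rightarrow> carrier A" for n
    using conv_unit_closed[OF A]
    by (induction n) (auto simp: lie_zero_def Pi_def intro!: funcset_mem[OF conv_closed[OF A]])
  obtain n where "p = Suc n" using p_pos gr0_implies_Suc by blast
  then have "p_map p G A (lie_zero G A) = lie_zero G A"
    using conv_lie_zero(1)[OF A pw[of n]] by (simp add: p_map_def)
  moreover have "lie_zero G A \<in> lie_points k G A"
    unfolding lie_points_def lie_zero_def by (intro CollectI exI[of _ 0]) auto
  ultimately show ?thesis by (simp add: nilp_points_def)
qed

lemma lie_bracket_zero:
  assumes A: "algebra k A" and f: "f \<in> carrier G \<rightarrow> carrier A"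
  shows "lie_bracket G A (lie_zero G A) f = lie_zero G A" "lie_bracket G A f (lie_zero G A) = lie_zero G A"
proof -
  interpret A1: cring A by (rule algebra.M_cring[OF A])
  show "lie_bracket G A (lie_zero G A) f = lie_zero G A" "lie_bracket G A f (lie_zero G A) = lie_zero G A"
    unfolding lie_bracket_def conv_lie_zero[OF A f]
    by (simp_all add: lie_zero_def restrict_def fun_eq_iff a_minus_def A1.r_neg)
qed

end

section \<open>Comparison of coefficients\<close>

lemma (in cring) finsum_product:
  assumes "finite I" "finite J" "\<And>i. i \<in> I \<Longrightarrow> x i \<in> carrier R" "\<And>j. j \<in> J \<Longrightarrow> y j \<in> carrier R"
  shows "(\<Oplus>i\<in>I. x i) \<otimes> (\<Oplus>j\<in>J. y j) = (\<Oplus>i\<in>I. \<Oplus>j\<in>J. x i \<otimes> y j)"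
proof -
  have Y: "(\<Oplus>j\<in>J. y j) \<in> carrier R" using assms(4) by (intro finsum_closed) auto
  have "(\<Oplus>i\<in>I. x i) \<otimes> (\<Oplus>j\<in>J. y j) = (\<Oplus>i\<in>I. x i \<otimes> (\<Oplus>j\<in>J. y j))"
    using assms(1,3) Y by (intro finsum_ldistr) auto
  also have "\<dots> = (\<Oplus>i\<in>I. \<Oplus>j\<in>J. x i \<otimes> y j)"
  proof (rule finsum_cong'[OF refl])
    fix i assume "i \<in> I"
    then show "x i \<otimes> (\<Oplus>j\<in>J. y j) = (\<Oplus>j\<in>J. x i \<otimes> y j)"
      using assms(2-4) by (intro finsum_rdistr) auto
  qed (use assms(3,4) in \<open>auto intro!: finsum_closed\<close>)
  finally show ?thesis .
qed

lemma (in abelian_monoid) finsum_if_eq: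
  fixes q m :: nat
  assumes "x \<in> carrier G"
  shows "(\<Oplus>j\<in>{..<q}. if j = m then x else \<zero>) = (if m < q then x else \<zero>)"
proof (cases "m < q")
  case True
  then show ?thesis using assms finsum_delta[of "{..<q}" m "\<lambda>_. x"] by simp
next
  case False
  then have "(\<Oplus>j\<in>{..<q}. if j = m then x else \<zero>) = \<zero>"
    by (intro add.finprod_one_eqI) auto
  then show ?thesis using False by simp
qed

text \<open>
  Terms with \<open>a + b\<close> at least \<open>q\<close> occur on the right only; they vanish by the
  assumption on \<open>g\<close>.
\<close>

lemma (in cring) power_series_of_sum:
  assumes g: "\<And>n. g n \<in> carrier R" "\<And>n. q \<le> n \<Longrightarrow> g n = \<zero>"
    and \<alpha>: "\<alpha> \<in> carrier R" and \<beta>: "\<beta> \<in> carrier R"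
  shows "(\<Oplus>n\<in>{..<q}. g n \<otimes> (\<alpha> \<oplus> \<beta>) [^] n) =
    (\<Oplus>a\<in>{..<q}. \<Oplus>b\<in>{..<q}. ([((a + b) choose a)] \<cdot> g (a + b)) \<otimes> (\<alpha> [^] a \<otimes> \<beta> [^] b))"
proof -
  define M where "M = (\<lambda>(a::nat) (b::nat). \<alpha> [^] a \<otimes> \<beta> [^] b)"
  have M: "M a b \<in> carrier R" for a b using \<alpha> \<beta> by (simp add: M_def)
  define t where "t = (\<lambda>n a b. if a + b = n then ([((a + b) choose a)] \<cdot> g (a + b)) \<otimes> M a b else \<zero>)"
  have t: "t n a b \<in> carrier R" for n a b using g(1) M by (simp add: t_def)
  have pow: "g n \<otimes> (\<alpha> \<oplus> \<beta>) [^] n = (\<Oplus>a\<in>{..<q}. \<Oplus>b\<in>{..<q}. t n a b)" if n: "n < q" for n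
  proof -
    have inner: "(\<Oplus>b\<in>{..<q}. t n a b) = (if a \<le> n then ([(n choose a)] \<cdot> g n) \<otimes> M a (n - a) else \<zero>)" for a
    proof -
      let ?x = "([(n choose a)] \<cdot> g n) \<otimes> M a (n - a)"
      have x: "?x \<in> carrier R" using g(1) M by simp
      show ?thesis
      proof (cases "a \<le> n")
        case True
        have "t n a b = (if b = n - a then ?x else \<zero>)" for b using True by (auto simp: t_def)
        then have "(\<Oplus>b\<in>{..<q}. t n a b) = (\<Oplus>b\<in>{..<q}. if b = n - a then ?x else \<zero>)" by simp
        also have "\<dots> = ?x" using x n True by (subst finsum_if_eq) auto
        finally show ?thesis using True by simp
      next
        case False
        then have "t n a b = \<zero>" for b by (simp add: t_def)
        then show ?thesis using False by simp
      qed
    qed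
    have "(\<Oplus>a\<in>{..<q}. \<Oplus>b\<in>{..<q}. t n a b) = (\<Oplus>a\<in>{..<q}. if a \<le> n then ([(n choose a)] \<cdot> g n) \<otimes> M a (n - a) else \<zero>)"
      by (simp only: inner)
    also have "\<dots> = (\<Oplus>a\<in>{..n}. ([(n choose a)] \<cdot> g n) \<otimes> M a (n - a))"
      using n g(1) M by (intro add.finprod_mono_neutral_cong_right) auto
    also have "\<dots> = (\<Oplus>a\<in>{..n}. g n \<otimes> ([(n choose a)] \<cdot> M a (n - a)))"
      using g(1) M by (intro finsum_cong') (auto simp: add_pow_ldistr add_pow_rdistr)
    also have "\<dots> = g n \<otimes> (\<Oplus>a\<in>{..n}. [(n choose a)] \<cdot> M a (n - a))"
      using g(1) M by (intro finsum_rdistr[symmetric]) auto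
    also have "(\<Oplus>a\<in>{..n}. [(n choose a)] \<cdot> M a (n - a)) = (\<alpha> \<oplus> \<beta>) [^] n"
      unfolding M_def by (rule binomial_theorem[OF \<alpha> \<beta> m_comm[OF \<alpha> \<beta>], symmetric])
    finally show ?thesis by simp
  qed
  have "(\<Oplus>n\<in>{..<q}. g n \<otimes> (\<alpha> \<oplus> \<beta>) [^] n) = (\<Oplus>n\<in>{..<q}. \<Oplus>a\<in>{..<q}. \<Oplus>b\<in>{..<q}. t n a b)"
    using t by (intro finsum_cong' pow) (auto intro!: finsum_closed)
  also have "\<dots> = (\<Oplus>a\<in>{..<q}. \<Oplus>n\<in>{..<q}. \<Oplus>b\<in>{..<q}. t n a b)"
    using t by (intro finsum_swap) (auto intro!: finsum_closed)
  also have "\<dots> = (\<Oplus>a\<in>{..<q}. \<Oplus>b\<in>{..<q}. \<Oplus>n\<in>{..<q}. t n a b)"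
    using t by (intro finsum_cong' finsum_swap) (auto intro!: finsum_closed)
  also have "\<dots> = (\<Oplus>a\<in>{..<q}. \<Oplus>b\<in>{..<q}. ([((a + b) choose a)] \<cdot> g (a + b)) \<otimes> M a b)"
  proof -
    have "(\<Oplus>n\<in>{..<q}. t n a b) = ([((a + b) choose a)] \<cdot> g (a + b)) \<otimes> M a b" for a b
    proof -
      let ?x = "([((a + b) choose a)] \<cdot> g (a + b)) \<otimes> M a b"
      have "(\<Oplus>n\<in>{..<q}. t n a b) = (\<Oplus>n\<in>{..<q}. if n = a + b then ?x else \<zero>)"
        unfolding t_def by (rule arg_cong[where f = "\<lambda>f. finsum R f {..<q}"]) auto
      also have "\<dots> = (if a + b < q then ?x else \<zero>)" using g(1) M by (intro finsum_if_eq) simp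
      also have "\<dots> = ?x" using g(2)[of "a + b"] M by (simp add: add.nat_pow_one)
      finally show ?thesis .
    qed
    then show ?thesis by simp
  qed
  finally show ?thesis by (simp add: M_def)
qed

lemma product_expansion:
  assumes "ring_hom_cring A A' \<phi>" "finite L" and \<alpha>: "\<alpha> \<in> carrier A'" and \<beta>: "\<beta> \<in> carrier A'"
    and x: "\<And>a l. l \<in> L \<Longrightarrow> x a l \<in> carrier A" and y: "\<And>b l. l \<in> L \<Longrightarrow> y b l \<in> carrier A"
  shows "(\<Oplus>\<^bsub>A'\<^esub>l\<in>L. (\<Oplus>\<^bsub>A'\<^esub>a\<in>{..<q::nat}. \<phi> (x a l) \<otimes>\<^bsub>A'\<^esub> \<alpha> [^]\<^bsub>A'\<^esub> a) \<otimes>\<^bsub>A'\<^esub>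
      (\<Oplus>\<^bsub>A'\<^esub>b\<in>{..<q}. \<phi> (y b l) \<otimes>\<^bsub>A'\<^esub> \<beta> [^]\<^bsub>A'\<^esub> b)) =
    (\<Oplus>\<^bsub>A'\<^esub>a\<in>{..<q}. \<Oplus>\<^bsub>A'\<^esub>b\<in>{..<q}. \<phi> (\<Oplus>\<^bsub>A\<^esub>l\<in>L. x a l \<otimes>\<^bsub>A\<^esub> y b l) \<otimes>\<^bsub>A'\<^esub> (\<alpha> [^]\<^bsub>A'\<^esub> a \<otimes>\<^bsub>A'\<^esub> \<beta> [^]\<^bsub>A'\<^esub> b))"
proof -
  interpret h: ring_hom_cring A A' \<phi> by fact
  define M where "M = (\<lambda>(a::nat) (b::nat). \<alpha> [^]\<^bsub>A'\<^esub> a \<otimes>\<^bsub>A'\<^esub> \<beta> [^]\<^bsub>A'\<^esub> b)"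
  have M: "M a b \<in> carrier A'" for a b using \<alpha> \<beta> by (simp add: M_def)
  define t where "t = (\<lambda>l a b. \<phi> (x a l \<otimes>\<^bsub>A\<^esub> y b l) \<otimes>\<^bsub>A'\<^esub> M a b)"
  have t: "t l a b \<in> carrier A'" if "l \<in> L" for l a b using x y M that by (simp add: t_def)
  have "(\<Oplus>\<^bsub>A'\<^esub>l\<in>L. (\<Oplus>\<^bsub>A'\<^esub>a\<in>{..<q}. \<phi> (x a l) \<otimes>\<^bsub>A'\<^esub> \<alpha> [^]\<^bsub>A'\<^esub> a) \<otimes>\<^bsub>A'\<^esub>
      (\<Oplus>\<^bsub>A'\<^esub>b\<in>{..<q}. \<phi> (y b l) \<otimes>\<^bsub>A'\<^esub> \<beta> [^]\<^bsub>A'\<^esub> b)) = (\<Oplus>\<^bsub>A'\<^esub>l\<in>L. \<Oplus>\<^bsub>A'\<^esub>a\<in>{..<q}. \<Oplus>\<^bsub>A'\<^esub>b\<in>{..<q}. t l a b)"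
  proof (rule h.S.finsum_cong'[OF refl])
    fix l assume l: "l \<in> L"
    have "(\<Oplus>\<^bsub>A'\<^esub>a\<in>{..<q}. \<phi> (x a l) \<otimes>\<^bsub>A'\<^esub> \<alpha> [^]\<^bsub>A'\<^esub> a) \<otimes>\<^bsub>A'\<^esub> (\<Oplus>\<^bsub>A'\<^esub>b\<in>{..<q}. \<phi> (y b l) \<otimes>\<^bsub>A'\<^esub> \<beta> [^]\<^bsub>A'\<^esub> b) =
        (\<Oplus>\<^bsub>A'\<^esub>a\<in>{..<q}. \<Oplus>\<^bsub>A'\<^esub>b\<in>{..<q}. (\<phi> (x a l) \<otimes>\<^bsub>A'\<^esub> \<alpha> [^]\<^bsub>A'\<^esub> a) \<otimes>\<^bsub>A'\<^esub> (\<phi> (y b l) \<otimes>\<^bsub>A'\<^esub> \<beta> [^]\<^bsub>A'\<^esub> b))"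
      using x[OF l] y[OF l] \<alpha> \<beta> by (intro h.S.finsum_product) auto
    also have "\<dots> = (\<Oplus>\<^bsub>A'\<^esub>a\<in>{..<q}. \<Oplus>\<^bsub>A'\<^esub>b\<in>{..<q}. t l a b)"
      using x[OF l] y[OF l] \<alpha> \<beta> t[OF l]
      by (intro h.S.finsum_cong') (auto simp: t_def M_def h.S.m_ac intro!: h.S.finsum_closed)
    finally show "(\<Oplus>\<^bsub>A'\<^esub>a\<in>{..<q}. \<phi> (x a l) \<otimes>\<^bsub>A'\<^esub> \<alpha> [^]\<^bsub>A'\<^esub> a) \<otimes>\<^bsub>A'\<^esub> (\<Oplus>\<^bsub>A'\<^esub>b\<in>{..<q}. \<phi> (y b l) \<otimes>\<^bsub>A'\<^esub> \<beta> [^]\<^bsub>A'\<^esub> b) =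
      (\<Oplus>\<^bsub>A'\<^esub>a\<in>{..<q}. \<Oplus>\<^bsub>A'\<^esub>b\<in>{..<q}. t l a b)" .
  qed (use t in \<open>auto intro!: h.S.finsum_closed\<close>)
  also have "\<dots> = (\<Oplus>\<^bsub>A'\<^esub>a\<in>{..<q}. \<Oplus>\<^bsub>A'\<^esub>l\<in>L. \<Oplus>\<^bsub>A'\<^esub>b\<in>{..<q}. t l a b)"
    using t assms(2) by (intro h.S.finsum_swap) (auto intro!: h.S.finsum_closed)
  also have "\<dots> = (\<Oplus>\<^bsub>A'\<^esub>a\<in>{..<q}. \<Oplus>\<^bsub>A'\<^esub>b\<in>{..<q}. \<Oplus>\<^bsub>A'\<^esub>l\<in>L. t l a b)"
    using t assms(2) by (intro h.S.finsum_cong' h.S.finsum_swap) (auto intro!: h.S.finsum_closed)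
  also have "\<dots> = (\<Oplus>\<^bsub>A'\<^esub>a\<in>{..<q}. \<Oplus>\<^bsub>A'\<^esub>b\<in>{..<q}. \<phi> (\<Oplus>\<^bsub>A\<^esub>l\<in>L. x a l \<otimes>\<^bsub>A\<^esub> y b l) \<otimes>\<^bsub>A'\<^esub> M a b)"
  proof -
    have "(\<Oplus>\<^bsub>A'\<^esub>l\<in>L. t l a b) = \<phi> (\<Oplus>\<^bsub>A\<^esub>l\<in>L. x a l \<otimes>\<^bsub>A\<^esub> y b l) \<otimes>\<^bsub>A'\<^esub> M a b" for a b
    proof -
      have "(\<Oplus>\<^bsub>A'\<^esub>l\<in>L. t l a b) = (\<Oplus>\<^bsub>A'\<^esub>l\<in>L. (\<phi> \<circ> (\<lambda>l. x a l \<otimes>\<^bsub>A\<^esub> y b l)) l) \<otimes>\<^bsub>A'\<^esub> M a b"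
        unfolding t_def comp_def using x y M assms(2) by (intro h.S.finsum_ldistr[symmetric]) auto
      also have "(\<Oplus>\<^bsub>A'\<^esub>l\<in>L. (\<phi> \<circ> (\<lambda>l. x a l \<otimes>\<^bsub>A\<^esub> y b l)) l) = \<phi> (\<Oplus>\<^bsub>A\<^esub>l\<in>L. x a l \<otimes>\<^bsub>A\<^esub> y b l)"
        using x y by (subst h.hom_finsum) auto
      finally show ?thesis .
    qed
    then show ?thesis by simp
  qed
  finally show ?thesis by (simp only: M_def)
qed

text \<open>
  Two truncated polynomial extensions in succession: \<open>A[s, t]/(s^q, t^q)\<close> with its
  independent monomials.
\<close>

lemma bivariate_extension:
  fixes A :: "('k, 'u) module" and q :: nat
  assumes A: "algebra k A" and inf: "infinite (UNIV :: 'u set)"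
  shows "\<exists>(A' :: ('k, 'u) module) \<phi> \<alpha> \<beta>. algebra k A' \<and> \<phi> \<in> alg_hom k A A' \<and>
    \<alpha> \<in> carrier A' \<and> \<beta> \<in> carrier A' \<and> \<alpha> [^]\<^bsub>A'\<^esub> q = \<zero>\<^bsub>A'\<^esub> \<and> \<beta> [^]\<^bsub>A'\<^esub> q = \<zero>\<^bsub>A'\<^esub> \<and>
    (\<forall>u. (\<forall>a<q. \<forall>b<q. u a b \<in> carrier A) \<longrightarrow>
      (\<Oplus>\<^bsub>A'\<^esub>a\<in>{..<q}. \<Oplus>\<^bsub>A'\<^esub>b\<in>{..<q}. \<phi> (u a b) \<otimes>\<^bsub>A'\<^esub> (\<alpha> [^]\<^bsub>A'\<^esub> a \<otimes>\<^bsub>A'\<^esub> \<beta> [^]\<^bsub>A'\<^esub> b)) = \<zero>\<^bsub>A'\<^esub> \<longrightarrow>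
      (\<forall>a<q. \<forall>b<q. u a b = \<zero>\<^bsub>A\<^esub>))"
proof -
  obtain A1 :: "('k, 'u) module" and \<phi>1 \<alpha>1 where 1: "algebra k A1" "\<phi>1 \<in> alg_hom k A A1" "\<alpha>1 \<in> carrier A1"
    "\<alpha>1 [^]\<^bsub>A1\<^esub> q = \<zero>\<^bsub>A1\<^esub>"
    and ind1: "\<forall>x. (\<forall>a<q. x a \<in> carrier A) \<longrightarrow> (\<Oplus>\<^bsub>A1\<^esub>a\<in>{..<q}. \<phi>1 (x a) \<otimes>\<^bsub>A1\<^esub> \<alpha>1 [^]\<^bsub>A1\<^esub> a) = \<zero>\<^bsub>A1\<^esub> \<longrightarrow>
      (\<forall>a<q. x a = \<zero>\<^bsub>A\<^esub>)"
    using truncated_extension[OF A inf, of q] by (elim exE conjE)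
  obtain A2 :: "('k, 'u) module" and \<phi>2 \<beta> where 2: "algebra k A2" "\<phi>2 \<in> alg_hom k A1 A2" "\<beta> \<in> carrier A2"
    "\<beta> [^]\<^bsub>A2\<^esub> q = \<zero>\<^bsub>A2\<^esub>"
    and ind2: "\<forall>x. (\<forall>a<q. x a \<in> carrier A1) \<longrightarrow> (\<Oplus>\<^bsub>A2\<^esub>a\<in>{..<q}. \<phi>2 (x a) \<otimes>\<^bsub>A2\<^esub> \<beta> [^]\<^bsub>A2\<^esub> a) = \<zero>\<^bsub>A2\<^esub> \<longrightarrow>
      (\<forall>a<q. x a = \<zero>\<^bsub>A1\<^esub>)"
    using truncated_extension[OF 1(1) inf, of q] by (elim exE conjE)
  interpret h1: ring_hom_cring A A1 \<phi>1
    by (intro ring_hom_cring.intro ring_hom_cring_axioms.intro algebra.M_cring[OF A] algebra.M_cring[OF 1(1)])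
      (use 1(2) in \<open>simp add: alg_hom_def\<close>)
  interpret h2: ring_hom_cring A1 A2 \<phi>2
    by (intro ring_hom_cring.intro ring_hom_cring_axioms.intro algebra.M_cring[OF 1(1)] algebra.M_cring[OF 2(1)])
      (use 2(2) in \<open>simp add: alg_hom_def\<close>)
  interpret A: algebra k A by fact
  define \<phi> where "\<phi> = compose (carrier A) \<phi>2 \<phi>1"
  define \<alpha> where "\<alpha> = \<phi>2 \<alpha>1"
  have \<phi>x: "\<phi> x = \<phi>2 (\<phi>1 x)" if "x \<in> carrier A" for x using that by (simp add: \<phi>_def compose_def)
  have \<phi>: "\<phi> \<in> alg_hom k A A2"
    unfolding alg_hom_def
  proof (intro CollectI conjI ballI)
    show "\<phi> \<in> ring_hom A A2" by (rule ring_hom_memI) (simp_all add: \<phi>x)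
    show "\<phi> \<in> extensional (carrier A)" by (simp add: \<phi>_def compose_def)
    fix c a assume c: "c \<in> carrier k" and a: "a \<in> carrier A"
    then have "\<phi>1 (c \<odot>\<^bsub>A\<^esub> a) = c \<odot>\<^bsub>A1\<^esub> \<phi>1 a" "\<phi>2 (c \<odot>\<^bsub>A1\<^esub> \<phi>1 a) = c \<odot>\<^bsub>A2\<^esub> \<phi>2 (\<phi>1 a)"
      using 1(2) 2(2) by (simp_all add: alg_hom_def)
    then show "\<phi> (c \<odot>\<^bsub>A\<^esub> a) = c \<odot>\<^bsub>A2\<^esub> \<phi> a" using c a by (simp add: \<phi>x)
  qed
  have \<alpha>: "\<alpha> \<in> carrier A2" using 1(3) by (simp add: \<alpha>_def)
  have \<alpha>q: "\<alpha> [^]\<^bsub>A2\<^esub> q = \<zero>\<^bsub>A2\<^esub>" unfolding \<alpha>_def using h2.hom_pow[OF 1(3), of q] 1(4) by simp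
  have ind: "u a b = \<zero>\<^bsub>A\<^esub>" if u: "\<forall>a<q. \<forall>b<q. u a b \<in> carrier A" and ab: "a < q" "b < q"
    and z: "(\<Oplus>\<^bsub>A2\<^esub>a\<in>{..<q}. \<Oplus>\<^bsub>A2\<^esub>b\<in>{..<q}. \<phi> (u a b) \<otimes>\<^bsub>A2\<^esub> (\<alpha> [^]\<^bsub>A2\<^esub> a \<otimes>\<^bsub>A2\<^esub> \<beta> [^]\<^bsub>A2\<^esub> b)) = \<zero>\<^bsub>A2\<^esub>"
    for u a b
  proof -
    let ?w = "\<lambda>b. \<Oplus>\<^bsub>A1\<^esub>a\<in>{..<q}. \<phi>1 (u a b) \<otimes>\<^bsub>A1\<^esub> \<alpha>1 [^]\<^bsub>A1\<^esub> a"
    have w: "?w b \<in> carrier A1" if "b < q" for b using u that 1(3) by (intro h1.S.finsum_closed) auto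
    have "(\<Oplus>\<^bsub>A2\<^esub>b\<in>{..<q}. \<phi>2 (?w b) \<otimes>\<^bsub>A2\<^esub> \<beta> [^]\<^bsub>A2\<^esub> b) =
        (\<Oplus>\<^bsub>A2\<^esub>b\<in>{..<q}. \<Oplus>\<^bsub>A2\<^esub>a\<in>{..<q}. \<phi> (u a b) \<otimes>\<^bsub>A2\<^esub> (\<alpha> [^]\<^bsub>A2\<^esub> a \<otimes>\<^bsub>A2\<^esub> \<beta> [^]\<^bsub>A2\<^esub> b))"
    proof (rule h2.S.finsum_cong'[OF refl])
      fix b assume b: "b \<in> {..<q}"
      have "\<phi>2 (?w b) = (\<Oplus>\<^bsub>A2\<^esub>a\<in>{..<q}. (\<phi>2 \<circ> (\<lambda>a. \<phi>1 (u a b) \<otimes>\<^bsub>A1\<^esub> \<alpha>1 [^]\<^bsub>A1\<^esub> a)) a)"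
        using u b 1(3) by (subst h2.hom_finsum) auto
      also have "\<dots> = (\<Oplus>\<^bsub>A2\<^esub>a\<in>{..<q}. \<phi> (u a b) \<otimes>\<^bsub>A2\<^esub> \<alpha> [^]\<^bsub>A2\<^esub> a)"
        using u b 1(3) by (intro h2.S.finsum_cong') (auto simp: \<phi>x \<alpha>_def)
      finally have "\<phi>2 (?w b) \<otimes>\<^bsub>A2\<^esub> \<beta> [^]\<^bsub>A2\<^esub> b = (\<Oplus>\<^bsub>A2\<^esub>a\<in>{..<q}. \<phi> (u a b) \<otimes>\<^bsub>A2\<^esub> \<alpha> [^]\<^bsub>A2\<^esub> a) \<otimes>\<^bsub>A2\<^esub> \<beta> [^]\<^bsub>A2\<^esub> b"
        by simp
      also have "\<dots> = (\<Oplus>\<^bsub>A2\<^esub>a\<in>{..<q}. (\<phi> (u a b) \<otimes>\<^bsub>A2\<^esub> \<alpha> [^]\<^bsub>A2\<^esub> a) \<otimes>\<^bsub>A2\<^esub> \<beta> [^]\<^bsub>A2\<^esub> b)"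
        using u b \<alpha> 2(3) by (intro h2.S.finsum_ldistr) (auto simp: \<phi>x)
      also have "\<dots> = (\<Oplus>\<^bsub>A2\<^esub>a\<in>{..<q}. \<phi> (u a b) \<otimes>\<^bsub>A2\<^esub> (\<alpha> [^]\<^bsub>A2\<^esub> a \<otimes>\<^bsub>A2\<^esub> \<beta> [^]\<^bsub>A2\<^esub> b))"
        using u b \<alpha> 2(3) by (intro h2.S.finsum_cong') (auto simp: \<phi>x h2.S.m_assoc)
      finally show "\<phi>2 (?w b) \<otimes>\<^bsub>A2\<^esub> \<beta> [^]\<^bsub>A2\<^esub> b =
        (\<Oplus>\<^bsub>A2\<^esub>a\<in>{..<q}. \<phi> (u a b) \<otimes>\<^bsub>A2\<^esub> (\<alpha> [^]\<^bsub>A2\<^esub> a \<otimes>\<^bsub>A2\<^esub> \<beta> [^]\<^bsub>A2\<^esub> b))" .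
    qed (use u \<alpha> 2(3) in \<open>auto simp: \<phi>x intro!: h2.S.finsum_closed\<close>)
    also have "\<dots> = (\<Oplus>\<^bsub>A2\<^esub>a\<in>{..<q}. \<Oplus>\<^bsub>A2\<^esub>b\<in>{..<q}. \<phi> (u a b) \<otimes>\<^bsub>A2\<^esub> (\<alpha> [^]\<^bsub>A2\<^esub> a \<otimes>\<^bsub>A2\<^esub> \<beta> [^]\<^bsub>A2\<^esub> b))"
      using u \<alpha> 2(3) by (intro h2.S.finsum_swap) (auto simp: \<phi>x)
    also note z
    finally have "\<forall>b<q. ?w b = \<zero>\<^bsub>A1\<^esub>" by (intro ind2[rule_format] allI impI) (use w in auto)
    then have "?w b = \<zero>\<^bsub>A1\<^esub>" using ab by blast
    then show ?thesis using ind1[rule_format, of "\<lambda>a. u a b" a] u ab by blast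
  qed
  show ?thesis
  proof (rule exI[of _ A2], rule exI[of _ \<phi>], rule exI[of _ \<alpha>], rule exI[of _ \<beta>], intro conjI allI impI)
    fix u a b
    assume "\<forall>a<q. \<forall>b<q. u a b \<in> carrier A" "a < q" "b < q"
      "(\<Oplus>\<^bsub>A2\<^esub>a\<in>{..<q}. \<Oplus>\<^bsub>A2\<^esub>b\<in>{..<q}. \<phi> (u a b) \<otimes>\<^bsub>A2\<^esub> (\<alpha> [^]\<^bsub>A2\<^esub> a \<otimes>\<^bsub>A2\<^esub> \<beta> [^]\<^bsub>A2\<^esub> b)) = \<zero>\<^bsub>A2\<^esub>"
    then show "u a b = \<zero>\<^bsub>A\<^esub>" by (rule ind)
  qed (rule 2(1) \<phi> \<alpha> 2(3) \<alpha>q 2(4))+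
qed

section \<open>Nilpotency of sums of divided powers\<close>

text \<open>
  Absorption gives \<open>p^s\<close> times the coefficient as \<open>p^(s+1)\<close> times another one,
  and \<open>p^s\<close> cancels.
\<close>

lemma prime_dvd_choose_power:
  assumes "Factorial_Ring.prime (p :: nat)"
  shows "p dvd ((p ^ Suc s) choose (p ^ s))"
proof -
  have p0: "0 < p" using assms by (simp add: prime_gt_0_nat)
  have "p ^ s * ((p ^ Suc s) choose (p ^ s)) = p ^ Suc s * ((p ^ Suc s - 1) choose (p ^ s - 1))"
    using times_binomial_minus1_eq[of "p ^ s" "p ^ Suc s"] p0 by simp
  then have "p ^ s * ((p ^ Suc s) choose (p ^ s)) = p ^ s * (p * ((p ^ Suc s - 1) choose (p ^ s - 1)))"
    by (simp add: mult.assoc mult.left_commute)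
  then have "(p ^ Suc s) choose (p ^ s) = p * ((p ^ Suc s - 1) choose (p ^ s - 1))" using p0 by simp
  then show ?thesis by simp
qed

text \<open>
  For fixed \<open>s\<close> the relations of divided powers make the \<open>p\<close>-th power of
  \<open>g s (p^s)\<close> an integer multiple of \<open>g s (p^(s+1))\<close>. The last factor
  multiplied in contributes the binomial coefficient of \<open>p^(s+1)\<close> over \<open>p^s\<close>,
  which is divisible by \<open>p\<close>. So every summand has \<open>p\<close>-th power zero, and the
  summands commute. The argument takes place in the ring of endomorphisms of \<open>R^d\<close>.
\<close>

lemma (in cring) divided_powers_nilpotent:
  assumes p: "Factorial_Ring.prime p" "[p] \<cdot> \<one> = \<zero>" and S: "finite (S :: nat set)"
    and g: "\<And>s n i j. s \<in> S \<Longrightarrow> i < d \<Longrightarrow> j < d \<Longrightarrow> g s n i j \<in> carrier R"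
    and dp: "\<And>s a b i j. s \<in> S \<Longrightarrow> i < d \<Longrightarrow> j < d \<Longrightarrow>
      [((a + b) choose a)] \<cdot> g s (a + b) i j = matrix_mult R d (g s a) (g s b) i j"
    and co: "\<And>s t a b i j. s \<in> S \<Longrightarrow> t \<in> S \<Longrightarrow> i < d \<Longrightarrow> j < d \<Longrightarrow>
      matrix_mult R d (g s a) (g t b) i j = matrix_mult R d (g t b) (g s a) i j"
    and x: "x \<in> {..<d} \<rightarrow>\<^sub>E carrier R"
  shows "(mat_op R d (\<lambda>i j. \<Oplus>s\<in>S. g s (p ^ s) i j) ^^ p) x = (\<lambda>l\<in>{..<d}. \<zero>)"
proof -
  let ?V = "vec_space R d"
  interpret V: module R ?V by (rule vec_space_module)
  let ?E = "End_ring ?V"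
  interpret E: ring ?E by (rule V.M.End_ring_ring)
  define T where "T = (\<lambda>s n. \<lambda>x\<in>carrier ?V. mat_op R d (g s n) x)"
  have T: "T s n \<in> carrier ?E" if s: "s \<in> S" for s n
    unfolding End_ring_simps(1) T_def
    using mat_op_closed[OF g[OF s]] mat_op_linear(1)[OF g[OF s]] V.M.a_closed by (simp del: vec_space_simps)
  have cong: "mat_op R d A y = mat_op R d B y"
    if "\<And>i j. i < d \<Longrightarrow> j < d \<Longrightarrow> A i j = B i j" "\<And>i j. i < d \<Longrightarrow> j < d \<Longrightarrow> B i j \<in> carrier R" "y \<in> carrier ?V" for A B y
    unfolding mat_op_def using that by (auto simp: restrict_def fun_eq_iff intro!: finsum_cong')
  have mult: "(T s a \<otimes>\<^bsub>?E\<^esub> T t b) y = mat_op R d (matrix_mult R d (g s a) (g t b)) y"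
    if s: "s \<in> S" "t \<in> S" and y: "y \<in> carrier ?V" for s t a b y
    using y mat_op_closed[OF g[OF s(2)] y] mat_op_mat_op[OF g[OF s(1)] g[OF s(2)] y]
    by (simp add: End_ring_simps T_def compose_def del: vec_space_simps)
  have mm: "matrix_mult R d (g s a) (g t b) i j \<in> carrier R" if "s \<in> S" "t \<in> S" "i < d" "j < d" for s t a b i j
    by (rule matrix_mult_closed[OF g[OF that(1)] g[OF that(2)] that(3,4)])
  have Eext: "f = f'" if "f \<in> carrier ?E" "f' \<in> carrier ?E" "\<And>y. y \<in> carrier ?V \<Longrightarrow> f y = f' y" for f f'
    using that by (intro End_ring_eqI[of f "carrier ?V" "carrier ?V" f']) (simp_all add: End_ring_simps del: vec_space_simps)
  have comm: "T s a \<otimes>\<^bsub>?E\<^esub> T t b = T t b \<otimes>\<^bsub>?E\<^esub> T s a" if s: "s \<in> S" "t \<in> S" for s t a b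
  proof (rule Eext)
    fix y assume y: "y \<in> carrier ?V"
    show "(T s a \<otimes>\<^bsub>?E\<^esub> T t b) y = (T t b \<otimes>\<^bsub>?E\<^esub> T s a) y"
      unfolding mult[OF s y] mult[OF s(2,1) y] by (rule cong[OF co mm y]) (use s in auto)
  qed (use T s in auto)
  have Eadd: "(u \<oplus>\<^bsub>?E\<^esub> v) y = u y \<oplus>\<^bsub>?V\<^esub> v y" if "y \<in> carrier ?V" for u v y
    using that by (simp add: End_ring_simps(5) del: vec_space_simps)
  have addpow: "([n] \<cdot>\<^bsub>?E\<^esub> f) y = [n] \<cdot>\<^bsub>?V\<^esub> (f y)" if f: "f \<in> carrier ?E" and y: "y \<in> carrier ?V" for f y and n :: nat
  proof (induction n)
    case 0
    show ?case using y by (simp add: End_ring_simps(4) del: vec_space_simps)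
  next
    case (Suc n)
    then show ?case by (simp add: Eadd[OF y] del: vec_space_simps)
  qed
  have addpowV: "([n] \<cdot>\<^bsub>?V\<^esub> y) l = [n] \<cdot> (y l)" if "l < d" for n :: nat and y l
    by (induction n) (use that in simp_all)
  have pE: "[p] \<cdot>\<^bsub>?E\<^esub> \<one>\<^bsub>?E\<^esub> = \<zero>\<^bsub>?E\<^esub>"
  proof (rule Eext)
    fix y assume y: "y \<in> carrier ?V"
    have "([p] \<cdot>\<^bsub>?E\<^esub> \<one>\<^bsub>?E\<^esub>) y = [p] \<cdot>\<^bsub>?V\<^esub> y"
      using addpow[OF E.one_closed y] y by (simp add: End_ring_simps(3) del: vec_space_simps)
    also have "\<dots> = \<zero>\<^bsub>?V\<^esub>"
    proof (rule vec_eqI[of _ d "carrier R" _ "carrier R"])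
      show "[p] \<cdot>\<^bsub>?V\<^esub> y \<in> {..<d} \<rightarrow>\<^sub>E carrier R"
        using V.M.add.nat_pow_closed[OF y, of p] by simp
      fix l assume l: "l < d"
      then have yl: "y l \<in> carrier R" using y by auto
      have "([p] \<cdot>\<^bsub>?V\<^esub> y) l = [p] \<cdot> (y l)" by (rule addpowV[OF l])
      also have "\<dots> = \<zero>" by (rule char_mult_zero[OF p(2) yl dvd_refl])
      finally show "([p] \<cdot>\<^bsub>?V\<^esub> y) l = \<zero>\<^bsub>?V\<^esub> l" using l by simp
    qed auto
    finally show "([p] \<cdot>\<^bsub>?E\<^esub> \<one>\<^bsub>?E\<^esub>) y = \<zero>\<^bsub>?E\<^esub> y" using y by (simp add: End_ring_simps(4) del: vec_space_simps)
  qed simp_all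
  have dpE: "T s a \<otimes>\<^bsub>?E\<^esub> T s b = [((a + b) choose a)] \<cdot>\<^bsub>?E\<^esub> T s (a + b)" if s: "s \<in> S" for s a b
  proof (rule Eext)
    fix y assume y: "y \<in> carrier ?V"
    then have yR: "\<And>l. l < d \<Longrightarrow> y l \<in> carrier R" by auto
    have "([((a + b) choose a)] \<cdot>\<^bsub>?E\<^esub> T s (a + b)) y = [((a + b) choose a)] \<cdot>\<^bsub>?V\<^esub> mat_op R d (g s (a + b)) y"
      using addpow[OF T[OF s] y] y by (simp add: T_def del: vec_space_simps)
    also have "\<dots> = mat_op R d (matrix_mult R d (g s a) (g s b)) y"
    proof (rule vec_eqI[of _ d "carrier R" _ "carrier R"])
      show "[((a + b) choose a)] \<cdot>\<^bsub>?V\<^esub> mat_op R d (g s (a + b)) y \<in> {..<d} \<rightarrow>\<^sub>E carrier R"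
        using V.M.add.nat_pow_closed[OF mat_op_closed[OF g[OF s] y]] by simp
      show "mat_op R d (matrix_mult R d (g s a) (g s b)) y \<in> {..<d} \<rightarrow>\<^sub>E carrier R"
        using mat_op_closed[OF mm[OF s s] y] by simp
      fix i assume i: "i < d"
      have "([((a + b) choose a)] \<cdot>\<^bsub>?V\<^esub> mat_op R d (g s (a + b)) y) i =
          [((a + b) choose a)] \<cdot> (\<Oplus>l\<in>{..<d}. g s (a + b) i l \<otimes> y l)"
        using i by (simp add: addpowV mat_op_def)
      also have "\<dots> = (\<Oplus>l\<in>{..<d}. ([((a + b) choose a)] \<cdot> \<one>) \<otimes> (g s (a + b) i l \<otimes> y l))"
      proof -
        let ?c = "[((a + b) choose a)] \<cdot> \<one>" and ?Z = "\<Oplus>l\<in>{..<d}. g s (a + b) i l \<otimes> y l"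
        have Z: "?Z \<in> carrier R" using g[OF s] i yR by (intro finsum_closed) auto
        have "[((a + b) choose a)] \<cdot> ?Z = ?c \<otimes> ?Z" using Z by (simp add: add_pow_ldistr)
        also have "\<dots> = (\<Oplus>l\<in>{..<d}. ?c \<otimes> (g s (a + b) i l \<otimes> y l))"
          using g[OF s] i yR by (intro finsum_rdistr) auto
        finally show ?thesis .
      qed
      also have "\<dots> = (\<Oplus>l\<in>{..<d}. matrix_mult R d (g s a) (g s b) i l \<otimes> y l)"
      proof (rule finsum_cong'[OF refl])
        fix l assume "l \<in> {..<d}"
        then have l: "l < d" by simp
        show "([((a + b) choose a)] \<cdot> \<one>) \<otimes> (g s (a + b) i l \<otimes> y l) = matrix_mult R d (g s a) (g s b) i l \<otimes> y l"
          unfolding dp[OF s i l, symmetric] using g[OF s i l] yR[OF l] by (simp add: add_pow_ldistr)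
      qed (use mm[OF s s i] yR in auto)
      finally show "([((a + b) choose a)] \<cdot>\<^bsub>?V\<^esub> mat_op R d (g s (a + b)) y) i =
        mat_op R d (matrix_mult R d (g s a) (g s b)) y i" using i by (simp add: mat_op_def)
    qed
    also have "\<dots> = (T s a \<otimes>\<^bsub>?E\<^esub> T s b) y" by (rule mult[OF s s y, symmetric])
    finally show "(T s a \<otimes>\<^bsub>?E\<^esub> T s b) y = ([((a + b) choose a)] \<cdot>\<^bsub>?E\<^esub> T s (a + b)) y" by simp
  qed (use T[OF s] in simp_all)
  have nil: "T s (p ^ s) [^]\<^bsub>?E\<^esub> p = \<zero>\<^bsub>?E\<^esub>" if s: "s \<in> S" for s
  proof -
    have pw: "\<exists>c::nat. T s (p ^ s) [^]\<^bsub>?E\<^esub> Suc m = [c] \<cdot>\<^bsub>?E\<^esub> T s (Suc m * p ^ s)" for m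
    proof (induction m)
      case 0
      show ?case using T[OF s] by (intro exI[of _ 1]) simp
    next
      case (Suc m)
      then obtain c :: nat where c: "T s (p ^ s) [^]\<^bsub>?E\<^esub> Suc m = [c] \<cdot>\<^bsub>?E\<^esub> T s (Suc m * p ^ s)" by blast
      have "T s (p ^ s) [^]\<^bsub>?E\<^esub> Suc (Suc m) = ([c] \<cdot>\<^bsub>?E\<^esub> T s (Suc m * p ^ s)) \<otimes>\<^bsub>?E\<^esub> T s (p ^ s)"
        using c by simp
      also have "\<dots> = [c] \<cdot>\<^bsub>?E\<^esub> (T s (Suc m * p ^ s) \<otimes>\<^bsub>?E\<^esub> T s (p ^ s))"
        using T[OF s] by (simp only: E.add_pow_ldistr)
      also have "\<dots> = [c] \<cdot>\<^bsub>?E\<^esub> ([((Suc m * p ^ s + p ^ s) choose (Suc m * p ^ s))] \<cdot>\<^bsub>?E\<^esub> T s (Suc m * p ^ s + p ^ s))"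
        by (simp only: dpE[OF s])
      also have "\<dots> = [(((Suc m * p ^ s + p ^ s) choose (Suc m * p ^ s)) * c)] \<cdot>\<^bsub>?E\<^esub> T s (Suc m * p ^ s + p ^ s)"
        using T[OF s] by (simp only: E.add.nat_pow_pow)
      also have "Suc m * p ^ s + p ^ s = Suc (Suc m) * p ^ s" by simp
      finally show ?case by blast
    qed
    have "2 \<le> p" using p(1) by (rule prime_ge_2_nat)
    then obtain m where m: "p = Suc (Suc m)" by (metis add_2_eq_Suc le_Suc_ex)
    obtain c :: nat where c: "T s (p ^ s) [^]\<^bsub>?E\<^esub> Suc m = [c] \<cdot>\<^bsub>?E\<^esub> T s (Suc m * p ^ s)" using pw by blast
    have e: "Suc m * p ^ s + p ^ s = p ^ Suc s" using m by simp
    have "T s (p ^ s) [^]\<^bsub>?E\<^esub> Suc (Suc m) = ([c] \<cdot>\<^bsub>?E\<^esub> T s (Suc m * p ^ s)) \<otimes>\<^bsub>?E\<^esub> T s (p ^ s)"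
      using c by simp
    also have "\<dots> = [c] \<cdot>\<^bsub>?E\<^esub> (T s (Suc m * p ^ s) \<otimes>\<^bsub>?E\<^esub> T s (p ^ s))"
      using T[OF s] by (simp only: E.add_pow_ldistr)
    also have "T s (Suc m * p ^ s) \<otimes>\<^bsub>?E\<^esub> T s (p ^ s) = [((p ^ Suc s) choose (Suc m * p ^ s))] \<cdot>\<^bsub>?E\<^esub> T s (p ^ Suc s)"
      unfolding dpE[OF s] e by (rule refl)
    also have "\<dots> = \<zero>\<^bsub>?E\<^esub>"
    proof (rule E.char_mult_zero[OF pE T[OF s]])
      have "p ^ s \<le> p ^ Suc s" "p ^ Suc s - p ^ s = Suc m * p ^ s" using e by linarith+
      then have "(p ^ Suc s) choose (Suc m * p ^ s) = (p ^ Suc s) choose (p ^ s)"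
        using binomial_symmetric[of "p ^ s" "p ^ Suc s"] by metis
      then show "p dvd ((p ^ Suc s) choose (Suc m * p ^ s))" using prime_dvd_choose_power[OF p(1)] by simp
    qed
    finally have "T s (p ^ s) [^]\<^bsub>?E\<^esub> Suc (Suc m) = \<zero>\<^bsub>?E\<^esub>" by simp
    then show ?thesis using m by simp
  qed
  let ?U = "\<lambda>i j. \<Oplus>s\<in>S. g s (p ^ s) i j"
  let ?F = "\<Oplus>\<^bsub>?E\<^esub>s\<in>S. T s (p ^ s)"
  have F0: "?F [^]\<^bsub>?E\<^esub> p = \<zero>\<^bsub>?E\<^esub>"
    by (rule E.sum_commuting_nilpotent[OF S T nil comm p(1) pE])
  have FE: "?F \<in> carrier ?E" using T by (intro E.finsum_closed) auto
  have Fx: "?F y = mat_op R d ?U y" if y: "y \<in> carrier ?V" for y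
  proof -
    have yR: "\<And>l. l < d \<Longrightarrow> y l \<in> carrier R" using y by auto
    have mo: "mat_op R d (g s (p ^ s)) y \<in> carrier ?V" if s: "s \<in> S" for s by (rule mat_op_closed[OF g[OF s] y])
    have "(\<Oplus>\<^bsub>?E\<^esub>s\<in>S'. T s (p ^ s)) y = (\<Oplus>\<^bsub>?V\<^esub>s\<in>S'. mat_op R d (g s (p ^ s)) y)" if "S' \<subseteq> S" for S'
      using finite_subset[OF that S] that
    proof (induction S')
      case empty
      show ?case using y by (simp add: End_ring_simps(4) del: vec_space_simps)
    next
      case (insert s S')
      have S': "S' \<subseteq> S" and s: "s \<in> S" using insert.prems by simp_all
      have 1: "(\<lambda>s. T s (p ^ s)) \<in> S' \<rightarrow> carrier ?E" by (intro funcsetI T subsetD[OF S'])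
      have 2: "(\<lambda>s. mat_op R d (g s (p ^ s)) y) \<in> S' \<rightarrow> carrier ?V" by (intro funcsetI mo subsetD[OF S'])
      have "(\<Oplus>\<^bsub>?E\<^esub>s\<in>insert s S'. T s (p ^ s)) = T s (p ^ s) \<oplus>\<^bsub>?E\<^esub> (\<Oplus>\<^bsub>?E\<^esub>s\<in>S'. T s (p ^ s))"
        by (rule E.finsum_insert[OF insert.hyps 1 T[OF s]])
      then have "(\<Oplus>\<^bsub>?E\<^esub>s\<in>insert s S'. T s (p ^ s)) y = T s (p ^ s) y \<oplus>\<^bsub>?V\<^esub> (\<Oplus>\<^bsub>?E\<^esub>s\<in>S'. T s (p ^ s)) y"
        using y by (simp only: End_ring_simps(5) restrict_apply if_True)
      also have "\<dots> = mat_op R d (g s (p ^ s)) y \<oplus>\<^bsub>?V\<^esub> (\<Oplus>\<^bsub>?V\<^esub>s\<in>S'. mat_op R d (g s (p ^ s)) y)"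
        unfolding insert.IH[OF S'] using y by (simp only: T_def restrict_apply if_True)
      also have "\<dots> = (\<Oplus>\<^bsub>?V\<^esub>s\<in>insert s S'. mat_op R d (g s (p ^ s)) y)"
        by (rule V.M.finsum_insert[OF insert.hyps 2 mo[OF s], symmetric])
      finally show ?case .
    qed
    then have "?F y = (\<Oplus>\<^bsub>?V\<^esub>s\<in>S. mat_op R d (g s (p ^ s)) y)" by blast
    also have "\<dots> = mat_op R d ?U y"
    proof (rule vec_eqI[of _ d "carrier R" _ "carrier R"])
      show "(\<Oplus>\<^bsub>?V\<^esub>s\<in>S. mat_op R d (g s (p ^ s)) y) \<in> {..<d} \<rightarrow>\<^sub>E carrier R"
        using V.M.finsum_closed[of "\<lambda>s. mat_op R d (g s (p ^ s)) y" S] mo by simp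
      have U: "?U i j \<in> carrier R" if "i < d" "j < d" for i j using g that by (intro finsum_closed) auto
      show "mat_op R d ?U y \<in> {..<d} \<rightarrow>\<^sub>E carrier R" using mat_op_closed[OF U y] by simp
      fix i assume i: "i < d"
      have "(\<Oplus>\<^bsub>?V\<^esub>s\<in>S. mat_op R d (g s (p ^ s)) y) i = (\<Oplus>s\<in>S. mat_op R d (g s (p ^ s)) y i)"
        by (rule vec_finsum[OF S mo i])
      also have "\<dots> = (\<Oplus>s\<in>S. \<Oplus>l\<in>{..<d}. g s (p ^ s) i l \<otimes> y l)" using i by (simp add: mat_op_def)
      also have "\<dots> = (\<Oplus>l\<in>{..<d}. \<Oplus>s\<in>S. g s (p ^ s) i l \<otimes> y l)"
        using S g i yR by (intro finsum_swap) auto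
      also have "\<dots> = (\<Oplus>l\<in>{..<d}. ?U i l \<otimes> y l)"
        using S g i yR by (intro finsum_cong' finsum_ldistr[symmetric]) (auto intro!: finsum_closed)
      finally show "(\<Oplus>\<^bsub>?V\<^esub>s\<in>S. mat_op R d (g s (p ^ s)) y) i = mat_op R d ?U y i" using i by (simp add: mat_op_def)
    qed
    finally show ?thesis .
  qed
  have U: "?U i j \<in> carrier R" if "i < d" "j < d" for i j using g that by (intro finsum_closed) auto
  have xV: "x \<in> carrier ?V" using x by simp
  have mo: "(mat_op R d ?U ^^ n) x \<in> carrier ?V" for n
    by (induction n) (use xV mat_op_closed[OF U] in \<open>simp_all del: vec_space_simps\<close>)
  have "(?F [^]\<^bsub>?E\<^esub> n) ((mat_op R d ?U ^^ m) x) = (mat_op R d ?U ^^ (n + m)) x" for n m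
  proof (induction n arbitrary: m)
    case 0
    then show ?case using mo by (simp add: End_ring_simps(3) del: vec_space_simps)
  next
    case (Suc n)
    have "(?F [^]\<^bsub>?E\<^esub> Suc n) ((mat_op R d ?U ^^ m) x) = (?F [^]\<^bsub>?E\<^esub> n) (?F ((mat_op R d ?U ^^ m) x))"
      using mo by (simp add: End_ring_simps(2) compose_def del: vec_space_simps)
    also have "\<dots> = (?F [^]\<^bsub>?E\<^esub> n) ((mat_op R d ?U ^^ Suc m) x)" using Fx[OF mo] by simp
    also have "\<dots> = (mat_op R d ?U ^^ (n + Suc m)) x" by (rule Suc)
    finally show ?case by simp
  qed
  from this[of p 0] have "(mat_op R d ?U ^^ p) x = (?F [^]\<^bsub>?E\<^esub> p) x" by simp
  then show ?thesis unfolding F0 using xV by (simp add: End_ring_simps(4))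
qed

section \<open>Values of an exponentiation\<close>

lemma add_pow_smult_one:
  assumes "algebra k A"
  shows "add_pow A (n :: nat) \<one>\<^bsub>A\<^esub> = add_pow k n \<one>\<^bsub>k\<^esub> \<odot>\<^bsub>A\<^esub> \<one>\<^bsub>A\<^esub>"
proof -
  interpret k: cring k by (rule algebra.R_cring[OF assms])
  interpret A1: cring A by (rule algebra.M_cring[OF assms])
  interpret A: algebra k A by fact
  show ?thesis by (induction n) (simp_all add: A.smult_l_distr)
qed

lemma frob_kernel_simps:
  "carrier (frob_kernel k p r G) = a_rcosets\<^bsub>G\<^esub> (frob_ideal k p r G)"
  "comult (frob_kernel k p r G) x = map (\<lambda>(a, b). (frob_ideal k p r G +>\<^bsub>G\<^esub> a, frob_ideal k p r G +>\<^bsub>G\<^esub> b))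
     (comult G (SOME h. h \<in> x))"
  by (simp_all add: frob_kernel_def Let_def module.defs hopf.defs quot_algebra_def algebra_via_def FactRing_def)

lemma poly_algebra_simps [simp]:
  "carrier (poly_algebra A) = carrier (UP A)" "monoid.mult (poly_algebra A) = monoid.mult (UP A)"
  "one (poly_algebra A) = one (UP A)" "zero (poly_algebra A) = zero (UP A)" "add (poly_algebra A) = add (UP A)"
  "c \<odot>\<^bsub>poly_algebra A\<^esub> f = monom (UP A) (c \<odot>\<^bsub>A\<^esub> \<one>\<^bsub>A\<^esub>) 0 \<otimes>\<^bsub>UP A\<^esub> f"
  by (simp_all add: poly_algebra_def algebra_via_def)

lemma coset_poly_algebra [simp]: "I +>\<^bsub>poly_algebra A\<^esub> f = I +>\<^bsub>UP A\<^esub> f"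
  by (simp add: a_r_coset_def r_coset_def)

lemma carrier_UP: "carrier (UP A) = up A"
  by (simp add: UP_def)

lemma coeff_UP: "f \<in> carrier (UP A) \<Longrightarrow> coeff (UP A) f n = f n"
  by (simp add: UP_def)

lemma trunc_ideal_iff:
  "f \<in> trunc_ideal p r A \<longleftrightarrow> (\<exists>g\<in>carrier (UP A). f = g \<otimes>\<^bsub>UP A\<^esub> monom (UP A) \<one>\<^bsub>A\<^esub> (p ^ r))"
  by (auto simp: trunc_ideal_def cgenideal_def)

lemma coset_member_diff:
  assumes "ideal I R" "x \<in> carrier R" "y \<in> I +>\<^bsub>R\<^esub> x"
  shows "\<exists>u\<in>I. y = u \<oplus>\<^bsub>R\<^esub> x"
  using assms by (auto simp: a_r_coset_def r_coset_def)

lemma (in algebraic_group_setup) char_zero_algebra: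
  assumes "algebra k A" shows "add_pow A p \<one>\<^bsub>A\<^esub> = \<zero>\<^bsub>A\<^esub>"
proof -
  interpret A1: cring A by (rule algebra.M_cring[OF assms])
  interpret A: algebra k A by fact
  show ?thesis unfolding add_pow_smult_one[OF assms] field(3) by simp
qed

lemma (in algebraic_group_setup) frob_ideal_ideal: "ideal (frob_ideal k p r G) G"
  unfolding frob_ideal_def by (rule G.genideal_ideal) auto

text \<open>
  A point that kills the Frobenius ideal agrees with the unit after raising to the power
  \<open>p^r\<close>. As this power is additive, the \<open>p^r\<close>-th power of a product of two
  such points is that of the unit with itself, so the product kills the ideal, too.
\<close>

lemma (in algebraic_group_setup) conv_kills_frob_ideal:
  fixes A :: "('k, 'u) module"
  assumes A: "algebra k A" and F: "F \<in> alg_hom k G A" and F': "F' \<in> alg_hom k G A"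
    and kF: "\<And>x. x \<in> frob_ideal k p r G \<Longrightarrow> F x = \<zero>\<^bsub>A\<^esub>" and kF': "\<And>x. x \<in> frob_ideal k p r G \<Longrightarrow> F' x = \<zero>\<^bsub>A\<^esub>"
  shows "conv G A F F' \<in> alg_hom k G A" "x \<in> frob_ideal k p r G \<Longrightarrow> conv G A F F' x = \<zero>\<^bsub>A\<^esub>"
proof -
  let ?I = "frob_ideal k p r G" and ?e = "conv_unit G A" and ?q = "p ^ r"
  interpret A1: cring A by (rule algebra.M_cring[OF A])
  interpret A: algebra k A by fact
  have grp: "group (points k G A)" using group A by (simp add: linear_algebraic_group_def)
  interpret grp: group "points k G A" by (rule grp)
  have e: "?e \<in> alg_hom k G A" using grp.one_closed by (simp add: points_def)
  show K: "conv G A F F' \<in> alg_hom k G A"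
    using grp.m_closed[of F F'] F F' by (simp add: points_def)
  have ee: "conv G A ?e ?e = ?e" using grp.l_one[of ?e] e by (simp add: points_def)
  interpret eh: ring_hom_cring G A ?e by (rule ring_hom_cring_of_alg_hom[OF G_algebra A e])
  have ex: "?e a = counit G a \<odot>\<^bsub>A\<^esub> \<one>\<^bsub>A\<^esub>" if "a \<in> carrier G" for a using that by (simp add: conv_unit_def)
  have pow: "H a [^]\<^bsub>A\<^esub> ?q = ?e a [^]\<^bsub>A\<^esub> ?q"
    if H: "H \<in> alg_hom k G A" "\<And>x. x \<in> ?I \<Longrightarrow> H x = \<zero>\<^bsub>A\<^esub>" and a: "a \<in> carrier G" for H a
  proof (cases "\<one>\<^bsub>A\<^esub> = \<zero>\<^bsub>A\<^esub>")
    case True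
    interpret H: ring_hom_cring G A H by (rule ring_hom_cring_of_alg_hom[OF G_algebra A H(1)])
    have "carrier A = {\<zero>\<^bsub>A\<^esub>}" using A1.carrier_one_zero True by simp
    moreover have "H a [^]\<^bsub>A\<^esub> ?q \<in> carrier A" "?e a [^]\<^bsub>A\<^esub> ?q \<in> carrier A" using a by simp_all
    ultimately show ?thesis by simp
  next
    case False
    interpret H: ring_hom_cring G A H by (rule ring_hom_cring_of_alg_hom[OF G_algebra A H(1)])
    let ?b = "counit G a \<odot>\<^bsub>G\<^esub> \<one>\<^bsub>G\<^esub>"
    have ck: "counit G a \<in> carrier k" by (rule counit_closed[OF a])
    have b: "?b \<in> carrier G" using ck by simp
    define z where "z = a \<ominus>\<^bsub>G\<^esub> ?b"
    have z: "z \<in> carrier G" using a b by (simp add: z_def)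
    have ebb: "?e ?b = ?e a" using alg_homD(3)[OF e ck G.one_closed] ex[OF a] by simp
    have "?e z = \<zero>\<^bsub>A\<^esub>" unfolding z_def using a b ebb by (simp add: a_minus_def A1.r_neg)
    then have cz: "counit G z \<odot>\<^bsub>A\<^esub> \<one>\<^bsub>A\<^esub> = \<zero>\<^bsub>A\<^esub>" using ex[OF z] by simp
    have "counit G z = \<zero>\<^bsub>k\<^esub>"
    proof (rule ccontr)
      assume nz: "counit G z \<noteq> \<zero>\<^bsub>k\<^esub>"
      let ?i = "inv\<^bsub>k\<^esub> counit G z"
      have u: "counit G z \<in> Units k" using nz counit_closed[OF z] kf.field_Units by simp
      have "\<one>\<^bsub>A\<^esub> = (?i \<otimes>\<^bsub>k\<^esub> counit G z) \<odot>\<^bsub>A\<^esub> \<one>\<^bsub>A\<^esub>" using kf.Units_l_inv[OF u] by simp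
      also have "\<dots> = ?i \<odot>\<^bsub>A\<^esub> (counit G z \<odot>\<^bsub>A\<^esub> \<one>\<^bsub>A\<^esub>)"
        using kf.Units_inv_closed[OF u] counit_closed[OF z] by (intro A.smult_assoc1) auto
      also have "\<dots> = \<zero>\<^bsub>A\<^esub>" unfolding cz using kf.Units_inv_closed[OF u] by simp
      finally show False using False by simp
    qed
    then have "z [^]\<^bsub>G\<^esub> ?q \<in> {h [^]\<^bsub>G\<^esub> ?q | h. h \<in> carrier G \<and> counit G h = \<zero>\<^bsub>k\<^esub>}" using z by blast
    then have "z [^]\<^bsub>G\<^esub> ?q \<in> ?I"
      unfolding frob_ideal_def using G.genideal_self[of "{h [^]\<^bsub>G\<^esub> ?q | h. h \<in> carrier G \<and> counit G h = \<zero>\<^bsub>k\<^esub>}"] by blast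
    then have "H (z [^]\<^bsub>G\<^esub> ?q) = \<zero>\<^bsub>A\<^esub>" by (rule H(2))
    moreover have "a = z \<oplus>\<^bsub>G\<^esub> ?b" unfolding z_def using a b by (simp add: a_minus_def G.a_assoc G.l_neg)
    then have "a [^]\<^bsub>G\<^esub> ?q = z [^]\<^bsub>G\<^esub> ?q \<oplus>\<^bsub>G\<^esub> ?b [^]\<^bsub>G\<^esub> ?q"
      using G.frobenius_add[OF z b field(2) char_zero_algebra[OF G_algebra], of r] by simp
    then have "H (a [^]\<^bsub>G\<^esub> ?q) = H (z [^]\<^bsub>G\<^esub> ?q) \<oplus>\<^bsub>A\<^esub> H (?b [^]\<^bsub>G\<^esub> ?q)" using z b by simp
    ultimately have "H a [^]\<^bsub>A\<^esub> ?q = H ?b [^]\<^bsub>A\<^esub> ?q" using a b by simp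
    also have "H ?b = ?e a" using alg_homD(3)[OF H(1) ck G.one_closed] ex[OF a] by simp
    finally show ?thesis .
  qed
  have frob: "tensor_sum A u v xs [^]\<^bsub>A\<^esub> ?q = tensor_sum A (\<lambda>a. u a [^]\<^bsub>A\<^esub> ?q) (\<lambda>a. v a [^]\<^bsub>A\<^esub> ?q) xs"
    if xs: "set xs \<subseteq> carrier G \<times> carrier G" and uv: "\<And>h. h \<in> carrier G \<Longrightarrow> u h \<in> carrier A" "\<And>h. h \<in> carrier G \<Longrightarrow> v h \<in> carrier A"
    for u v xs using xs
  proof (induction xs)
    case Nil
    show ?case using p_pos by (simp add: A1.nat_pow_zero)
  next
    case (Cons x xs)
    obtain a b where x: "x = (a, b)" by (cases x)
    have ab: "a \<in> carrier G" "b \<in> carrier G" and xs: "set xs \<subseteq> carrier G \<times> carrier G" using Cons.prems x by auto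
    have t: "tensor_sum A u v xs \<in> carrier A" by (rule tensor_sum_closed[OF A1.is_cring xs uv])
    have "tensor_sum A u v (x # xs) [^]\<^bsub>A\<^esub> ?q = (u a \<otimes>\<^bsub>A\<^esub> v b) [^]\<^bsub>A\<^esub> ?q \<oplus>\<^bsub>A\<^esub> tensor_sum A u v xs [^]\<^bsub>A\<^esub> ?q"
      using A1.frobenius_add[OF _ t field(2) char_zero_algebra[OF A], of "u a \<otimes>\<^bsub>A\<^esub> v b" r] uv ab x by simp
    then show ?case using Cons.IH[OF xs] uv ab x by (simp add: A1.nat_pow_distrib)
  qed
  have Fc: "\<And>h. h \<in> carrier G \<Longrightarrow> F h \<in> carrier A" "\<And>h. h \<in> carrier G \<Longrightarrow> F' h \<in> carrier A"
    using alg_homD(4)[OF F] alg_homD(4)[OF F'] by auto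
  have tcong: "tensor_sum A u v xs = tensor_sum A u' v' xs"
    if "set xs \<subseteq> carrier G \<times> carrier G" "\<And>h. h \<in> carrier G \<Longrightarrow> u h = u' h" "\<And>h. h \<in> carrier G \<Longrightarrow> v h = v' h" for u v u' v' xs
    using that(1) by (induction xs) (auto simp: that(2,3))
  interpret K: ring_hom_cring G A "conv G A F F'" by (rule ring_hom_cring_of_alg_hom[OF G_algebra A K])
  have gen: "conv G A F F' (h [^]\<^bsub>G\<^esub> ?q) = \<zero>\<^bsub>A\<^esub>" if h: "h \<in> carrier G" "counit G h = \<zero>\<^bsub>k\<^esub>" for h
  proof -
    note cm = comult_closed[OF h(1)]
    have "conv G A F F' (h [^]\<^bsub>G\<^esub> ?q) = conv G A F F' h [^]\<^bsub>A\<^esub> ?q" using h by simp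
    also have "\<dots> = tensor_sum A (\<lambda>a. F a [^]\<^bsub>A\<^esub> ?q) (\<lambda>a. F' a [^]\<^bsub>A\<^esub> ?q) (comult G h)"
      unfolding conv_tensor_sum[OF h(1)] by (rule frob[OF cm Fc])
    also have "\<dots> = tensor_sum A (\<lambda>a. ?e a [^]\<^bsub>A\<^esub> ?q) (\<lambda>a. ?e a [^]\<^bsub>A\<^esub> ?q) (comult G h)"
      by (rule tcong[OF cm]) (rule pow[OF F kF], assumption+, rule pow[OF F' kF'])
    also have "\<dots> = conv G A ?e ?e h [^]\<^bsub>A\<^esub> ?q"
      unfolding conv_tensor_sum[OF h(1)] by (rule frob[OF cm, symmetric]) simp_all
    also have "\<dots> = \<zero>\<^bsub>A\<^esub>" unfolding ee ex[OF h(1)] h(2) using p_pos by (simp add: A1.nat_pow_zero)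
    finally show ?thesis .
  qed
  have gk: "{h [^]\<^bsub>G\<^esub> ?q | h. h \<in> carrier G \<and> counit G h = \<zero>\<^bsub>k\<^esub>} \<subseteq> a_kernel G A (conv G A F F')"
  proof (rule subsetI)
    fix y assume "y \<in> {h [^]\<^bsub>G\<^esub> ?q | h. h \<in> carrier G \<and> counit G h = \<zero>\<^bsub>k\<^esub>}"
    then obtain h where h: "h \<in> carrier G" "counit G h = \<zero>\<^bsub>k\<^esub>" "y = h [^]\<^bsub>G\<^esub> ?q" by blast
    show "y \<in> a_kernel G A (conv G A F F')"
      unfolding a_kernel_def' h(3) by (rule CollectI) (rule conjI[OF G.nat_pow_closed[OF h(1)] gen[OF h(1,2)]])
  qed
  have sub: "?I \<subseteq> a_kernel G A (conv G A F F')"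
    unfolding frob_ideal_def by (rule G.genideal_minimal[OF K.ring.kernel_is_ideal gk])
  show "conv G A F F' x = \<zero>\<^bsub>A\<^esub>" if "x \<in> ?I"
    using subsetD[OF sub that] unfolding a_kernel_def' by (rule CollectE) (rule conjunct2)
qed

locale exp_setup = algebraic_group_setup k p G ty
  for k :: "'k ring" and p :: nat and G :: "('k, 'h) hopf" and ty :: "'u itself" +
  fixes N :: "('k, 'u, 'h \<Rightarrow> 'u) coord" and E :: "'h \<Rightarrow> nat \<Rightarrow> 'u"
    and d :: nat and c :: "nat \<Rightarrow> nat \<Rightarrow> 'h"
  assumes inf: "infinite (UNIV :: 'u set)"
    and nilp: "nilp_scheme k p G N"
    and exp_type: "exponential_type_infinite k p G N E"
    and module: "rational_module TYPE('u) k G d c"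
begin

lemma N_algebra: "algebra k N" using nilp unfolding nilp_scheme_def by (rule conjunct1)

lemma univ_point: "univ N \<in> nilp_points k p G N" using nilp unfolding nilp_scheme_def by (rule conjunct1[OF conjunct2])

sublocale N: cring N by (rule algebra.M_cring[OF N_algebra])
sublocale Na: algebra k N by (rule N_algebra)
sublocale P: UP_cring N "UP N" by (intro UP_cring.intro N.is_cring) simp

lemma classify:
  fixes A :: "('k, 'u, 'm) module_scheme"
  assumes A: "algebra k A" and B: "B \<in> nilp_points k p G A"
  shows "nilp_classify k G N A B \<in> alg_hom k N A" "compose (carrier G) (nilp_classify k G N A B) (univ N) = B"
    "\<And>\<phi>. \<phi> \<in> alg_hom k N A \<Longrightarrow> compose (carrier G) \<phi> (univ N) = B \<Longrightarrow> \<phi> = nilp_classify k G N A B"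
proof -
  have "algebra k (plain A)" "B \<in> nilp_points k p G (plain A)" using algebra_plain[OF A] B by simp_all
  then have "\<exists>!\<phi>. \<phi> \<in> alg_hom k N (plain A) \<and> compose (carrier G) \<phi> (univ N) = B"
    using nilp unfolding nilp_scheme_def by blast
  then have ex: "\<exists>!\<phi>. \<phi> \<in> alg_hom k N A \<and> compose (carrier G) \<phi> (univ N) = B" by simp
  show "nilp_classify k G N A B \<in> alg_hom k N A" "compose (carrier G) (nilp_classify k G N A B) (univ N) = B"
    using theI'[OF ex] unfolding nilp_classify_def by blast+
  show "\<phi> = nilp_classify k G N A B" if "\<phi> \<in> alg_hom k N A" "compose (carrier G) \<phi> (univ N) = B" for \<phi>
    unfolding nilp_classify_def by (rule the1_equality[OF ex, symmetric]) (use that in simp)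
qed

lemma univ_closed: "univ N \<in> carrier G \<rightarrow> carrier N"
  by (rule nilp_points_closed[OF N_algebra univ_point])

text \<open>
  Both sides classify the image of \<open>B\<close>.
\<close>

lemma classify_hom:
  assumes A: "algebra k A" and A': "algebra k A'" and \<phi>: "\<phi> \<in> alg_hom k A A'" and B: "B \<in> nilp_points k p G A"
  shows "nilp_classify k G N A' (compose (carrier G) \<phi> B) = compose (carrier N) \<phi> (nilp_classify k G N A B)"
proof (rule classify(3)[OF A' nilp_points_hom[OF A A' \<phi> B], symmetric])
  show "compose (carrier N) \<phi> (nilp_classify k G N A B) \<in> alg_hom k N A'"
    by (rule alg_hom_compose[OF N_algebra classify(1)[OF A B] \<phi>])
  have "compose (carrier G) (compose (carrier N) \<phi> (nilp_classify k G N A B)) (univ N) =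
      compose (carrier G) \<phi> (compose (carrier G) (nilp_classify k G N A B) (univ N))"
    using univ_closed by (auto simp: compose_def restrict_def fun_eq_iff Pi_def)
  then show "compose (carrier G) (compose (carrier N) \<phi> (nilp_classify k G N A B)) (univ N) = compose (carrier G) \<phi> B"
    unfolding classify(2)[OF A B] .
qed

lemma E_hom: "E \<in> ring_hom G (UP N)" and E_smult: "\<And>a h. a \<in> carrier k \<Longrightarrow> h \<in> carrier G \<Longrightarrow>
    E (a \<odot>\<^bsub>G\<^esub> h) = monom (UP N) (a \<odot>\<^bsub>N\<^esub> \<one>\<^bsub>N\<^esub>) 0 \<otimes>\<^bsub>UP N\<^esub> E h"
proof -
  have E: "E \<in> alg_hom k G (poly_algebra N)" using exp_type by (simp add: exponential_type_infinite_def)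
  show "E \<in> ring_hom G (UP N)" using alg_homD(1)[OF E] by (simp add: ring_hom_def)
  show "E (a \<odot>\<^bsub>G\<^esub> h) = monom (UP N) (a \<odot>\<^bsub>N\<^esub> \<one>\<^bsub>N\<^esub>) 0 \<otimes>\<^bsub>UP N\<^esub> E h"
    if "a \<in> carrier k" "h \<in> carrier G" for a h using alg_homD(3)[OF E that] by simp
qed

sublocale Eh: ring_hom_cring G "UP N" E
  by (intro ring_hom_cring.intro ring_hom_cring_axioms.intro E_hom G.is_cring P.UP_cring)

lemma E_coeff: "h \<in> carrier G \<Longrightarrow> E h n \<in> carrier N"
  by (rule mem_upD[OF Eh.hom_closed[unfolded carrier_UP]])

lemma E_coeff_eq: "h \<in> carrier G \<Longrightarrow> coeff (UP N) (E h) n = E h n"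
  by (rule coeff_UP[OF Eh.hom_closed])

lemma exp_typeD:
  assumes "0 < r"
  shows "E ` frob_ideal k p r G \<subseteq> trunc_ideal p r N" "exponential_type k p r G N (exp_restrict k p r G N E)"
proof -
  have "\<forall>r>0. E ` frob_ideal k p r G \<subseteq> trunc_ideal p r N \<and> exponential_type k p r G N (exp_restrict k p r G N E)"
    using exp_type unfolding exponential_type_infinite_def by (rule conjunct2)
  note this[rule_format, OF assms]
  then show "E ` frob_ideal k p r G \<subseteq> trunc_ideal p r N" "exponential_type k p r G N (exp_restrict k p r G N E)"
    by (rule conjunct1, rule conjunct2)
qed

lemma E_frob: "0 < r \<Longrightarrow> x \<in> frob_ideal k p r G \<Longrightarrow> E x \<in> trunc_ideal p r N"
  by (rule subsetD[OF exp_typeD(1) imageI])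

text \<open>The comorphism of the point \<open>E_B(\<alpha>)\<close> for \<open>\<chi>\<close> classifying \<open>B\<close>.\<close>

definition exp_point :: "('k, 'u) module \<Rightarrow> ('u \<Rightarrow> 'u) \<Rightarrow> 'u \<Rightarrow> 'h \<Rightarrow> 'u" where
  "exp_point A \<chi> \<alpha> = (\<lambda>h\<in>carrier G. UnivPoly.eval N A \<chi> \<alpha> (E h))"

context
  fixes A :: "('k, 'u) module" and \<chi> :: "'u \<Rightarrow> 'u" and \<alpha> :: 'u and r :: nat
  assumes A: "algebra k A" and \<chi>: "\<chi> \<in> alg_hom k N A" and \<alpha>: "\<alpha> \<in> ga_points p r A"
begin

interpretation h: ring_hom_cring N A \<chi> by (rule ring_hom_cring_of_alg_hom[OF N_algebra A \<chi>])
interpretation ev: UP_pre_univ_prop N A \<chi> "UP N"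
  by (intro UP_pre_univ_prop.intro h.ring_hom_cring_axioms P.UP_cring_axioms)

lemma ga: "\<alpha> \<in> carrier A" "\<alpha> [^]\<^bsub>A\<^esub> (p ^ r) = \<zero>\<^bsub>A\<^esub>"
  using \<alpha> by (auto simp: ga_points_def)

lemma eval_hom: "ring_hom_cring (UP N) A (UnivPoly.eval N A \<chi> \<alpha>)"
  by (intro ring_hom_cring.intro ring_hom_cring_axioms.intro P.UP_cring h.S.is_cring ev.eval_ring_hom ga)

lemma eval_trunc_ideal:
  assumes "f \<in> trunc_ideal p r N" shows "f \<in> carrier (UP N)" "UnivPoly.eval N A \<chi> \<alpha> f = \<zero>\<^bsub>A\<^esub>"
proof -
  interpret e: ring_hom_cring "UP N" A "UnivPoly.eval N A \<chi> \<alpha>" by (rule eval_hom)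
  obtain g where g: "g \<in> carrier (UP N)" "f = g \<otimes>\<^bsub>UP N\<^esub> monom (UP N) \<one>\<^bsub>N\<^esub> (p ^ r)"
    using assms trunc_ideal_iff by blast
  then show "f \<in> carrier (UP N)" by simp
  have "UnivPoly.eval N A \<chi> \<alpha> (monom (UP N) \<one>\<^bsub>N\<^esub> (p ^ r)) = \<chi> \<one>\<^bsub>N\<^esub> \<otimes>\<^bsub>A\<^esub> \<alpha> [^]\<^bsub>A\<^esub> (p ^ r)"
    by (rule ev.eval_monom) (use ga in simp_all)
  then show "UnivPoly.eval N A \<chi> \<alpha> f = \<zero>\<^bsub>A\<^esub>" using g ga by simp
qed

lemma exp_point_hom: "exp_point A \<chi> \<alpha> \<in> alg_hom k G A"
proof -
  interpret e: ring_hom_cring "UP N" A "UnivPoly.eval N A \<chi> \<alpha>" by (rule eval_hom)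
  interpret Aa: algebra k A by (rule A)
  have x: "exp_point A \<chi> \<alpha> h = UnivPoly.eval N A \<chi> \<alpha> (E h)" if "h \<in> carrier G" for h
    using that by (simp add: exp_point_def)
  show ?thesis
    unfolding alg_hom_def
  proof (intro CollectI conjI ballI)
    show "exp_point A \<chi> \<alpha> \<in> ring_hom G A" by (rule ring_hom_memI) (simp_all add: x)
    show "exp_point A \<chi> \<alpha> \<in> extensional (carrier G)" by (simp add: exp_point_def)
    fix a h assume a: "a \<in> carrier k" and h: "h \<in> carrier G"
    have "UnivPoly.eval N A \<chi> \<alpha> (monom (UP N) (a \<odot>\<^bsub>N\<^esub> \<one>\<^bsub>N\<^esub>) 0) = \<chi> (a \<odot>\<^bsub>N\<^esub> \<one>\<^bsub>N\<^esub>) \<otimes>\<^bsub>A\<^esub> \<alpha> [^]\<^bsub>A\<^esub> (0::nat)"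
      by (rule ev.eval_monom) (use ga a in simp_all)
    also have "\<dots> = a \<odot>\<^bsub>A\<^esub> \<one>\<^bsub>A\<^esub>" using alg_homD(3)[OF \<chi> a N.one_closed] a by simp
    finally have m: "UnivPoly.eval N A \<chi> \<alpha> (monom (UP N) (a \<odot>\<^bsub>N\<^esub> \<one>\<^bsub>N\<^esub>) 0) = a \<odot>\<^bsub>A\<^esub> \<one>\<^bsub>A\<^esub>" .
    have "UnivPoly.eval N A \<chi> \<alpha> (E (a \<odot>\<^bsub>G\<^esub> h)) = (a \<odot>\<^bsub>A\<^esub> \<one>\<^bsub>A\<^esub>) \<otimes>\<^bsub>A\<^esub> UnivPoly.eval N A \<chi> \<alpha> (E h)"
      unfolding E_smult[OF a h] using a h m by simp
    also have "\<dots> = a \<odot>\<^bsub>A\<^esub> UnivPoly.eval N A \<chi> \<alpha> (E h)" using a h by (simp add: Aa.smult_assoc2)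
    finally show "exp_point A \<chi> \<alpha> (a \<odot>\<^bsub>G\<^esub> h) = a \<odot>\<^bsub>A\<^esub> exp_point A \<chi> \<alpha> h" using a h by (simp add: x)
  qed
qed

lemma exp_point_kills:
  assumes r: "0 < r" and x: "x \<in> frob_ideal k p r G" shows "exp_point A \<chi> \<alpha> x = \<zero>\<^bsub>A\<^esub>"
proof -
  interpret I: ideal "frob_ideal k p r G" G by (rule frob_ideal_ideal)
  show ?thesis using eval_trunc_ideal(2)[OF E_frob[OF r x]] I.Icarr[OF x] by (simp add: exp_point_def)
qed

text \<open>
  Powers of \<open>\<alpha>\<close> from \<open>p^r\<close> on vanish, and so do coefficients beyond the
  degree.
\<close>

lemma exp_point_sum:
  assumes h: "h \<in> carrier G"
  shows "exp_point A \<chi> \<alpha> h = (\<Oplus>\<^bsub>A\<^esub>n\<in>{..<p ^ r}. \<chi> (E h n) \<otimes>\<^bsub>A\<^esub> \<alpha> [^]\<^bsub>A\<^esub> n)"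
proof -
  let ?D = "deg N (E h)" and ?t = "\<lambda>n. \<chi> (E h n) \<otimes>\<^bsub>A\<^esub> \<alpha> [^]\<^bsub>A\<^esub> n"
  have t: "?t n \<in> carrier A" for n using E_coeff[OF h] ga by simp
  have zD: "?t n = \<zero>\<^bsub>A\<^esub>" if "?D < n" for n
    using P.deg_aboveD[OF that Eh.hom_closed[OF h]] E_coeff_eq[OF h, of n] ga by simp
  have zq: "?t n = \<zero>\<^bsub>A\<^esub>" if "p ^ r \<le> n" for n
  proof -
    have "\<alpha> [^]\<^bsub>A\<^esub> n = \<alpha> [^]\<^bsub>A\<^esub> (p ^ r) \<otimes>\<^bsub>A\<^esub> \<alpha> [^]\<^bsub>A\<^esub> (n - p ^ r)"
      unfolding h.S.nat_pow_mult[OF ga(1)] using that by simp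
    also have "\<dots> = \<zero>\<^bsub>A\<^esub>" unfolding ga(2) by (rule h.S.l_null[OF h.S.nat_pow_closed[OF ga(1)]])
    finally have "\<alpha> [^]\<^bsub>A\<^esub> n = \<zero>\<^bsub>A\<^esub>" .
    then show ?thesis using h.S.r_null[OF h.hom_closed[OF E_coeff[OF h]]] by simp
  qed
  have "exp_point A \<chi> \<alpha> h = (\<Oplus>\<^bsub>A\<^esub>n\<in>{..?D}. ?t n)"
    using h by (simp add: exp_point_def UnivPoly.eval_def E_coeff_eq)
  also have "\<dots> = (\<Oplus>\<^bsub>A\<^esub>n\<in>{..max ?D (p ^ r)}. ?t n)"
    by (rule h.S.finsum_mono_neutral) (use t zD in auto)
  also have "\<dots> = (\<Oplus>\<^bsub>A\<^esub>n\<in>{..<p ^ r}. ?t n)"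
    by (rule h.S.finsum_mono_neutral[symmetric]) (use t zq in auto)
  finally show ?thesis .
qed

end

lemma coset_rep:
  assumes h: "h \<in> carrier G"
  obtains u where "(SOME x. x \<in> frob_ideal k p r G +>\<^bsub>G\<^esub> h) = u \<oplus>\<^bsub>G\<^esub> h" "u \<in> frob_ideal k p r G"
    "u \<in> carrier G"
proof -
  interpret I: ideal "frob_ideal k p r G" G by (rule frob_ideal_ideal)
  have "h \<in> frob_ideal k p r G +>\<^bsub>G\<^esub> h" by (rule I.a_rcos_self[OF h])
  then have "(SOME x. x \<in> frob_ideal k p r G +>\<^bsub>G\<^esub> h) \<in> frob_ideal k p r G +>\<^bsub>G\<^esub> h"
    by (rule someI[of "\<lambda>x. x \<in> frob_ideal k p r G +>\<^bsub>G\<^esub> h"])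
  from coset_member_diff[OF frob_ideal_ideal h this] show ?thesis using that I.Icarr by blast
qed

lemma trunc_ideal_ideal: "ideal (trunc_ideal p r N) (UP N)"
proof -
  have "trunc_ideal p r N = PIdl\<^bsub>UP N\<^esub> (monom (UP N) \<one>\<^bsub>N\<^esub> (p ^ r))"
    by (auto simp: trunc_ideal_def cgenideal_def)
  then show ?thesis using P.P.cgenideal_ideal[of "monom (UP N) \<one>\<^bsub>N\<^esub> (p ^ r)"] by simp
qed

lemma exp_restrict_coset:
  assumes r: "0 < r" and h: "h \<in> carrier G"
  shows "exp_restrict k p r G N E (frob_ideal k p r G +>\<^bsub>G\<^esub> h) = trunc_ideal p r N +>\<^bsub>UP N\<^esub> E h"
proof -
  let ?I = "frob_ideal k p r G" and ?J = "trunc_ideal p r N"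
  interpret I: ideal ?I G by (rule frob_ideal_ideal)
  interpret J: ideal ?J "UP N" by (rule trunc_ideal_ideal)
  have mem: "?I +>\<^bsub>G\<^esub> h \<in> carrier (frob_kernel k p r G)"
    unfolding frob_kernel_simps(1) A_RCOSETS_def' using h by blast
  have "?J +>\<^bsub>UP N\<^esub> E y = ?J +>\<^bsub>UP N\<^esub> E h" if y: "y \<in> ?I +>\<^bsub>G\<^esub> h" for y
  proof -
    obtain u where u: "u \<in> ?I" "y = u \<oplus>\<^bsub>G\<^esub> h" using coset_member_diff[OF frob_ideal_ideal h y] by blast
    have uc: "u \<in> carrier G" using u I.Icarr by blast
    have "E y = E u \<oplus>\<^bsub>UP N\<^esub> E h" using u uc h by simp
    then have "E y \<in> ?J +>\<^bsub>UP N\<^esub> E h"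
      using E_frob[OF r u(1)] by (auto simp: a_r_coset_def r_coset_def)
    then show ?thesis
      using P.P.a_repr_independence[OF _ Eh.hom_closed[OF h] J.a_subgroup] by blast
  qed
  then have "(\<lambda>h. ?J +>\<^bsub>UP N\<^esub> E h) ` (?I +>\<^bsub>G\<^esub> h) = {?J +>\<^bsub>UP N\<^esub> E h}"
    using I.a_rcos_self[OF h] by blast
  then show ?thesis using mem by (simp add: exp_restrict_def)
qed

lemma exp_value_coset:
  fixes A :: "('k, 'u) module"
  assumes A: "algebra k A" and B: "B \<in> nilp_points k p G A" and \<alpha>: "\<alpha> \<in> ga_points p r A"
    and r: "0 < r" and h: "h \<in> carrier G"
  shows "exp_value k p r G N (exp_restrict k p r G N E) A B \<alpha> (frob_ideal k p r G +>\<^bsub>G\<^esub> h) =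
    exp_point A (nilp_classify k G N A B) \<alpha> h"
proof -
  let ?I = "frob_ideal k p r G" and ?J = "trunc_ideal p r N" and ?\<chi> = "nilp_classify k G N A B"
  interpret J: ideal ?J "UP N" by (rule trunc_ideal_ideal)
  interpret e: ring_hom_cring "UP N" A "UnivPoly.eval N A ?\<chi> \<alpha>" by (rule eval_hom[OF A classify(1)[OF A B] \<alpha>])
  have mem: "?I +>\<^bsub>G\<^esub> h \<in> carrier (frob_kernel k p r G)"
    unfolding frob_kernel_simps(1) A_RCOSETS_def' using h by blast
  have "UnivPoly.eval N A ?\<chi> \<alpha> f = UnivPoly.eval N A ?\<chi> \<alpha> (E h)" if f: "f \<in> ?J +>\<^bsub>UP N\<^esub> E h" for f
  proof -
    obtain u where u: "u \<in> ?J" "f = u \<oplus>\<^bsub>UP N\<^esub> E h"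
      using coset_member_diff[OF trunc_ideal_ideal Eh.hom_closed[OF h] f] by blast
    have "UnivPoly.eval N A ?\<chi> \<alpha> f = UnivPoly.eval N A ?\<chi> \<alpha> u \<oplus>\<^bsub>A\<^esub> UnivPoly.eval N A ?\<chi> \<alpha> (E h)"
      unfolding u(2) by (rule e.hom_add[OF eval_trunc_ideal(1)[OF A classify(1)[OF A B] \<alpha> u(1)] Eh.hom_closed[OF h]])
    also have "UnivPoly.eval N A ?\<chi> \<alpha> u = \<zero>\<^bsub>A\<^esub>" by (rule eval_trunc_ideal(2)[OF A classify(1)[OF A B] \<alpha> u(1)])
    finally show ?thesis using e.S.l_zero[OF e.hom_closed[OF Eh.hom_closed[OF h]]] by simp
  qed
  then have "UnivPoly.eval N A ?\<chi> \<alpha> ` (?J +>\<^bsub>UP N\<^esub> E h) = {UnivPoly.eval N A ?\<chi> \<alpha> (E h)}"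
    using J.a_rcos_self[OF Eh.hom_closed[OF h]] by blast
  then show ?thesis
    unfolding exp_value_def value_at_def exp_point_def using mem h
    by (simp only: exp_restrict_coset[OF r h] restrict_apply if_True the_elem_eq)
qed

text \<open>
  The comultiplication of the Frobenius kernel is computed from a chosen representative of the coset.
  The choice does not matter because the product of the two points kills the ideal.
\<close>

lemma frob_kernel_mult:
  fixes A :: "('k, 'u) module"
  assumes A: "algebra k A" and r: "0 < r" and h: "h \<in> carrier G"
    and F: "F \<in> alg_hom k G A" "\<And>x. x \<in> frob_ideal k p r G \<Longrightarrow> F x = \<zero>\<^bsub>A\<^esub>"
    and F': "F' \<in> alg_hom k G A" "\<And>x. x \<in> frob_ideal k p r G \<Longrightarrow> F' x = \<zero>\<^bsub>A\<^esub>"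
    and f: "\<And>h. h \<in> carrier G \<Longrightarrow> f (frob_ideal k p r G +>\<^bsub>G\<^esub> h) = F h"
      "\<And>h. h \<in> carrier G \<Longrightarrow> f' (frob_ideal k p r G +>\<^bsub>G\<^esub> h) = F' h"
  shows "(f \<otimes>\<^bsub>points k (frob_kernel k p r G) A\<^esub> f') (frob_ideal k p r G +>\<^bsub>G\<^esub> h) = conv G A F F' h"
proof -
  let ?I = "frob_ideal k p r G"
  obtain u where u: "(SOME x. x \<in> ?I +>\<^bsub>G\<^esub> h) = u \<oplus>\<^bsub>G\<^esub> h" "u \<in> ?I" "u \<in> carrier G"
    using coset_rep[OF h] .
  have uh: "u \<oplus>\<^bsub>G\<^esub> h \<in> carrier G" by (rule G.a_closed[OF u(3) h])
  have mem: "?I +>\<^bsub>G\<^esub> h \<in> carrier (frob_kernel k p r G)"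
    unfolding frob_kernel_simps(1) A_RCOSETS_def' using h by blast
  have ts: "foldr (\<lambda>(a, b) z. (f a \<otimes>\<^bsub>A\<^esub> f' b) \<oplus>\<^bsub>A\<^esub> z) (map (\<lambda>(a, b). (?I +>\<^bsub>G\<^esub> a, ?I +>\<^bsub>G\<^esub> b)) xs) \<zero>\<^bsub>A\<^esub> =
      tensor_sum A F F' xs" if "set xs \<subseteq> carrier G \<times> carrier G" for xs
    using that by (induction xs) (auto simp: f)
  note K = conv_kills_frob_ideal[OF A F(1) F'(1) F(2) F'(2)]
  interpret K: ring_hom_cring G A "conv G A F F'" by (rule ring_hom_cring_of_alg_hom[OF G_algebra A K(1)])
  have K2: "conv G A F F' u = \<zero>\<^bsub>A\<^esub>"
    by (rule conv_kills_frob_ideal(2)[OF A F(1) F'(1) _ _ u(2)], erule F(2), erule F'(2))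
  have "(f \<otimes>\<^bsub>points k (frob_kernel k p r G) A\<^esub> f') (?I +>\<^bsub>G\<^esub> h) = tensor_sum A F F' (comult G (u \<oplus>\<^bsub>G\<^esub> h))"
    unfolding points_def monoid.simps conv_def restrict_apply if_P[OF mem] frob_kernel_simps(2) u(1)
    by (rule ts[OF comult_closed[OF uh]])
  also have "\<dots> = conv G A F F' (u \<oplus>\<^bsub>G\<^esub> h)" by (rule conv_tensor_sum[OF uh, symmetric])
  also have "\<dots> = conv G A F F' u \<oplus>\<^bsub>A\<^esub> conv G A F F' h" by (rule K.hom_add[OF u(3) h])
  also have "\<dots> = conv G A F F' h" unfolding K2 by (rule K.S.l_zero[OF K.hom_closed[OF h]])
  finally show ?thesis .
qed

end

section \<open>The operators of an exponentiation\<close>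

lemma hom_add_pow:
  assumes "ring_hom_cring A A' \<phi>" "x \<in> carrier A"
  shows "\<phi> (add_pow A (n :: nat) x) = add_pow A' n (\<phi> x)"
proof -
  interpret h: ring_hom_cring A A' \<phi> by fact
  show ?thesis by (induction n) (use assms(2) in simp_all)
qed

text \<open>
  Independence of monomials is stated for sums that vanish; this puts an equality of two sums in that
  form.
\<close>

lemma double_sum_diff:
  assumes "ring_hom_cring A A' \<phi>" and m: "\<And>a b. m a b \<in> carrier A'"
    and u: "\<And>a b. u a b \<in> carrier A" and v: "\<And>a b. v a b \<in> carrier A"
    and eq: "(\<Oplus>\<^bsub>A'\<^esub>a\<in>{..<q::nat}. \<Oplus>\<^bsub>A'\<^esub>b\<in>{..<q}. \<phi> (u a b) \<otimes>\<^bsub>A'\<^esub> m a b) =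
      (\<Oplus>\<^bsub>A'\<^esub>a\<in>{..<q}. \<Oplus>\<^bsub>A'\<^esub>b\<in>{..<q}. \<phi> (v a b) \<otimes>\<^bsub>A'\<^esub> m a b)"
  shows "(\<Oplus>\<^bsub>A'\<^esub>a\<in>{..<q}. \<Oplus>\<^bsub>A'\<^esub>b\<in>{..<q}. \<phi> (u a b \<ominus>\<^bsub>A\<^esub> v a b) \<otimes>\<^bsub>A'\<^esub> m a b) = \<zero>\<^bsub>A'\<^esub>"
proof -
  interpret h: ring_hom_cring A A' \<phi> by fact
  define w where "w = (\<lambda>a b. u a b \<ominus>\<^bsub>A\<^esub> v a b)"
  have w: "w a b \<in> carrier A" for a b unfolding w_def by (rule h.R.minus_closed[OF u v])
  define Sw where "Sw = (\<Oplus>\<^bsub>A'\<^esub>a\<in>{..<q}. \<Oplus>\<^bsub>A'\<^esub>b\<in>{..<q}. \<phi> (w a b) \<otimes>\<^bsub>A'\<^esub> m a b)"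
  define Sv where "Sv = (\<Oplus>\<^bsub>A'\<^esub>a\<in>{..<q}. \<Oplus>\<^bsub>A'\<^esub>b\<in>{..<q}. \<phi> (v a b) \<otimes>\<^bsub>A'\<^esub> m a b)"
  have tw: "\<phi> (w a b) \<otimes>\<^bsub>A'\<^esub> m a b \<in> carrier A'" for a b by (rule h.S.m_closed[OF h.hom_closed[OF w] m])
  have tv: "\<phi> (v a b) \<otimes>\<^bsub>A'\<^esub> m a b \<in> carrier A'" for a b by (rule h.S.m_closed[OF h.hom_closed[OF v] m])
  have cw: "(\<Oplus>\<^bsub>A'\<^esub>b\<in>{..<q}. \<phi> (w a b) \<otimes>\<^bsub>A'\<^esub> m a b) \<in> carrier A'" for a
    by (intro h.S.finsum_closed funcsetI tw)
  have cv: "(\<Oplus>\<^bsub>A'\<^esub>b\<in>{..<q}. \<phi> (v a b) \<otimes>\<^bsub>A'\<^esub> m a b) \<in> carrier A'" for a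
    by (intro h.S.finsum_closed funcsetI tv)
  have Sw: "Sw \<in> carrier A'" unfolding Sw_def by (intro h.S.finsum_closed funcsetI cw)
  have Sv: "Sv \<in> carrier A'" unfolding Sv_def by (intro h.S.finsum_closed funcsetI cv)
  have uw: "\<phi> (u a b) \<otimes>\<^bsub>A'\<^esub> m a b = \<phi> (w a b) \<otimes>\<^bsub>A'\<^esub> m a b \<oplus>\<^bsub>A'\<^esub> \<phi> (v a b) \<otimes>\<^bsub>A'\<^esub> m a b" for a b
  proof -
    have "u a b = w a b \<oplus>\<^bsub>A\<^esub> v a b"
      unfolding w_def a_minus_def using u[of a b] v[of a b] by (simp add: h.R.a_assoc h.R.l_neg)
    then have "\<phi> (u a b) = \<phi> (w a b) \<oplus>\<^bsub>A'\<^esub> \<phi> (v a b)" using h.hom_add[OF w v] by simp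
    then show ?thesis using h.S.l_distr[OF h.hom_closed[OF w] h.hom_closed[OF v] m] by simp
  qed
  have "(\<Oplus>\<^bsub>A'\<^esub>a\<in>{..<q}. \<Oplus>\<^bsub>A'\<^esub>b\<in>{..<q}. \<phi> (u a b) \<otimes>\<^bsub>A'\<^esub> m a b) =
      (\<Oplus>\<^bsub>A'\<^esub>a\<in>{..<q}. (\<Oplus>\<^bsub>A'\<^esub>b\<in>{..<q}. \<phi> (w a b) \<otimes>\<^bsub>A'\<^esub> m a b) \<oplus>\<^bsub>A'\<^esub> (\<Oplus>\<^bsub>A'\<^esub>b\<in>{..<q}. \<phi> (v a b) \<otimes>\<^bsub>A'\<^esub> m a b))"
    unfolding uw by (rule h.S.finsum_cong'[OF refl])
      (intro funcsetI h.S.add.m_closed cw cv, intro h.S.finsum_addf funcsetI tw tv)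
  also have "\<dots> = Sw \<oplus>\<^bsub>A'\<^esub> Sv" unfolding Sw_def Sv_def by (intro h.S.finsum_addf funcsetI cw cv)
  finally have "Sw \<oplus>\<^bsub>A'\<^esub> Sv = Sv" using eq unfolding Sv_def by simp
  then have "Sw = \<zero>\<^bsub>A'\<^esub>" using Sw Sv h.S.add.l_cancel_one by simp
  then show ?thesis unfolding Sw_def w_def .
qed

context exp_setup
begin

lemma entry: "i < d \<Longrightarrow> j < d \<Longrightarrow> c i j \<in> carrier G"
  using module unfolding rational_module_def by (elim conjE) blast

lemma conv_entry:
  fixes A :: "('k, 'u) module"
  assumes A: "algebra k A" and ij: "i < d" "j < d" and x: "x \<in> alg_hom k G A" and y: "y \<in> alg_hom k G A"
  shows "conv G A x y (c i j) = (\<Oplus>\<^bsub>A\<^esub>l\<in>{..<d}. x (c i l) \<otimes>\<^bsub>A\<^esub> y (c l j))"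
proof -
  have e: "\<forall>A :: ('k, 'u) module. algebra k A \<longrightarrow> (\<forall>i<d. \<forall>j<d.
        \<one>\<^bsub>points k G A\<^esub> (c i j) = (if i = j then \<one>\<^bsub>A\<^esub> else \<zero>\<^bsub>A\<^esub>) \<and>
        (\<forall>x\<in>carrier (points k G A). \<forall>y\<in>carrier (points k G A).
           (x \<otimes>\<^bsub>points k G A\<^esub> y) (c i j) = (\<Oplus>\<^bsub>A\<^esub>l\<in>{..<d}. x (c i l) \<otimes>\<^bsub>A\<^esub> y (c l j))))"
    using module unfolding rational_module_def by (rule conjunct2)
  have xy: "x \<in> carrier (points k G A)" "y \<in> carrier (points k G A)" using x y by (simp_all add: points_def)
  have "(x \<otimes>\<^bsub>points k G A\<^esub> y) (c i j) = (\<Oplus>\<^bsub>A\<^esub>l\<in>{..<d}. x (c i l) \<otimes>\<^bsub>A\<^esub> y (c l j))"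
    by (rule bspec[OF bspec[OF conjunct2[OF mp[OF spec[OF mp[OF spec[OF mp[OF spec[OF e] A]] ij(1)]] ij(2)]] xy(1)] xy(2)])
  then show ?thesis by (simp add: points_def)
qed

text \<open>\<open>coefm \<chi> n\<close> is the matrix by which the coefficient of \<open>t^n\<close> in \<open>E_B(t)\<close> acts on the module, for
  \<open>\<chi>\<close> classifying \<open>B\<close>.\<close>

definition coefm :: "('u \<Rightarrow> 'x) \<Rightarrow> nat \<Rightarrow> nat \<Rightarrow> nat \<Rightarrow> 'x" where
  "coefm \<chi> n i j = \<chi> (E (c i j) n)"

lemma exponentiationD:
  fixes A :: "('k, 'u) module"
  assumes r: "0 < r" and A: "algebra k A" and B: "B \<in> nilp_points k p G A"
  defines "\<psi> \<equiv> exp_restrict k p r G N E"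
  shows "\<And>(A' :: ('k, 'u) module) \<phi> \<alpha> \<beta>. algebra k A' \<Longrightarrow> \<phi> \<in> alg_hom k A A' \<Longrightarrow>
      \<alpha> \<in> ga_points p r A' \<Longrightarrow> \<beta> \<in> ga_points p r A' \<Longrightarrow>
      exp_value k p r G N \<psi> A' (compose (carrier G) \<phi> B) (\<alpha> \<oplus>\<^bsub>A'\<^esub> \<beta>) =
        exp_value k p r G N \<psi> A' (compose (carrier G) \<phi> B) \<alpha> \<otimes>\<^bsub>points k (frob_kernel k p r G) A'\<^esub>
        exp_value k p r G N \<psi> A' (compose (carrier G) \<phi> B) \<beta>"
    "\<And>B' \<alpha> \<beta>. B' \<in> nilp_points k p G A \<Longrightarrow> lie_bracket G A B B' = lie_zero G A \<Longrightarrow>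
      \<alpha> \<in> ga_points p r A \<Longrightarrow> \<beta> \<in> ga_points p r A \<Longrightarrow>
      exp_value k p r G N \<psi> A B \<alpha> \<otimes>\<^bsub>points k (frob_kernel k p r G) A\<^esub> exp_value k p r G N \<psi> A B' \<beta> =
      exp_value k p r G N \<psi> A B' \<beta> \<otimes>\<^bsub>points k (frob_kernel k p r G) A\<^esub> exp_value k p r G N \<psi> A B \<alpha>"
proof -
  have "exponentiation k p r G N \<psi>"
    using exp_typeD(2)[OF r] unfolding \<psi>_def exponential_type_def by (rule conjunct1)
  note e = bspec[OF mp[OF spec[OF conjunct2[OF this[unfolded exponentiation_def]]] A] B]
  show "exp_value k p r G N \<psi> A' (compose (carrier G) \<phi> B) (\<alpha> \<oplus>\<^bsub>A'\<^esub> \<beta>) =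
        exp_value k p r G N \<psi> A' (compose (carrier G) \<phi> B) \<alpha> \<otimes>\<^bsub>points k (frob_kernel k p r G) A'\<^esub>
        exp_value k p r G N \<psi> A' (compose (carrier G) \<phi> B) \<beta>"
    if "algebra k A'" "\<phi> \<in> alg_hom k A A'" "\<alpha> \<in> ga_points p r A'" "\<beta> \<in> ga_points p r A'"
    for A' :: "('k, 'u) module" and \<phi> \<alpha> \<beta>
    by (rule bspec[OF bspec[OF mp[OF spec[OF spec[OF conjunct1[OF e]]] conjI[OF that(1,2)]] that(3)] that(4)])
  show "exp_value k p r G N \<psi> A B \<alpha> \<otimes>\<^bsub>points k (frob_kernel k p r G) A\<^esub> exp_value k p r G N \<psi> A B' \<beta> =
      exp_value k p r G N \<psi> A B' \<beta> \<otimes>\<^bsub>points k (frob_kernel k p r G) A\<^esub> exp_value k p r G N \<psi> A B \<alpha>"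
    if "B' \<in> nilp_points k p G A" "lie_bracket G A B B' = lie_zero G A" "\<alpha> \<in> ga_points p r A" "\<beta> \<in> ga_points p r A"
    for B' \<alpha> \<beta>
    by (rule bspec[OF bspec[OF mp[OF bspec[OF conjunct1[OF conjunct2[OF e]] that(1)] that(2)] that(3)] that(4)])
qed

text \<open>
  Multiplication in the group becomes multiplication of matrices, by the defining property of the
  coaction.
\<close>

lemma exp_value_product:
  fixes A :: "('k, 'u) module"
  assumes r: "0 < r" and A: "algebra k A" and B: "B \<in> nilp_points k p G A" and B': "B' \<in> nilp_points k p G A"
    and \<alpha>: "\<alpha> \<in> ga_points p r A" and \<beta>: "\<beta> \<in> ga_points p r A" and ij: "i < d" "j < d"
  shows "(exp_value k p r G N (exp_restrict k p r G N E) A B \<alpha> \<otimes>\<^bsub>points k (frob_kernel k p r G) A\<^esub>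
      exp_value k p r G N (exp_restrict k p r G N E) A B' \<beta>) (frob_ideal k p r G +>\<^bsub>G\<^esub> c i j) =
    (\<Oplus>\<^bsub>A\<^esub>l\<in>{..<d}.
      (\<Oplus>\<^bsub>A\<^esub>a\<in>{..<p ^ r}. coefm (nilp_classify k G N A B) a i l \<otimes>\<^bsub>A\<^esub> \<alpha> [^]\<^bsub>A\<^esub> a) \<otimes>\<^bsub>A\<^esub>
      (\<Oplus>\<^bsub>A\<^esub>b\<in>{..<p ^ r}. coefm (nilp_classify k G N A B') b l j \<otimes>\<^bsub>A\<^esub> \<beta> [^]\<^bsub>A\<^esub> b))"
proof -
  let ?\<chi> = "nilp_classify k G N A B" and ?\<chi>' = "nilp_classify k G N A B'"
  interpret A1: cring A by (rule algebra.M_cring[OF A])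
  note \<chi> = classify(1)[OF A B] and \<chi>' = classify(1)[OF A B']
  have gc: "\<alpha> \<in> carrier A" "\<beta> \<in> carrier A" using \<alpha> \<beta> by (simp_all add: ga_points_def)
  note F = exp_point_hom[OF A \<chi> \<alpha>] and F' = exp_point_hom[OF A \<chi>' \<beta>]
  have "(exp_value k p r G N (exp_restrict k p r G N E) A B \<alpha> \<otimes>\<^bsub>points k (frob_kernel k p r G) A\<^esub>
      exp_value k p r G N (exp_restrict k p r G N E) A B' \<beta>) (frob_ideal k p r G +>\<^bsub>G\<^esub> c i j) =
    conv G A (exp_point A ?\<chi> \<alpha>) (exp_point A ?\<chi>' \<beta>) (c i j)"
    by (rule frob_kernel_mult[OF A r entry[OF ij] F _ F'])
      (rule exp_point_kills[OF A \<chi> \<alpha> r], assumption, rule exp_point_kills[OF A \<chi>' \<beta> r], assumption,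
       rule exp_value_coset[OF A B \<alpha> r], assumption, rule exp_value_coset[OF A B' \<beta> r], assumption)
  also have "\<dots> = (\<Oplus>\<^bsub>A\<^esub>l\<in>{..<d}. exp_point A ?\<chi> \<alpha> (c i l) \<otimes>\<^bsub>A\<^esub> exp_point A ?\<chi>' \<beta> (c l j))"
    by (rule conv_entry[OF A ij F F'])
  also have "\<dots> = (\<Oplus>\<^bsub>A\<^esub>l\<in>{..<d}.
      (\<Oplus>\<^bsub>A\<^esub>a\<in>{..<p ^ r}. coefm ?\<chi> a i l \<otimes>\<^bsub>A\<^esub> \<alpha> [^]\<^bsub>A\<^esub> a) \<otimes>\<^bsub>A\<^esub>
      (\<Oplus>\<^bsub>A\<^esub>b\<in>{..<p ^ r}. coefm ?\<chi>' b l j \<otimes>\<^bsub>A\<^esub> \<beta> [^]\<^bsub>A\<^esub> b))"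
  proof (rule A1.finsum_cong'[OF refl])
    show "(\<lambda>l. (\<Oplus>\<^bsub>A\<^esub>a\<in>{..<p ^ r}. coefm ?\<chi> a i l \<otimes>\<^bsub>A\<^esub> \<alpha> [^]\<^bsub>A\<^esub> a) \<otimes>\<^bsub>A\<^esub>
      (\<Oplus>\<^bsub>A\<^esub>b\<in>{..<p ^ r}. coefm ?\<chi>' b l j \<otimes>\<^bsub>A\<^esub> \<beta> [^]\<^bsub>A\<^esub> b)) \<in> {..<d} \<rightarrow> carrier A"
    proof (rule funcsetI)
      fix l assume "l \<in> {..<d}"
      then have l: "l < d" by simp
      show "(\<Oplus>\<^bsub>A\<^esub>a\<in>{..<p ^ r}. coefm ?\<chi> a i l \<otimes>\<^bsub>A\<^esub> \<alpha> [^]\<^bsub>A\<^esub> a) \<otimes>\<^bsub>A\<^esub>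
        (\<Oplus>\<^bsub>A\<^esub>b\<in>{..<p ^ r}. coefm ?\<chi>' b l j \<otimes>\<^bsub>A\<^esub> \<beta> [^]\<^bsub>A\<^esub> b) \<in> carrier A"
        unfolding coefm_def
        by (intro A1.m_closed A1.finsum_closed funcsetI A1.nat_pow_closed alg_homD(4)[OF \<chi>] alg_homD(4)[OF \<chi>'] E_coeff entry ij l gc)
    qed
    fix l assume "l \<in> {..<d}"
    then have l: "l < d" by simp
    show "exp_point A ?\<chi> \<alpha> (c i l) \<otimes>\<^bsub>A\<^esub> exp_point A ?\<chi>' \<beta> (c l j) =
      (\<Oplus>\<^bsub>A\<^esub>a\<in>{..<p ^ r}. coefm ?\<chi> a i l \<otimes>\<^bsub>A\<^esub> \<alpha> [^]\<^bsub>A\<^esub> a) \<otimes>\<^bsub>A\<^esub>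
      (\<Oplus>\<^bsub>A\<^esub>b\<in>{..<p ^ r}. coefm ?\<chi>' b l j \<otimes>\<^bsub>A\<^esub> \<beta> [^]\<^bsub>A\<^esub> b)"
      unfolding exp_point_sum[OF A \<chi> \<alpha> entry[OF ij(1) l]] exp_point_sum[OF A \<chi>' \<beta> entry[OF l ij(2)]] coefm_def
      by (rule refl)
  qed
  finally show ?thesis .
qed

lemma coefm_closed:
  assumes "\<chi> \<in> alg_hom k N A" "i < d" "j < d" shows "coefm \<chi> n i j \<in> carrier A"
  unfolding coefm_def by (rule alg_homD(4)[OF assms(1) E_coeff[OF entry[OF assms(2,3)]]])

lemma matrix_mult_coefm_closed:
  assumes "algebra k A" "\<chi> \<in> alg_hom k N A" "\<chi>' \<in> alg_hom k N A" "i < d" "j < d"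
  shows "matrix_mult A d (coefm \<chi> a) (coefm \<chi>' b) i j \<in> carrier A"
proof -
  interpret A1: cring A by (rule algebra.M_cring[OF assms(1)])
  show ?thesis
    unfolding matrix_mult_def
    by (rule A1.finsum_closed, rule funcsetI, rule A1.m_closed; rule coefm_closed)
      (use assms in simp_all)
qed

lemma coefm_compose:
  assumes "i < d" "j < d" shows "coefm (compose (carrier N) \<phi> \<chi>) n i j = \<phi> (coefm \<chi> n i j)"
  using E_coeff[OF entry[OF assms]] by (simp add: coefm_def compose_def)

lemma entry_bound: "\<exists>n0. \<forall>i<d. \<forall>j<d. \<forall>n\<ge>n0. E (c i j) n = \<zero>\<^bsub>N\<^esub>"
proof -
  let ?n = "Suc (\<Sum>i<d. \<Sum>j<d. deg N (E (c i j)))"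
  have "E (c i j) n = \<zero>\<^bsub>N\<^esub>" if "i < d" "j < d" "?n \<le> n" for i j n
  proof -
    have "deg N (E (c i j)) \<le> (\<Sum>j<d. deg N (E (c i j)))"
      using that by (intro member_le_sum) auto
    also have "\<dots> \<le> (\<Sum>i<d. \<Sum>j<d. deg N (E (c i j)))"
      by (rule member_le_sum[where f = "\<lambda>i. \<Sum>j<d. deg N (E (c i j))"]) (use that in auto)
    finally have "deg N (E (c i j)) < n" using that(3) by simp
    from P.deg_aboveD[OF this Eh.hom_closed[OF entry[OF that(1,2)]]]
    show ?thesis unfolding E_coeff_eq[OF entry[OF that(1,2)]] .
  qed
  then show ?thesis by blast
qed

lemma less_p_power: "s < p ^ s"
  by (rule power_gt_expt) (use prime_gt_1_nat[OF field(2)] in simp)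

text \<open>
  The additivity \<open>E_B(\<alpha> + \<beta>) = E_B(\<alpha>) E_B(\<beta>)\<close> is used at points
  \<open>\<alpha>\<close>, \<open>\<beta>\<close> of an extension of \<open>A\<close> in which the
  monomials below the truncation are independent; comparing coefficients of \<open>\<alpha>^a
  \<beta>^b\<close> gives the relation of divided powers. The truncation exceeds the degrees of all
  matrix coefficients, so that no term of degree at least \<open>p^r\<close> is lost on the left.
\<close>

lemma coefm_divided_power:
  fixes A :: "('k, 'u) module"
  assumes A: "algebra k A" and B: "B \<in> nilp_points k p G A" and ij: "i < d" "j < d"
  defines "\<chi> \<equiv> nilp_classify k G N A B"
  shows "add_pow A ((a + b) choose a) (coefm \<chi> (a + b) i j) = matrix_mult A d (coefm \<chi> a) (coefm \<chi> b) i j"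
proof -
  obtain n0 where n0: "\<And>i j n. i < d \<Longrightarrow> j < d \<Longrightarrow> n0 \<le> n \<Longrightarrow> E (c i j) n = \<zero>\<^bsub>N\<^esub>" using entry_bound by blast
  \<comment> \<open>Any \<open>r\<close> with \<open>a\<close>, \<open>b\<close> and \<open>n0\<close> below \<open>p^r\<close> would do.\<close>
  define r where "r = Suc (a + b + n0)"
  let ?q = "p ^ r" and ?\<psi> = "exp_restrict k p r G N E"
  have r: "0 < r" and q: "a < ?q" "b < ?q" "n0 \<le> ?q" using less_p_power[of r] by (simp_all add: r_def)
  obtain A' :: "('k, 'u) module" and \<phi> \<alpha> \<beta> where A': "algebra k A'" and \<phi>: "\<phi> \<in> alg_hom k A A'"
    and \<alpha>: "\<alpha> \<in> carrier A'" and \<beta>: "\<beta> \<in> carrier A'" and z: "\<alpha> [^]\<^bsub>A'\<^esub> ?q = \<zero>\<^bsub>A'\<^esub>" "\<beta> [^]\<^bsub>A'\<^esub> ?q = \<zero>\<^bsub>A'\<^esub>"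
    and ind: "\<forall>u. (\<forall>a<?q. \<forall>b<?q. u a b \<in> carrier A) \<longrightarrow>
      (\<Oplus>\<^bsub>A'\<^esub>a\<in>{..<?q}. \<Oplus>\<^bsub>A'\<^esub>b\<in>{..<?q}. \<phi> (u a b) \<otimes>\<^bsub>A'\<^esub> (\<alpha> [^]\<^bsub>A'\<^esub> a \<otimes>\<^bsub>A'\<^esub> \<beta> [^]\<^bsub>A'\<^esub> b)) = \<zero>\<^bsub>A'\<^esub> \<longrightarrow>
      (\<forall>a<?q. \<forall>b<?q. u a b = \<zero>\<^bsub>A\<^esub>)"
    using bivariate_extension[OF A inf, of ?q] by (elim exE conjE)
  interpret h: ring_hom_cring A A' \<phi> by (rule ring_hom_cring_of_alg_hom[OF A A' \<phi>])
  let ?m = "\<lambda>(a :: nat) (b :: nat). \<alpha> [^]\<^bsub>A'\<^esub> a \<otimes>\<^bsub>A'\<^esub> \<beta> [^]\<^bsub>A'\<^esub> b"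
  have m: "?m a b \<in> carrier A'" for a b by (intro h.S.m_closed h.S.nat_pow_closed \<alpha> \<beta>)
  have ga\<alpha>: "\<alpha> \<in> ga_points p r A'" and ga\<beta>: "\<beta> \<in> ga_points p r A'" using \<alpha> \<beta> z by (simp_all add: ga_points_def)
  have "(\<alpha> \<oplus>\<^bsub>A'\<^esub> \<beta>) [^]\<^bsub>A'\<^esub> ?q = \<zero>\<^bsub>A'\<^esub>"
    using h.S.frobenius_add[OF \<alpha> \<beta> field(2) char_zero_algebra[OF A'], of r] unfolding z by simp
  then have ga\<alpha>\<beta>: "\<alpha> \<oplus>\<^bsub>A'\<^esub> \<beta> \<in> ga_points p r A'" using \<alpha> \<beta> by (simp add: ga_points_def)
  let ?B = "compose (carrier G) \<phi> B"
  have B': "?B \<in> nilp_points k p G A'" by (rule nilp_points_hom[OF A A' \<phi> B])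
  have \<chi>: "\<chi> \<in> alg_hom k N A" unfolding \<chi>_def by (rule classify(1)[OF A B])
  have \<chi>': "nilp_classify k G N A' ?B = compose (carrier N) \<phi> \<chi>" unfolding \<chi>_def by (rule classify_hom[OF A A' \<phi> B])
  note cc = coefm_closed[OF \<chi>]
  let ?u = "\<lambda>a b. add_pow A ((a + b) choose a) (coefm \<chi> (a + b) i j)"
  let ?v = "\<lambda>a b. matrix_mult A d (coefm \<chi> a) (coefm \<chi> b) i j"
  have u: "?u a b \<in> carrier A" for a b by (intro h.R.add.nat_pow_closed cc ij)
  have v: "?v a b \<in> carrier A" for a b by (rule matrix_mult_coefm_closed[OF A \<chi> \<chi> ij])
  have hc: "\<phi> (coefm \<chi> n i j) \<in> carrier A'" if "i < d" "j < d" for n i j by (rule h.hom_closed[OF cc[OF that]])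
  have "(\<Oplus>\<^bsub>A'\<^esub>a\<in>{..<?q}. \<Oplus>\<^bsub>A'\<^esub>b\<in>{..<?q}. \<phi> (?u a b) \<otimes>\<^bsub>A'\<^esub> ?m a b) =
      (\<Oplus>\<^bsub>A'\<^esub>n\<in>{..<?q}. \<phi> (coefm \<chi> n i j) \<otimes>\<^bsub>A'\<^esub> (\<alpha> \<oplus>\<^bsub>A'\<^esub> \<beta>) [^]\<^bsub>A'\<^esub> n)"
    unfolding hom_add_pow[OF h.ring_hom_cring_axioms cc[OF ij]]
  proof (rule h.S.power_series_of_sum[OF hc[OF ij] _ \<alpha> \<beta>, symmetric])
    fix n assume "?q \<le> n"
    then have "E (c i j) n = \<zero>\<^bsub>N\<^esub>" using n0[OF ij, of n] q(3) by simp
    moreover interpret X: ring_hom_cring N A \<chi> by (rule ring_hom_cring_of_alg_hom[OF N_algebra A \<chi>])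
    have "\<chi> \<zero>\<^bsub>N\<^esub> = \<zero>\<^bsub>A\<^esub>" by (rule X.hom_zero)
    ultimately show "\<phi> (coefm \<chi> n i j) = \<zero>\<^bsub>A'\<^esub>" by (simp add: coefm_def)
  qed
  also have "\<dots> = exp_value k p r G N ?\<psi> A' ?B (\<alpha> \<oplus>\<^bsub>A'\<^esub> \<beta>) (frob_ideal k p r G +>\<^bsub>G\<^esub> c i j)"
    unfolding exp_value_coset[OF A' B' ga\<alpha>\<beta> r entry[OF ij]] \<chi>'
    unfolding exp_point_sum[OF A' alg_hom_compose[OF N_algebra \<chi> \<phi>] ga\<alpha>\<beta> entry[OF ij]]
      coefm_compose[OF ij, where \<phi> = \<phi> and \<chi> = \<chi>, symmetric]
    unfolding coefm_def by (rule refl)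
  also have "\<dots> = (\<Oplus>\<^bsub>A'\<^esub>l\<in>{..<d}.
      (\<Oplus>\<^bsub>A'\<^esub>a\<in>{..<?q}. coefm (nilp_classify k G N A' ?B) a i l \<otimes>\<^bsub>A'\<^esub> \<alpha> [^]\<^bsub>A'\<^esub> a) \<otimes>\<^bsub>A'\<^esub>
      (\<Oplus>\<^bsub>A'\<^esub>b\<in>{..<?q}. coefm (nilp_classify k G N A' ?B) b l j \<otimes>\<^bsub>A'\<^esub> \<beta> [^]\<^bsub>A'\<^esub> b))"
    unfolding exponentiationD(1)[OF r A B A' \<phi> ga\<alpha> ga\<beta>] by (rule exp_value_product[OF r A' B' B' ga\<alpha> ga\<beta> ij])
  also have "\<dots> = (\<Oplus>\<^bsub>A'\<^esub>l\<in>{..<d}.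
      (\<Oplus>\<^bsub>A'\<^esub>a\<in>{..<?q}. \<phi> (coefm \<chi> a i l) \<otimes>\<^bsub>A'\<^esub> \<alpha> [^]\<^bsub>A'\<^esub> a) \<otimes>\<^bsub>A'\<^esub>
      (\<Oplus>\<^bsub>A'\<^esub>b\<in>{..<?q}. \<phi> (coefm \<chi> b l j) \<otimes>\<^bsub>A'\<^esub> \<beta> [^]\<^bsub>A'\<^esub> b))"
  proof (rule h.S.finsum_cong'[OF refl])
    show "(\<lambda>l. (\<Oplus>\<^bsub>A'\<^esub>a\<in>{..<?q}. \<phi> (coefm \<chi> a i l) \<otimes>\<^bsub>A'\<^esub> \<alpha> [^]\<^bsub>A'\<^esub> a) \<otimes>\<^bsub>A'\<^esub>
      (\<Oplus>\<^bsub>A'\<^esub>b\<in>{..<?q}. \<phi> (coefm \<chi> b l j) \<otimes>\<^bsub>A'\<^esub> \<beta> [^]\<^bsub>A'\<^esub> b)) \<in> {..<d} \<rightarrow> carrier A'"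
      by (intro funcsetI h.S.m_closed h.S.finsum_closed h.S.nat_pow_closed hc \<alpha> \<beta> ij) simp_all
    fix l assume "l \<in> {..<d}"
    then have l: "l < d" by simp
    show "(\<Oplus>\<^bsub>A'\<^esub>a\<in>{..<?q}. coefm (nilp_classify k G N A' ?B) a i l \<otimes>\<^bsub>A'\<^esub> \<alpha> [^]\<^bsub>A'\<^esub> a) \<otimes>\<^bsub>A'\<^esub>
        (\<Oplus>\<^bsub>A'\<^esub>b\<in>{..<?q}. coefm (nilp_classify k G N A' ?B) b l j \<otimes>\<^bsub>A'\<^esub> \<beta> [^]\<^bsub>A'\<^esub> b) =
      (\<Oplus>\<^bsub>A'\<^esub>a\<in>{..<?q}. \<phi> (coefm \<chi> a i l) \<otimes>\<^bsub>A'\<^esub> \<alpha> [^]\<^bsub>A'\<^esub> a) \<otimes>\<^bsub>A'\<^esub>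
        (\<Oplus>\<^bsub>A'\<^esub>b\<in>{..<?q}. \<phi> (coefm \<chi> b l j) \<otimes>\<^bsub>A'\<^esub> \<beta> [^]\<^bsub>A'\<^esub> b)"
      unfolding \<chi>' coefm_compose[OF ij(1) l] coefm_compose[OF l ij(2)] by (rule refl)
  qed
  also have "\<dots> = (\<Oplus>\<^bsub>A'\<^esub>a\<in>{..<?q}. \<Oplus>\<^bsub>A'\<^esub>b\<in>{..<?q}. \<phi> (?v a b) \<otimes>\<^bsub>A'\<^esub> ?m a b)"
    unfolding matrix_mult_def
    by (rule product_expansion[OF h.ring_hom_cring_axioms _ \<alpha> \<beta>]) (simp_all add: cc ij)
  finally have "(\<Oplus>\<^bsub>A'\<^esub>a\<in>{..<?q}. \<Oplus>\<^bsub>A'\<^esub>b\<in>{..<?q}. \<phi> (?u a b \<ominus>\<^bsub>A\<^esub> ?v a b) \<otimes>\<^bsub>A'\<^esub> ?m a b) = \<zero>\<^bsub>A'\<^esub>"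
    by (rule double_sum_diff[OF h.ring_hom_cring_axioms m u v])
  then have "\<forall>a<?q. \<forall>b<?q. ?u a b \<ominus>\<^bsub>A\<^esub> ?v a b = \<zero>\<^bsub>A\<^esub>"
    by (rule mp[OF mp[OF spec[OF ind, of "\<lambda>a b. ?u a b \<ominus>\<^bsub>A\<^esub> ?v a b"]], rotated]) (intro allI impI h.R.minus_closed u v)
  then have "?u a b \<ominus>\<^bsub>A\<^esub> ?v a b = \<zero>\<^bsub>A\<^esub>" using q(1,2) by blast
  then show ?thesis using h.R.r_right_minus_eq[OF u v] by (rule iffD1[rotated])
qed

text \<open>
  The same comparison of coefficients, for the commutation of \<open>E_B(\<alpha>)\<close> with
  \<open>E_D(\<beta>)\<close>.
\<close>

lemma coefm_commute:
  fixes A :: "('k, 'u) module"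
  assumes A: "algebra k A" and B: "B \<in> nilp_points k p G A" and D: "D \<in> nilp_points k p G A"
    and br: "lie_bracket G A B D = lie_zero G A" and ij: "i < d" "j < d"
  defines "\<chi> \<equiv> nilp_classify k G N A B" and "\<theta> \<equiv> nilp_classify k G N A D"
  shows "matrix_mult A d (coefm \<chi> a) (coefm \<theta> b) i j = matrix_mult A d (coefm \<theta> b) (coefm \<chi> a) i j"
proof -
  define r where "r = Suc (a + b)"
  let ?q = "p ^ r" and ?\<psi> = "exp_restrict k p r G N E"
  have r: "0 < r" and q: "a < ?q" "b < ?q" using less_p_power[of r] by (simp_all add: r_def)
  obtain A' :: "('k, 'u) module" and \<phi> \<alpha> \<beta> where A': "algebra k A'" and \<phi>: "\<phi> \<in> alg_hom k A A'"
    and \<alpha>: "\<alpha> \<in> carrier A'" and \<beta>: "\<beta> \<in> carrier A'" and z: "\<alpha> [^]\<^bsub>A'\<^esub> ?q = \<zero>\<^bsub>A'\<^esub>" "\<beta> [^]\<^bsub>A'\<^esub> ?q = \<zero>\<^bsub>A'\<^esub>"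
    and ind: "\<forall>u. (\<forall>a<?q. \<forall>b<?q. u a b \<in> carrier A) \<longrightarrow>
      (\<Oplus>\<^bsub>A'\<^esub>a\<in>{..<?q}. \<Oplus>\<^bsub>A'\<^esub>b\<in>{..<?q}. \<phi> (u a b) \<otimes>\<^bsub>A'\<^esub> (\<alpha> [^]\<^bsub>A'\<^esub> a \<otimes>\<^bsub>A'\<^esub> \<beta> [^]\<^bsub>A'\<^esub> b)) = \<zero>\<^bsub>A'\<^esub> \<longrightarrow>
      (\<forall>a<?q. \<forall>b<?q. u a b = \<zero>\<^bsub>A\<^esub>)"
    using bivariate_extension[OF A inf, of ?q] by (elim exE conjE)
  interpret h: ring_hom_cring A A' \<phi> by (rule ring_hom_cring_of_alg_hom[OF A A' \<phi>])
  let ?m = "\<lambda>(a :: nat) (b :: nat). \<alpha> [^]\<^bsub>A'\<^esub> a \<otimes>\<^bsub>A'\<^esub> \<beta> [^]\<^bsub>A'\<^esub> b"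
  have m: "?m a b \<in> carrier A'" for a b by (intro h.S.m_closed h.S.nat_pow_closed \<alpha> \<beta>)
  have ga\<alpha>: "\<alpha> \<in> ga_points p r A'" and ga\<beta>: "\<beta> \<in> ga_points p r A'" using \<alpha> \<beta> z by (simp_all add: ga_points_def)
  let ?B = "compose (carrier G) \<phi> B" and ?D = "compose (carrier G) \<phi> D"
  have B': "?B \<in> nilp_points k p G A'" by (rule nilp_points_hom[OF A A' \<phi> B])
  have D': "?D \<in> nilp_points k p G A'" by (rule nilp_points_hom[OF A A' \<phi> D])
  have br': "lie_bracket G A' ?B ?D = lie_zero G A'"
    by (rule lie_bracket_hom[OF A A' \<phi> nilp_points_closed[OF A B] nilp_points_closed[OF A D] br])
  have \<chi>: "\<chi> \<in> alg_hom k N A" unfolding \<chi>_def by (rule classify(1)[OF A B])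
  have \<theta>: "\<theta> \<in> alg_hom k N A" unfolding \<theta>_def by (rule classify(1)[OF A D])
  have \<chi>': "nilp_classify k G N A' ?B = compose (carrier N) \<phi> \<chi>" unfolding \<chi>_def by (rule classify_hom[OF A A' \<phi> B])
  have \<theta>': "nilp_classify k G N A' ?D = compose (carrier N) \<phi> \<theta>" unfolding \<theta>_def by (rule classify_hom[OF A A' \<phi> D])
  note cc = coefm_closed[OF \<chi>] and ct = coefm_closed[OF \<theta>]
  let ?f = "\<lambda>\<chi> x i j. \<Oplus>\<^bsub>A'\<^esub>a\<in>{..<?q}. \<phi> (coefm \<chi> a i j) \<otimes>\<^bsub>A'\<^esub> x [^]\<^bsub>A'\<^esub> a"
  have f: "?f \<chi> \<alpha> i j \<in> carrier A'" "?f \<theta> \<beta> i j \<in> carrier A'" if "i < d" "j < d" for i j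
    by (intro h.S.finsum_closed funcsetI h.S.m_closed h.S.nat_pow_closed \<alpha> \<beta> h.hom_closed cc ct that)+
  let ?u = "\<lambda>a b. matrix_mult A d (coefm \<chi> a) (coefm \<theta> b) i j"
  let ?v = "\<lambda>a b. matrix_mult A d (coefm \<theta> b) (coefm \<chi> a) i j"
  have u: "?u a b \<in> carrier A" for a b by (rule matrix_mult_coefm_closed[OF A \<chi> \<theta> ij])
  have v: "?v a b \<in> carrier A" for a b by (rule matrix_mult_coefm_closed[OF A \<theta> \<chi> ij])
  have v': "?v a b = (\<Oplus>\<^bsub>A\<^esub>l\<in>{..<d}. coefm \<chi> a l j \<otimes>\<^bsub>A\<^esub> coefm \<theta> b i l)" for a b
    unfolding matrix_mult_def
  proof (rule h.R.finsum_cong'[OF refl])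
    show "(\<lambda>l. coefm \<chi> a l j \<otimes>\<^bsub>A\<^esub> coefm \<theta> b i l) \<in> {..<d} \<rightarrow> carrier A"
      by (intro funcsetI h.R.m_closed cc ct ij) simp_all
    fix l assume "l \<in> {..<d}"
    then show "coefm \<theta> b i l \<otimes>\<^bsub>A\<^esub> coefm \<chi> a l j = coefm \<chi> a l j \<otimes>\<^bsub>A\<^esub> coefm \<theta> b i l"
      by (intro h.R.m_comm cc ct ij) simp_all
  qed
  have "(\<Oplus>\<^bsub>A'\<^esub>a\<in>{..<?q}. \<Oplus>\<^bsub>A'\<^esub>b\<in>{..<?q}. \<phi> (?u a b) \<otimes>\<^bsub>A'\<^esub> ?m a b) =
      (\<Oplus>\<^bsub>A'\<^esub>l\<in>{..<d}. ?f \<chi> \<alpha> i l \<otimes>\<^bsub>A'\<^esub> ?f \<theta> \<beta> l j)"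
    unfolding matrix_mult_def
    by (rule product_expansion[OF h.ring_hom_cring_axioms _ \<alpha> \<beta>, symmetric]) (simp_all add: cc ct ij)
  also have "\<dots> = (exp_value k p r G N ?\<psi> A' ?B \<alpha> \<otimes>\<^bsub>points k (frob_kernel k p r G) A'\<^esub>
      exp_value k p r G N ?\<psi> A' ?D \<beta>) (frob_ideal k p r G +>\<^bsub>G\<^esub> c i j)"
    unfolding exp_value_product[OF r A' B' D' ga\<alpha> ga\<beta> ij]
  proof (rule h.S.finsum_cong'[OF refl, symmetric])
    show "(\<lambda>l. ?f \<chi> \<alpha> i l \<otimes>\<^bsub>A'\<^esub> ?f \<theta> \<beta> l j) \<in> {..<d} \<rightarrow> carrier A'"
      by (intro funcsetI h.S.m_closed f ij) simp_all
    fix l assume "l \<in> {..<d}"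
    then have l: "l < d" by simp
    show "(\<Oplus>\<^bsub>A'\<^esub>a\<in>{..<?q}. coefm (nilp_classify k G N A' ?B) a i l \<otimes>\<^bsub>A'\<^esub> \<alpha> [^]\<^bsub>A'\<^esub> a) \<otimes>\<^bsub>A'\<^esub>
        (\<Oplus>\<^bsub>A'\<^esub>b\<in>{..<?q}. coefm (nilp_classify k G N A' ?D) b l j \<otimes>\<^bsub>A'\<^esub> \<beta> [^]\<^bsub>A'\<^esub> b) =
      ?f \<chi> \<alpha> i l \<otimes>\<^bsub>A'\<^esub> ?f \<theta> \<beta> l j"
      unfolding \<chi>' \<theta>' coefm_compose[OF ij(1) l] coefm_compose[OF l ij(2)] by (rule refl)
  qed
  also have "\<dots> = (\<Oplus>\<^bsub>A'\<^esub>l\<in>{..<d}. ?f \<chi> \<alpha> l j \<otimes>\<^bsub>A'\<^esub> ?f \<theta> \<beta> i l)"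
    unfolding exponentiationD(2)[OF r A' B' D' br' ga\<alpha> ga\<beta>] exp_value_product[OF r A' D' B' ga\<beta> ga\<alpha> ij]
  proof (rule h.S.finsum_cong'[OF refl])
    show "(\<lambda>l. ?f \<chi> \<alpha> l j \<otimes>\<^bsub>A'\<^esub> ?f \<theta> \<beta> i l) \<in> {..<d} \<rightarrow> carrier A'"
      by (intro funcsetI h.S.m_closed f ij) simp_all
    fix l assume "l \<in> {..<d}"
    then have l: "l < d" by simp
    show "(\<Oplus>\<^bsub>A'\<^esub>a\<in>{..<?q}. coefm (nilp_classify k G N A' ?D) a i l \<otimes>\<^bsub>A'\<^esub> \<beta> [^]\<^bsub>A'\<^esub> a) \<otimes>\<^bsub>A'\<^esub>
        (\<Oplus>\<^bsub>A'\<^esub>b\<in>{..<?q}. coefm (nilp_classify k G N A' ?B) b l j \<otimes>\<^bsub>A'\<^esub> \<alpha> [^]\<^bsub>A'\<^esub> b) =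
      ?f \<chi> \<alpha> l j \<otimes>\<^bsub>A'\<^esub> ?f \<theta> \<beta> i l"
      unfolding \<chi>' \<theta>' coefm_compose[OF ij(1) l] coefm_compose[OF l ij(2)]
      by (rule h.S.m_comm[OF f(2)[OF ij(1) l] f(1)[OF l ij(2)]])
  qed
  also have "\<dots> = (\<Oplus>\<^bsub>A'\<^esub>a\<in>{..<?q}. \<Oplus>\<^bsub>A'\<^esub>b\<in>{..<?q}. \<phi> (?v a b) \<otimes>\<^bsub>A'\<^esub> ?m a b)"
    unfolding v'
    by (rule product_expansion[OF h.ring_hom_cring_axioms _ \<alpha> \<beta>]) (simp_all add: cc ct ij)
  finally have "(\<Oplus>\<^bsub>A'\<^esub>a\<in>{..<?q}. \<Oplus>\<^bsub>A'\<^esub>b\<in>{..<?q}. \<phi> (?u a b \<ominus>\<^bsub>A\<^esub> ?v a b) \<otimes>\<^bsub>A'\<^esub> ?m a b) = \<zero>\<^bsub>A'\<^esub>"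
    by (rule double_sum_diff[OF h.ring_hom_cring_axioms m u v])
  then have "\<forall>a<?q. \<forall>b<?q. ?u a b \<ominus>\<^bsub>A\<^esub> ?v a b = \<zero>\<^bsub>A\<^esub>"
    by (rule mp[OF mp[OF spec[OF ind, of "\<lambda>a b. ?u a b \<ominus>\<^bsub>A\<^esub> ?v a b"]], rotated]) (intro allI impI h.R.minus_closed u v)
  then have "?u a b \<ominus>\<^bsub>A\<^esub> ?v a b = \<zero>\<^bsub>A\<^esub>" using q(1,2) by blast
  then show ?thesis using h.R.r_right_minus_eq[OF u v] by (rule iffD1[rotated])
qed

text \<open>
  The coefficients of one exponential are divided powers, those of commuting elements commute. So the
  summands commute and have \<open>p\<close>-th power zero, and then so does the sum, in characteristic
  \<open>p\<close>.
\<close>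

lemma exp_operator_nilpotent:
  fixes A :: "('k, 'u, 'm) module_scheme"
  assumes A: "algebra k A" and S: "finite (S :: nat set)"
    and B: "\<And>s. s \<in> S \<Longrightarrow> B s \<in> nilp_points k p G A"
    and br: "\<And>s t. s \<in> S \<Longrightarrow> t \<in> S \<Longrightarrow> lie_bracket G A (B s) (B t) = lie_zero G A"
  shows "nilpotent_matrix A d p (\<lambda>i j. \<Oplus>\<^bsub>A\<^esub>s\<in>S. coefm (nilp_classify k G N A (B s)) (p ^ s) i j)"
proof -
  interpret A1: cring A by (rule algebra.M_cring[OF A])
  let ?A = "plain A" and ?g = "\<lambda>s. coefm (nilp_classify k G N A (B s))"
  have A': "algebra k ?A" by (rule algebra_plain[OF A])
  have B': "B s \<in> nilp_points k p G ?A" if "s \<in> S" for s using B[OF that] by simp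
  have mmp: "matrix_mult ?A d = matrix_mult A d" by (simp add: matrix_mult_def fun_eq_iff)
  have app: "add_pow ?A (n :: nat) x = add_pow A n x" for n x by (simp add: add_pow_def nat_pow_def)
  have brp: "lie_bracket G ?A = lie_bracket G A" "lie_zero G ?A = lie_zero G A"
    by (simp_all add: lie_bracket_def lie_zero_def fun_eq_iff)
  have g: "?g s n i j \<in> carrier A" if "s \<in> S" "i < d" "j < d" for s n i j
    by (rule coefm_closed[OF classify(1)[OF A B[OF that(1)]] that(2,3)])
  have dp: "add_pow A ((a + b) choose a) (?g s (a + b) i j) = matrix_mult A d (?g s a) (?g s b) i j"
    if "s \<in> S" "i < d" "j < d" for s a b i j
    using coefm_divided_power[OF A' B'[OF that(1)] that(2,3), of a b] unfolding points_plain mmp app .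
  have co: "matrix_mult A d (?g s a) (?g t b) i j = matrix_mult A d (?g t b) (?g s a) i j"
    if "s \<in> S" "t \<in> S" "i < d" "j < d" for s t a b i j
    using coefm_commute[OF A' B'[OF that(1)] B'[OF that(2)] br[OF that(1,2), folded brp] that(3,4), of a b]
    unfolding points_plain mmp .
  show ?thesis
  proof (intro nilpotent_matrix.intro nilpotent_matrix_axioms.intro A1.is_cring)
    fix i j assume "i < d" "j < d"
    then show "(\<Oplus>\<^bsub>A\<^esub>s\<in>S. ?g s (p ^ s) i j) \<in> carrier A"
      by (intro A1.finsum_closed funcsetI g)
  next
    fix x assume x: "x \<in> {..<d} \<rightarrow>\<^sub>E carrier A"
    show "(mat_op A d (\<lambda>i j. \<Oplus>\<^bsub>A\<^esub>s\<in>S. ?g s (p ^ s) i j) ^^ p) x = (\<lambda>l\<in>{..<d}. \<zero>\<^bsub>A\<^esub>)"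
      by (rule A1.divided_powers_nilpotent[OF field(2) char_zero_algebra[OF A] S g dp co x])
  qed
qed

end

section \<open>Coefficients modulo a power of the variable\<close>

lemma mem_trunc_ideal_iff:
  assumes "cring A"
  shows "f \<in> trunc_ideal p r A \<longleftrightarrow> f \<in> carrier (UP A) \<and> (\<forall>n<p ^ r. f n = \<zero>\<^bsub>A\<^esub>)"
proof -
  interpret A: cring A by fact
  interpret P: UP_cring A "UP A" by (intro UP_cring.intro assms) simp
  let ?q = "p ^ r"
  let ?t = "monom (UP A) \<one>\<^bsub>A\<^esub> ?q"
  have t: "?t \<in> carrier (UP A)" by simp
  show ?thesis
  proof (intro iffI conjI allI impI)
    assume "f \<in> trunc_ideal p r A"
    then obtain g where g: "g \<in> carrier (UP A)" "f = g \<otimes>\<^bsub>UP A\<^esub> ?t" using trunc_ideal_iff by blast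
    show f: "f \<in> carrier (UP A)" unfolding g(2) by (rule P.P.m_closed[OF g(1) t])
    fix n assume n: "n < ?q"
    have "f n = coeff (UP A) (g \<otimes>\<^bsub>UP A\<^esub> ?t) n" using coeff_UP[OF f, of n] g(2) by simp
    also have "\<dots> = (\<Oplus>\<^bsub>A\<^esub>i\<in>{..n}. coeff (UP A) g i \<otimes>\<^bsub>A\<^esub> coeff (UP A) ?t (n - i))"
      by (rule P.coeff_mult[OF g(1) t])
    also have "\<dots> = \<zero>\<^bsub>A\<^esub>"
    proof (rule A.add.finprod_one_eqI)
      fix i assume "i \<in> {..n}"
      have "n - i \<noteq> ?q" using n by simp
      then show "coeff (UP A) g i \<otimes>\<^bsub>A\<^esub> coeff (UP A) ?t (n - i) = \<zero>\<^bsub>A\<^esub>"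
        using g(1) by simp
    qed
    finally show "f n = \<zero>\<^bsub>A\<^esub>" .
  next
    assume f: "f \<in> carrier (UP A) \<and> (\<forall>n<?q. f n = \<zero>\<^bsub>A\<^esub>)"
    define g where "g = (\<lambda>n. f (n + ?q))"
    have fu: "f \<in> up A" using f by (simp add: carrier_UP)
    obtain B where B: "bound \<zero>\<^bsub>A\<^esub> B f" using fu unfolding up_def by blast
    have "bound \<zero>\<^bsub>A\<^esub> B g" unfolding g_def bound_def using B unfolding bound_def by simp
    then have b: "\<exists>B. bound \<zero>\<^bsub>A\<^esub> B g" by (rule exI)
    have g: "g \<in> carrier (UP A)"
      unfolding carrier_UP
    proof (rule mem_upI[OF _ b])
      show "g n \<in> carrier A" for n unfolding g_def by (rule mem_upD[OF fu])
    qed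
    have "f = ?t \<otimes>\<^bsub>UP A\<^esub> g"
    proof (rule P.up_eqI)
      fix n
      show "coeff (UP A) f n = coeff (UP A) (?t \<otimes>\<^bsub>UP A\<^esub> g) n"
      proof (cases "n < ?q")
        case True
        have "coeff (UP A) (?t \<otimes>\<^bsub>UP A\<^esub> g) n = (\<Oplus>\<^bsub>A\<^esub>i\<in>{..n}. coeff (UP A) ?t i \<otimes>\<^bsub>A\<^esub> coeff (UP A) g (n - i))"
          by (rule P.coeff_mult[OF t g])
        also have "\<dots> = \<zero>\<^bsub>A\<^esub>"
        proof (rule A.add.finprod_one_eqI)
          fix i assume "i \<in> {..n}"
          then have "i \<noteq> ?q" using True by simp
          then show "coeff (UP A) ?t i \<otimes>\<^bsub>A\<^esub> coeff (UP A) g (n - i) = \<zero>\<^bsub>A\<^esub>" using g by simp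
        qed
        finally show ?thesis using f True by (simp add: coeff_UP)
      next
        case False
        then have n: "n = (n - ?q) + ?q" by simp
        have "coeff (UP A) (?t \<otimes>\<^bsub>UP A\<^esub> g) ((n - ?q) + ?q) = \<one>\<^bsub>A\<^esub> \<otimes>\<^bsub>A\<^esub> coeff (UP A) g (n - ?q)"
          by (rule P.coeff_monom_mult[OF A.one_closed g])
        also have "\<dots> = coeff (UP A) g (n - ?q)" by (rule A.l_one[OF P.coeff_closed[OF g]])
        also have "\<dots> = g (n - ?q)" by (rule coeff_UP[OF g])
        also have "\<dots> = f n" unfolding g_def by (simp add: n[symmetric])
        also have "\<dots> = coeff (UP A) f n" by (rule coeff_UP[OF conjunct1[OF f], symmetric])
        finally show ?thesis by (simp add: n[symmetric])
      qed
    qed (use f t g in simp_all)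
    also have "\<dots> = g \<otimes>\<^bsub>UP A\<^esub> ?t" by (rule P.P.m_comm[OF t g])
    finally show "f \<in> trunc_ideal p r A" unfolding trunc_ideal_iff using g by blast
  qed
qed

lemma image_constant_on: "x \<in> S \<Longrightarrow> (\<And>y. y \<in> S \<Longrightarrow> f y = z) \<Longrightarrow> f ` S = {z}"
  by auto

lemma poly_map_closed:
  assumes "ring_hom_cring S A \<chi>" "f \<in> carrier (UP S)"
  shows "poly_map \<chi> f \<in> carrier (UP A)"
proof -
  interpret h: ring_hom_cring S A \<chi> by fact
  have f: "f \<in> up S" using assms(2) by (simp add: carrier_UP)
  obtain B where B: "bound \<zero>\<^bsub>S\<^esub> B f" using f unfolding up_def by blast
  have "bound \<zero>\<^bsub>A\<^esub> B (poly_map \<chi> f)" unfolding bound_def poly_map_def using B unfolding bound_def by simp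
  then have b: "\<exists>B. bound \<zero>\<^bsub>A\<^esub> B (poly_map \<chi> f)" by (rule exI)
  show ?thesis
    unfolding carrier_UP
  proof (rule mem_upI[OF _ b])
    show "poly_map \<chi> f n \<in> carrier A" for n unfolding poly_map_def by (rule h.hom_closed[OF mem_upD[OF f]])
  qed
qed

lemma trunc_coset_coeff:
  assumes "cring A" "f \<in> carrier (UP A)" "g \<in> trunc_ideal p r A +>\<^bsub>UP A\<^esub> f" "n < p ^ r"
  shows "coeff (UP A) g n = f n"
proof -
  interpret A: cring A by fact
  interpret P: UP_cring A "UP A" by (intro UP_cring.intro assms(1)) simp
  obtain u where u: "u \<in> trunc_ideal p r A" "g = u \<oplus>\<^bsub>UP A\<^esub> f"
    using assms(3) by (auto simp: a_r_coset_def r_coset_def)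
  have uc: "u \<in> carrier (UP A)" and un: "u n = \<zero>\<^bsub>A\<^esub>"
    using u(1) assms(4) unfolding mem_trunc_ideal_iff[OF assms(1)] by blast+
  have "coeff (UP A) g n = u n \<oplus>\<^bsub>A\<^esub> f n"
    unfolding u(2) P.coeff_add[OF uc assms(2)] coeff_UP[OF uc] coeff_UP[OF assms(2)] by (rule refl)
  also have "\<dots> = f n" unfolding un by (rule A.l_zero) (use P.coeff_closed[OF assms(2), of n] in \<open>simp add: coeff_UP[OF assms(2)]\<close>)
  finally show ?thesis .
qed

context exp_setup
begin

lemma exp_push_eq:
  assumes "ring_hom_cring N L \<chi>" "h \<in> carrier G"
  shows "exp_push p L \<chi> E s h = \<chi> (E h (p ^ s))"
  unfolding exp_push_def coeff_UP[OF poly_map_closed[OF assms(1) Eh.hom_closed[OF assms(2)]]]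
  by (simp add: poly_map_def)

text \<open>
  Changing a representative modulo \<open>t^(p^r)\<close> affects no coefficient below
  \<open>p^r\<close>, and all coefficients in question are at \<open>p^s\<close> with \<open>s <
  r\<close>.
\<close>

lemma exp_push_trunc_eq:
  assumes h: "ring_hom_cring N L \<chi>" and x: "x \<in> carrier G" and r: "0 < r" and s: "s < r"
  shows "exp_push_trunc p r L \<chi> (exp_restrict k p r G N E) s (frob_ideal k p r G +>\<^bsub>G\<^esub> x) = \<chi> (E x (p ^ s))"
proof -
  interpret h: ring_hom_cring N L \<chi> by fact
  interpret Q: UP_cring L "UP L" by (intro UP_cring.intro h.S.is_cring) simp
  let ?J = "trunc_ideal p r N" and ?JL = "trunc_ideal p r L" and ?y = "poly_map \<chi> (E x)"
  have y: "?y \<in> carrier (UP L)" by (rule poly_map_closed[OF h Eh.hom_closed[OF x]])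
  have "?JL = PIdl\<^bsub>UP L\<^esub> (monom (UP L) \<one>\<^bsub>L\<^esub> (p ^ r))"
    by (auto simp: trunc_ideal_def cgenideal_def)
  then have JL: "ideal ?JL (UP L)" using Q.P.cgenideal_ideal[of "monom (UP L) \<one>\<^bsub>L\<^esub> (p ^ r)"] by simp
  interpret JL: ideal ?JL "UP L" by (rule JL)
  interpret J: ideal ?J "UP N" by (rule trunc_ideal_ideal)
  have pm: "?JL +>\<^bsub>UP L\<^esub> poly_map \<chi> f = ?JL +>\<^bsub>UP L\<^esub> ?y" if f: "f \<in> ?J +>\<^bsub>UP N\<^esub> E x" for f
  proof -
    obtain u where u: "u \<in> ?J" "f = u \<oplus>\<^bsub>UP N\<^esub> E x"
      using coset_member_diff[OF trunc_ideal_ideal Eh.hom_closed[OF x] f] by blast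
    have uc: "u \<in> carrier (UP N)" and un: "\<And>n. n < p ^ r \<Longrightarrow> u n = \<zero>\<^bsub>N\<^esub>"
      using u(1) unfolding mem_trunc_ideal_iff[OF N.is_cring] by blast+
    have pu: "poly_map \<chi> u \<in> ?JL"
      unfolding mem_trunc_ideal_iff[OF h.S.is_cring]
      using poly_map_closed[OF h uc] un by (simp add: poly_map_def)
    have fc: "f \<in> carrier (UP N)" unfolding u(2) by (rule P.P.a_closed[OF uc Eh.hom_closed[OF x]])
    have "poly_map \<chi> f = poly_map \<chi> u \<oplus>\<^bsub>UP L\<^esub> ?y"
    proof (rule Q.up_eqI)
      fix n
      have "f n = u n \<oplus>\<^bsub>N\<^esub> E x n"
        using P.coeff_add[OF uc Eh.hom_closed[OF x], of n] unfolding u(2)[symmetric] coeff_UP[OF fc] coeff_UP[OF uc] E_coeff_eq[OF x] .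
      moreover have "u n \<in> carrier N" using P.coeff_closed[OF uc, of n] unfolding coeff_UP[OF uc] .
      ultimately have "\<chi> (f n) = \<chi> (u n) \<oplus>\<^bsub>L\<^esub> \<chi> (E x n)" using h.hom_add E_coeff[OF x] by simp
      then show "coeff (UP L) (poly_map \<chi> f) n = coeff (UP L) (poly_map \<chi> u \<oplus>\<^bsub>UP L\<^esub> ?y) n"
        unfolding Q.coeff_add[OF poly_map_closed[OF h uc] y] coeff_UP[OF poly_map_closed[OF h uc]] coeff_UP[OF y]
          coeff_UP[OF poly_map_closed[OF h fc]] by (simp only: poly_map_def)
    qed (use poly_map_closed[OF h fc] Q.P.a_closed[OF poly_map_closed[OF h uc] y] in simp_all)
    then have "poly_map \<chi> f \<in> ?JL +>\<^bsub>UP L\<^esub> ?y" using pu by (auto simp: a_r_coset_def r_coset_def)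
    then show ?thesis using Q.P.a_repr_independence[OF _ y JL.a_subgroup] by blast
  qed
  have "(\<lambda>f. ?JL +>\<^bsub>UP L\<^esub> poly_map \<chi> f) ` (?J +>\<^bsub>UP N\<^esub> E x) = {?JL +>\<^bsub>UP L\<^esub> ?y}"
    by (rule image_constant_on[OF J.a_rcos_self[OF Eh.hom_closed[OF x]] pm])
  moreover have "(\<lambda>f. coeff (UP L) f (p ^ s)) ` (?JL +>\<^bsub>UP L\<^esub> ?y) = {?y (p ^ s)}"
  proof -
    have lt: "p ^ s < p ^ r" using s prime_gt_1_nat[OF field(2)] by simp
    show ?thesis
      by (rule image_constant_on[OF JL.a_rcos_self[OF y]]) (rule trunc_coset_coeff[OF h.S.is_cring y _ lt])
  qed
  ultimately show ?thesis
    unfolding exp_push_trunc_def exp_restrict_coset[OF r x] coset_poly_algebra by (simp add: poly_map_def)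
qed

section \<open>The generic nilpotent operator\<close>

text \<open>\<open>exp_matrix A B r\<close> is the matrix of the sum over \<open>s < r\<close> of the operators of \<open>u_s\<close> for the
  points \<open>B s\<close>.\<close>

definition exp_matrix :: "('k, 'u, 'm) module_scheme \<Rightarrow> (nat \<Rightarrow> 'h \<Rightarrow> 'u) \<Rightarrow> nat \<Rightarrow> nat \<Rightarrow> nat \<Rightarrow> 'u" where
  "exp_matrix A B r = (\<lambda>i j. \<Oplus>\<^bsub>A\<^esub>s\<in>{..<r}. coefm (nilp_classify k G N A (B s)) (p ^ s) i j)"

lemma exp_matrix_hom:
  assumes A: "algebra k A" and A': "algebra k A'" and f: "f \<in> alg_hom k A A'"
    and B: "\<And>s. s < r \<Longrightarrow> B s \<in> nilp_points k p G A"
    and B': "\<And>s. s < r \<Longrightarrow> compose (carrier G) f (B s) = B' s"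
    and ij: "i < d" "j < d"
  shows "f (exp_matrix A B r i j) = exp_matrix A' B' r i j"
proof -
  interpret h: ring_hom_cring A A' f by (rule ring_hom_cring_of_alg_hom[OF A A' f])
  let ?t = "\<lambda>s. coefm (nilp_classify k G N A (B s)) (p ^ s) i j"
  have t: "?t s \<in> carrier A" if "s < r" for s by (rule coefm_closed[OF classify(1)[OF A B[OF that]] ij])
  have "f (exp_matrix A B r i j) = (\<Oplus>\<^bsub>A'\<^esub>s\<in>{..<r}. (f \<circ> ?t) s)"
    unfolding exp_matrix_def by (rule h.hom_finsum) (intro funcsetI t, simp)
  also have "\<dots> = exp_matrix A' B' r i j"
    unfolding exp_matrix_def
  proof (rule h.S.finsum_cong'[OF refl])
    have e: "(f \<circ> ?t) s = coefm (nilp_classify k G N A' (B' s)) (p ^ s) i j" if s: "s < r" for s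
      unfolding B'[OF s, symmetric] classify_hom[OF A A' f B[OF s]] coefm_compose[OF ij] by (rule o_apply)
    then show "(f \<circ> ?t) s = coefm (nilp_classify k G N A' (B' s)) (p ^ s) i j" if "s \<in> {..<r}" for s
      using that by simp
    show "(\<lambda>s. coefm (nilp_classify k G N A' (B' s)) (p ^ s) i j) \<in> {..<r} \<rightarrow> carrier A'"
    proof (rule funcsetI)
      fix s assume "s \<in> {..<r}"
      then have s: "s < r" by simp
      show "coefm (nilp_classify k G N A' (B' s)) (p ^ s) i j \<in> carrier A'"
        unfolding e[OF s, symmetric] o_apply by (rule h.hom_closed[OF t[OF s]])
    qed
  qed
  finally show ?thesis .
qed

end

locale jt_setup = exp_setup k p G ty N E d c
  for k :: "'k ring" and p :: nat and G :: "('k, 'h) hopf" and ty :: "'u itself"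
    and N :: "('k, 'u, 'h \<Rightarrow> 'u) coord" and E :: "'h \<Rightarrow> nat \<Rightarrow> 'u"
    and d :: nat and c :: "nat \<Rightarrow> nat \<Rightarrow> 'h" +
  fixes C :: "nat \<Rightarrow> ('k, 'u, ('h \<Rightarrow> 'u) list) coord"
  assumes comm: "\<And>r. comm_scheme k p G r (C r)"
begin

lemma C_algebra: "algebra k (C r)"
  using comm[of r] unfolding comm_scheme_def by (rule conjunct1)

lemma C_cring: "cring (C r)" by (rule algebra.M_cring[OF C_algebra])

lemma univ_comm: "univ (C r) \<in> comm_points k p G r (C r)"
  using comm[of r] unfolding comm_scheme_def by (rule conjunct1[OF conjunct2])

lemma length_univ: "length (univ (C r)) = r"
  using univ_comm[of r] by (simp add: comm_points_def)

lemma comm_classify: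
  fixes A :: "('k, 'u, 'm) module_scheme"
  assumes A: "algebra k A" and Bs: "Bs \<in> comm_points k p G r A"
  shows "comm_classify k G (C r) A Bs \<in> alg_hom k (C r) A"
    "map (compose (carrier G) (comm_classify k G (C r) A Bs)) (univ (C r)) = Bs"
    "\<And>\<phi>. \<phi> \<in> alg_hom k (C r) A \<Longrightarrow> map (compose (carrier G) \<phi>) (univ (C r)) = Bs \<Longrightarrow>
      \<phi> = comm_classify k G (C r) A Bs"
proof -
  have "Bs \<in> comm_points k p G r (plain A)" using Bs by simp
  then have "\<exists>!\<phi>. \<phi> \<in> alg_hom k (C r) (plain A) \<and> map (compose (carrier G) \<phi>) (univ (C r)) = Bs"
    by (rule bspec[OF mp[OF spec[OF conjunct2[OF conjunct2[OF comm[of r, unfolded comm_scheme_def]]]] algebra_plain[OF A]]])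
  then have ex: "\<exists>!\<phi>. \<phi> \<in> alg_hom k (C r) A \<and> map (compose (carrier G) \<phi>) (univ (C r)) = Bs"
    unfolding alg_hom_plain .
  show "comm_classify k G (C r) A Bs \<in> alg_hom k (C r) A"
    "map (compose (carrier G) (comm_classify k G (C r) A Bs)) (univ (C r)) = Bs"
    using theI'[OF ex] unfolding comm_classify_def by (rule conjunct1, rule conjunct2)
  show "\<phi> = comm_classify k G (C r) A Bs"
    if "\<phi> \<in> alg_hom k (C r) A" "map (compose (carrier G) \<phi>) (univ (C r)) = Bs" for \<phi>
    unfolding comm_classify_def by (rule the1_equality[OF ex, symmetric]) (rule conjI[OF that])
qed

lemma component_simps:
  "s < m \<Longrightarrow> component G (C m) s = univ (C m) ! s" "m \<le> s \<Longrightarrow> component G (C m) s = lie_zero G (C m)"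
  by (simp_all add: component_def length_univ)

lemma component_nilp: "component G (C m) s \<in> nilp_points k p G (C m)"
proof (cases "s < m")
  case True
  then have "univ (C m) ! s \<in> set (univ (C m))" by (simp add: length_univ)
  moreover have "set (univ (C m)) \<subseteq> nilp_points k p G (C m)" using univ_comm[of m] by (simp add: comm_points_def)
  ultimately show ?thesis using component_simps(1)[OF True] by auto
next
  case False
  then show ?thesis using component_simps(2) lie_zero_nilp[OF C_algebra] by simp
qed

lemma component_bracket: "lie_bracket G (C m) (component G (C m) s) (component G (C m) t) = lie_zero G (C m)"
proof -
  note cl = nilp_points_closed[OF C_algebra component_nilp]
  consider "s < m" "t < m" | "m \<le> s" | "m \<le> t" by linarith
  then show ?thesis
  proof cases
    case 1
    have "univ (C m) ! s \<in> set (univ (C m))" "univ (C m) ! t \<in> set (univ (C m))" using 1 by (simp_all add: length_univ)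
    moreover have "\<forall>B\<in>set (univ (C m)). \<forall>B'\<in>set (univ (C m)). lie_bracket G (C m) B B' = lie_zero G (C m)"
      using univ_comm[of m] unfolding comm_points_def by (elim CollectE conjE)
    ultimately show ?thesis unfolding component_simps(1)[OF 1(1)] component_simps(1)[OF 1(2)] by blast
  next
    case 2
    show ?thesis unfolding component_simps(2)[OF 2] by (rule lie_bracket_zero(1)[OF C_algebra cl])
  next
    case 3
    show ?thesis unfolding component_simps(2)[OF 3] by (rule lie_bracket_zero(2)[OF C_algebra cl])
  qed
qed

lemma components_comm:
  assumes "length xs = r" shows "map (component G (C m)) xs \<in> comm_points k p G r (C m)"
  using assms component_nilp component_bracket by (auto simp: comm_points_def)

lemma comm_classify_component:
  assumes xs: "length xs = l" and s: "s < l"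
  shows "compose (carrier G) (comm_classify k G (C l) (C m) (map (component G (C m)) xs)) (component G (C l) s) =
    component G (C m) (xs ! s)"
proof -
  let ?f = "comm_classify k G (C l) (C m) (map (component G (C m)) xs)"
  have "map (compose (carrier G) ?f) (univ (C l)) = map (component G (C m)) xs"
    by (rule comm_classify(2)[OF C_algebra components_comm[OF xs]])
  then have "map (compose (carrier G) ?f) (univ (C l)) ! s = map (component G (C m)) xs ! s" by simp
  then show ?thesis using s xs by (simp add: length_univ component_simps)
qed

lemma extend_hom_hom: "extend_hom k G C m l \<in> alg_hom k (C l) (C m)"
  unfolding extend_hom_def by (rule comm_classify(1)[OF C_algebra components_comm]) simp

lemma extend_hom_component:
  assumes "m \<le> l"
  shows "compose (carrier G) (extend_hom k G C m l) (component G (C l) s) = component G (C m) s"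
proof (cases "s < l")
  case True
  then show ?thesis unfolding extend_hom_def using comm_classify_component[of "[0..<l]" l s m] by simp
next
  case False
  then show ?thesis
    using assms lie_zero_hom[OF C_algebra C_algebra extend_hom_hom[of m l]] by (simp add: component_simps)
qed

definition lambda_hom :: "nat \<Rightarrow> nat \<Rightarrow> 'u \<Rightarrow> 'u" where
  "lambda_hom r m = comm_classify k G (C r) (C m) (map (component G (C m)) (rev [0..<r]))"

lemma lambda_hom_hom: "lambda_hom r m \<in> alg_hom k (C r) (C m)"
  unfolding lambda_hom_def by (rule comm_classify(1)[OF C_algebra components_comm]) simp

lemma lambda_hom_component:
  assumes "s < r"
  shows "compose (carrier G) (lambda_hom r m) (component G (C r) s) = component G (C m) (r - Suc s)"
  unfolding lambda_hom_def using comm_classify_component[of "rev [0..<r]" r s m] assms by (simp add: rev_nth)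

text \<open>
  Both sides classify the same reversed tuple over \<open>C_m\<close>. This makes the map to
  \<open>C_r\<close> independent of the representative of a point of the ind-scheme.
\<close>

lemma lambda_hom_extend:
  assumes "m \<le> l"
  shows "lambda_hom r m = compose (carrier (C r)) (extend_hom k G C m l) (lambda_hom r l)"
  unfolding lambda_hom_def[of r m]
proof (rule comm_classify(3)[OF C_algebra components_comm, symmetric])
  let ?e = "extend_hom k G C m l"
  show "length (rev [0..<r]) = r" by simp
  show "compose (carrier (C r)) ?e (lambda_hom r l) \<in> alg_hom k (C r) (C m)"
    by (rule alg_hom_compose[OF C_algebra lambda_hom_hom extend_hom_hom])
  show "map (compose (carrier G) (compose (carrier (C r)) ?e (lambda_hom r l))) (univ (C r)) =
      map (component G (C m)) (rev [0..<r])"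
  proof (rule nth_equalityI)
    fix s assume "s < length (map (compose (carrier G) (compose (carrier (C r)) ?e (lambda_hom r l))) (univ (C r)))"
    then have s: "s < r" by (simp add: length_univ)
    let ?u = "component G (C r) s"
    have u: "?u \<in> carrier G \<rightarrow> carrier (C r)" by (rule nilp_points_closed[OF C_algebra component_nilp])
    have "compose (carrier G) (compose (carrier (C r)) ?e (lambda_hom r l)) ?u =
        compose (carrier G) ?e (compose (carrier G) (lambda_hom r l) ?u)"
      using u by (auto simp: compose_def restrict_def fun_eq_iff Pi_def)
    also have "\<dots> = component G (C m) (r - Suc s)"
      unfolding lambda_hom_component[OF s] by (rule extend_hom_component[OF assms])
    finally show "map (compose (carrier G) (compose (carrier (C r)) ?e (lambda_hom r l))) (univ (C r)) ! s =
        map (component G (C m)) (rev [0..<r]) ! s"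
      using s by (simp add: length_univ component_simps rev_nth)
  qed (simp add: length_univ)
qed

lemma spec_map_prime:
  assumes f: "f \<in> alg_hom k (C l) (C m)" and P: "P \<in> Spec (C m)"
  shows "spec_map f (C l) P \<in> Spec (C l)"
proof -
  interpret h: ring_hom_cring "C l" "C m" f by (rule ring_hom_cring_of_alg_hom[OF C_algebra C_algebra f])
  have "primeideal P (C m)" using P by (simp add: Spec_def)
  from h.ring.primeideal_vimage[OF C_cring this] show ?thesis by (simp add: Spec_def spec_map_def)
qed

abbreviation "U m r \<equiv> exp_matrix (C m) (component G (C m)) r"

lemma U_nilpotent: "nilpotent_matrix (C m) d p (U m r)"
  unfolding exp_matrix_def
  by (rule exp_operator_nilpotent[OF C_algebra finite_lessThan component_nilp component_bracket])

text \<open>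
  The matrix for the reversed universal tuple, which computes the Jordan type of height
  \<open>r\<close>.
\<close>

abbreviation "V r \<equiv> exp_matrix (C r) (\<lambda>t. component G (C r) (r - Suc t)) r"

lemma V_nilpotent: "nilpotent_matrix (C r) d p (V r)"
  unfolding exp_matrix_def
  by (rule exp_operator_nilpotent[OF C_algebra finite_lessThan component_nilp component_bracket])

text \<open>
  The bound \<open>r\<close> on the summation must be large enough for this to be the exponential Jordan
  type of infinite height.
\<close>

definition jtC :: "nat \<Rightarrow> nat \<Rightarrow> 'u set \<Rightarrow> nat \<Rightarrow> nat" where
  "jtC r m P = jordan_type (residue_field (C m) P) d (res_mat (C m) P (U m r))"

lemma U_closed: "i < d \<Longrightarrow> j < d \<Longrightarrow> U m r i j \<in> carrier (C m)"
  by (rule nilpotent_matrix.entries[OF U_nilpotent])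

lemma res_mat_cong:
  assumes P: "P \<in> Spec (C m)" and "\<And>i j. i < d \<Longrightarrow> j < d \<Longrightarrow> S i j = S' i j"
    "\<And>i j. i < d \<Longrightarrow> j < d \<Longrightarrow> S' i j \<in> carrier (C m)"
  shows "jordan_type (residue_field (C m) P) d (res_mat (C m) P S) = jordan_type (residue_field (C m) P) d (res_mat (C m) P S')"
proof -
  have pP: "primeideal P (C m)" using P by (simp add: Spec_def)
  interpret pp: prime_point P "C m" by (rule prime_point.intro[OF pP])
  show ?thesis
    by (rule jordan_type_cong[OF pp.residue_field_field])
      (simp_all add: res_mat_def assms(2) ring_hom_closed[OF pp.to_residue_hom assms(3)])
qed

text \<open>
  Extension by zeros pulls the universal tuple of \<open>C_l\<close> back to that of \<open>C_m\<close>,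
  hence also the matrix; its Jordan type is then compared along the extension of residue fields.
\<close>

lemma jtC_extend:
  assumes ml: "m \<le> l" and P: "P \<in> Spec (C m)"
  shows "jtC r m P = jtC r l (spec_map (extend_hom k G C m l) (C l) P)"
proof -
  let ?f = "extend_hom k G C m l"
  have pP: "primeideal P (C m)" using P by (simp add: Spec_def)
  have "?f (U l r i j) = U m r i j" if "i < d" "j < d" for i j
    by (rule exp_matrix_hom[OF C_algebra C_algebra extend_hom_hom component_nilp extend_hom_component[OF ml] that])
  then have "jtC r m P = jordan_type (residue_field (C m) P) d (res_mat (C m) P (\<lambda>i j. ?f (U l r i j)))"
    unfolding jtC_def by (intro res_mat_cong[OF P, symmetric] U_closed)
  also have "\<dots> = jtC r l (spec_map ?f (C l) P)"
    unfolding jtC_def by (rule nilpotent_matrix.jt_extension[OF U_nilpotent alg_homD(1)[OF extend_hom_hom] C_cring pP])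
  finally show ?thesis .
qed

text \<open>
  Reversal pulls the matrix of height \<open>r\<close> over \<open>C_r\<close> back to the matrix over
  \<open>C_m\<close>: this is the identity between the two Jordan types.
\<close>

lemma jtC_lambda:
  assumes P: "P \<in> Spec (C m)"
  shows "jtC r m P = jordan_type (residue_field (C r) (spec_map (lambda_hom r m) (C r) P)) d
    (res_mat (C r) (spec_map (lambda_hom r m) (C r) P) (V r))"
proof -
  let ?f = "lambda_hom r m"
  have pP: "primeideal P (C m)" using P by (simp add: Spec_def)
  have "compose (carrier G) ?f (component G (C r) (r - Suc s)) = component G (C m) s" if "s < r" for s
    using lambda_hom_component[of "r - Suc s" r m] that by (simp add: Suc_diff_Suc)
  then have "?f (V r i j) = U m r i j" if "i < d" "j < d" for i j
    using that by (intro exp_matrix_hom[OF C_algebra C_algebra lambda_hom_hom component_nilp])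
  then have "jtC r m P = jordan_type (residue_field (C m) P) d (res_mat (C m) P (\<lambda>i j. ?f (V r i j)))"
    unfolding jtC_def by (intro res_mat_cong[OF P, symmetric] U_closed)
  also have "\<dots> = jordan_type (residue_field (C r) (spec_map ?f (C r) P)) d (res_mat (C r) (spec_map ?f (C r) P) (V r))"
    by (rule nilpotent_matrix.jt_extension[OF V_nilpotent alg_homD(1)[OF lambda_hom_hom] C_cring pP])
  finally show ?thesis .
qed

lemma at_point_hom:
  assumes P: "P \<in> Spec (C m)"
  shows "ring_hom_cring N (residue_field (C m) P) (at_point k G N (C m) P s)"
    "ring_hom_cring (C m) (residue_field (C m) P) (to_residue (C m) P)"
proof -
  have pP: "primeideal P (C m)" using P by (simp add: Spec_def)
  interpret pp: prime_point P "C m" by (rule prime_point.intro[OF pP])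
  show "ring_hom_cring (C m) (residue_field (C m) P) (to_residue (C m) P)"
    by (rule pp.h.ring_hom_cring_axioms)
  have "at_point k G N (C m) P s \<in> ring_hom N (residue_field (C m) P)"
    unfolding at_point_def
    by (rule ring_hom_trans[OF alg_homD(1)[OF classify(1)[OF C_algebra component_nilp]] pp.to_residue_hom])
  then show "ring_hom_cring N (residue_field (C m) P) (at_point k G N (C m) P s)"
    by (intro ring_hom_cring.intro ring_hom_cring_axioms.intro pp.K.is_cring N.is_cring)
qed

text \<open>
  Only \<open>s < r\<close> contribute, because the coefficient of \<open>t^(p^s)\<close> in a matrix
  coefficient vanishes once \<open>p^s\<close> exceeds its degree.
\<close>

lemma jordan_type_infinite:
  fixes m :: nat
  assumes P: "P \<in> Spec (C m)" and r: "\<And>i j s. i < d \<Longrightarrow> j < d \<Longrightarrow> r \<le> s \<Longrightarrow> E (c i j) (p ^ s) = \<zero>\<^bsub>N\<^esub>"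
  defines "K \<equiv> residue_field (C m) P"
    and "T \<equiv> \<lambda>s i j. exp_push p (residue_field (C m) P) (at_point k G N (C m) P s) E s (c i j)"
  shows "jordan_type K d (\<lambda>i j. \<Oplus>\<^bsub>K\<^esub>s\<in>{s. T s i j \<noteq> \<zero>\<^bsub>K\<^esub>}. T s i j) = jtC r m P"
proof -
  have pP: "primeideal P (C m)" using P by (simp add: Spec_def)
  interpret pp: prime_point P "C m" by (rule prime_point.intro[OF pP])
  interpret K: field K unfolding K_def by (rule pp.residue_field_field)
  interpret h: ring_hom_cring "C m" K "to_residue (C m) P" unfolding K_def by (rule at_point_hom(2)[OF P])
  let ?t = "\<lambda>i j s. coefm (nilp_classify k G N (C m) (component G (C m) s)) (p ^ s) i j"
  have t: "?t i j s \<in> carrier (C m)" if "i < d" "j < d" for i j s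
    by (rule coefm_closed[OF classify(1)[OF C_algebra component_nilp] that])
  have T: "T s i j = to_residue (C m) P (?t i j s)" if "i < d" "j < d" for s i j
    unfolding T_def exp_push_eq[OF at_point_hom(1)[OF P] entry[OF that]]
    unfolding at_point_def coefm_def by (rule o_apply)
  have Tc: "T s i j \<in> carrier K" if "i < d" "j < d" for s i j
    unfolding T[OF that] by (rule h.hom_closed[OF t[OF that]])
  have Tz: "T s i j = \<zero>\<^bsub>K\<^esub>" if "i < d" "j < d" "r \<le> s" for s i j
  proof -
    interpret a: ring_hom_cring N K "at_point k G N (C m) P s" unfolding K_def by (rule at_point_hom(1)[OF P])
    show ?thesis
      unfolding T_def exp_push_eq[OF at_point_hom(1)[OF P] entry[OF that(1,2)]] r[OF that] by (rule a.hom_zero)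
  qed
  show ?thesis
    unfolding jtC_def K_def[symmetric]
  proof (rule jordan_type_cong[OF K.field_axioms])
    fix i j assume ij: "i < d" "j < d"
    let ?Z = "{s. T s i j \<noteq> \<zero>\<^bsub>K\<^esub>}"
    have sub: "?Z \<subseteq> {..<r}" using Tz[OF ij] by (auto simp: not_less[symmetric])
    have "(\<Oplus>\<^bsub>K\<^esub>s\<in>?Z. T s i j) = (\<Oplus>\<^bsub>K\<^esub>s\<in>{..<r}. T s i j)"
      by (rule K.finsum_mono_neutral[OF finite_lessThan sub]) (use Tc[OF ij] in auto)
    also have "\<dots> = (\<Oplus>\<^bsub>K\<^esub>s\<in>{..<r}. (to_residue (C m) P \<circ> ?t i j) s)" unfolding T[OF ij] o_apply by (rule refl)
    also have "\<dots> = to_residue (C m) P (\<Oplus>\<^bsub>C m\<^esub>s\<in>{..<r}. ?t i j s)"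
      by (rule h.hom_finsum[symmetric]) (intro funcsetI t ij)
    finally show "(\<Oplus>\<^bsub>K\<^esub>s\<in>?Z. T s i j) = res_mat (C m) P (U m r) i j" by (simp only: res_mat_def exp_matrix_def)
    show "res_mat (C m) P (U m r) i j \<in> carrier K"
      unfolding res_mat_def by (rule h.hom_closed[OF U_closed[OF ij]])
  qed
qed

text \<open>
  In height \<open>r\<close> the component \<open>s\<close> is paired with \<open>u_(r-s-1)\<close>;
  summing over \<open>r - s - 1\<close> instead turns this into the usual pairing for the reversed
  tuple.
\<close>

lemma JT_exp_eq:
  assumes r: "0 < r" and P: "P \<in> Spec (C r)"
  shows "JT_exp k p G N C r (exp_restrict k p r G N E) d (restrict_module k p r G c) P =
    jordan_type (residue_field (C r) P) d (res_mat (C r) P (V r))"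
proof -
  let ?K = "residue_field (C r) P"
  have pP: "primeideal P (C r)" using P by (simp add: Spec_def)
  interpret pp: prime_point P "C r" by (rule prime_point.intro[OF pP])
  let ?t = "\<lambda>i j t. coefm (nilp_classify k G N (C r) (component G (C r) (r - Suc t))) (p ^ t) i j"
  have t: "?t i j s \<in> carrier (C r)" if "i < d" "j < d" for i j s
    by (rule coefm_closed[OF classify(1)[OF C_algebra component_nilp] that])
  show ?thesis
    unfolding JT_exp_def Let_def
  proof (rule jordan_type_cong[OF pp.residue_field_field])
    fix i j assume ij: "i < d" "j < d"
    let ?e = "\<lambda>s. exp_push_trunc p r ?K (at_point k G N (C r) P s) (exp_restrict k p r G N E) (r - s - 1)
        (restrict_module k p r G c i j)"
    have e: "?e s = to_residue (C r) P (?t i j (r - Suc s))" if s: "s < r" for s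
    proof -
      have r1: "r - s - 1 < r" using r by linarith
      have r2: "r - Suc (r - Suc s) = s" "r - s - 1 = r - Suc s" using s by linarith+
      show ?thesis
        unfolding restrict_module_def exp_push_trunc_eq[OF at_point_hom(1)[OF P] entry[OF ij] r r1]
        unfolding at_point_def coefm_def r2 by (rule o_apply)
    qed
    have "(\<Oplus>\<^bsub>?K\<^esub>s\<in>{..<r}. ?e s) = (\<Oplus>\<^bsub>?K\<^esub>s\<in>{..<r}. to_residue (C r) P (?t i j (r - Suc s)))"
      by (rule pp.K.finsum_cong'[OF refl]) (intro funcsetI pp.h.hom_closed t ij, rule e, simp)
    also have "\<dots> = (\<Oplus>\<^bsub>?K\<^esub>s\<in>(\<lambda>s. r - Suc s) ` {..<r}. to_residue (C r) P (?t i j s))"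
      by (rule pp.K.finsum_reindex[symmetric]) (intro funcsetI pp.h.hom_closed t ij, auto simp: inj_on_def)
    also have "(\<lambda>s. r - Suc s) ` {..<r} = {..<r}"
    proof (intro equalityI subsetI)
      fix s assume "s \<in> {..<r}"
      then show "s \<in> (\<lambda>s. r - Suc s) ` {..<r}" by (intro image_eqI[of _ _ "r - Suc s"]) auto
    qed auto
    also have "(\<Oplus>\<^bsub>?K\<^esub>s\<in>{..<r}. to_residue (C r) P (?t i j s)) = (\<Oplus>\<^bsub>?K\<^esub>s\<in>{..<r}. (to_residue (C r) P \<circ> ?t i j) s)"
      unfolding o_apply by (rule refl)
    also have "\<dots> = to_residue (C r) P (\<Oplus>\<^bsub>C r\<^esub>s\<in>{..<r}. ?t i j s)"
      by (rule pp.h.hom_finsum[symmetric]) (intro funcsetI t ij)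
    finally show "(\<Oplus>\<^bsub>?K\<^esub>s\<in>{..<r}. ?e s) = res_mat (C r) P (V r) i j" by (simp only: res_mat_def exp_matrix_def)
    show "res_mat (C r) P (V r) i j \<in> carrier ?K"
      unfolding res_mat_def by (rule pp.h.hom_closed[OF nilpotent_matrix.entries[OF V_nilpotent ij]])
  qed
qed

section \<open>Functions on the ind-scheme\<close>

lemma ind_rel_refl: "P \<in> Spec (C m) \<Longrightarrow> (m, P) \<in> ind_rel k G C `` {(m, P)}"
  by (auto simp: ind_rel_def)

text \<open>
  Two representatives of a point become equal after extension by zeros, so a function that is invariant
  under extension is constant on the class.
\<close>

lemma ind_class_value:
  assumes P: "P \<in> Spec (C m)"
    and inv: "\<And>m l P. m \<le> l \<Longrightarrow> P \<in> Spec (C m) \<Longrightarrow> g m P = g l (spec_map (extend_hom k G C m l) (C l) P)"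
  shows "the_elem ((\<lambda>(n, Q). g n Q) ` (ind_rel k G C `` {(m, P)})) = g m P"
proof -
  have const: "g n Q = g m P" if nQ: "(n, Q) \<in> ind_rel k G C `` {(m, P)}" for n Q
  proof -
    have "((m, P), (n, Q)) \<in> ind_rel k G C" using nQ by simp
    then obtain l where l: "m \<le> l" "n \<le> l" "Q \<in> Spec (C n)"
      "spec_map (extend_hom k G C m l) (C l) P = spec_map (extend_hom k G C n l) (C l) Q"
      unfolding ind_rel_def by blast
    have "g n Q = g l (spec_map (extend_hom k G C n l) (C l) Q)" by (rule inv[OF l(2,3)])
    also have "\<dots> = g m P" unfolding l(4)[symmetric] by (rule inv[OF l(1) P, symmetric])
    finally show ?thesis .
  qed
  have "(\<lambda>(n, Q). g n Q) ` (ind_rel k G C `` {(m, P)}) = {g m P}"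
  proof (rule image_constant_on[OF ind_rel_refl[OF P]])
    fix y assume y: "y \<in> ind_rel k G C `` {(m, P)}"
    obtain n Q where nQ: "y = (n, Q)" by (cases y)
    show "(case y of (n, Q) \<Rightarrow> g n Q) = g m P" unfolding nQ prod.case by (rule const[OF y[unfolded nQ]])
  qed
  then show ?thesis by simp
qed

lemma JT_infinite_class:
  assumes P: "P \<in> Spec (C m)" and r: "\<And>i j s. i < d \<Longrightarrow> j < d \<Longrightarrow> r \<le> s \<Longrightarrow> E (c i j) (p ^ s) = \<zero>\<^bsub>N\<^esub>"
  shows "JT_exp_infinite k p G N C E d c (ind_rel k G C `` {(m, P)}) = jtC r m P"
proof -
  define g where "g = (\<lambda>m P. let K = residue_field (C m) P;
         T = (\<lambda>s i j. exp_push p K (at_point k G N (C m) P s) E s (c i j))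
     in jordan_type K d (\<lambda>i j. \<Oplus>\<^bsub>K\<^esub>s\<in>{s. T s i j \<noteq> \<zero>\<^bsub>K\<^esub>}. T s i j))"
  have g: "g m P = jtC r m P" if "P \<in> Spec (C m)" for m P
    unfolding g_def Let_def by (rule jordan_type_infinite[OF that r])
  have "JT_exp_infinite k p G N C E d c (ind_rel k G C `` {(m, P)}) =
      the_elem ((\<lambda>(n, Q). g n Q) ` (ind_rel k G C `` {(m, P)}))"
    by (simp only: JT_exp_infinite_def g_def)
  also have "\<dots> = g m P"
  proof (rule ind_class_value[OF P])
    fix m l P assume ml: "m \<le> l" and P: "P \<in> Spec (C m)"
    show "g m P = g l (spec_map (extend_hom k G C m l) (C l) P)"
      unfolding g[OF P] g[OF spec_map_prime[OF extend_hom_hom P]] by (rule jtC_extend[OF ml P])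
  qed
  also have "\<dots> = jtC r m P" by (rule g[OF P])
  finally show ?thesis .
qed

lemma Lambda_class:
  assumes P: "P \<in> Spec (C m)"
  shows "Lambda k G C r (ind_rel k G C `` {(m, P)}) = spec_map (lambda_hom r m) (C r) P"
proof -
  have "Lambda k G C r (ind_rel k G C `` {(m, P)}) =
      the_elem ((\<lambda>(n, Q). spec_map (lambda_hom r n) (C r) Q) ` (ind_rel k G C `` {(m, P)}))"
    by (simp only: Lambda_def lambda_hom_def)
  also have "\<dots> = spec_map (lambda_hom r m) (C r) P"
  proof (rule ind_class_value[OF P])
    fix m l P assume ml: "m \<le> l" and P: "P \<in> Spec (C m)"
    have cl: "lambda_hom r l a \<in> carrier (C l)" if "a \<in> carrier (C r)" for a
      by (rule alg_homD(4)[OF lambda_hom_hom that])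
    show "spec_map (lambda_hom r m) (C r) P =
        spec_map (lambda_hom r l) (C r) (spec_map (extend_hom k G C m l) (C l) P)"
      unfolding lambda_hom_extend[OF ml] spec_map_def using cl by (auto simp: compose_def)
  qed
  finally show ?thesis .
qed

lemma ind_point_cases:
  assumes "x \<in> ind_points k G C"
  obtains m P where "P \<in> Spec (C m)" "x = ind_rel k G C `` {(m, P)}"
  using assms unfolding ind_points_def by (elim quotientE) auto

lemma ind_class_point: "P \<in> Spec (C m) \<Longrightarrow> ind_rel k G C `` {(m, P)} \<in> ind_points k G C"
  unfolding ind_points_def by (rule quotientI) auto

lemma jordan_types_open: "openin (jt_topology p) (jordan_types p)"
  unfolding openin_jt_topology by simp

lemma jtC_continuous:
  assumes "openin (jt_topology p) W" shows "openin (zariski (C m)) {P \<in> Spec (C m). jtC r m P \<in> W}"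
  unfolding jtC_def by (rule nilpotent_matrix.jt_continuous[OF U_nilpotent assms])

lemma jtC_jordan_types: "P \<in> Spec (C m) \<Longrightarrow> jtC r m P \<in> jordan_types p"
  unfolding jtC_def Spec_def by (rule nilpotent_matrix.jt_in_jordan_types[OF U_nilpotent]) simp

text \<open>
  The set of all points is open: its preimage in each \<open>C_m\<close> is the preimage of the open set
  of all Jordan types.
\<close>

lemma topspace_ind: "topspace (ind_topology k G C) = ind_points k G C"
proof (rule antisym)
  show "topspace (ind_topology k G C) \<subseteq> ind_points k G C"
    using openin_topspace[of "ind_topology k G C"] unfolding openin_ind_topology by (rule conjunct1)
  have "{P \<in> Spec (C m). ind_rel k G C `` {(m, P)} \<in> ind_points k G C} =
      {P \<in> Spec (C m). jtC 0 m P \<in> jordan_types p}" for m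
    using ind_class_point jtC_jordan_types by blast
  then have "openin (ind_topology k G C) (ind_points k G C)"
    unfolding openin_ind_topology using jtC_continuous[OF jordan_types_open] by simp
  then show "ind_points k G C \<subseteq> topspace (ind_topology k G C)" by (rule openin_subset)
qed

lemma topspace_jt: "topspace (jt_topology p) = jordan_types p"
proof (rule antisym)
  show "topspace (jt_topology p) \<subseteq> jordan_types p"
    using openin_topspace[of "jt_topology p"] unfolding openin_jt_topology by (rule conjunct1)
  show "jordan_types p \<subseteq> topspace (jt_topology p)" by (rule openin_subset[OF jordan_types_open])
qed

theorem JT_factors_and_continuous:
  "(\<exists>r0. \<forall>r\<ge>r0. \<forall>x\<in>ind_points k G C.
      Lambda k G C r x \<in> Spec (C r) \<and>
      JT_exp_infinite k p G N C E d c x =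
      JT_exp k p G N C r (exp_restrict k p r G N E) d (restrict_module k p r G c) (Lambda k G C r x)) \<and>
   continuous_map (ind_topology k G C) (jt_topology p) (JT_exp_infinite k p G N C E d c)"
proof -
  obtain n0 where n0: "\<And>i j n. i < d \<Longrightarrow> j < d \<Longrightarrow> n0 \<le> n \<Longrightarrow> E (c i j) n = \<zero>\<^bsub>N\<^esub>" using entry_bound by blast
  \<comment> \<open>As \<open>s < p^s\<close>, the bound on the degrees also bounds \<open>s\<close>; the successor excludes height \<open>0\<close>.\<close>
  have bd: "E (c i j) (p ^ s) = \<zero>\<^bsub>N\<^esub>" if "i < d" "j < d" "Suc n0 \<le> s" for i j s
    by (rule n0[OF that(1,2)]) (use less_p_power[of s] that(3) in linarith)
  have factor: "Lambda k G C r x \<in> Spec (C r) \<and>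
      JT_exp_infinite k p G N C E d c x =
      JT_exp k p G N C r (exp_restrict k p r G N E) d (restrict_module k p r G c) (Lambda k G C r x)"
    if r: "Suc n0 \<le> r" and x: "x \<in> ind_points k G C" for r x
  proof -
    obtain m P where P: "P \<in> Spec (C m)" and xP: "x = ind_rel k G C `` {(m, P)}" using ind_point_cases[OF x] .
    have r0: "0 < r" using r by simp
    have Q: "spec_map (lambda_hom r m) (C r) P \<in> Spec (C r)" by (rule spec_map_prime[OF lambda_hom_hom P])
    have "JT_exp_infinite k p G N C E d c x = jtC r m P"
      unfolding xP by (rule JT_infinite_class[OF P bd]) (use r in auto)
    then show ?thesis
      unfolding xP Lambda_class[OF P] using Q jtC_lambda[OF P, of r] JT_exp_eq[OF r0 Q] by simp
  qed
  let ?J = "JT_exp_infinite k p G N C E d c" and ?r = "Suc n0"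
  have J: "?J (ind_rel k G C `` {(m, P)}) = jtC ?r m P" if "P \<in> Spec (C m)" for m P
    by (rule JT_infinite_class[OF that bd])
  have "continuous_map (ind_topology k G C) (jt_topology p) ?J"
    unfolding continuous_map_def topspace_ind topspace_jt
  proof (intro conjI allI impI)
    show "?J \<in> ind_points k G C \<rightarrow> jordan_types p"
    proof (rule funcsetI)
      fix x assume "x \<in> ind_points k G C"
      then obtain m P where P: "P \<in> Spec (C m)" and xP: "x = ind_rel k G C `` {(m, P)}" by (rule ind_point_cases)
      show "?J x \<in> jordan_types p" unfolding xP J[OF P] by (rule jtC_jordan_types[OF P])
    qed
    fix W assume W: "openin (jt_topology p) W"
    show "openin (ind_topology k G C) {x \<in> ind_points k G C. ?J x \<in> W}"
      unfolding openin_ind_topology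
    proof (intro conjI allI)
      fix m
      have "{P \<in> Spec (C m). ind_rel k G C `` {(m, P)} \<in> {x \<in> ind_points k G C. ?J x \<in> W}} =
          {P \<in> Spec (C m). jtC ?r m P \<in> W}"
        by (intro Collect_cong conj_cong refl) (simp add: J ind_class_point)
      then show "openin (zariski (C m)) {P \<in> Spec (C m). ind_rel k G C `` {(m, P)} \<in> {x \<in> ind_points k G C. ?J x \<in> W}}"
        using jtC_continuous[OF W] by simp
    qed blast
  qed
  then show ?thesis using factor by blast
qed

end

theorem proposition8p4:
  fixes k :: "'k ring" and p :: nat and G :: "('k, 'h) hopf"
    and N :: "('k, 'u, 'h \<Rightarrow> 'u) coord"
    and C :: "nat \<Rightarrow> ('k, 'u, ('h \<Rightarrow> 'u) list) coord"
    and E :: "'h \<Rightarrow> nat \<Rightarrow> 'u"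
    and d :: nat and c :: "nat \<Rightarrow> nat \<Rightarrow> 'h"
  assumes universe: "infinite (UNIV :: 'u set)" "carrier k \<lesssim> (UNIV :: 'u set)"
    and field: "field k" "Factorial_Ring.prime p" "add_pow k p \<one>\<^bsub>k\<^esub> = \<zero>\<^bsub>k\<^esub>"
    and group: "linear_algebraic_group TYPE('u) k G"
    and nilp: "nilp_scheme k p G N"
    and comm: "\<And>r. comm_scheme k p G r (C r)"
    and exp_type: "exponential_type_infinite k p G N E"
    and module: "rational_module TYPE('u) k G d c"
  shows "(\<exists>r0. \<forall>r\<ge>r0. \<forall>x\<in>ind_points k G C.
            Lambda k G C r x \<in> Spec (C r) \<and>
            JT_exp_infinite k p G N C E d c x =
            JT_exp k p G N C r (exp_restrict k p r G N E) d (restrict_module k p r G c)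
              (Lambda k G C r x)) \<and>
         continuous_map (ind_topology k G C) (jt_topology p) (JT_exp_infinite k p G N C E d c)"
proof (rule jt_setup.JT_factors_and_continuous)
  show "jt_setup k p G N E d c C"
    by (intro jt_setup.intro jt_setup_axioms.intro exp_setup.intro exp_setup_axioms.intro algebraic_group_setup.intro
        field group universe(1) nilp comm exp_type module)
qed

end
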